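(* Let $\ell = 2k+1 \geq 5$ be prime and let $d$ be the order of $2$ in $(\mathbb{Z}/\ell \mathbb{Z})^\times/\{\pm 1\}$. Then $U_\ell^R \subseteq U_\ell^+$ and $$\mathrm{Rank}(U_\ell^R)= k - \frac{k}{d}.$$ In particular, whenever $2$ generates $(\mathbb{Z}/\ell \mathbb{Z})^\times/\{\pm 1\}$, we have $U_\ell^R \times \mathbb{Q}(\zeta_\ell)^\times=U_\ell^+$ (internal direct product, with $\mathbb{Q}(\zeta_\ell)^\times$ the group of nonzero constant functions).
   Context: Let $q=e^{2\pi i\tau}$, $\tau$ in the upper half-plane, $\zeta_\ell=e^{2\pi i/\ell}$. For $0<a<1$ the Siegel function is $g_{(a,0)}(\tau) = -q^{\frac12(a^2-a+\frac16)}\prod_{n=1}^\infty(1-q^{n-1+a})(1-q^{n-a})$. For $1\le m\le k-1$ set $$s_{\ell,m}(\tau) = \prod_{j=1}^m \frac{g_{(2j/\ell,0)}(\ell\tau)}{g_{(j/\ell,0)}(\ell\tau)}$$ (this is the quotient $\Psi_1(m,\frac{\ell-1}{2}-m;\tau)$ of normalized Hall-Littlewood $q$-series of Griffin, Ono and Warnaar). $\mathcal{F}_\ell$ is the field of modular functions for $\Gamma(\ell)$ whose Fourier expansions (in $q^{1/\ell}$) have coefficients in $\mathbb{Q}(\zeta_\ell)$, and $U_\ell$ is the unit group of the integral closure of $\mathbb{Q}[j]$ in $\mathcal{F}_\ell$ ($j$ the modular invariant). $U_\ell^R := \langle s_{\ell,m}(\tau): 1\le m\le k-1\rangle$ is the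 multiplicative group generated by the $s_{\ell,m}$, and $\mathrm{Rank}$ denotes the rank as an abelian group. Let $\pi:X(\ell)\to X_0(\ell)$ be the canonical projection of modular curves, $\mathcal{A}_\ell=\pi^{-1}(\infty)$, and $$U_\ell^+ := \{f\in U_\ell : \text{all zeros and poles of } f \text{ on } X(\ell) \text{ lie in } \mathcal{A}_\ell\}.$$ *)

theory Defs
  imports
    "HOL-Complex_Analysis.Complex_Analysis"
    "HOL-Algebra.Algebra"
    "HOL-Algebra.Algebraic_Closure_Type"
    "HOL-Number_Theory.Residues"
begin

no_notation fps_nth (infixl \<open>$\<close> 75)

section \<open>The field of meromorphic functions on the upper half-plane\<close>

definition uhp :: "complex set" where
  "uhp = {z. Im z > 0}"

lemma open_uhp: "open uhp"
  unfolding uhp_def by (rule open_halfspace_Im_gt)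

lemma connected_uhp: "connected uhp"
  unfolding uhp_def by (intro convex_connected convex_halfspace_Im_gt)

lemma eventually_in_uhp: "z \<in> uhp \<Longrightarrow> eventually (\<lambda>w. w \<in> uhp) (at z)"
  using eventually_at_in_open'[OF open_uhp] by blast

text \<open>
  A meromorphic function is represented by its unique total representative that has no removable
  singularities and takes the value 0 at its poles and outside the upper half-plane.
\<close>

typedef mero_uhp = "{f. f nicely_meromorphic_on uhp \<and> (\<forall>z. z \<notin> uhp \<longrightarrow> f z = 0)}"
  morphisms eval_mero Abs_mero_uhp
proof
  show "(\<lambda>_. 0) \<in> {f. f nicely_meromorphic_on uhp \<and> (\<forall>z. z \<notin> uhp \<longrightarrow> f z = 0)}"
    by auto
qed

text \<open>
  The element given by an arbitrary meromorphic function on the upper half-plane; the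
  second case is a default for arguments that are not meromorphic there.
\<close>

definition mero :: "(complex \<Rightarrow> complex) \<Rightarrow> mero_uhp" where
  "mero f = Abs_mero_uhp
     (if f meromorphic_on uhp then (\<lambda>z. if z \<in> uhp then remove_sings f z else 0) else (\<lambda>_. 0))"

lemma eval_mero_nicely_meromorphic: "eval_mero f nicely_meromorphic_on uhp"
  using eval_mero[of f] by auto

lemma eval_mero_meromorphic [meromorphic_intros]: "eval_mero f meromorphic_on uhp"
  using eval_mero_nicely_meromorphic[of f] by (auto simp: nicely_meromorphic_on_def)

lemma eval_mero_outside: "z \<notin> uhp \<Longrightarrow> eval_mero f z = 0"
  using eval_mero[of f] by auto

lemma eval_mero_mero:
  assumes "f meromorphic_on uhp"
  shows   "eval_mero (mero f) = (\<lambda>z. if z \<in> uhp then remove_sings f z else 0)"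
proof -
  let ?g = "\<lambda>z. if z \<in> uhp then remove_sings f z else 0"
  have g: "remove_sings f nicely_meromorphic_on uhp"
    using assms by (rule remove_sings_nicely_meromorphic)
  have ev: "eventually (\<lambda>w. remove_sings f w = ?g w) (at z)" if "z \<in> uhp" for z
    using eventually_in_uhp[OF that] by eventually_elim auto
  have "?g meromorphic_on uhp"
  proof -
    have "remove_sings f meromorphic_on uhp \<longleftrightarrow> ?g meromorphic_on uhp"
      by (intro meromorphic_on_cong ev) auto
    thus ?thesis using g by (auto simp: nicely_meromorphic_on_def)
  qed
  moreover have "(is_pole ?g z \<and> ?g z = 0) \<or> (?g \<midarrow>z\<rightarrow> ?g z)" if z: "z \<in> uhp" for z
  proof -
    have "is_pole (remove_sings f) z \<longleftrightarrow> is_pole ?g z"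
      using ev[OF z] by (intro is_pole_cong) auto
    moreover have "(remove_sings f \<midarrow>z\<rightarrow> remove_sings f z) \<longleftrightarrow> (?g \<midarrow>z\<rightarrow> remove_sings f z)"
      using ev[OF z] by (intro tendsto_cong)
    ultimately show ?thesis
      using g z by (auto simp: nicely_meromorphic_on_def)
  qed
  ultimately have "?g nicely_meromorphic_on uhp"
    by (simp add: nicely_meromorphic_on_def)
  thus ?thesis
    using assms by (simp add: mero_def Abs_mero_uhp_inverse)
qed

lemma eventually_eval_mero_mero:
  assumes "f meromorphic_on uhp" "z \<in> uhp"
  shows   "eventually (\<lambda>w. eval_mero (mero f) w = f w) (at z)"
proof -
  have "isolated_singularity_at f z"
    using assms meromorphic_on_isolated_singularity meromorphic_on_subset by blast
  from eventually_remove_sings_eq_at[OF this] eventually_in_uhp[OF assms(2)]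
  show ?thesis
    by eventually_elim (simp add: eval_mero_mero[OF assms(1)])
qed

lemma mero_uhp_eqI:
  assumes "\<And>z. z \<in> uhp \<Longrightarrow> eventually (\<lambda>w. eval_mero f w = eval_mero g w) (at z)"
  shows   "f = g"
proof -
  have "eval_mero f z = eval_mero g z" for z
  proof (cases "z \<in> uhp")
    case True
    have *: "remove_sings (eval_mero h) z = eval_mero h z" for h
    proof (cases "is_pole (eval_mero h) z")
      case pole: True
      have "eval_mero h z = 0"
        using eval_mero_nicely_meromorphic[of h] True pole
        unfolding nicely_meromorphic_on_def
        by (meson at_neq_bot is_pole_def not_tendsto_and_filterlim_at_infinity)
      thus ?thesis using pole by simp
    next
      case False
      thus ?thesis
        using nicely_meromorphic_on_imp_analytic_at[OF eval_mero_nicely_meromorphic True False]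
        by simp
    qed
    have "remove_sings (eval_mero f) z = remove_sings (eval_mero g) z"
      by (intro remove_sings_cong assms True refl)
    thus ?thesis by (simp add: *)
  qed (simp add: eval_mero_outside)
  hence "eval_mero f = eval_mero g" by blast
  thus ?thesis by (simp add: eval_mero_inject)
qed

instantiation mero_uhp :: field
begin

definition zero_mero_uhp :: mero_uhp where "0 = mero (\<lambda>_. 0)"
definition one_mero_uhp :: mero_uhp where "1 = mero (\<lambda>_. 1)"
definition plus_mero_uhp :: "mero_uhp \<Rightarrow> mero_uhp \<Rightarrow> mero_uhp"
  where "f + g = mero (\<lambda>z. eval_mero f z + eval_mero g z)"
definition uminus_mero_uhp :: "mero_uhp \<Rightarrow> mero_uhp"
  where "- f = mero (\<lambda>z. - eval_mero f z)"
definition minus_mero_uhp :: "mero_uhp \<Rightarrow> mero_uhp \<Rightarrow> mero_uhp"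
  where "f - g = mero (\<lambda>z. eval_mero f z - eval_mero g z)"
definition times_mero_uhp :: "mero_uhp \<Rightarrow> mero_uhp \<Rightarrow> mero_uhp"
  where "f * g = mero (\<lambda>z. eval_mero f z * eval_mero g z)"
definition inverse_mero_uhp :: "mero_uhp \<Rightarrow> mero_uhp"
  where "inverse f = mero (\<lambda>z. inverse (eval_mero f z))"
definition divide_mero_uhp :: "mero_uhp \<Rightarrow> mero_uhp \<Rightarrow> mero_uhp"
  where "f div g = mero (\<lambda>z. eval_mero f z / eval_mero g z)"

lemma eventually_eval_0: "z \<in> uhp \<Longrightarrow> eventually (\<lambda>w. eval_mero 0 w = 0) (at z)"
  unfolding zero_mero_uhp_def by (intro eventually_eval_mero_mero meromorphic_intros)
lemma eventually_eval_1: "z \<in> uhp \<Longrightarrow> eventually (\<lambda>w. eval_mero 1 w = 1) (at z)"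
  unfolding one_mero_uhp_def by (intro eventually_eval_mero_mero meromorphic_intros)
lemma eventually_eval_add:
  "z \<in> uhp \<Longrightarrow> eventually (\<lambda>w. eval_mero (f + g) w = eval_mero f w + eval_mero g w) (at z)"
  unfolding plus_mero_uhp_def by (intro eventually_eval_mero_mero meromorphic_intros)
lemma eventually_eval_uminus:
  "z \<in> uhp \<Longrightarrow> eventually (\<lambda>w. eval_mero (- f) w = - eval_mero f w) (at z)"
  unfolding uminus_mero_uhp_def by (intro eventually_eval_mero_mero meromorphic_intros)
lemma eventually_eval_diff:
  "z \<in> uhp \<Longrightarrow> eventually (\<lambda>w. eval_mero (f - g) w = eval_mero f w - eval_mero g w) (at z)"
  unfolding minus_mero_uhp_def by (intro eventually_eval_mero_mero meromorphic_intros)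
lemma eventually_eval_mult:
  "z \<in> uhp \<Longrightarrow> eventually (\<lambda>w. eval_mero (f * g) w = eval_mero f w * eval_mero g w) (at z)"
  unfolding times_mero_uhp_def by (intro eventually_eval_mero_mero meromorphic_intros)
lemma eventually_eval_inverse:
  "z \<in> uhp \<Longrightarrow> eventually (\<lambda>w. eval_mero (inverse f) w = inverse (eval_mero f w)) (at z)"
  unfolding inverse_mero_uhp_def by (intro eventually_eval_mero_mero meromorphic_intros)
lemma eventually_eval_divide:
  "z \<in> uhp \<Longrightarrow> eventually (\<lambda>w. eval_mero (f div g) w = eval_mero f w / eval_mero g w) (at z)"
  unfolding divide_mero_uhp_def by (intro eventually_eval_mero_mero meromorphic_intros)

lemma eventually_eval_nonzero:
  assumes "f \<noteq> 0" "z \<in> uhp"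
  shows   "eventually (\<lambda>w. eval_mero f w \<noteq> 0) (at z)"
proof -
  have "(\<forall>x\<in>uhp. eval_mero f x = 0) \<or> (\<forall>\<^sub>\<approx>x\<in>uhp. eval_mero f x \<noteq> 0)"
    by (intro nicely_meromorphic_imp_constant_or_avoid eval_mero_nicely_meromorphic
          open_uhp connected_uhp)
  moreover have "\<not>(\<forall>x\<in>uhp. eval_mero f x = 0)"
  proof
    assume *: "\<forall>x\<in>uhp. eval_mero f x = 0"
    have "f = 0"
    proof (rule mero_uhp_eqI)
      fix z assume "z \<in> uhp"
      from eventually_in_uhp[OF this] eventually_eval_0[OF this]
      show "eventually (\<lambda>w. eval_mero f w = eval_mero 0 w) (at z)"
        by eventually_elim (use * in auto)
    qed
    with assms show False by blast
  qed
  ultimately show ?thesis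
    using assms by (auto simp: eventually_cosparse_open_eq open_uhp)
qed

instance proof
  fix f g h :: mero_uhp
  show "f + g + h = f + (g + h)"
  proof (rule mero_uhp_eqI)
    fix z assume z: "z \<in> uhp"
    show "eventually (\<lambda>w. eval_mero (f + g + h) w = eval_mero (f + (g + h)) w) (at z)"
      using eventually_eval_add[OF z, of "f + g" h] eventually_eval_add[OF z, of f "g + h"]
        eventually_eval_add[OF z, of f g] eventually_eval_add[OF z, of g h]
      by eventually_elim auto
  qed
  show "f + g = g + f"
    by (simp add: plus_mero_uhp_def add.commute)
  show "0 + f = f"
  proof (rule mero_uhp_eqI)
    fix z assume z: "z \<in> uhp"
    show "eventually (\<lambda>w. eval_mero (0 + f) w = eval_mero f w) (at z)"
      using eventually_eval_add[OF z, of 0 f] eventually_eval_0[OF z] by eventually_elim auto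
  qed
  show "- f + f = 0"
  proof (rule mero_uhp_eqI)
    fix z assume z: "z \<in> uhp"
    show "eventually (\<lambda>w. eval_mero (- f + f) w = eval_mero 0 w) (at z)"
      using eventually_eval_add[OF z, of "- f" f] eventually_eval_uminus[OF z, of f]
        eventually_eval_0[OF z] by eventually_elim auto
  qed
  show "f - g = f + - g"
  proof (rule mero_uhp_eqI)
    fix z assume z: "z \<in> uhp"
    show "eventually (\<lambda>w. eval_mero (f - g) w = eval_mero (f + - g) w) (at z)"
      using eventually_eval_add[OF z, of f "- g"] eventually_eval_uminus[OF z, of g]
        eventually_eval_diff[OF z, of f g] by eventually_elim auto
  qed
  show "f * g * h = f * (g * h)"
  proof (rule mero_uhp_eqI)
    fix z assume z: "z \<in> uhp"
    show "eventually (\<lambda>w. eval_mero (f * g * h) w = eval_mero (f * (g * h)) w) (at z)"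
      using eventually_eval_mult[OF z, of "f * g" h] eventually_eval_mult[OF z, of f "g * h"]
        eventually_eval_mult[OF z, of f g] eventually_eval_mult[OF z, of g h]
      by eventually_elim auto
  qed
  show "f * g = g * f"
    by (simp add: times_mero_uhp_def mult.commute)
  show "1 * f = f"
  proof (rule mero_uhp_eqI)
    fix z assume z: "z \<in> uhp"
    show "eventually (\<lambda>w. eval_mero (1 * f) w = eval_mero f w) (at z)"
      using eventually_eval_mult[OF z, of 1 f] eventually_eval_1[OF z] by eventually_elim auto
  qed
  show "(f + g) * h = f * h + g * h"
  proof (rule mero_uhp_eqI)
    fix z assume z: "z \<in> uhp"
    show "eventually (\<lambda>w. eval_mero ((f + g) * h) w = eval_mero (f * h + g * h) w) (at z)"
      using eventually_eval_mult[OF z, of "f + g" h] eventually_eval_mult[OF z, of f h]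
        eventually_eval_mult[OF z, of g h] eventually_eval_add[OF z, of f g]
        eventually_eval_add[OF z, of "f * h" "g * h"]
      by eventually_elim (auto simp: algebra_simps)
  qed
  show "(0 :: mero_uhp) \<noteq> 1"
  proof
    assume *: "(0 :: mero_uhp) = 1"
    have z: "\<i> \<in> uhp" by (simp add: uhp_def)
    have "eventually (\<lambda>_. False) (at \<i>)"
      using eventually_eval_0[OF z] eventually_eval_1[OF z] by eventually_elim (use * in auto)
    thus False by simp
  qed
  show "inverse f * f = 1" if "f \<noteq> 0"
  proof (rule mero_uhp_eqI)
    fix z assume z: "z \<in> uhp"
    show "eventually (\<lambda>w. eval_mero (inverse f * f) w = eval_mero 1 w) (at z)"
      using eventually_eval_mult[OF z, of "inverse f" f] eventually_eval_inverse[OF z, of f]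
        eventually_eval_1[OF z] eventually_eval_nonzero[OF that z] by eventually_elim auto
  qed
  show "f div g = f * inverse g"
  proof (rule mero_uhp_eqI)
    fix z assume z: "z \<in> uhp"
    show "eventually (\<lambda>w. eval_mero (f div g) w = eval_mero (f * inverse g) w) (at z)"
      using eventually_eval_mult[OF z, of f "inverse g"] eventually_eval_inverse[OF z, of g]
        eventually_eval_divide[OF z, of f g] by eventually_elim (auto simp: field_simps)
  qed
  show "inverse (0 :: mero_uhp) = 0"
  proof (rule mero_uhp_eqI)
    fix z assume z: "z \<in> uhp"
    show "eventually (\<lambda>w. eval_mero (inverse 0) w = eval_mero 0 w) (at z)"
      using eventually_eval_inverse[OF z, of 0] eventually_eval_0[OF z] by eventually_elim auto
  qed
qed

end

instance mero_uhp :: field_char_0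
proof
  have *: "eventually (\<lambda>w. eval_mero (of_nat n) w = of_nat n) (at z)" if z: "z \<in> uhp" for n z
  proof (induction n)
    case 0
    thus ?case using eventually_eval_0[OF z] by simp
  next
    case (Suc n)
    show ?case
      using Suc eventually_eval_1[OF z] eventually_eval_add[OF z, of 1 "of_nat n"]
      by eventually_elim simp
  qed
  show "inj (of_nat :: nat \<Rightarrow> mero_uhp)"
  proof (rule injI)
    fix m n assume eq: "(of_nat m :: mero_uhp) = of_nat n"
    have z: "\<i> \<in> uhp" by (simp add: uhp_def)
    have "eventually (\<lambda>w::complex. (of_nat m :: complex) = of_nat n) (at \<i>)"
      using *[OF z, of m, unfolded eq] *[OF z, of n] by eventually_elim simp
    hence "(of_nat m :: complex) = of_nat n" by simp
    thus "m = n" by simp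
  qed
qed

definition mero_group :: "mero_uhp monoid" where
  "mero_group = mult_of ring_of_type_algebra"


section \<open>Modular functions of level \<open>\<ell>\<close>\<close>

definition SL2Z :: "(int ^ 2 ^ 2) set" where
  "SL2Z = {\<gamma>. det \<gamma> = 1}"

definition Gamma_princ :: "nat \<Rightarrow> (int ^ 2 ^ 2) set" where
  "Gamma_princ l = {\<gamma> \<in> SL2Z. \<forall>i j. [\<gamma> $ i $ j = mat 1 $ i $ j] (mod int l)}"

definition Gamma0 :: "nat \<Rightarrow> (int ^ 2 ^ 2) set" where
  "Gamma0 l = {\<gamma> \<in> SL2Z. int l dvd \<gamma> $ 2 $ 1}"

definition moebius :: "int ^ 2 ^ 2 \<Rightarrow> complex \<Rightarrow> complex" where
  "moebius \<gamma> z =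
     (of_int (\<gamma> $ 1 $ 1) * z + of_int (\<gamma> $ 1 $ 2)) / (of_int (\<gamma> $ 2 $ 1) * z + of_int (\<gamma> $ 2 $ 2))"

text \<open>\<open>q\<close> raised to the real power \<open>x\<close>, where \<open>q = exp (2\<pi>i\<tau>)\<close>; not the principal power of \<open>q\<close>.\<close>

definition qpow :: "real \<Rightarrow> complex \<Rightarrow> complex" where
  "qpow x \<tau> = exp (2 * of_real pi * \<i> * of_real x * \<tau>)"

text \<open>\<open>F\<close> is the Laurent expansion of \<open>f\<close> at \<open>i\<infinity>\<close> in the local parameter \<open>q\<close> to the power \<open>1 / \<ell>\<close>.\<close>

definition has_qexp :: "nat \<Rightarrow> (complex \<Rightarrow> complex) \<Rightarrow> complex fls \<Rightarrow> bool" where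
  "has_qexp l f F \<longleftrightarrow> fls_conv_radius F > 0 \<and>
     eventually (\<lambda>\<tau>. f \<tau> = eval_fls F (qpow (1 / real l) \<tau>)) (filtercomap Im at_top)"

text \<open>Every cusp is \<open>\<gamma>\<infinity>\<close> for some \<open>\<gamma>\<close> in \<open>SL2Z\<close>, and has width \<open>\<ell>\<close> for \<open>\<Gamma>(\<ell>)\<close>.\<close>

definition modular_function :: "nat \<Rightarrow> mero_uhp \<Rightarrow> bool" where
  "modular_function l f \<longleftrightarrow>
     (\<forall>\<gamma>\<in>Gamma_princ l. \<forall>z\<in>uhp. eval_mero f (moebius \<gamma> z) = eval_mero f z) \<and>
     (\<forall>\<gamma>\<in>SL2Z. \<exists>F. has_qexp l (\<lambda>z. eval_mero f (moebius \<gamma> z)) F)"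

definition cyclotomic :: "nat \<Rightarrow> complex set" where
  "cyclotomic l = generate_field ring_of_type_algebra {exp (2 * of_real pi * \<i> / of_nat l)}"

definition modular_field :: "nat \<Rightarrow> mero_uhp set" where
  "modular_field l = {f. modular_function l f \<and>
     (\<exists>F. has_qexp l (eval_mero f) F \<and> (\<forall>n. fls_nth F n \<in> cyclotomic l))}"

definition const_units :: "nat \<Rightarrow> mero_uhp set" where
  "const_units l = {mero (\<lambda>_. c) | c. c \<in> cyclotomic l - {0}}"


section \<open>Modular units\<close>

definition eisenstein :: "nat \<Rightarrow> complex \<Rightarrow> complex" where
  "eisenstein k \<tau> = (\<Sum>\<^sub>\<infinity>(m, n)\<in>UNIV - {(0, 0)}. 1 / (of_int m + of_int n * \<tau>) ^ k)"

definition klein_j :: mero_uhp where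
  "klein_j = mero (\<lambda>\<tau>. let g2 = 60 * eisenstein 4 \<tau>; g3 = 140 * eisenstein 6 \<tau>
                       in 1728 * g2 ^ 3 / (g2 ^ 3 - 27 * g3 ^ 2))"

definition Q_adjoin :: "'a :: field_char_0 \<Rightarrow> 'a set" where
  "Q_adjoin x = {poly (map_poly of_rat p) x | p :: rat poly. True}"

definition integral_over :: "'a :: comm_ring_1 set \<Rightarrow> 'a \<Rightarrow> bool" where
  "integral_over A x \<longleftrightarrow> (\<exists>p :: 'a poly. Polynomial.coeff p (Polynomial.degree p) = 1 \<and>
     (\<forall>i. Polynomial.coeff p i \<in> A) \<and> poly p x = 0)"

definition integral_closure_j :: "nat \<Rightarrow> mero_uhp set" where
  "integral_closure_j l = {f \<in> modular_field l. integral_over (Q_adjoin klein_j) f}"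

definition modular_units :: "nat \<Rightarrow> mero_uhp set" where
  "modular_units l = {f \<in> integral_closure_j l. \<exists>g\<in>integral_closure_j l. f * g = 1}"


section \<open>Modular curves and the units supported above \<open>\<infinity>\<close>\<close>

text \<open>
  Points of the extended upper half-plane: \<^const>\<open>None\<close> is the cusp \<open>\<infinity>\<close>, and \<^term>\<open>Some z\<close> with
  rational \<open>z\<close> are the remaining cusps.
\<close>

definition ext_uhp :: "complex option set" where
  "ext_uhp = insert None (Some ` (uhp \<union> \<rat>))"

fun ext_moebius :: "int ^ 2 ^ 2 \<Rightarrow> complex option \<Rightarrow> complex option" where
  "ext_moebius \<gamma> None =
     (if \<gamma> $ 2 $ 1 = 0 then None else Some (of_int (\<gamma> $ 1 $ 1) / of_int (\<gamma> $ 2 $ 1)))"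
| "ext_moebius \<gamma> (Some z) =
     (if of_int (\<gamma> $ 2 $ 1) * z + of_int (\<gamma> $ 2 $ 2) = 0 then None else Some (moebius \<gamma> z))"

definition orbit_of :: "(int ^ 2 ^ 2) set \<Rightarrow> complex option \<Rightarrow> complex option set" where
  "orbit_of G x = (\<lambda>\<gamma>. ext_moebius \<gamma> x) ` G"

definition modular_curve :: "(int ^ 2 ^ 2) set \<Rightarrow> complex option set set" where
  "modular_curve G = orbit_of G ` ext_uhp"

text \<open>The canonical projection onto the curve of a larger group \<open>G\<close> maps the orbit of \<open>x\<close> to \<open>Gx\<close>.\<close>

definition curve_proj :: "(int ^ 2 ^ 2) set \<Rightarrow> complex option set \<Rightarrow> complex option set" where
  "curve_proj G P = (\<Union>x\<in>P. orbit_of G x)"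

definition cusps_above_inf :: "nat \<Rightarrow> complex option set set" where
  "cusps_above_inf l =
     {P \<in> modular_curve (Gamma_princ l). curve_proj (Gamma0 l) P = orbit_of (Gamma0 l) None}"

text \<open>
  The order of a modular function for \<open>\<Gamma>(\<ell>)\<close>, \<open>\<ell> \<ge> 3\<close>, at the point of \<open>X(\<ell>)\<close> represented by \<open>x\<close>:
  there are no elliptic points, and \<open>q\<close> to the power \<open>1 / \<ell>\<close>, transported by \<open>\<gamma>\<close>, is a local
  parameter at the cusp \<open>\<gamma>\<infinity>\<close>.  The order at a cusp does not depend on the choice of \<open>\<gamma>\<close>.
\<close>

definition order_at :: "nat \<Rightarrow> mero_uhp \<Rightarrow> complex option \<Rightarrow> int" where
  "order_at l f x =
     (if x \<in> Some ` uhp then zorder (eval_mero f) (the x)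
      else (THE n. \<exists>\<gamma>\<in>SL2Z. \<exists>F. ext_moebius \<gamma> None = x \<and>
              has_qexp l (\<lambda>z. eval_mero f (moebius \<gamma> z)) F \<and> n = fls_subdegree F))"

definition zeros_and_poles :: "nat \<Rightarrow> mero_uhp \<Rightarrow> complex option set set" where
  "zeros_and_poles l f = {P \<in> modular_curve (Gamma_princ l). \<exists>x\<in>P. order_at l f x \<noteq> 0}"

definition units_plus :: "nat \<Rightarrow> mero_uhp set" where
  "units_plus l = {f \<in> modular_units l. zeros_and_poles l f \<subseteq> cusps_above_inf l}"


section \<open>Siegel functions and the units generated by their quotients\<close>

text \<open>The Siegel function \<open>g\<close> with index \<open>(a, 0)\<close>; the product index is shifted to start at 0.\<close>

definition siegel :: "real \<Rightarrow> complex \<Rightarrow> complex" where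
  "siegel a \<tau> = - qpow ((a\<^sup>2 - a + 1 / 6) / 2) \<tau> *
     prodinf (\<lambda>n. (1 - qpow (real n + a) \<tau>) * (1 - qpow (real (Suc n) - a) \<tau>))"

definition siegel_quotient :: "nat \<Rightarrow> nat \<Rightarrow> mero_uhp" where
  "siegel_quotient l m = mero (\<lambda>\<tau>. \<Prod>j=1..m.
     siegel (2 * real j / real l) (of_nat l * \<tau>) / siegel (real j / real l) (of_nat l * \<tau>))"

definition real_units :: "nat \<Rightarrow> nat \<Rightarrow> mero_uhp set" where
  "real_units l k = generate mero_group (siegel_quotient l ` {1..k-1})"


section \<open>Rank, internal direct products and residues modulo \<open>\<plusminus>1\<close>\<close>

definition int_independent :: "('a, 'b) monoid_scheme \<Rightarrow> 'a set \<Rightarrow> bool" where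
  "int_independent G B \<longleftrightarrow> (\<forall>n :: 'a \<Rightarrow> int.
     finprod G (\<lambda>b. b [^]\<^bsub>G\<^esub> n b) B = \<one>\<^bsub>G\<^esub> \<longrightarrow> (\<forall>b\<in>B. n b = 0))"

definition abelian_rank :: "('a, 'b) monoid_scheme \<Rightarrow> enat" where
  "abelian_rank G = (SUP B\<in>{B. finite B \<and> B \<subseteq> carrier G \<and> int_independent G B}. enat (card B))"

definition internal_direct_product ::
    "('a, 'b) monoid_scheme \<Rightarrow> 'a set \<Rightarrow> 'a set \<Rightarrow> 'a set \<Rightarrow> bool" where
  "internal_direct_product G A B C \<longleftrightarrow>
     subgroup A G \<and> subgroup B G \<and> A \<inter> B = {\<one>\<^bsub>G\<^esub>} \<and> A <#>\<^bsub>G\<^esub> B = C"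

text \<open>Residues are represented by \<open>0, \<dots>, \<ell> - 1\<close>, so the class of \<open>-1\<close> is \<open>\<ell> - 1\<close>.\<close>

definition residue_units :: "nat \<Rightarrow> int monoid" where
  "residue_units l = units_of (residue_ring (int l))"

definition residue_units_pm1 :: "nat \<Rightarrow> int set monoid" where
  "residue_units_pm1 l = residue_units l Mod {1, int l - 1}"

definition class_of_2 :: "nat \<Rightarrow> int set" where
  "class_of_2 l = {1, int l - 1} #>\<^bsub>residue_units l\<^esub> 2"

end

theory Submission
 imports Defs "HOL-Real_Asymp.Real_Asymp" "Jordan_Normal_Form.Char_Poly"
begin

text \<open>Put Q_i(tau) = g_(2i/l,0)(l tau) for 1 <= i <= k (\<open>hsiegel\<close>), and for an
  integer vector e let \<open>hquot l k e\<close> be the product of the Q_i^(e_i). Everything is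
  reduced to these products with sum e = 0.

  Membership in U^+. The distribution relation \<open>siegel_distribution\<close> writes Q_i as a
  product of l Siegel functions g_(2i/l,2t/l)(tau), and \<open>gsiegel_moebius\<close>, proved with
  theta products and Liouville's theorem, shows that SL2(Z) acts on the indices of Siegel functions
  up to a factor independent of the index. For sum e = 0 that factor cancels, so
  \<open>hquot\<close> is invariant under Gamma(l), without zeros or poles on the upper half-plane,
  and its order at the cusp with first column (a, c) is a combination of values of the second
  Bernoulli polynomial (\<open>hquot_has_qexp\<close>). If l does not divide c, all Q_i contribute
  equally and the order is 0 (\<open>hquot_ord_not_dvd\<close>), so the divisor lies above infinity.
  Integrality: the elementary symmetric functions of the SL2(Z)-conjugates have level one and no
  poles on the half-plane, hence are polynomials in j (\<open>level_one_polynomial\<close>);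
  rational q-expansions make the coefficients rational (\<open>integral_over_j\<close>). The
  required expansion of j comes from those of the Eisenstein series and from E_4^3 - E_6^2 = 1728
  Delta (\<open>eisen_discriminant\<close>, \<open>klein_j_eq\<close>).

  Rank. Since g_(a,0) = g_(1-a,0), the denominator g_(j/l,0)(l tau) is Q_h(j) with 2 h(j) = +-j mod
  l (\<open>half_index\<close>), so the m-th generator is the product of Q_j/Q_h(j) over j <= m. As
  h permutes 1..k, the product over all j is 1, and therefore every Q_j/Q_h(j) lies in the group.
  The group consists of the \<open>hquot\<close> whose exponents sum to 0 over each orbit of
  doubling on (Z/l)^x/{+-1} (\<open>orbit_null_in_unit_group\<close>,
  \<open>unit_group_orbit_null\<close>). There are k/d orbits of d elements each
  (\<open>card_orbit_reps\<close>), and the logarithmic derivative of the q-expansion shows that a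
  constant \<open>hquot\<close> has e = 0 (\<open>hquot_constant\<close>). Hence the rank is k -
  k/d.

  Equality for d = k. With one orbit it suffices that every f in U^+ is a constant times some
  \<open>hquot\<close> with sum e = 0 (\<open>units_plus_imp_hquot\<close>). The orders of f at the
  k classes of cusps above infinity satisfy one relation, because the norm to level one has neither
  zeros nor poles; linear algebra then gives f^M = c \<open>hquot l k e\<close> with M > 0
  (\<open>units_plus_power\<close>). To extract the root, let F be the q-expansion of f divided by
  its leading coefficient. F^M has integer coefficients and F has rational ones; Lagrange
  interpolation in the primitive element Q_1/Q_k (\<open>separator_stabilizer\<close>,
  \<open>qexp_fraction\<close>) exhibits F as a quotient of integral series, so F is integral by
  normality (\<open>fls_root_integral\<close>). The logarithmic derivative of F^M is thus M times an
  integral series, which forces M to divide every e_i (\<open>dvd_exponents\<close>), and f divided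
  by \<open>hquot\<close> with exponents e/M has constant M-th power.\<close>

no_notation vec_index (infixl "$" 100)
hide_const (open) Matrix.mat Matrix.vec Determinant.det Matrix.row Matrix.col

section \<open>Infinite products with geometrically bounded factors\<close>

text \<open>All infinite products below have factors 1 - g_n with g_n dominated on compact sets by a
  geometric series. The Weierstrass test gives locally uniform convergence, and holomorphy, the zero
  set and the logarithmic derivative are inherited from the partial products.\<close>

lemma geometric_product:
 fixes g::"nat => complex => complex"
 assumes S: "open S"
 and hol:"!!n. g n holomorphic_on S"
 and bd:"!!K. compact K==>K \<subseteq> S ==>
 EX C r. 0\<le>r&r<1&(ALL n. \<forall>z\<in>K. norm (g n z) \<le> C * r ^ n)"
 defines "P \<equiv> (%z. prodinf (%n. 1-g n z))"
 shows geometric_product_convergent:"!!z. z\<in>S ==> convergent_prod (%n. 1-g n z)"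
 and geometric_product_uniform_limit:"!!K. compact K==>K \<subseteq> S ==>
 uniform_limit K (%N z. \<Prod>n<N. 1-g n z) P sequentially"
 and geometric_product_holomorphic:"P holomorphic_on S"
 and geometric_product_eq_0_iff:"!!z. z\<in>S==>P z=0\<longleftrightarrow>(EX n. g n z=1)"
 and geometric_product_logderiv:"!!z. z\<in>S==>P z~=0 ==>
 (%n. - deriv (g n) z/(1-g n z)) sums (deriv P z/P z)"
proof -
 show conv:"convergent_prod (%n. 1-g n z)" if "z\<in>S" for z
 proof -
 have "EX C r. 0\<le>r&r<1&(ALL n. \<forall>z\<in>{z}. norm (g n z) \<le> C * r ^ n)"
 using that by (intro bd) auto
 then obtain C r where "0\<le>r" "r<1" and le:"!!n. norm (g n z) \<le> C * r ^ n"
 by auto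
 have "summable (%n. norm ((1-g n z)-1))"
 proof (rule summable_comparison_test')
 show "summable (%n. C * r ^ n)"
 using \<open>0\<le>r\<close> \<open>r<1\<close> by (intro summable_mult summable_geometric) auto
 qed (use le in auto)
 thus ?thesis
 by (intro abs_convergent_prod_imp_convergent_prod summable_imp_abs_convergent_prod)
 qed
 show lim:"uniform_limit K (%N z. \<Prod>n<N. 1-g n z) P sequentially"
 if K: "compact K" "K \<subseteq> S" for K
 proof -
 obtain C r where r:"0\<le>r" "r<1" and le:"!!n z. z\<in>K==>norm (g n z) \<le> C * r ^ n"
 using bd[OF K] by metis
 have cont:"continuous_on K (g n)" for n
 using holomorphic_on_imp_continuous_on[OF hol] K(2) continuous_on_subset by blast
 have "uniformly_convergent_on K (%N z. \<Sum>n<N. norm ((1-g n z)-1))"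
 proof (rule Weierstrass_m_test'_ev)
 show "summable (%n. C * r ^ n)"
 using r by (intro summable_mult summable_geometric) auto
 qed (use le in auto)
 hence "uniformly_convergent_on K (%N z. \<Prod>n<N. 1-g n z)"
 using K cont by (intro uniformly_convergent_on_prod') (auto intro!: continuous_intros)
 then obtain l where l:"uniform_limit K (%N z. \<Prod>n<N. 1-g n z) l sequentially"
 by (auto simp:uniformly_convergent_on_def)
 have "l z=P z" if "z\<in>K" for z
 proof -
 have "(%N. \<Prod>n<N. 1-g n z) \<longlonglongrightarrow> l z"
 using tendsto_uniform_limitI[OF l that] .
 moreover have "(%N. \<Prod>n\<le>N. 1-g n z) \<longlonglongrightarrow> P z"
 unfolding P_def using conv K(2) that by (intro convergent_prod_LIMSEQ) auto
 ultimately show ?thesis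
 using LIMSEQ_lessThan_iff_atMost LIMSEQ_unique by blast
 qed
 thus ?thesis
 using l by (simp cong:uniform_limit_cong')
 qed
 show holo:"P holomorphic_on S"
 proof (rule holomorphic_uniform_sequence[OF S,where f = "%N z. \<Prod>n<N. 1-g n z"])
 show "(%z. \<Prod>n<N. 1-g n z) holomorphic_on S" for N
 by (intro holomorphic_intros hol)
 show "\<exists>d>0. cball x d \<subseteq> S&uniform_limit (cball x d) (%N z. \<Prod>n<N. 1-g n z) P sequentially"
 if "x\<in>S" for x
 using open_contains_cball[of S] S that lim by (meson compact_cball)
 qed
 show "P z=0\<longleftrightarrow>(EX n. g n z=1)" if "z\<in>S" for z
 proof
 assume "P z=0"
 thus "EX n. g n z=1"
 using prodinf_nonzero[OF conv[OF that]] unfolding P_def by auto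
 next
 assume "EX n. g n z=1"
 then obtain m where m:"g m z=1" by blast
 have "(%N. \<Prod>n\<le>N. 1-g n z) \<longlonglongrightarrow> P z"
 unfolding P_def using conv that by (intro convergent_prod_LIMSEQ) auto
 moreover have "eventually (%N. (\<Prod>n\<le>N. 1-g n z)=0) sequentially"
 using eventually_ge_at_top[of m] by eventually_elim (use m in auto)
 ultimately show "P z=0"
 using tendsto_eventually[of "%N. (\<Prod>n\<le>N. 1-g n z)" 0 sequentially] LIMSEQ_unique by blast
 qed
 show "(%n. - deriv (g n) z/(1-g n z)) sums (deriv P z/P z)"
 if z:"z\<in>S" "P z~=0" for z
 proof -
 obtain d where d:"d > 0" "cball z d \<subseteq> S"
 using open_contains_cball[of S] S z by blast
 have "(%n. deriv (%z. 1-g n z) z/(1-g n z)) sums (deriv P z/P z)"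
 proof (rule logderiv_prodinf_complex_uniform_limit[where A = "ball z d"])
 show "uniform_limit (ball z d) (%N z. \<Prod>n<N. 1-g n z) P sequentially"
 using lim[OF compact_cball d(2)] by (rule uniform_limit_on_subset) auto
 show "(%z. 1-g n z) holomorphic_on ball z d" for n
 using d by (intro holomorphic_intros holomorphic_on_subset[OF hol]) auto
 qed (use z d in auto)
 moreover have "deriv (%z. 1-g n z) z = - deriv (g n) z" for n
 using holomorphic_on_imp_differentiable_at[OF hol S z(1),of n]
 by (subst deriv_diff) auto
 ultimately show ?thesis by simp
 qed
qed

text \<open>Derivatives at 0 converge along a locally uniform limit, so a Taylor coefficient that
  stabilises on the partial products is that of the limit.\<close>

lemma fps_expansion_uniform_limit_eventually_const:
 assumes "!!N. f N has_fps_expansion F N" "g has_fps_expansion G"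
 and "!!N. f N holomorphic_on A" "open A" "0\<in>A"
 and "uniform_limit A f g sequentially"
 and "eventually (%N. fps_nth (F N) n = c) sequentially"
 shows "fps_nth G n = c"
proof -
 have "(%N. (deriv ^^ n) (f N) 0) \<longlonglongrightarrow> (deriv ^^ n) g 0"
 using assms by (intro higher_deriv_complex_uniform_limit) auto
 hence "(%N. (deriv ^^ n) (f N) 0/fact n) \<longlonglongrightarrow> (deriv ^^ n) g 0/fact n"
 by (intro tendsto_divide) auto
 also have "(%N. (deriv ^^ n) (f N) 0/fact n)=(%N. fps_nth (F N) n)"
 using fps_nth_fps_expansion[OF assms(1)] by simp
 also have "(deriv ^^ n) g 0/fact n=fps_nth G n"
 using fps_nth_fps_expansion[OF assms(2)] by simp
 finally show ?thesis
 using tendsto_eventually[OF assms(7)] LIMSEQ_unique by blast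
qed

text \<open>Integrality of coefficients passes to locally uniform limits because \<open>\<int>\<close> is closed.\<close>
lemma fps_expansion_uniform_limit_Ints:
 assumes "!!N. f N has_fps_expansion F N" "g has_fps_expansion G"
 and "!!N. f N holomorphic_on A" "open A" "0\<in>A"
 and "uniform_limit A f g sequentially"
 and "!!N. fps_nth (F N) n\<in>\<int>"
 shows "fps_nth G n\<in>\<int>"
proof -
 have "(%N. (deriv ^^ n) (f N) 0) \<longlonglongrightarrow> (deriv ^^ n) g 0"
 using assms by (intro higher_deriv_complex_uniform_limit) auto
 hence "(%N. (deriv ^^ n) (f N) 0/fact n) \<longlonglongrightarrow> (deriv ^^ n) g 0/fact n"
 by (intro tendsto_divide) auto
 also have "(%N. (deriv ^^ n) (f N) 0/fact n)=(%N. fps_nth (F N) n)"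
 using fps_nth_fps_expansion[OF assms(1)] by simp
 also have "(deriv ^^ n) g 0/fact n=fps_nth G n"
 using fps_nth_fps_expansion[OF assms(2)] by simp
 finally have lim:"(%N. fps_nth (F N) n) \<longlonglongrightarrow> fps_nth G n" .
 show ?thesis
 by (rule closed_sequentially[OF closed_Ints assms(7) lim])
qed

section \<open>Power series with integer coefficients\<close>

definition int_fps::"complex fps=>bool" where
 "int_fps F\<longleftrightarrow>(ALL n. fps_nth F n\<in>\<int>)"

lemma int_fps_1 [simp,intro]:"int_fps 1"
 by (auto simp:int_fps_def fps_one_nth)

lemma int_fps_mult [intro]:"int_fps F==>int_fps G==>int_fps (F * G)"
 by (auto simp:int_fps_def fps_mult_nth)

lemma int_fps_add [intro]:"int_fps F==>int_fps G==>int_fps (F+G)"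
 by (auto simp:int_fps_def)

lemma int_fps_diff [intro]:"int_fps F==>int_fps G==>int_fps (F-G)"
 by (auto simp:int_fps_def)

lemma int_fps_power [intro]:"int_fps F==>int_fps (F ^ n)"
 by (induction n) auto

lemma int_fps_prod [intro]:"(!!i. i\<in>I==>int_fps (F i))==>int_fps (\<Prod>i\<in>I. F i)"
 by (induction I rule:infinite_finite_induct) auto

text \<open>The recursion for the coefficients of the inverse divides only by the constant term,
  which is 1.\<close>

lemma int_fps_inverse:
 assumes "int_fps F" "fps_nth F 0=1"
 shows "int_fps (inverse F)"
proof -
 have "fps_nth (inverse F) n\<in>\<int>" for n
 proof (induction n rule:less_induct)
 case (less n)
 have 1:"inverse F * F=1"
 using assms(2) by (intro inverse_mult_eq_1) auto
 show ?case
 proof (cases "n=0")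
 case True
 thus ?thesis using assms by simp
 next
 case False
 have "0=fps_nth (inverse F * F) n"
 using False by (simp add: 1)
 also have "...=(\<Sum>i<n. fps_nth (inverse F) i * fps_nth F (n-i))+fps_nth (inverse F) n"
 using assms(2) by (simp add:fps_mult_nth atLeast0AtMost lessThan_Suc_atMost[symmetric])
 finally have "fps_nth (inverse F) n = - (\<Sum>i<n. fps_nth (inverse F) i * fps_nth F (n-i))"
 by (simp add:eq_neg_iff_add_eq_0 add.commute)
 also have "...\<in>\<int>"
 using less assms(1) by (auto simp:int_fps_def intro!: Ints_sum Ints_mult)
 finally show ?thesis .
 qed
 qed
 thus ?thesis by (simp add:int_fps_def)
qed

section \<open>Products in the unit disc\<close>

lemma power_product_bound:
 assumes "!!n. n \<le> c n" "!!n. norm (w n)\<le>(W::real)" "compact K" "K \<subseteq> ball (0::complex) 1"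
 shows "EX C r. 0\<le>r&r<1&(ALL n. \<forall>z\<in>K. norm (w n * z ^ c n::complex) \<le> C * r ^ n)"
proof (cases "K={}")
 case True
 thus ?thesis by (intro exI[of _ 0]) auto
next
 case False
 obtain z0 where z0:"z0\<in>K" "!!z. z\<in>K==>norm z\<le>norm z0"
 using continuous_attains_sup[OF assms(3) False,of norm] by (auto intro:continuous_intros)
 have *: "norm (w n * z ^ c n)\<le>W * norm z0 ^ n" if z:"z\<in>K" for n z
 proof -
 have "norm z0<1" using z0 assms(4) by auto
 have "norm (w n * z ^ c n)=norm (w n) * norm z ^ c n"
 by (simp add:norm_mult norm_power)
 also have "...\<le>W * norm z0 ^ n"
 proof (intro mult_mono assms)
 have "norm z ^ c n\<le>norm z0 ^ c n"
 using z0 z by (intro power_mono) auto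
 also have "...\<le>norm z0 ^ n"
 using assms(1) \<open>norm z0<1\<close> by (intro power_decreasing) auto
 finally show "norm z ^ c n\<le>norm z0 ^ n" .
 show "0\<le>W" using order.trans[OF norm_ge_zero assms(2)[of 0]] .
 qed auto
 finally show ?thesis .
 qed
 have "norm z0<1" using z0 assms(4) by auto
 with * show ?thesis
 by (intro exI[of _ W] exI[of _ "norm z0"]) auto
qed

text \<open>This form serves two purposes: expansions in q^(1/l) at arbitrary cusps, where
  \<open>w\<close> is a constant of modulus 1, and products in q at infinity with integer
  coefficients, where \<open>w\<close> is 1.\<close>

definition qprod::"(nat => complex)=>(nat=>nat) => complex => complex" where
 "qprod w c z=prodinf (%n. 1-w n * z ^ c n)"

context
 fixes w::"nat => complex" and c::"nat=>nat" and W::real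
 assumes c:"!!n. n \<le> c n" and W: "!!n. norm (w n)\<le>W"
begin
lemma qprod_factor_holomorphic:"(%z. w n * z ^ c n) holomorphic_on ball 0 1"
 by (intro holomorphic_intros)

lemmas qprod_bound=power_product_bound[OF c W]

lemma qprod_convergent:"norm z<1 ==> convergent_prod (%n. 1-w n * z ^ c n)"
 using geometric_product_convergent[OF open_ball qprod_factor_holomorphic qprod_bound] by simp

lemma qprod_uniform_limit:"compact K==>K \<subseteq> ball 0 1 ==>
 uniform_limit K (%N z. \<Prod>n<N. 1-w n * z ^ c n) (qprod w c) sequentially"
 using geometric_product_uniform_limit[OF open_ball qprod_factor_holomorphic qprod_bound]
 by (simp add:qprod_def[abs_def])

lemma qprod_holomorphic:"qprod w c holomorphic_on ball 0 1"
 using geometric_product_holomorphic[OF open_ball qprod_factor_holomorphic qprod_bound]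
 by (simp add:qprod_def[abs_def])

lemma qprod_eq_0_iff:"norm z<1==>qprod w c z=0\<longleftrightarrow>(EX n. w n * z ^ c n=1)"
 using geometric_product_eq_0_iff[OF open_ball qprod_factor_holomorphic qprod_bound]
 by (simp add:qprod_def[abs_def])

lemma qprod_logderiv:"norm z<1==>qprod w c z~=0 ==>
 (%n. - deriv (%z. w n * z ^ c n) z/(1-w n * z ^ c n))
 sums (deriv (qprod w c) z/qprod w c z)"
 using geometric_product_logderiv[OF open_ball qprod_factor_holomorphic qprod_bound]
 by (simp add:qprod_def[abs_def])

lemma qprod_has_fps_expansion:"qprod w c has_fps_expansion fps_expansion (qprod w c) 0"
proof -
 have "qprod w c analytic_on {0}"
 using qprod_holomorphic analytic_at[of "qprod w c" 0] by auto
 thus ?thesis by (rule analytic_at_imp_has_fps_expansion_0)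
qed

lemma qprod_partial_fps:
 "(%z. \<Prod>n<N. 1-w n * z ^ c n) has_fps_expansion (\<Prod>n<N. 1-fps_const (w n) * fps_X ^ c n)"
 by (intro fps_expansion_intros)

lemma qprod_uniform_limit_half:
 "uniform_limit (ball 0 (1/2)) (%N z. \<Prod>n<N. 1-w n * z ^ c n) (qprod w c) sequentially"
proof (rule uniform_limit_on_subset[OF qprod_uniform_limit])
 show "cball 0 (1/2::real) \<subseteq> ball (0::complex) 1" by (simp add:cball_subset_ball_iff)
qed auto

lemma qprod_int_fps:
 assumes "!!n. w n\<in>\<int>"
 shows "int_fps (fps_expansion (qprod w c) 0)"
 unfolding int_fps_def
proof
 fix n
 have "int_fps (\<Prod>n<N. 1-fps_const (w n) * fps_X ^ c n)" for N
 using assms by (intro int_fps_prod int_fps_diff int_fps_mult int_fps_power)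
 (auto simp:int_fps_def )
 thus "fps_nth (fps_expansion (qprod w c) 0) n\<in>\<int>"
 by (intro fps_expansion_uniform_limit_Ints[OF qprod_partial_fps qprod_has_fps_expansion
 _ open_ball _ qprod_uniform_limit_half])
 (auto simp:int_fps_def intro!: holomorphic_intros)
qed
end

section \<open>The exponential and theta products\<close>

definition ee::"complex => complex" where
 "ee z=exp (2 * of_real pi*\<i> * z)"

lemma ee_0 [simp]:"ee 0=1" by (simp add:ee_def)
lemma ee_nonzero [simp]:"ee z~=0" by (simp add:ee_def)
lemma ee_add:"ee (a+b)=ee a * ee b" by (simp add:ee_def exp_add ring_distribs)
lemma ee_minus:"ee (- a)=inverse (ee a)" by (simp add:ee_def exp_minus)
lemma ee_diff:"ee (a-b)=ee a/ee b" by (simp add:ee_def exp_diff ring_distribs)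
lemma ee_power:"ee z ^ n=ee (of_nat n * z)"
 by (simp add:ee_def exp_of_nat_mult[symmetric] mult_ac)
lemma ee_sum:"ee (sum f I)=(\<Prod>i\<in>I. ee (f i))"
 by (induction I rule:infinite_finite_induct) (auto simp:ee_add)

lemma ee_eq_1_iff:"ee z=1\<longleftrightarrow>(\<exists>n::int. z = of_int n)"
proof -
 have "ee z=1\<longleftrightarrow>(\<exists>n::int. 2 * of_real pi*\<i> * z=(of_int (2 * n) * pi)*\<i>)"
 unfolding ee_def by (subst exp_eq_1) (auto simp:complex_eq_iff)
 also have "...\<longleftrightarrow>(\<exists>n::int. z = of_int n)"
 by (intro ex_cong1) (auto simp:field_simps)
 finally show ?thesis .
qed

lemma ee_of_int [simp]:"ee (of_int n)=1"
 using ee_eq_1_iff by blast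

lemma ee_of_nat [simp]:"ee (of_nat n)=1"
 using ee_of_int[of "int n"] by simp

lemma ee_1 [simp]:"ee 1=1"
 using ee_of_int[of 1] by simp

lemma ee_half [simp]:"ee (1/2) = -1"
 by (simp add:ee_def)

lemma ee_add_int [simp]:"ee (z + of_int n)=ee z" "ee (of_int n+z)=ee z"
 by (simp_all add:ee_add)

lemma norm_ee:"norm (ee z)=exp (- 2 * pi * Im z)"
 by (simp add:ee_def)

lemma norm_ee_of_real [simp]:"norm (ee (of_real x))=1"
 by (simp add:norm_ee)

lemma qpow_eq_ee:"qpow x z=ee (of_real x * z)"
 by (simp add:qpow_def ee_def mult_ac)

lemma ee_holomorphic [holomorphic_intros]:"f holomorphic_on S==>(%z. ee (f z)) holomorphic_on S"
 unfolding ee_def by (intro holomorphic_intros)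

lemma ee_continuous [continuous_intros]:"continuous_on S f ==> continuous_on S (%z. ee (f z))"
 unfolding ee_def by (intro continuous_intros)

lemma norm_qpow_less_1:"Im tt > 0==>x > 0==>norm (qpow x tt)<1"
 by (simp add:qpow_eq_ee norm_ee)

text \<open>With x = \<open>ee z\<close> and q = \<open>ee tt\<close> this is the q-Pochhammer
  symbol (x; q)_infinity, one half of the Jacobi product.\<close>

definition half_theta::"complex => complex => complex" where
 "half_theta tt z=prodinf (%n. 1-ee (z + of_nat n * tt))"

context
 fixes tt::complex assumes tau:"Im tt > 0"
begin
lemma half_theta_bound:
 assumes "compact K" "K \<subseteq> (UNIV::complex set)"
 shows "EX C r. 0\<le>r&r<1&(ALL n. \<forall>z\<in>K. norm (ee (z + of_nat n * tt)) \<le> C * r ^ n)"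
proof -
 have "compact (ee ` K)"
 using assms by (intro compact_continuous_image continuous_intros)
 then obtain C where C: "!!z. z\<in>K==>norm (ee z) \<le> C"
 using compact_imp_bounded bounded_iff by (metis image_eqI)
 have "norm (ee (z + of_nat n * tt)) \<le> C * norm (ee tt) ^ n" if "z\<in>K" for z n
 using C[OF that] by (simp add:ee_add ee_power[symmetric] norm_mult norm_power mult_right_mono)
 moreover have "norm (ee tt)<1" using tau by (simp add:norm_ee)
 ultimately show ?thesis
 by (intro exI[of _ C] exI[of _ "norm (ee tt)"]) auto
qed

lemma half_theta_factor_holomorphic:"(%z. ee (z + of_nat n * tt)) holomorphic_on UNIV"
 by (intro holomorphic_intros)

lemmas half_theta_geometric = open_UNIV half_theta_factor_holomorphic half_theta_bound

lemma half_theta_convergent:"convergent_prod (%n. 1-ee (z + of_nat n * tt))"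
 using geometric_product_convergent[OF half_theta_geometric] by simp

lemma half_theta_holomorphic:"half_theta tt holomorphic_on UNIV"
 using geometric_product_holomorphic[OF half_theta_geometric] by (simp add:half_theta_def[abs_def])

lemma half_theta_eq_0_iff:"half_theta tt z=0\<longleftrightarrow>(\<exists>n::nat. ee (z + of_nat n * tt)=1)"
 using geometric_product_eq_0_iff[OF half_theta_geometric] by (simp add:half_theta_def[abs_def])

lemma half_theta_shift:"half_theta tt z=(1-ee z) * half_theta tt (z+tt)"
proof (cases "ee z=1")
 case True
 thus ?thesis using half_theta_eq_0_iff[of z] by (auto intro:exI[of _ 0])
next
 case False
 have "half_theta tt z=(1-ee z) * prodinf (%n. 1-ee (z + of_nat (Suc n) * tt))"
 unfolding half_theta_def
 by (subst prodinf_split_head[OF half_theta_convergent]) (use False in auto)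
 thus ?thesis by (simp add:half_theta_def algebra_simps)
qed

lemma half_theta_nonzero:
 assumes "Im z > 0"
 shows "half_theta tt z~=0"
proof
 assume "half_theta tt z=0"
 then obtain n::nat where "ee (z + of_nat n * tt)=1"
 by (auto simp:half_theta_eq_0_iff)
 hence "norm (ee (z + of_nat n * tt))=1" by simp
 hence "Im z+real n * Im tt=0" by (simp add:norm_ee)
 with tau assms show False
 by (metis add_pos_nonneg less_irrefl mult_nonneg_nonneg of_nat_0_le_iff less_imp_le)
qed
end

lemma half_theta_add_int [simp]:"half_theta tt (z + of_int m)=half_theta tt z"
proof -
 have "ee (z + of_int m + of_nat n * tt)=ee (z + of_nat n * tt)" for n
 by (simp add:ee_add)
 thus ?thesis by (simp add:half_theta_def)
qed

lemma half_theta_add_1 [simp]:"half_theta tt (z+1)=half_theta tt z"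
 using half_theta_add_int[of tt z 1] by simp

lemma half_theta_diff_int [simp]:"half_theta tt (z - of_int m)=half_theta tt z"
 using half_theta_add_int[of tt z "-m"] by simp

text \<open>The hypothesis on \<open>u\<close> says that the \<open>ee (u t)\<close> run through the
  N-th roots of unity. Multiplying the factors with the same n replaces \<open>ee z\<close> and q by
  their N-th powers.\<close>

lemma half_theta_distribution:
 assumes tau:"Im tt > 0" and N: "N > 0" and u:"!!x. (\<Prod>t<N. 1-x * ee (u t))=1-x ^ N"
 shows "(\<Prod>t<N. half_theta tt (z+u t))=half_theta (of_nat N * tt) (of_nat N * z)"
proof -
 have "(\<Prod>t<N. half_theta tt (z+u t))=prodinf (%n. \<Prod>t<N. 1-ee (z+u t + of_nat n * tt))"
 unfolding half_theta_def by (intro prodinf_prod[symmetric] half_theta_convergent tau)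
 also have "(%n. \<Prod>t<N. 1-ee (z+u t + of_nat n * tt)) =
 (%n. 1-ee (of_nat N * z + of_nat n*(of_nat N * tt)))"
 proof
 fix n::nat
 have "(\<Prod>t<N. 1-ee (z+u t + of_nat n * tt))=(\<Prod>t<N. 1-ee (z + of_nat n * tt) * ee (u t))"
 by (intro prod.cong refl) (simp add:ee_add)
 also have "...=1-ee (z + of_nat n * tt) ^ N" by (rule u)
 finally show "(\<Prod>t<N. 1-ee (z+u t + of_nat n * tt)) =
 1-ee (of_nat N * z + of_nat n*(of_nat N * tt))"
 by (simp add:ee_power algebra_simps)
 qed
 finally show ?thesis by (simp add:half_theta_def)
qed

lemma half_theta_even_odd:
 assumes tau:"Im tt > 0"
 shows "half_theta tt z=half_theta (2 * tt) z * half_theta (2 * tt) (z+tt)"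
proof -
 have tau2:"Im (2 * tt) > 0" using tau by simp
 define f where "f=(%n. 1-ee (z + of_nat n * tt))"
 have lim:"(%N. prod f {..<N}) \<longlonglongrightarrow> half_theta tt z"
 using convergent_prod_LIMSEQ[OF half_theta_convergent[OF tau,of z]]
 unfolding LIMSEQ_lessThan_iff_atMost f_def half_theta_def .
 have lim2:"(%N. \<Prod>n<N. 1-ee (y + of_nat n*(2 * tt))) \<longlonglongrightarrow> half_theta (2 * tt) y" for y
 using convergent_prod_LIMSEQ[OF half_theta_convergent[OF tau2,of y]]
 unfolding LIMSEQ_lessThan_iff_atMost half_theta_def .
 have split:"prod f {..<2 * N}=(\<Prod>n<N. 1-ee (z + of_nat n*(2 * tt))) *
 (\<Prod>n<N. 1-ee (z+tt + of_nat n*(2 * tt)))" for N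
 by (induction N) (simp_all add:f_def algebra_simps)
 have "strict_mono (%N::nat. 2 * N)" by (auto simp:strict_mono_def)
 from LIMSEQ_subseq_LIMSEQ[OF lim this]
 have "(%N. prod f {..<2 * N}) \<longlonglongrightarrow> half_theta tt z" by (simp add:o_def)
 moreover have "(%N. prod f {..<2 * N}) \<longlonglongrightarrow> half_theta (2 * tt) z * half_theta (2 * tt) (z+tt)"
 unfolding split by (intro tendsto_mult lim2)
 ultimately show ?thesis using LIMSEQ_unique by blast
qed

text \<open>After multiplication by (q; q) the four products pair up, by the duplication formula, to
  the even and odd parts of (q; q); cancelling (q; q) leaves 1.\<close>

lemma half_theta_Euler:
 assumes tau:"Im tt > 0"
 shows "half_theta tt (tt/2) * half_theta tt (tt/2+1/2) * half_theta tt (tt+1/2)=1"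
proof -
 have two:"half_theta tt z * half_theta tt (z+1/2)=half_theta (2 * tt) (2 * z)" for z
 proof -
 have "(\<Prod>t<2. 1-x * ee (of_nat t/2))=1-x^2" for x
 by (simp add:numeral_2_eq_2 algebra_simps power2_eq_square)
 from half_theta_distribution[OF tau _ this,of z]
 show ?thesis by (simp add:numeral_2_eq_2)
 qed
 have "half_theta tt (tt/2) * half_theta tt (tt/2+1/2) * half_theta tt (tt+1/2) * half_theta tt tt
 = half_theta (2 * tt) tt * half_theta (2 * tt) (tt+tt)"
 using two[of "tt/2"] two[of tt] by (simp add:algebra_simps)
 also have "...=half_theta tt tt"
 using half_theta_even_odd[OF tau,of tt] by simp
 finally show ?thesis
 using half_theta_nonzero[OF tau,of tt] tau by simp
qed

text \<open>Jacobi's theta function up to elementary factors: entire in z, quasi-periodic, with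
  zeros exactly on the lattice Z + Z tt.\<close>

definition theta_prod::"complex => complex => complex" where
 "theta_prod tt z=half_theta tt z * half_theta tt (tt-z)"

lemma theta_prod_add_int [simp]:"theta_prod tt (z + of_int m)=theta_prod tt z"
proof -
 have "tt-(z + of_int m)=tt-z - of_int m" by simp
 thus ?thesis unfolding theta_prod_def by (simp only:half_theta_add_int half_theta_diff_int)
qed

context
 fixes tt::complex assumes tau:"Im tt > 0"
begin
lemma theta_prod_holomorphic:"theta_prod tt holomorphic_on UNIV"
proof -
 have "(%z. half_theta tt (tt-z)) holomorphic_on UNIV"
 using holomorphic_on_compose_gen[OF _ half_theta_holomorphic[OF tau],of "%z. tt-z" UNIV]
 by (simp add:o_def holomorphic_on_diff)
 thus ?thesis
 unfolding theta_prod_def[abs_def] by (intro holomorphic_intros half_theta_holomorphic tau)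
qed

lemma theta_prod_shift:"theta_prod tt (z+tt) = - ee (- z) * theta_prod tt z"
proof -
 have 1:"half_theta tt z=(1-ee z) * half_theta tt (z+tt)"
 by (rule half_theta_shift[OF tau])
 have 2:"half_theta tt (- z)=(1-ee (- z)) * half_theta tt (tt-z)"
 using half_theta_shift[OF tau,of "- z"] by simp
 have "theta_prod tt (z+tt)=half_theta tt (z+tt) * half_theta tt (- z)"
 by (simp add:theta_prod_def)
 also have "... = - ee (- z) * theta_prod tt z"
 unfolding theta_prod_def 1 2 by (simp add:ee_minus field_simps)
 finally show ?thesis .
qed

lemma theta_prod_eq_0_iff:"theta_prod tt z=0\<longleftrightarrow>(\<exists>m n::int. z = of_int m + of_int n * tt)"
proof
 assume "theta_prod tt z=0"
 then consider n::nat where "ee (z + of_nat n * tt)=1"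
 | n::nat where "ee (tt-z + of_nat n * tt)=1"
 by (auto simp:theta_prod_def half_theta_eq_0_iff[OF tau])
 thus "\<exists>m n::int. z = of_int m + of_int n * tt"
 proof cases
 case 1
 then obtain m::int where "z + of_nat n * tt = of_int m" by (auto simp:ee_eq_1_iff)
 hence "z = of_int m + of_int (- int n) * tt" by (simp add:algebra_simps)
 thus ?thesis by blast
 next
 case 2
 then obtain m::int where "tt-z + of_nat n * tt = of_int m" by (auto simp:ee_eq_1_iff)
 hence "z = of_int (- m) + of_int (int n+1) * tt" by (simp add:algebra_simps)
 thus ?thesis by blast
 qed
next
 assume "\<exists>m n::int. z = of_int m + of_int n * tt"
 then obtain m n::int where z:"z = of_int n * tt + of_int m" by (auto simp:add.commute)
 have 0:"theta_prod tt 0=0"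
 unfolding theta_prod_def using half_theta_eq_0_iff[OF tau,of 0] by (auto intro:exI[of _ 0])
 have iff:"theta_prod tt (y+tt)=0\<longleftrightarrow>theta_prod tt y=0" for y
 by (simp add:theta_prod_shift)
 have "theta_prod tt (of_int n * tt)=0"
 proof (induction n rule:int_induct[where k=0])
 case base thus ?case using 0 by simp
 next
 case (step1 i) thus ?case using iff[of "of_int i * tt"] by (simp add:algebra_simps)
 next
 case (step2 i) thus ?case using iff[of "of_int i * tt-tt"] by (simp add:algebra_simps)
 qed
 thus "theta_prod tt z=0" by (simp add:z)
qed

text \<open>Isolates the zero at z = 0, so that limits of quotients of theta products can be
  computed there.\<close>

lemma theta_prod_near_0:"theta_prod tt z=(1-ee z)*(half_theta tt (z+tt) * half_theta tt (tt-z))"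
 by (simp add:theta_prod_def half_theta_shift[OF tau,of z])

end

section \<open>Siegel functions with two-component index\<close>

text \<open>The Siegel function g_(a,b), with z = a tt + b. The exponential factors combine to
  q^(B_2(a)/2) e(b(a-1)/2), where B_2(a) = a^2 - a + 1/6. A second component is needed because
  SL2(Z) acts on the row (a, b).\<close>

definition gsiegel::"real=>real => complex => complex" where
 "gsiegel a b tt = - ee (tt/12) * ee ((of_real a-1)*(of_real a * tt + of_real b)/2)
 * theta_prod tt (of_real a * tt + of_real b)"

lemma siegel_eq_gsiegel:
 assumes "Im tt > 0"
 shows "siegel a tt=gsiegel a 0 tt"
proof -
 have 1:"qpow (real n+a) tt=ee (of_real a * tt + of_nat n * tt)" for n
 by (simp add:qpow_eq_ee algebra_simps)
 have 2:"qpow (real (Suc n)-a) tt=ee (tt - of_real a * tt + of_nat n * tt)" for n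
 by (simp add:qpow_eq_ee algebra_simps)
 have "siegel a tt = - qpow ((a\<^sup>2-a+1/6)/2) tt * theta_prod tt (of_real a * tt)"
 unfolding siegel_def 1 2 theta_prod_def half_theta_def
 by (subst prodinf_mult) (use half_theta_convergent[OF assms] in auto)
 also have "qpow ((a\<^sup>2-a+1/6)/2) tt=ee (tt/12) * ee ((of_real a-1)*(of_real a * tt)/2)"
 unfolding qpow_eq_ee ee_add[symmetric] by (simp add:field_simps power2_eq_square)
 finally show ?thesis by (simp add:gsiegel_def)
qed

lemma gsiegel_eq_0_iff:
 assumes "Im tt > 0"
 shows "gsiegel a b tt=0\<longleftrightarrow>a\<in>\<int>&b\<in>\<int>"
proof -
 have "gsiegel a b tt=0\<longleftrightarrow>(\<exists>m n::int. of_real a * tt + of_real b = of_int m + of_int n * tt)"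
 by (simp add:gsiegel_def theta_prod_eq_0_iff[OF assms])
 also have "...\<longleftrightarrow>(\<exists>m n::int. a = of_int n&b = of_int m)"
 using assms by (intro ex_cong1) (auto simp:complex_eq_iff)
 also have "...\<longleftrightarrow>a\<in>\<int>&b\<in>\<int>"
 by (auto elim!: Ints_cases)
 finally show ?thesis .
qed

text \<open>Translating b by an integer changes only the exponential; translating a by 1 uses the
  quasi-periodicity of \<open>theta_prod\<close>, whose factor cancels all dependence on tt. The
  integer \<open>m * n + m + n\<close> records the sign.\<close>

lemma gsiegel_shift:
 assumes "Im tt > 0"
 shows "gsiegel (a + of_int m) (b + of_int n) tt =
 ee ((of_int n * of_real a - of_int m * of_real b + of_int (m * n+m+n))/2) * gsiegel a b tt"
proof -
 have b:"gsiegel a (b + of_int n) tt=ee (of_int n*(of_real a-1)/2) * gsiegel a b tt" for a b n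
 proof -
 have "gsiegel a (b + of_int n) tt = - ee (tt/12) *
 ee ((of_real a-1)*(of_real a * tt + of_real b)/2 + of_int n*(of_real a-1)/2) *
 theta_prod tt (of_real a * tt + of_real b + of_int n)"
 by (simp add:gsiegel_def algebra_simps add_divide_distrib diff_divide_distrib)
 thus ?thesis by (simp add:ee_add gsiegel_def)
 qed
 have a1:"gsiegel (a+1) b tt=ee ((1 - of_real b)/2) * gsiegel a b tt" for a b
 proof -
 define z where "z = of_real a * tt + of_real b"
 have "ee ((1 - of_real b)/2) * ee ((of_real a-1) * z/2) = - ee (of_real a*(z+tt)/2) * ee (-z)"
 proof -
 have "ee ((1 - of_real b)/2) * ee ((of_real a-1) * z/2) =
 ee (1/2 + of_real a*(z+tt)/2 + - z)"
 unfolding ee_add[symmetric] by (intro arg_cong[of _ _ ee]) (simp add:z_def field_simps)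
 thus ?thesis unfolding ee_add ee_half by simp
 qed
 hence "ee ((1 - of_real b)/2) * gsiegel a b tt =
 - ee (tt/12)*(- ee (of_real a*(z+tt)/2) * ee (-z)) * theta_prod tt z"
 unfolding gsiegel_def z_def[symmetric] by (simp add:mult_ac)
 moreover have "gsiegel (a+1) b tt =
 - ee (tt/12) * ee (of_real a*(z+tt)/2) * theta_prod tt (z+tt)"
 by (simp add:gsiegel_def z_def algebra_simps)
 ultimately show ?thesis by (simp add:theta_prod_shift[OF assms])
 qed
 have a:"gsiegel (a + of_int m) b tt=ee (of_int m*(1 - of_real b)/2) * gsiegel a b tt" for a b m
 proof (induction m rule:int_induct[where k=0])
 case (step1 i)
 have "gsiegel (a + of_int (i+1)) b tt=gsiegel (a + of_int i+1) b tt"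
 by (simp add:algebra_simps)
 also have "...=ee ((1 - of_real b)/2 + of_int i*(1 - of_real b)/2) * gsiegel a b tt"
 by (simp add:a1 step1.IH ee_add)
 also have "(1 - of_real b)/2 + of_int i*(1 - of_real b)/2 = of_int (i+1)*(1 - complex_of_real b)/2"
 by (simp add:field_simps)
 finally show ?case .
 next
 case (step2 i)
 have "ee ((1 - of_real b)/2) * gsiegel (a + of_int (i-1)) b tt=gsiegel (a + of_int i) b tt"
 using a1[of "a + of_int (i-1)"] by simp
 also have "...=ee ((1 - of_real b)/2 + of_int (i-1)*(1 - of_real b)/2) * gsiegel a b tt"
 by (simp add:step2.IH field_simps)
 finally show ?case by (simp add:ee_add)
 qed auto
 have "gsiegel (a + of_int m) (b + of_int n) tt =
 ee (of_int n*(of_real a + of_int m-1)/2 + of_int m*(1 - of_real b)/2) * gsiegel a b tt"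
 by (simp add:a b ee_add)
 also have "of_int n*(of_real a + of_int m-1)/2 + of_int m*(1 - of_real b)/2 =
 (of_int n * of_real a - of_int m * of_real b + of_int (m * n+m+n))/2+(of_int (- n)::complex)"
 by (simp add:field_simps)
 also have "ee ...=ee ((of_int n * of_real a - of_int m * of_real b + of_int (m * n+m+n))/2)"
 by (rule ee_add_int)
 finally show ?thesis .
qed

section \<open>The action of SL2(Z) on the upper half-plane\<close>

lemma mat2_exhaust:
 fixes gg::"int^2^2"
 shows "gg\<in>SL2Z\<longleftrightarrow>gg$1$1 * gg$2$2-gg$1$2 * gg$2$1=1"
 by (simp add:SL2Z_def det_2)

definition autom::"int^2^2 => complex => complex" where
 "autom gg z = of_int (gg$2$1) * z + of_int (gg$2$2)"

lemma autom_nonzero: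
 assumes "gg\<in>SL2Z" "Im z > 0"
 shows "autom gg z~=0"
proof
 assume *: "autom gg z=0"
 hence "of_int (gg$2$1) * Im z=0"
 by (auto simp:autom_def complex_eq_iff)
 hence "gg$2$1=0" using assms by simp
 with * have "gg$2$2=0" by (simp add:autom_def)
 with \<open>gg$2$1=0\<close> assms show False by (simp add:mat2_exhaust)
qed

lemma moebius_autom:"moebius gg z=(of_int (gg$1$1) * z + of_int (gg$1$2))/autom gg z"
 by (simp add:moebius_def autom_def)

lemma Im_moebius:
 assumes "gg\<in>SL2Z" "Im z > 0"
 shows "Im (moebius gg z)=Im z/norm (autom gg z)^2"
proof -
 define J where "J=autom gg z"
 have "Im (moebius gg z)=Im ((of_int (gg$1$1) * z + of_int (gg$1$2)) * cnj J)/norm J^2"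
 unfolding moebius_autom J_def[symmetric] by (subst complex_div_cnj) (simp add:Im_divide_of_real)
 also have "Im ((of_int (gg$1$1) * z + of_int (gg$1$2)) * cnj J)
 = Im z * of_int (gg$1$1 * gg$2$2-gg$1$2 * gg$2$1)"
 by (simp add:J_def autom_def algebra_simps)
 also have "gg$1$1 * gg$2$2-gg$1$2 * gg$2$1=1"
 using assms by (simp only:mat2_exhaust)
 finally show ?thesis by (simp add:J_def)
qed

lemma Im_moebius_pos:"gg\<in>SL2Z==>Im z > 0==>Im (moebius gg z) > 0"
 using autom_nonzero[of gg z] by (simp add:Im_moebius)

lemma moebius_in_uhp:"gg\<in>SL2Z==>z\<in>uhp==>moebius gg z\<in>uhp"
 using Im_moebius_pos by (simp add:uhp_def)

lemma matrix_mult_2: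
 fixes A B::"int^2^2"
 shows "(A ** B)$i$j=A$i$1 * B$1$j+A$i$2 * B$2$j"
 by (simp add:matrix_matrix_mult_def sum_2)

lemma SL2Z_mult [intro]:"A\<in>SL2Z==>B\<in>SL2Z==>A ** B\<in>SL2Z"
 by (simp add:SL2Z_def det_mul)

lemma moebius_times_autom:
 assumes "gg\<in>SL2Z" "Im z > 0"
 shows "moebius gg z * autom gg z = of_int (gg$1$1) * z + of_int (gg$1$2)"
 using autom_nonzero[OF assms] by (simp add:moebius_autom)

lemma autom_mult:
 assumes "A\<in>SL2Z" "B\<in>SL2Z" "Im z > 0"
 shows "autom (A ** B) z=autom A (moebius B z) * autom B z"
proof -
 have "autom A (moebius B z) * autom B z =
 of_int (A$2$1)*(moebius B z * autom B z) + of_int (A$2$2) * autom B z"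
 by (simp add:autom_def[of A] algebra_simps)
 thus ?thesis
 unfolding moebius_times_autom[OF assms(2,3)]
 by (simp add:autom_def matrix_mult_2 algebra_simps)
qed

lemma moebius_mult:
 assumes "A\<in>SL2Z" "B\<in>SL2Z" "Im z > 0"
 shows "moebius (A ** B) z=moebius A (moebius B z)"
proof -
 have "(of_int (A$1$1) * moebius B z + of_int (A$1$2)) * autom B z =
 of_int (A$1$1)*(moebius B z * autom B z) + of_int (A$1$2) * autom B z"
 by (simp add:algebra_simps)
 hence "of_int ((A ** B)$1$1) * z + of_int ((A ** B)$1$2) =
 (of_int (A$1$1) * moebius B z + of_int (A$1$2)) * autom B z"
 unfolding moebius_times_autom[OF assms(2,3)]
 by (simp add:autom_def matrix_mult_2 algebra_simps)
 thus ?thesis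
 using autom_nonzero[OF assms(2,3)] by (simp add:moebius_autom[of A] moebius_autom[of "A ** B"] autom_mult[OF assms])
qed

definition mat2::"int=>int=>int=>int=>int^2^2" where
 "mat2 a b c d = vector [vector [a,b],vector [c,d]]"

lemma mat2_nth [simp]:
 "mat2 a b c d$1$1=a" "mat2 a b c d$1$2=b"
 "mat2 a b c d$2$1 = c" "mat2 a b c d$2$2=d"
 by (simp_all add:mat2_def)

lemma mat2_eqI:
 fixes A B::"int^2^2"
 shows "A$1$1=B$1$1==>A$1$2=B$1$2==>A$2$1=B$2$1 ==>
 A$2$2=B$2$2==>A=B"
 by (simp add:Finite_Cartesian_Product.vec_eq_iff forall_2)

lemma mat1_nth [simp]:
 "(mat 1::int^2^2)$1$1=1" "(mat 1::int^2^2)$1$2=0"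
 "(mat 1::int^2^2)$2$1=0" "(mat 1::int^2^2)$2$2=1"
 by (simp_all add:Finite_Cartesian_Product.mat_def)

definition minv::"int^2^2=>int^2^2" where
 "minv gg=mat2 (gg$2$2) (- gg$1$2) (- gg$2$1) (gg$1$1)"

lemma minv_in_SL2Z [intro]:"gg\<in>SL2Z==>minv gg\<in>SL2Z"
 by (simp add:mat2_exhaust minv_def mult.commute)

lemma minv_mult:"gg\<in>SL2Z==>minv gg ** gg=mat 1" "gg\<in>SL2Z==>gg ** minv gg=mat 1"
 by (rule mat2_eqI; simp add:mat2_exhaust minv_def matrix_mult_2 algebra_simps)+

lemma mat1_in_SL2Z [simp,intro]:"mat 1\<in>SL2Z"
 by (simp add:mat2_exhaust)

lemma moebius_mat1 [simp]:"moebius (mat 1) z=z"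
 by (simp add:moebius_def)

lemma moebius_minv [simp]:
 assumes "gg\<in>SL2Z" "Im z > 0"
 shows "moebius gg (moebius (minv gg) z)=z" "moebius (minv gg) (moebius gg z)=z"
 using moebius_mult[of gg "minv gg" z] moebius_mult[of "minv gg" gg z] assms minv_in_SL2Z[of gg]
 by (auto simp:minv_mult)

lemma moebius_holomorphic [holomorphic_intros]:
 assumes "gg\<in>SL2Z" shows "moebius gg holomorphic_on uhp"
 unfolding moebius_def using autom_nonzero[OF assms]
 by (intro holomorphic_intros) (auto simp:autom_def uhp_def)

section \<open>Transformation of Siegel functions and of the discriminant\<close>

text \<open>The square of Dedekind's eta function.\<close>

definition eta_sq::"complex => complex" where
 "eta_sq tt=ee (tt/12) * half_theta tt tt^2"

lemma eta_sq_nonzero:"Im tt > 0==>eta_sq tt~=0"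
 by (simp add:eta_sq_def half_theta_nonzero)

text \<open>The common factor in the transformation law of all Siegel functions. It turns out to be
  a twelfth root of unity; what matters for quotients is that it does not involve the index (a,
  b).\<close>

definition siegel_factor::"int^2^2 => complex => complex" where
 "siegel_factor gg tt=eta_sq (moebius gg tt)/(autom gg tt * eta_sq tt)"

text \<open>The number a b + a + b is even only if a and b are both even, which a row of a matrix of
  determinant 1 excludes. This makes the signs in \<open>gsiegel_shift\<close> agree on both sides
  of the transformation law.\<close>

lemma SL2Z_parity:
 assumes "a * d-b * c=(1::int)"
 shows "odd (a * b+a+b)" "odd (c * d + c+d)"
proof -
 have "odd (a * d-b * c)" using assms by simp
 thus "odd (a * b+a+b)" "odd (c * d + c+d)" by auto
qed

lemma ee_odd_half:
 assumes "odd n" shows "ee ((x + of_int n)/2)=ee ((x+1)/2)"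
proof -
 obtain m where m:"n=2 * m+1" using assms by (elim oddE)
 have "(x + of_int n)/2=(x+1)/2 + of_int m" by (simp add:m field_simps)
 thus ?thesis by (simp only:ee_add_int)
qed

text \<open>
 For fixed \<open>\<tau>\<close> the quotient of the two sides is, up to a constant, the function \<open>h\<close> below; the
 shift formula makes it doubly periodic and it has no poles, so it is constant by Liouville's
 theorem.  Its value is read off at \<open>0\<close>.
\<close>

theorem gsiegel_moebius:
 assumes gg:"gg\<in>SL2Z" and tau:"Im tt > 0" and ab:"~ (a\<in>\<int>&b\<in>\<int>)"
 shows "gsiegel a b (moebius gg tt) = siegel_factor gg tt *
 gsiegel (a * of_int (gg$1$1)+b * of_int (gg$2$1))
 (a * of_int (gg$1$2)+b * of_int (gg$2$2)) tt"
proof -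
 define p q r s where "p=gg$1$1" and "q=gg$1$2" and "r=gg$2$1" and "s=gg$2$2"
 note pqrs=p_def[symmetric] q_def[symmetric] r_def[symmetric] s_def[symmetric]
 have det:"p * s-q * r=1" using gg by (simp add:mat2_exhaust pqrs)
 have detc:"of_int p * of_int s - of_int q * of_int r=(1::complex)"
 using arg_cong[OF det,of "of_int::int => complex"] by simp
 have detr:"of_int p * of_int s - of_int q * of_int r=(1::real)"
 using arg_cong[OF det,of "of_int::int=>real"] by simp
 define tt' where "tt'=moebius gg tt"
 define J where "J=autom gg tt"
 have tau':"Im tt' > 0" using Im_moebius_pos[OF gg tau] by (simp add:tt'_def)
 have J: "J~=0" using autom_nonzero[OF gg tau] by (simp add:J_def)
 have J_eq:"J = of_int r * tt + of_int s" by (simp add:J_def autom_def pqrs)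
 have Jtt':"J * tt' = of_int p * tt + of_int q"
 using J by (simp add:tt'_def moebius_autom J_def[symmetric] pqrs)
 define x where "x=(%a b. a * of_int p+b * of_int r::real)"
 define y where "y=(%a b. a * of_int q+b * of_int s::real)"
 \<comment> \<open>Up to the constant \<open>ee ((tt'-tt)/12)\<close> this is the quotient of the
   two Siegel functions at z = J (a tt' + b). The quadratic exponent collects their exponential
   factors and no longer mentions a and b.\<close>
 define h where "h=(%z. ee ((- of_int r * z^2/J-z/J+z)/2) * theta_prod tt' (z/J)/theta_prod tt z)"
 have xy:"of_real (x a b) * tt + of_real (y a b)=J * (of_real a * tt' + of_real b)" for a b
 proof -
 have "J * (of_real a * tt' + of_real b) = of_real a*(J * tt') + of_real b * J"
 by (simp add:algebra_simps)
 thus ?thesis unfolding Jtt' unfolding J_eq by (simp add:x_def y_def algebra_simps)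
 qed
 have ratio:"gsiegel a b tt'/gsiegel (x a b) (y a b) tt =
 ee ((tt'-tt)/12) * h (J * (of_real a * tt' + of_real b))" for a b
 proof -
 define z' where "z' = of_real a * tt' + of_real b"
 have "of_real (x a b) * J - of_real a = of_int r * J * z'"
 proof -
 have "of_int r * J * z' = of_int r*(of_real a*(J * tt') + of_real b * J)"
 by (simp add:z'_def algebra_simps)
 also have "... = of_real a*(of_int r*(of_int p * tt + of_int q)) + of_real b * of_int r * J"
 unfolding Jtt' by (simp add:algebra_simps)
 also have "of_int r*(of_int p * tt + of_int q) = of_int p * J-1"
 using detc unfolding J_eq by (simp add:algebra_simps)
 finally show ?thesis by (simp add:x_def algebra_simps)
 qed
 moreover have "(of_real a-1) * z'-(of_real (x a b)-1)*(J * z') =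
 - (z' * (of_real (x a b) * J - of_real a))-z'+J * z'"
 by (simp add:algebra_simps)
 ultimately have "(of_real a-1) * z'-(of_real (x a b)-1)*(J * z') =
 - (z' * (of_int r * J * z'))-z'+J * z'"
 by (simp only:)
 also have "... = - of_int r*(J * z')^2/J-(J * z')/J+J * z'"
 using J by (simp add:power2_eq_square)
 finally have e:"ee ((of_real a-1) * z'/2)/ee ((of_real (x a b)-1)*(J * z')/2) =
 ee ((- of_int r*(J * z')^2/J-(J * z')/J+J * z')/2)"
 by (simp only:ee_diff[symmetric] diff_divide_distrib[symmetric])
 have "gsiegel a b tt'/gsiegel (x a b) (y a b) tt =
 (ee (tt'/12)/ee (tt/12)) *
 (ee ((of_real a-1) * z'/2)/ee ((of_real (x a b)-1)*(J * z')/2)) *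
 (theta_prod tt' z'/theta_prod tt (J * z'))"
 unfolding gsiegel_def xy z'_def by simp
 also have "...=ee ((tt'-tt)/12) * h (J * z')"
 unfolding e h_def using J by (simp add:ee_diff diff_divide_distrib)
 finally show ?thesis by (simp add:z'_def)
 qed
 have coords:"EX a b. z=J * (of_real a * tt' + of_real b)" for z
 proof -
 define a where "a=Im (z/J)/Im tt'"
 have "z/J = of_real a * tt' + of_real (Re (z/J)-a * Re tt')"
 using tau' by (simp add:complex_eq_iff a_def)
 moreover have "z=J * (z/J)" using J by simp
 ultimately have "z=J * (of_real a * tt' + of_real (Re (z/J)-a * Re tt'))"
 by (simp only:)
 thus ?thesis by blast
 qed
 have per:"h (z+1)=h z&h (z+tt)=h z" for z
 proof -
 obtain a b where z:"z=J * (of_real a * tt' + of_real b)" using coords by blast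
 have shift:"h (z + of_int (m * p+n * r) * tt + of_int (m * q+n * s))=h z"
 if mn:"odd (m * n+m+n)"
 and mn':"odd ((m * p+n * r)*(m * q+n * s)+(m * p+n * r)+(m * q+n * s))" for m n
 proof -
 have z':"z + of_int (m * p+n * r) * tt + of_int (m * q+n * s) =
 J * (of_real (a + of_int m) * tt' + of_real (b + of_int n))"
 unfolding xy[symmetric] z by (simp add:x_def y_def algebra_simps)
 have "ee ((tt'-tt)/12) * h (z + of_int (m * p+n * r) * tt + of_int (m * q+n * s)) =
 gsiegel (a + of_int m) (b + of_int n) tt' /
 gsiegel (x a b + of_int (m * p+n * r)) (y a b + of_int (m * q+n * s)) tt"
 unfolding z' ratio[symmetric] by (simp add:x_def y_def algebra_simps)
 also have "...=ee ((of_int n * of_real a - of_int m * of_real b+1)/2) * gsiegel a b tt' /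
 (ee ((of_int (m * q+n * s) * of_real (x a b) - of_int (m * p+n * r) * of_real (y a b)+1)/2)
 * gsiegel (x a b) (y a b) tt)"
 unfolding gsiegel_shift[OF tau] gsiegel_shift[OF tau'] ee_odd_half[OF mn] ee_odd_half[OF mn'] ..
 also have "of_int (m * q+n * s) * of_real (x a b) - of_int (m * p+n * r) * of_real (y a b)
 = (of_int n * of_real a - of_int m * of_real b) *
 (of_int p * of_int s - of_int q * of_int r::complex)"
 by (simp add:x_def y_def algebra_simps)
 also have "... = of_int n * of_real a - of_int m * of_real b"
 by (simp add:detc)
 also have "ee ((of_int n * of_real a - of_int m * of_real b+1)/2) * gsiegel a b tt' /
 (ee ((of_int n * of_real a - of_int m * of_real b+1)/2) * gsiegel (x a b) (y a b) tt)
 = gsiegel a b tt'/gsiegel (x a b) (y a b) tt" by simp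
 also have "...=ee ((tt'-tt)/12) * h z" unfolding ratio z ..
 finally show ?thesis by simp
 qed
 have det':"s * p-q * r=1" "s * p-r * q=1" using det by (simp_all add:algebra_simps)
 \<comment> \<open>Translation of z by 1 is the shift of (a, b) by (-r, p), translation by
   \<open>tt\<close> the shift by (s, -q); both satisfy the parity conditions.\<close>
 have s1:"h (z + of_int ((- r) * p+p * r) * tt + of_int ((- r) * q+p * s))=h z"
 using SL2Z_parity[of p s r q] SL2Z_parity[of p s q r] det
 by (intro shift) (auto simp:algebra_simps)
 have e1:"(- r) * p+p * r=0" "(- r) * q+p * s=1"
 using det by (simp_all add:algebra_simps)
 have s2:"h (z + of_int (s * p+(- q) * r) * tt + of_int (s * q+(- q) * s))=h z"
 using SL2Z_parity[of p s r q] SL2Z_parity[of p s q r] det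
 by (intro shift) (auto simp:algebra_simps)
 have e2:"s * p+(- q) * r=1" "s * q+(- q) * s=0"
 using det by (simp_all add:algebra_simps)
 show ?thesis using s1[unfolded e1] s2[unfolded e2] by simp
 qed
 define \<psi> where "\<psi>=(%tt z. half_theta tt (z+tt) * half_theta tt (tt-z))"
 \<comment> \<open>The limit of \<open>h\<close> at 0: the simple zeros of the two theta products
   contribute 1/J, the remaining factors the quotient of squares.\<close>
 define L where "L=half_theta tt' tt'^2/(J * half_theta tt tt^2)"
 \<comment> \<open>The denominator vanishes exactly on the lattice. Giving \<open>H\<close> the
   value \<open>L\<close> at every lattice point keeps it periodic, so only the singularity at 0 has
   to be removed.\<close>
 define H where "H=(%z. if theta_prod tt z=0 then L else h z)"
 have thol:"theta_prod tt holomorphic_on UNIV" by (rule theta_prod_holomorphic[OF tau])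
 have open_nz:"open {z. theta_prod tt z~=0}"
 using holomorphic_on_imp_continuous_on[OF thol] by (intro open_Collect_neq) auto
 have "(%z. theta_prod tt' (z/J)) holomorphic_on UNIV"
 using holomorphic_on_compose_gen[OF _ theta_prod_holomorphic[OF tau'],of "%z. z/J" UNIV] J
 by (simp add:o_def holomorphic_on_divide)
 hence h_hol:"h holomorphic_on {z. theta_prod tt z~=0}"
 unfolding h_def by (intro holomorphic_intros holomorphic_on_subset[OF thol] J)
 (auto intro:holomorphic_on_subset)
 have per_0:"theta_prod tt (z+1)=0\<longleftrightarrow>theta_prod tt z=0"
 "theta_prod tt (z+tt)=0\<longleftrightarrow>theta_prod tt z=0" for z
 using theta_prod_add_int[of tt z 1] by (simp_all add:theta_prod_shift[OF tau])
 have H_per:"H (z+1)=H z" "H (z+tt)=H z" for z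
 using per[of z] by (simp_all add:H_def per_0)
 have H_per':"H (z + of_int m + of_int n * tt)=H z" for z m n
 proof -
 have 1:"H (z + of_int m)=H z" for z m
 proof (induction m rule:int_induct[where k=0])
 case (step1 i) thus ?case using H_per(1)[of "z + of_int i"] by (simp add:algebra_simps)
 next
 case (step2 i) thus ?case using H_per(1)[of "z + of_int i-1"] by (simp add:algebra_simps)
 qed auto
 have 2:"H (z + of_int n * tt)=H z" for z
 proof (induction n rule:int_induct[where k=0])
 case (step1 i) thus ?case using H_per(2)[of "z + of_int i * tt"] by (simp add:algebra_simps)
 next
 case (step2 i) thus ?case using H_per(2)[of "z + of_int i * tt-tt"] by (simp add:algebra_simps)
 qed auto
 show ?thesis by (simp add: 1 2)
 qed
 have \<psi>_cont:"continuous_on UNIV (\<psi> tt)" if "Im tt > 0" for tt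
 proof -
 have c:"continuous_on UNIV (half_theta tt)"
 using half_theta_holomorphic[OF that] holomorphic_on_imp_continuous_on by blast
 have "continuous_on UNIV (%z. half_theta tt (z+tt))"
 by (rule continuous_on_compose2[OF c]) (auto intro!: continuous_intros)
 moreover have "continuous_on UNIV (%z. half_theta tt (tt-z))"
 by (rule continuous_on_compose2[OF c]) (auto intro!: continuous_intros)
 ultimately show ?thesis unfolding \<psi>_def by (rule continuous_on_mult)
 qed
 have \<psi>0:"\<psi> tt 0=half_theta tt tt^2" for tt by (simp add: \<psi>_def power2_eq_square)
 have lim:"h \<midarrow>0\<rightarrow> L"
 proof -
 have lim1:"((%z. ee ((- of_int r * z^2/J-z/J+z)/2) *
 (((1-ee (z/J))/(z/J)) * inverse ((1-ee z)/z)/J)*(\<psi> tt' (z/J)/\<psi> tt z))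
 \<longlongrightarrow> 1*((- (2 * pi*\<i>)) * inverse (- (2 * pi*\<i>))/J)*(\<psi> tt' 0/\<psi> tt 0)) (at 0)"
 proof (intro tendsto_intros)
 have 1:"((%z. (1-ee z)/z) \<longlongrightarrow> - (2 * pi*\<i>)) (at 0)"
 proof -
 have "((%z. 1-ee z) has_field_derivative-(2 * pi*\<i>)) (at 0)"
 unfolding ee_def by (auto intro!: derivative_eq_intros)
 thus ?thesis by (simp add:has_field_derivative_iff)
 qed
 thus "((%z. (1-ee z)/z) \<longlongrightarrow> - (2 * pi*\<i>)) (at 0)" .
 have "filterlim (%z. z/J) (at 0) (at 0)"
 unfolding filterlim_at using J
 by (auto intro!: tendsto_eq_intros simp:eventually_at intro:exI[of _ 1])
 from filterlim_compose[OF 1 this]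
 show "((%z. (1-ee (z/J))/(z/J)) \<longlongrightarrow> - (2 * pi*\<i>)) (at 0)" .
 have "isCont (\<psi> tt') 0" using \<psi>_cont[OF tau'] by (simp add:continuous_on_eq_continuous_at)
 thus "((%z. \<psi> tt' (z/J)) \<longlongrightarrow> \<psi> tt' 0) (at 0)"
 using J by (auto intro!: isCont_tendsto_compose[of 0 "\<psi> tt'"] tendsto_eq_intros)
 have "isCont (\<psi> tt) 0" using \<psi>_cont[OF tau] by (simp add:continuous_on_eq_continuous_at)
 thus "((%z. \<psi> tt z) \<longlongrightarrow> \<psi> tt 0) (at 0)" by (simp add:isCont_def)
 show "\<psi> tt 0~=0" using half_theta_nonzero[OF tau tau] by (simp add: \<psi>0)
 have "isCont (%z. ee ((- of_int r * z^2/J-z/J+z)/2)) 0"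
 unfolding ee_def using J by (intro continuous_intros) auto
 thus "((%z. ee ((- of_int r * z^2/J-z/J+z)/2)) \<longlongrightarrow> 1) (at 0)"
 by (simp add:isCont_def)
 qed (use J in auto)
 have eqL: "1*((- (2 * pi*\<i>)) * inverse (- (2 * pi*\<i>))/J)*(\<psi> tt' 0/\<psi> tt 0)=L"
 by (subst right_inverse) (simp_all add: \<psi>0 L_def)
 have "eventually (%z::complex. z~=0) (at 0)" by (simp add:eventually_at_filter)
 hence "eventually (%z. ee ((- of_int r * z^2/J-z/J+z)/2) *
 (((1-ee (z/J))/(z/J)) * inverse ((1-ee z)/z)/J)*(\<psi> tt' (z/J)/\<psi> tt z)
 = h z) (at 0)"
 by eventually_elim
 (use J in \<open>simp add:h_def theta_prod_near_0[OF tau] theta_prod_near_0[OF tau'] \<psi>_def\<close>)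
 from Lim_transform_eventually[OF lim1 this] show ?thesis unfolding eqL .
 qed
 have th0:"theta_prod tt 0=0" using theta_prod_eq_0_iff[OF tau,of 0] by (auto intro:exI[of _ 0])
 obtain eps where eps:"eps > 0" "!!z. z\<in>ball 0 eps==>z~=0==>theta_prod tt z~=0"
 proof -
 have "isCont (\<psi> tt) 0" using \<psi>_cont[OF tau] by (simp add:continuous_on_eq_continuous_at)
 hence "eventually (%z. \<psi> tt z~=0) (at 0)"
 using half_theta_nonzero[OF tau tau]
 by (intro tendsto_imp_eventually_ne[where c = "\<psi> tt 0"]) (auto simp:isCont_def \<psi>0)
 moreover have "eventually (%z. z\<in>ball 0 1-{0::complex}) (at 0)"
 by (intro eventually_at_in_open) auto
 ultimately have "eventually (%z. theta_prod tt z~=0) (at 0)"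
 proof eventually_elim
 case (elim z)
 have "ee z~=1"
 proof
 assume "ee z=1"
 then obtain n::int where "z = of_int n" by (auto simp:ee_eq_1_iff)
 with elim show False by auto
 qed
 with elim show ?case by (simp add:theta_prod_near_0[OF tau] \<psi>_def)
 qed
 thus ?thesis using that by (auto simp:eventually_at dist_norm)
 qed
 have H_diff0:"H field_differentiable at 0"
 proof -
 have "H holomorphic_on ball 0 eps"
 proof (rule no_isolated_singularity[where K = "{0}"])
 have hol:"H holomorphic_on (ball 0 eps-{0})"
 using eps by (subst holomorphic_cong[OF refl,where g=h])
 (auto simp:H_def intro!: holomorphic_on_subset[OF h_hol])
 thus "H holomorphic_on (ball 0 eps-{0})" .
 show "continuous_on (ball 0 eps) H"
 proof (subst continuous_on_eq_continuous_at[OF open_ball],safe)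
 fix z::complex assume z:"z\<in>ball 0 eps"
 show "isCont H z"
 proof (cases "z=0")
 case False
 thus ?thesis using holomorphic_on_imp_continuous_on[OF hol] z
 by (auto simp:continuous_on_eq_continuous_at open_Diff)
 next
 case True
 have "eventually (%z. H z=h z) (at 0)"
 using eps by (auto simp:eventually_at H_def dist_norm intro!: exI[of _ eps])
 hence "H \<midarrow>0\<rightarrow> L" using lim by (simp add:tendsto_cong)
 thus ?thesis by (simp add:isCont_def True H_def th0)
 qed
 qed
 qed auto
 thus ?thesis using eps(1) by (intro holomorphic_on_imp_differentiable_at[of _ "ball 0 eps"]) auto
 qed
 have "H holomorphic_on UNIV"
 unfolding holomorphic_on_def
 proof safe
 fix z
 show "H field_differentiable at z"
 proof (cases "theta_prod tt z=0")
 case False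
 have "H holomorphic_on {z. theta_prod tt z~=0}"
 by (subst holomorphic_cong[OF refl,where g=h]) (auto simp:H_def h_hol)
 thus ?thesis using False open_nz by (auto intro:holomorphic_on_imp_differentiable_at)
 next
 case True
 then obtain m n::int where mn:"z = of_int m + of_int n * tt"
 using theta_prod_eq_0_iff[OF tau] by blast
 have "(%w. H (w+z))=H" using H_per'[of _ m n] by (simp add:mn add.assoc[symmetric])
 hence "(%w. H (w+z)) field_differentiable at 0" using H_diff0 by simp
 then obtain D where "((%w. H (w+z)) has_field_derivative D) (at 0)"
 by (auto simp:field_differentiable_def)
 hence "(H has_field_derivative D) (at (0+z))"
 by (subst DERIV_shift) simp
 thus ?thesis by (auto simp:field_differentiable_def)
 qed
 qed
 moreover have "bounded (range H)"
 proof -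
 define K where "K=(%(s,t). of_real s + of_real t * tt) ` ({0..1} \<times> {0..1::real})"
 have "compact K" unfolding K_def
 by (intro compact_continuous_image compact_Times) (auto intro!: continuous_intros simp:case_prod_unfold)
 moreover have "continuous_on K H"
 using holomorphic_on_imp_continuous_on[OF \<open>H holomorphic_on UNIV\<close>] continuous_on_subset by blast
 ultimately have "bounded (H ` K)"
 using compact_continuous_image compact_imp_bounded by blast
 moreover have "range H \<subseteq> H ` K"
 proof safe
 fix z
 define t where "t=Im z/Im tt"
 define u where "u = Re z-t * Re tt"
 have z:"z = of_real u + of_real t * tt" using tau by (simp add:complex_eq_iff u_def t_def)
 have "H z=H (of_real (frac u) + of_real (frac t) * tt + of_int \<lfloor>u\<rfloor> + of_int \<lfloor>t\<rfloor> * tt)"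
 by (simp add:z frac_def algebra_simps)
 also have "...=H (of_real (frac u) + of_real (frac t) * tt)" by (rule H_per')
 finally have "H z=H (of_real (frac u) + of_real (frac t) * tt)" .
 moreover have "of_real (frac u) + of_real (frac t) * tt\<in>K"
 unfolding K_def by (intro image_eqI[of _ _ "(frac u,frac t)"]) (auto simp:frac_lt_1 less_imp_le)
 ultimately show "H z\<in>H ` K" by blast
 qed
 ultimately show ?thesis by (rule bounded_subset)
 qed
 ultimately obtain c where c:"!!z. H z = c"
 using Liouville_theorem unfolding constant_on_def by blast
 have "c=L" using c[of 0] by (simp add:H_def th0)
 have xyZ: "~ (x a b\<in>\<int>&y a b\<in>\<int>)"
 proof
 assume *: "x a b\<in>\<int>&y a b\<in>\<int>"
 have "a=a*(of_int p * of_int s - of_int q * of_int r)" by (simp add:detr)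
 also have "...=x a b * of_int s-y a b * of_int r" by (simp add:x_def y_def algebra_simps)
 finally have 1:"a = ..." .
 have 1:"a\<in>\<int>" by (subst 1,intro Ints_diff Ints_mult) (use * in auto)
 have "b=b*(of_int p * of_int s - of_int q * of_int r)" by (simp add:detr)
 also have "...=y a b * of_int p-x a b * of_int q" by (simp add:x_def y_def algebra_simps)
 finally have 2:"b = ..." .
 have "b\<in>\<int>" by (subst 2,intro Ints_diff Ints_mult) (use * in auto)
 with 1 ab show False by blast
 qed
 define z where "z=J * (of_real a * tt' + of_real b)"
 have nz:"gsiegel (x a b) (y a b) tt~=0" using xyZ by (simp add:gsiegel_eq_0_iff[OF tau])
 hence "theta_prod tt z~=0" unfolding gsiegel_def xy z_def by auto
 hence "h z=L" using c[of z] \<open>c=L\<close> by (simp add:H_def)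
 hence "gsiegel a b tt'=ee ((tt'-tt)/12) * L * gsiegel (x a b) (y a b) tt"
 using ratio[of a b] nz by (simp add:z_def field_simps)
 also have "ee ((tt'-tt)/12) * L = siegel_factor gg tt"
 by (simp add:siegel_factor_def L_def eta_sq_def tt'_def J_def ee_diff diff_divide_distrib)
 finally show ?thesis by (simp add:x_def y_def tt'_def pqrs)
qed

text \<open>For half-integral indices the factor in \<open>gsiegel_shift\<close> is a fourth root of
  unity.\<close>

lemma gsiegel_half_power_4:
 assumes "Im tt > 0"
 shows "gsiegel (of_int u/2) (of_int v/2) tt^4 =
 gsiegel (if even u then 0 else 1/2) (if even v then 0 else 1/2) tt^4"
proof -
 have halves:"of_int u/2 = of_int (u mod 2)/2+(of_int (u div 2)::real)" for u
 proof -
 have "real_of_int (2*(u div 2)+u mod 2) = of_int u" by (simp only:mult_div_mod_eq)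
 thus ?thesis unfolding of_int_add of_int_mult of_int_numeral by linarith
 qed
 have mod2:"(if even u then 0 else 1/2)=(of_int (u mod 2)/2::real)" for u
 by (auto elim!: evenE oddE)
 have fac:"ee ((of_int n * of_real (of_int x/2) - of_int m * of_real (of_int y/2) + of_int k)/2)^4=1"
 for m n x y k
 proof -
 have "of_nat 4*((of_int n * of_real (of_int x/2) - of_int m * of_real (of_int y/2) + of_int k)/2) =
 complex_of_int (n * x-m * y+2 * k)"
 by simp
 thus ?thesis unfolding ee_power by (simp only:ee_of_int)
 qed
 show ?thesis
 unfolding mod2 halves[of u] halves[of v] gsiegel_shift[OF assms] power_mult_distrib fac
 by (rule mult_1)
qed

text \<open>The three theta products are squares of the factors in \<open>half_theta_Euler\<close>,
  with an extra factor 2 from the index (0, 1/2), and the powers of q cancel: 3/12 - 1/8 - 1/8 =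
  0.\<close>

lemma gsiegel_two_torsion_prod:
 assumes "Im tt > 0"
 shows "gsiegel (1/2) 0 tt * gsiegel 0 (1/2) tt * gsiegel (1/2) (1/2) tt = - 2 * ee (- 3/8)"
proof -
 have 1:"theta_prod tt (tt/2)=half_theta tt (tt/2)^2"
 by (simp add:theta_prod_def power2_eq_square)
 have 2:"theta_prod tt (1/2)=2 * half_theta tt (tt+1/2)^2"
 proof -
 have "half_theta tt (tt-1/2)=half_theta tt (tt-1/2+1)" by (simp only:half_theta_add_1)
 also have "tt-1/2+1=tt+1/2" by simp
 finally show ?thesis
 using half_theta_shift[OF assms,of "1/2"]
 by (simp add:theta_prod_def power2_eq_square add.commute)
 qed
 have 3:"theta_prod tt (tt/2+1/2)=half_theta tt (tt/2+1/2)^2"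
 proof -
 have "half_theta tt (tt-(tt/2+1/2))=half_theta tt (tt-(tt/2+1/2)+1)"
 by (simp only:half_theta_add_1)
 also have "tt-(tt/2+1/2)+1=tt/2+1/2" by (simp add:field_simps)
 finally show ?thesis by (simp add:theta_prod_def power2_eq_square)
 qed
 have g1:"gsiegel (1/2) 0 tt = - ee (tt/12) * ee (- tt/8) * half_theta tt (tt/2)^2"
 by (simp add:gsiegel_def 1)
 have g2:"gsiegel 0 (1/2) tt = - ee (tt/12) * ee (- 1/4)*(2 * half_theta tt (tt+1/2)^2)"
 by (simp add:gsiegel_def 2)
 have g3:"gsiegel (1/2) (1/2) tt =
 - ee (tt/12) * ee (- (tt/2+1/2)/4) * half_theta tt (tt/2+1/2)^2"
 proof -
 have "(complex_of_real (1/2)-1)*(complex_of_real (1/2) * tt + complex_of_real (1/2))/2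
 = - (tt/2+1/2)/4" by (simp add:field_simps)
 moreover have "complex_of_real (1/2) * tt + complex_of_real (1/2)=tt/2+1/2" by simp
 ultimately show ?thesis unfolding gsiegel_def 3[symmetric] by (simp only:)
 qed
 have "gsiegel (1/2) 0 tt * gsiegel 0 (1/2) tt * gsiegel (1/2) (1/2) tt =
 - 2*(ee (tt/12) * ee (tt/12) * ee (tt/12) * ee (- tt/8) * ee (- 1/4) * ee (- (tt/2+1/2)/4)) *
 (half_theta tt (tt/2) * half_theta tt (tt/2+1/2) * half_theta tt (tt+1/2))^2"
 unfolding g1 g2 g3 power_mult_distrib by (simp only:mult_ac mult_minus_left mult_minus_right minus_minus)
 also have "... = - 2 * ee (tt/12+tt/12+tt/12 + - tt/8 + - 1/4 + - (tt/2+1/2)/4)"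
 unfolding half_theta_Euler[OF assms] by (simp only:ee_add power_one mult_1_right)
 also have "tt/12+tt/12+tt/12 + - tt/8 + - 1/4 + - (tt/2+1/2)/4 = - 3/8"
 by (simp add:field_simps)
 finally show ?thesis .
qed

text \<open>The matrix permutes the three nonzero indices of order two modulo integers, and the
  product of the corresponding Siegel functions is a nonzero constant. Comparing fourth powers, in
  which integral translations are invisible, leaves the twelfth power of the factor equal to
  1.\<close>

lemma siegel_factor_power_12:
 assumes gg:"gg\<in>SL2Z" and tau:"Im tt > 0"
 shows "siegel_factor gg tt^12=1"
proof -
 define p q r s where "p=gg$1$1" and "q=gg$1$2" and "r=gg$2$1" and "s=gg$2$2"
 note pqrs=p_def[symmetric] q_def[symmetric] r_def[symmetric] s_def[symmetric]
 have det:"odd (p * s-q * r)" using gg by (simp add:mat2_exhaust pqrs)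
 define C where "C = siegel_factor gg tt"
 define T where "T=(%tt. gsiegel (1/2) 0 tt * gsiegel 0 (1/2) tt * gsiegel (1/2) (1/2) tt)"
 have half:"(1/2::real) ~: \<int>"
 proof
 assume "(1/2::real)\<in>\<int>"
 then obtain n::int where "(1/2::real) = of_int n" by (auto elim:Ints_cases)
 hence "(1::real) = of_int (2 * n)" by simp
 hence "1=2 * n" by linarith
 thus False by presburger
 qed
 have "T (moebius gg tt)=(C * gsiegel (of_int p/2) (of_int q/2) tt) *
 (C * gsiegel (of_int r/2) (of_int s/2) tt) *
 (C * gsiegel (of_int (p+r)/2) (of_int (q + s)/2) tt)"
 unfolding T_def C_def using half
 by (simp add:gsiegel_moebius[OF gg tau] pqrs add_divide_distrib)
 hence "T (moebius gg tt)^4 = C^12*(gsiegel (of_int p/2) (of_int q/2) tt^4 *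
 gsiegel (of_int r/2) (of_int s/2) tt^4 *
 gsiegel (of_int (p+r)/2) (of_int (q + s)/2) tt^4)"
 by (simp add:power_mult_distrib flip:power_add)
 also have "gsiegel (of_int p/2) (of_int q/2) tt^4 *
 gsiegel (of_int r/2) (of_int s/2) tt^4 *
 gsiegel (of_int (p+r)/2) (of_int (q + s)/2) tt^4=T tt^4"
 unfolding gsiegel_half_power_4[OF tau] T_def power_mult_distrib
 using det by (cases "even p"; cases "even q"; cases "even r"; cases "even s") simp_all
 also have "T (moebius gg tt)=T tt"
 unfolding T_def using Im_moebius_pos[OF gg tau] tau by (simp add:gsiegel_two_torsion_prod)
 finally have "T tt^4 = C^12 * T tt^4" .
 moreover have "T tt~=0" unfolding T_def by (simp add:gsiegel_two_torsion_prod[OF tau])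
 ultimately show ?thesis by (simp add:C_def)
qed

text \<open>The discriminant q prod (1 - q^n)^24, that is, the twelfth power of
  \<open>eta_sq\<close>; its weight 12 transformation follows from
  \<open>siegel_factor_power_12\<close>.\<close>

definition disc_prod::"complex => complex" where
 "disc_prod tt=ee tt * half_theta tt tt^24"

lemma disc_prod_moebius:
 assumes gg:"gg\<in>SL2Z" and tau:"Im tt > 0"
 shows "disc_prod (moebius gg tt)=autom gg tt^12 * disc_prod tt"
proof -
 have eta:"disc_prod tt=eta_sq tt^12" for tt
 by (simp add:disc_prod_def eta_sq_def power_mult_distrib ee_power flip:power_mult)
 have "eta_sq (moebius gg tt) = siegel_factor gg tt*(autom gg tt * eta_sq tt)"
 using autom_nonzero[OF gg tau] eta_sq_nonzero[OF tau] by (simp add:siegel_factor_def)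
 thus ?thesis
 by (simp add:eta power_mult_distrib siegel_factor_power_12[OF gg tau])
qed

lemma disc_prod_nonzero:"Im tt > 0==>disc_prod tt~=0"
 by (simp add:disc_prod_def half_theta_nonzero)

section \<open>Distribution relations\<close>

text \<open>Both sides are polynomials in x of degree at most N that agree at 0 and at the N inverse
  roots of unity.\<close>

lemma prod_one_minus_roots_of_unity:
 fixes \<omega>::complex
 assumes N: "N > 0" and \<omega>: "\<omega> ^ N=1" and inj:"inj_on (%t. \<omega> ^ t) {..<N}"
 shows "(\<Prod>t<N. 1-x * \<omega> ^ t)=1-x ^ N"
proof -
 define A where "A=insert 0 ((%t. inverse (\<omega> ^ t)) ` {..<N})"
 have "\<omega>~=0" using \<omega> N by (auto simp:zero_power)
 have "inj_on (%t. inverse (\<omega> ^ t)) {..<N}"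
 using inj by (auto simp:inj_on_def)
 hence card:"card A=N+1"
 unfolding A_def using \<open>\<omega>~=0\<close> by (subst card_insert_disjoint) (auto simp:card_image)
 have "(\<Prod>t<N. pCons 1 (pCons (- (\<omega> ^ t)) 0)) = [:1:]-Polynomial.monom 1 N"
 proof (rule poly_eqI_degree[where A=A])
 fix y assume "y\<in>A"
 then consider "y=0" | t where "t<N" "y=inverse (\<omega> ^ t)" by (auto simp:A_def)
 thus "poly (\<Prod>t<N. pCons 1 (pCons (- (\<omega> ^ t)) 0)) y=poly ([:1:]-Polynomial.monom 1 N) y"
 proof cases
 case 1 thus ?thesis using N by (simp add:poly_prod poly_monom zero_power)
 next
 case 2
 have "(\<Prod>t<N. 1-y * \<omega> ^ t)=0"
 using 2 \<open>\<omega>~=0\<close> by (intro prod_zero bexI[of _ t]) auto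
 moreover have "y ^ N=1"
 using 2 \<omega> by (simp add:power_inverse mult.commute flip:power_mult) (simp add:power_mult)
 ultimately show ?thesis by (simp add:poly_prod poly_monom)
 qed
 next
 have "Polynomial.degree (\<Prod>t<N. pCons 1 (pCons (- (\<omega> ^ t)) 0))\<le>(\<Sum>t<N. Polynomial.degree (pCons 1 (pCons (- (\<omega> ^ t)) 0)))"
 using degree_prod_sum_le[of "{..<N}" "%t. pCons 1 (pCons (- (\<omega> ^ t)) 0)"] by (simp add:o_def)
 also have "...\<le>(\<Sum>t<N. 1)" by (intro sum_mono) auto
 finally show "Polynomial.degree (\<Prod>t<N. pCons 1 (pCons (- (\<omega> ^ t)) 0)) < card A" by (simp add:card)
 have "Polynomial.degree ([:1:]-Polynomial.monom (1::complex) N)\<le>N"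
 by (intro degree_diff_le) (auto simp:degree_monom_le)
 thus "Polynomial.degree ([:1:]-Polynomial.monom (1::complex) N) < card A" by (simp add:card)
 qed
 from arg_cong[OF this,of "%p. poly p x"] show ?thesis
 by (simp add:poly_prod poly_monom)
qed

text \<open>For odd l doubling permutes the residues, so the even numerators 2t still give all l-th
  roots of unity. The sign \<open>sg\<close> covers both halves of \<open>theta_prod\<close>, which
  involve z and -z.\<close>

lemma prod_one_minus_ee:
 assumes l:"odd l" and sg:"sg=1 | sg = -1"
 shows "(\<Prod>t<l. 1-x * ee (sg*(2 * of_nat t / of_nat l)))=1-x ^ l"
proof -
 define \<omega> where "\<omega>=ee (sg*(2 / of_nat l))"
 have l0:"l > 0" using l by (auto intro:Nat.gr0I)
 have pow:"\<omega> ^ t=ee (sg*(2 * of_nat t / of_nat l))" for t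
 by (simp add: \<omega>_def ee_power mult_ac)
 have eq_dvd:"int l dvd int s-int t" if "\<omega> ^ s=\<omega> ^ t" for s t
 proof -
 have "ee (sg*(2 * of_nat s / of_nat l) - sg*(2 * of_nat t / of_nat l))=1"
 using that by (simp add:pow ee_diff)
 then obtain n::int where "sg*(2 * of_nat s / of_nat l) - sg*(2 * of_nat t / of_nat l) = of_int n"
 by (auto simp:ee_eq_1_iff)
 hence "sg*(2 * of_nat s-2 * of_nat t) = of_int n * of_nat l"
 using l0 by (simp add:field_simps)
 hence "\<exists>m::int. 2 * of_nat s-2 * of_nat t=(of_int (m * int l)::complex)"
 using sg by (elim disjE) (auto intro:exI[of _ n] exI[of _ "- n"] simp:algebra_simps)
 then obtain m::int where "of_int (2 * int s-2 * int t)=(of_int (m * int l)::complex)"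
 by auto
 hence "2*(int s-int t)=m * int l" by (simp only:of_int_eq_iff) simp
 hence "int l dvd 2*(int s-int t)" by simp
 moreover have "coprime (int l) 2" using l by simp
 ultimately show ?thesis by (rule iffD1[OF coprime_dvd_mult_right_iff,rotated])
 qed
 have "inj_on (%t. \<omega> ^ t) {..<l}"
 proof (rule inj_onI)
 fix s t assume st:"s\<in>{..<l}" "t\<in>{..<l}" "\<omega> ^ s=\<omega> ^ t"
 from eq_dvd[OF st(3)] have "int l dvd \<bar>int s-int t\<bar>" by simp
 hence "\<bar>int s-int t\<bar>=0 | int l\<le>\<bar>int s-int t\<bar>"
 using zdvd_imp_le[of "int l" "\<bar>int s-int t\<bar>"] by linarith
 with st show "s=t" by auto
 qed
 moreover have "\<omega> ^ l=1"
 proof -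
 have "\<omega> ^ l=ee (sg*2)" using l0 by (simp add:pow)
 also have "...=1" using sg ee_of_int[of 2] ee_of_int[of "-2"] by auto
 finally show ?thesis .
 qed
 ultimately show ?thesis using prod_one_minus_roots_of_unity[OF l0,of \<omega> x] by (simp add:pow)
qed

lemma theta_prod_distribution:
 assumes tau:"Im tt > 0" and l:"odd l"
 shows "(\<Prod>t<l. theta_prod tt (z+2 * of_nat t / of_nat l))=theta_prod (of_nat l * tt) (of_nat l * z)"
proof -
 have l0:"l > 0" using l by (auto intro:Nat.gr0I)
 have "(\<Prod>t<l. half_theta tt (z+1*(2 * of_nat t / of_nat l)))=half_theta (of_nat l * tt) (of_nat l * z)"
 by (intro half_theta_distribution[OF tau l0] prod_one_minus_ee l) auto
 moreover have "(\<Prod>t<l. half_theta tt ((tt-z)+(- 1)*(2 * of_nat t / of_nat l))) =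
 half_theta (of_nat l * tt) (of_nat l*(tt-z))"
 by (intro half_theta_distribution[OF tau l0] prod_one_minus_ee l) auto
 moreover have "of_nat l*(tt-z) = of_nat l * tt - of_nat l * z" by (simp add:algebra_simps)
 ultimately show ?thesis
 by (simp add:theta_prod_def prod.distrib diff_diff_eq)
qed

text \<open>Replaces a function of l tau by a product of l Siegel functions of tau itself, to which
  all of SL2(Z) can be applied. The exponential prefactor comes from the sum of the second
  components.\<close>

lemma siegel_distribution:
 assumes tau:"Im tt > 0" and l:"odd l"
 shows "siegel a (of_nat l * tt)=ee (- (of_real a-1)*(of_nat l-1)/2) *
 (\<Prod>t<l. gsiegel a (2 * real t/real l) tt)"
proof -
 have l0:"l > 0" using l by (auto intro:Nat.gr0I)
 have tl:"Im (of_nat l * tt) > 0" using tau l0 by simp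
 have sum:"(\<Sum>t<l. 2 * of_nat t / of_nat l)=(of_nat l-1::complex)"
 proof -
 have "(\<Sum>t<l. 2 * of_nat t)=(of_nat l*(of_nat l-1)::complex)"
 by (induction l) (auto simp:algebra_simps)
 thus ?thesis using l0 by (simp flip:sum_divide_distrib)
 qed
 have "(\<Prod>t<l. gsiegel a (2 * real t/real l) tt) =
 (\<Prod>t<l. - ee (tt/12)) * ee (\<Sum>t<l. (of_real a-1)*(of_real a * tt+2 * of_nat t / of_nat l)/2) *
 theta_prod (of_nat l * tt) (of_nat l*(of_real a * tt))"
 unfolding gsiegel_def theta_prod_distribution[OF tau l,symmetric] ee_sum
 by (simp only:prod.distrib[symmetric] of_real_mult of_real_divide of_real_numeral of_real_of_nat_eq)
 also have "(\<Prod>t<l. - ee (tt/12)) = - ee (of_nat l * tt/12)"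
 using l by (simp add:power_minus_odd ee_power)
 also have "(\<Sum>t<l. (of_real a-1)*(of_real a * tt+2 * of_nat t / of_nat l)/2) =
 (of_real a-1)*(\<Sum>t<l. of_real a * tt+2 * of_nat t / of_nat l)/(2::complex)"
 by (simp only:sum_distrib_left sum_divide_distrib)
 also have "(\<Sum>t<l. of_real a * tt+2 * of_nat t / of_nat l) = of_nat l*(of_real a * tt)+(of_nat l-1)"
 unfolding sum.distrib sum by simp
 also have "(of_real a-1)*(of_nat l*(of_real a * tt)+(of_nat l-1))/2 =
 (of_real a-1)*(of_real a*(of_nat l * tt))/2-(- (of_real a-1)*(of_nat l-1)/2)"
 by (simp add:field_simps)
 finally have "(\<Prod>t<l. gsiegel a (2 * real t/real l) tt) = - ee (of_nat l * tt/12) *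
 (ee ((of_real a-1)*(of_real a*(of_nat l * tt))/2)/ee (- (of_real a-1)*(of_nat l-1)/2)) *
 theta_prod (of_nat l * tt) (of_nat l*(of_real a * tt))"
 by (simp only:ee_diff)
 thus ?thesis
 unfolding siegel_eq_gsiegel[OF tl] gsiegel_def by (simp add:mult_ac)
qed

section \<open>Expansions of Siegel functions\<close>

text \<open>Half the second Bernoulli polynomial at the fractional part of u/l: the leading exponent
  of q of a Siegel function with first index u/l.\<close>

definition bern::"nat=>int=>real" where
 "bern l u=((frac (of_int u/real l))\<^sup>2-frac (of_int u/real l)+1/6)/2"

definition disc_unit::"(complex => complex)=>bool" where
 "disc_unit P\<longleftrightarrow>P holomorphic_on ball 0 1&(\<forall>x\<in>ball 0 1. P x~=0)"

lemma disc_unit_mult [intro]:"disc_unit P==>disc_unit Q==>disc_unit (%x. P x * Q x)"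
 by (auto simp:disc_unit_def intro!: holomorphic_intros)

lemma disc_unit_const [intro]:"c~=0==>disc_unit (%_. c)"
 by (auto simp:disc_unit_def)

lemma disc_unit_prod [intro]:"(!!i. i\<in>I==>disc_unit (P i))==>disc_unit (%x. \<Prod>i\<in>I. P i x)"
 by (induction I rule:infinite_finite_induct) auto

lemma disc_unit_power_int [intro]:"disc_unit P==>disc_unit (%x. P x powi n)"
 by (auto simp:disc_unit_def intro!: holomorphic_intros)

text \<open>Reducing the first index to its fractional part f costs a constant; the two theta
  factors then become products in q^(1/l) with exponents n l + f l and n l + (l - f l). Their only
  possible constant factor is dealt with by the hypothesis on u and v.\<close>

lemma gsiegel_expansion:
 assumes l:"l > 0" and uv:"~ (int l dvd u&int l dvd v)"
 shows "EX P. disc_unit P&(ALL tt. Im tt > 0 -->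
 gsiegel (of_int u/real l) (of_int v/real l) tt =
 qpow (bern l u) tt * P (qpow (1/real l) tt))"
proof -
 define \<rho> where "\<rho>=nat (u mod int l)"
 define m where "m=u div int l"
 have u:"u=int \<rho>+m * int l" using l by (simp add: \<rho>_def m_def)
 have \<rho>: "\<rho><l" using l by (simp add: \<rho>_def nat_less_iff)
 define f where "f=real \<rho>/real l"
 have ul:"of_int u/real l=f + of_int m"
 proof -
 have "real_of_int u=real \<rho> + of_int m * real l"
 using arg_cong[OF u,of real_of_int] by simp
 thus ?thesis using l by (simp only:f_def add_divide_distrib) simp
 qed
 have f:"0\<le>f" "f<1" using \<rho> by (auto simp:f_def)
 hence bern:"bern l u=(f\<^sup>2-f+1/6)/2"
 unfolding bern_def ul by (simp add:frac_add_of_int_right frac_eq)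
 define b where "b = of_int v/real l"
 define \<omega> where "\<omega>=ee (of_real b)"
 have \<omega>: "norm \<omega>=1" by (simp add: \<omega>_def)
 define c1 where "c1=(%n. n * l+\<rho>)"
 define c2 where "c2=(%n. n * l+(l-\<rho>))"
 have c1:"n \<le> c1 n" for n using l by (simp add:c1_def trans_le_add1)
 have c2:"n \<le> c2 n" for n using l by (simp add:c2_def trans_le_add1)
 define P1 where "P1=qprod (%_. \<omega>) c1"
 define P2 where "P2=qprod (%_. inverse \<omega>) c2"
 have nz:"w * x ^ n~=1" if "norm w=1" "norm x<1" "n > 0" for x w::complex and n
 proof
 assume "w * x ^ n=1"
 hence "norm (w * x ^ n)=1" by simp
 hence "norm x ^ n=1" using that by (simp add:norm_mult norm_power)
 moreover have "norm x ^ n<1" using power_strict_mono[of "norm x" 1 n] that by simp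
 ultimately show False by simp
 qed
 \<comment> \<open>For \<rho> = 0 the factor with n = 0 is the constant 1 - \<omega>, which would
   vanish only if l divided both u and v.\<close>
 have \<omega>1:"\<omega>~=1" if "\<rho>=0"
 proof
 assume "\<omega>=1"
 then obtain n::int where "complex_of_real b = of_int n" by (auto simp: \<omega>_def ee_eq_1_iff)
 hence "b = of_int n" by (metis of_real_eq_iff of_real_of_int_eq)
 hence "of_int v=real_of_int (n * int l)" using l by (simp add:b_def field_simps)
 hence "v=n * int l" by linarith
 moreover have "int l dvd u" using that by (simp add:u)
 ultimately show False using uv by simp
 qed
 have P1:"disc_unit P1"
 unfolding disc_unit_def P1_def
 proof safe
 show "qprod (%_. \<omega>) c1 holomorphic_on ball 0 1"
 by (rule qprod_holomorphic[of _ _ 1]) (auto simp:c1 \<omega>)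
 fix x::complex assume x:"x\<in>ball 0 1" "qprod (%_. \<omega>) c1 x=0"
 hence "EX n. \<omega> * x ^ c1 n=1"
 using qprod_eq_0_iff[of c1 "%_. \<omega>" 1 x] c1 \<omega> by auto
 then obtain n where n:"\<omega> * x ^ c1 n=1" by blast
 hence "c1 n=0" using nz[OF \<omega>,of x "c1 n"] x by auto
 hence "\<rho>=0" by (simp add:c1_def)
 with \<omega>1 n \<open>c1 n=0\<close> show False by simp
 qed
 have P2:"disc_unit P2"
 unfolding disc_unit_def P2_def
 proof safe
 show "qprod (%_. inverse \<omega>) c2 holomorphic_on ball 0 1"
 by (rule qprod_holomorphic[of _ _ 1]) (auto simp:c2 \<omega> norm_inverse)
 fix x::complex assume x:"x\<in>ball 0 1" "qprod (%_. inverse \<omega>) c2 x=0"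
 hence "EX n. inverse \<omega> * x ^ c2 n=1"
 using qprod_eq_0_iff[of c2 "%_. inverse \<omega>" 1 x] c2 \<omega> by (auto simp:norm_inverse)
 then obtain n where n:"inverse \<omega> * x ^ c2 n=1" by blast
 moreover have "c2 n > 0" using \<rho> by (simp add:c2_def)
 ultimately show False using nz[of "inverse \<omega>" x "c2 n"] x \<omega> by (auto simp:norm_inverse)
 qed
 define \<kappa> where "\<kappa>=ee ((of_int 0 * of_real f - of_int m * of_real b + of_int (m*0+m+0))/2)
 * (- ee ((of_real f-1) * of_real b/2))"
 have "gsiegel (of_int u/real l) (of_int v/real l) tt =
 qpow (bern l u) tt*(\<kappa> * P1 (qpow (1/real l) tt) * P2 (qpow (1/real l) tt))"
 if tau:"Im tt > 0" for tt
 proof -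
 define x where "x=qpow (1/real l) tt"
 have xpow:"x ^ n=ee (of_nat n / of_nat l * tt)" for n
 by (simp add:x_def qpow_eq_ee ee_power)
 have 1:"half_theta tt (of_real f * tt + of_real b)=P1 x"
 proof -
 have "ee (of_real f * tt + of_real b + of_nat n * tt)=\<omega> * x ^ c1 n" for n
 proof -
 have "of_nat (c1 n) / of_nat l = of_nat n + complex_of_real f"
 using l by (simp add:c1_def f_def add_divide_distrib)
 hence "\<omega> * x ^ c1 n=ee (of_real b+(of_nat n + of_real f) * tt)"
 by (simp only:xpow \<omega>_def ee_add)
 thus ?thesis by (simp add:algebra_simps)
 qed
 thus ?thesis by (simp add:half_theta_def P1_def qprod_def)
 qed
 have 2:"half_theta tt (tt-(of_real f * tt + of_real b))=P2 x"
 proof -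
 have "ee (tt-(of_real f * tt + of_real b) + of_nat n * tt)=inverse \<omega> * x ^ c2 n" for n
 proof -
 have "of_nat (c2 n) / of_nat l = of_nat n+1 - complex_of_real f"
 using l \<rho> by (simp add:c2_def f_def add_divide_distrib diff_divide_distrib of_nat_diff)
 hence "inverse \<omega> * x ^ c2 n=ee (- of_real b+(of_nat n+1 - of_real f) * tt)"
 by (simp only:xpow \<omega>_def ee_add ee_minus)
 thus ?thesis by (simp add:algebra_simps)
 qed
 thus ?thesis by (simp add:half_theta_def P2_def qprod_def)
 qed
 have "gsiegel (of_int u/real l) (of_int v/real l) tt=gsiegel (f + of_int m) (b + of_int 0) tt"
 by (simp add:ul b_def)
 also have "...=ee ((of_int 0 * of_real f - of_int m * of_real b + of_int (m*0+m+0))/2) *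
 gsiegel f b tt" by (rule gsiegel_shift[OF tau])
 also have "gsiegel f b tt = - ee (tt/12) * ee ((of_real f-1)*(of_real f * tt + of_real b)/2)*(P1 x * P2 x)"
 unfolding gsiegel_def theta_prod_def 1 2 ..
 also have "ee ((of_real f-1)*(of_real f * tt + of_real b)/2) =
 ee ((of_real f-1) * of_real f * tt/2) * ee ((of_real f-1) * of_real b/2)"
 unfolding ee_add[symmetric] by (simp add:algebra_simps flip:add_divide_distrib)
 finally have "gsiegel (of_int u/real l) (of_int v/real l) tt =
 (ee (tt/12) * ee ((of_real f-1) * of_real f * tt/2))*(\<kappa> * P1 x * P2 x)"
 by (simp add: \<kappa>_def)
 also have "ee (tt/12) * ee ((of_real f-1) * of_real f * tt/2)=qpow (bern l u) tt"
 unfolding ee_add[symmetric] qpow_eq_ee bern by (simp add:field_simps power2_eq_square)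
 finally show ?thesis by (simp add:x_def)
 qed
 moreover have "disc_unit (%x. \<kappa> * P1 x * P2 x)"
 using P1 P2 by (intro disc_unit_mult disc_unit_const) (auto simp: \<kappa>_def)
 ultimately show ?thesis by blast
qed

section \<open>q-expansions at infinity\<close>

abbreviation at_cusp::"complex filter" where "at_cusp \<equiv> filtercomap Im at_top"

lemma eventually_at_cusp:"eventually P at_cusp\<longleftrightarrow>(EX y. ALL z. Im z > y-->P z)"
 by (simp add:eventually_filtercomap_at_top_dense)

lemma eventually_at_cusp_uhp:"eventually (%z. z\<in>uhp) at_cusp"
 by (auto simp:eventually_at_cusp uhp_def)

lemma at_cusp_neq_bot [simp]:"at_cusp~=bot"
proof
 assume "at_cusp=bot"
 hence "eventually (%_. False) at_cusp" by simp
 then obtain y where "ALL z. Im z > y-->False" by (auto simp:eventually_at_cusp)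
 from this[rule_format,of "Complex 0 (y+1)"] show False by simp
qed

context
 fixes l::nat assumes l:"l > 0"
begin
lemma norm_qpow_l:"norm (qpow (1/real l) tt)=exp (- 2 * pi * Im tt/real l)"
 by (simp add:qpow_eq_ee norm_ee)

lemma filterlim_qpow_at_cusp:"filterlim (qpow (1/real l)) (at 0) at_cusp"
proof -
 have "((%tt. norm (qpow (1/real l) tt)) \<longlongrightarrow> 0) at_cusp"
 proof -
 have "((%y::real. exp (- (2 * pi/real l) * y)) \<longlongrightarrow> 0) at_top"
 by (rule filterlim_compose[OF exp_at_bot filterlim_tendsto_neg_mult_at_bot[OF tendsto_const _ filterlim_ident]])
 (use l in simp)
 from filterlim_compose[OF this filterlim_filtercomap[of Im at_top]]
 show ?thesis by (simp add:norm_qpow_l)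
 qed
 hence "(qpow (1/real l) \<longlongrightarrow> 0) at_cusp" by (rule tendsto_norm_zero_cancel)
 moreover have "eventually (%tt. qpow (1/real l) tt~=0) at_cusp" by (simp add:qpow_eq_ee)
 ultimately show ?thesis by (simp add:filterlim_at)
qed

text \<open>Every small nonzero x is the value of q^(1/l) at a point of large imaginary part, found
  with a logarithm. This carries identities near the cusp over to the punctured disc.\<close>

lemma eventually_at_0_if_at_cusp:
 assumes "eventually (%tt. Q (qpow (1/real l) tt)) at_cusp"
 shows "eventually Q (at 0)"
proof -
 obtain y where y:"!!z. Im z > y==>Q (qpow (1/real l) z)"
 using assms by (auto simp:eventually_at_cusp)
 have "Q x" if x:"x~=0" "norm x<exp (- 2 * pi * y/real l)" for x
 proof -
 define tt where "tt = of_nat l * Ln x/(2 * of_real pi*\<i>)"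
 have "2 * of_real pi*\<i>*(1 / of_nat l * tt)=Ln x"
 using l by (simp add:tt_def)
 hence q:"qpow (1/real l) tt=x"
 using x by (simp add:qpow_eq_ee ee_def)
 have "norm (qpow (1/real l) tt)<exp (- 2 * pi * y/real l)"
 unfolding q by (rule x(2))
 hence "exp (- 2 * pi * Im tt/real l)<exp (- 2 * pi * y/real l)"
 by (simp only:norm_qpow_l)
 hence "- 2 * pi * Im tt/real l < - 2 * pi * y/real l" by simp
 hence "Im tt > y" using l by (simp add:divide_less_cancel)
 from y[OF this] q show ?thesis by simp
 qed
 thus ?thesis
 unfolding eventually_at by (intro exI[of _ "exp (- 2 * pi * y/real l)"]) (auto simp:dist_norm)
qed

lemma has_qexpI:
 assumes "g has_laurent_expansion F" "eventually (%tt. f tt=g (qpow (1/real l) tt)) at_cusp"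
 shows "has_qexp l f F"
proof -
 have "eventually (%x. eval_fls F x=g x) (at 0)" "fls_conv_radius F > 0"
 using assms(1) by (auto simp:has_laurent_expansion_def)
 from eventually_compose_filterlim[OF this(1) filterlim_qpow_at_cusp] assms(2)
 have "eventually (%tt. f tt=eval_fls F (qpow (1/real l) tt)) at_cusp"
 by eventually_elim simp
 with \<open>fls_conv_radius F > 0\<close> show ?thesis by (simp add:has_qexp_def)
qed

lemma has_qexpE:
 assumes "has_qexp l f F"
 obtains "eval_fls F has_laurent_expansion F"
 and "eventually (%tt. f tt=eval_fls F (qpow (1/real l) tt)) at_cusp"
 using assms eval_fls_has_laurent_expansion by (auto simp:has_qexp_def)

lemma has_qexp_cong:
 assumes "has_qexp l f F" "eventually (%tt. f tt=g tt) at_cusp"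
 shows "has_qexp l g F"
 using assms unfolding has_qexp_def
 by (auto elim:eventually_elim2)

lemma has_qexp_const:"has_qexp l (%_. c) (fls_const c)"
 by (rule has_qexpI[of "%_. c"]) auto

lemma has_qexp_add:"has_qexp l f F==>has_qexp l g G==>has_qexp l (%tt. f tt+g tt) (F+G)"
 by (elim has_qexpE,rule has_qexpI[OF has_laurent_expansion_add]) (auto elim:eventually_elim2)

lemma has_qexp_diff:"has_qexp l f F==>has_qexp l g G==>has_qexp l (%tt. f tt-g tt) (F-G)"
 by (elim has_qexpE,rule has_qexpI[OF has_laurent_expansion_diff]) (auto elim:eventually_elim2)

lemma has_qexp_mult:"has_qexp l f F==>has_qexp l g G==>has_qexp l (%tt. f tt * g tt) (F * G)"
 by (elim has_qexpE,rule has_qexpI[OF has_laurent_expansion_mult]) (auto elim:eventually_elim2)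

lemma has_qexp_inverse:"has_qexp l f F==>has_qexp l (%tt. inverse (f tt)) (inverse F)"
 by (elim has_qexpE,rule has_qexpI[OF has_laurent_expansion_inverse]) (auto elim:eventually_mono)

lemma has_qexp_uminus:"has_qexp l f F==>has_qexp l (%tt. - f tt) (- F)"
 by (elim has_qexpE,rule has_qexpI[OF has_laurent_expansion_minus]) (auto elim:eventually_mono)

lemma has_qexp_power:"has_qexp l f F==>has_qexp l (%tt. f tt ^ n) (F ^ n)"
 using has_qexp_const[of 1] by (induction n) (auto intro:has_qexp_mult)

lemma has_qexp_sum:"(!!i. i\<in>I==>has_qexp l (f i) (F i)) ==>
 has_qexp l (%tt. \<Sum>i\<in>I. f i tt) (\<Sum>i\<in>I. F i)"
 using has_qexp_const[of 0]
 by (induction I rule:infinite_finite_induct) (auto intro:has_qexp_add)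

lemma has_qexp_prod:"(!!i. i\<in>I==>has_qexp l (f i) (F i)) ==>
 has_qexp l (%tt. \<Prod>i\<in>I. f i tt) (\<Prod>i\<in>I. F i)"
 using has_qexp_const[of 1]
 by (induction I rule:infinite_finite_induct) (auto intro:has_qexp_mult)

lemma has_qexp_unique:
 assumes "has_qexp l f F" "has_qexp l f G"
 shows "F=G"
proof -
 have F: "eval_fls F has_laurent_expansion F" and G: "eval_fls G has_laurent_expansion G"
 using assms by (auto elim:has_qexpE)
 have "eventually (%tt. eval_fls F (qpow (1/real l) tt)=eval_fls G (qpow (1/real l) tt)) at_cusp"
 using assms unfolding has_qexp_def by (auto elim:eventually_elim2)
 hence "eventually (%x. eval_fls F x=eval_fls G x) (at 0)"
 by (rule eventually_at_0_if_at_cusp)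
 hence "eval_fls F has_laurent_expansion G"
 using has_laurent_expansion_cong[of "eval_fls F" "eval_fls G" G G] G by simp
 with F show ?thesis using has_laurent_expansion_unique by blast
qed

lemma has_qexp_tendsto:
 assumes "has_qexp l f F" "fls_subdegree F\<ge>0"
 shows "(f \<longlongrightarrow> fls_nth F 0) at_cusp"
proof -
 have F: "eval_fls F has_laurent_expansion F"
 and f:"eventually (%tt. f tt=eval_fls F (qpow (1/real l) tt)) at_cusp"
 using assms(1) by (auto elim:has_qexpE)
 have "((%tt. eval_fls F (qpow (1/real l) tt)) \<longlongrightarrow> fls_nth F 0) at_cusp"
 using has_laurent_expansion_imp_tendsto_0[OF F assms(2)] filterlim_qpow_at_cusp
 by (rule filterlim_compose)
 thus ?thesis using f by (simp add:tendsto_cong)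
qed

lemma qpow_add:"qpow (x+y) tt=qpow x tt * qpow y tt"
 by (simp add:qpow_eq_ee ring_distribs ee_add)

lemma has_qexp_qpow:"has_qexp l (qpow (of_int n/real l)) (fls_X_intpow n)"
proof (rule has_qexpI)
 show "(%x. x powi n) has_laurent_expansion fls_X_intpow n"
 by (intro laurent_expansion_intros)
 have nat:"qpow (1/real l) tt ^ n=qpow (real n/real l) tt" for n tt
 by (simp add:qpow_eq_ee ee_power)
 have "qpow (of_int n/real l) tt=qpow (1/real l) tt powi n" for tt
 proof (cases "n\<ge>0")
 case True
 thus ?thesis by (simp add:power_int_def nat)
 next
 case False
 have "qpow (1/real l) tt powi n=inverse (qpow (real (nat (- n))/real l) tt)"
 using False by (simp add:power_int_def power_inverse nat)
 also have "real (nat (- n)) = - of_int n" using False by simp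
 finally show ?thesis by (simp add:qpow_eq_ee flip:ee_minus)
 qed
 thus "eventually (%tt. qpow (of_int n/real l) tt=qpow (1/real l) tt powi n) at_cusp"
 by simp
qed

text \<open>A finite nonzero limit excludes a pole as well as a zero of the series shifted by n, so
  orders can be read off from growth.\<close>

lemma has_qexp_order_iff:
 assumes "has_qexp l f F" "c~=0" "((%tt. f tt * qpow (- of_int n/real l) tt) \<longlongrightarrow> c) at_cusp"
 shows "F~=0&fls_subdegree F=n"
proof -
 define G where "G=fls_shift n F"
 have G: "has_qexp l (%tt. f tt * qpow (- of_int n/real l) tt) G"
 using has_qexp_mult[OF assms(1) has_qexp_qpow[of "- n"],unfolded fls_X_intpow_times_conv_shift]
 by (simp add:G_def)
 have G':"eval_fls G has_laurent_expansion G"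
 and ev:"eventually (%tt. f tt * qpow (- of_int n/real l) tt=eval_fls G (qpow (1/real l) tt)) at_cusp"
 using G by (auto elim:has_qexpE)
 have ne:"G~=0"
 proof
 assume "G=0"
 hence "((%tt. f tt * qpow (- of_int n/real l) tt) \<longlongrightarrow> 0) at_cusp"
 using has_qexp_tendsto[OF G] by simp
 thus False using tendsto_unique[OF at_cusp_neq_bot assms(3)] assms(2) by simp
 qed
 have "~ fls_subdegree G<0"
 proof
 assume "fls_subdegree G<0"
 hence "filterlim (eval_fls G) at_infinity (at 0)"
 using has_laurent_expansion_imp_filterlim_infinity_0[OF G'] by simp
 from filterlim_compose[OF this filterlim_qpow_at_cusp]
 have "filterlim (%tt. f tt * qpow (- of_int n/real l) tt) at_infinity at_cusp"
 using ev by (simp cong:filterlim_cong)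
 thus False
 using not_tendsto_and_filterlim_at_infinity[OF at_cusp_neq_bot assms(3)] by blast
 qed
 moreover have "~ fls_subdegree G > 0"
 proof
 assume "fls_subdegree G > 0"
 hence "((%tt. f tt * qpow (- of_int n/real l) tt) \<longlongrightarrow> 0) at_cusp"
 using has_qexp_tendsto[OF G] by simp
 thus False using tendsto_unique[OF at_cusp_neq_bot assms(3)] assms(2) by simp
 qed
 ultimately have "fls_subdegree G=0" by simp
 moreover have "F~=0" using ne by (auto simp:G_def)
 ultimately show ?thesis by (simp add:G_def)
qed

lemma has_qexp_lead_tendsto:
 assumes "has_qexp l f F" "F~=0"
 shows "((%tt. f tt * qpow (- of_int (fls_subdegree F)/real l) tt) \<longlongrightarrow> fls_nth F (fls_subdegree F)) at_cusp"
proof -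
 define G where "G=fls_shift (fls_subdegree F) F"
 have G: "has_qexp l (%tt. f tt * qpow (- of_int (fls_subdegree F)/real l) tt) G"
 using has_qexp_mult[OF assms(1) has_qexp_qpow[of "- fls_subdegree F"],unfolded fls_X_intpow_times_conv_shift]
 by (simp add:G_def)
 have "fls_subdegree G=0" using assms(2) by (simp add:G_def)
 moreover have "fls_nth G 0=fls_nth F (fls_subdegree F)"
 by (simp add:G_def)
 ultimately show ?thesis using has_qexp_tendsto[OF G] by simp
qed

lemma has_qexp_disc_unit:
 assumes "disc_unit P" "!!tt. Im tt > 0==>f tt=qpow (of_int n/real l) tt * P (qpow (1/real l) tt)"
 shows "has_qexp l f (fls_X_intpow n * fps_to_fls (fps_expansion P 0))"
 and "fls_subdegree (fls_X_intpow n * fps_to_fls (fps_expansion P 0))=n"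
 and "fls_X_intpow n * fps_to_fls (fps_expansion P 0)~=0"
proof -
 have "P analytic_on {0}"
 using assms(1) unfolding disc_unit_def by (auto simp:analytic_at intro!: exI[of _ "ball 0 1"])
 hence P: "P has_fps_expansion fps_expansion P 0" by (rule analytic_at_imp_has_fps_expansion_0)
 have "has_qexp l (%tt. P (qpow (1/real l) tt)) (fps_to_fls (fps_expansion P 0))"
 by (rule has_qexpI[OF has_laurent_expansion_fps[OF P]]) auto
 from has_qexp_mult[OF has_qexp_qpow this]
 have "has_qexp l (%tt. qpow (of_int n/real l) tt * P (qpow (1/real l) tt))
 (fls_X_intpow n * fps_to_fls (fps_expansion P 0))" .
 thus "has_qexp l f (fls_X_intpow n * fps_to_fls (fps_expansion P 0))"
 by (rule has_qexp_cong)
 (use assms(2) eventually_at_cusp_uhp in \<open>auto elim!: eventually_mono simp:uhp_def\<close>)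
 have "fps_nth (fps_expansion P 0) 0=P 0"
 using has_fps_expansion_imp_0_eq_fps_nth_0[OF P] by simp
 hence nz:"fps_nth (fps_expansion P 0) 0~=0" using assms(1) by (simp add:disc_unit_def)
 hence "fps_expansion P 0~=0" "subdegree (fps_expansion P 0)=0" by auto
 thus "fls_subdegree (fls_X_intpow n * fps_to_fls (fps_expansion P 0))=n"
 and "fls_X_intpow n * fps_to_fls (fps_expansion P 0)~=0"
 by (simp_all add:fls_subdegree_fls_to_fps)
qed
end

section \<open>Products of the functions Q_i and their expansions at all cusps\<close>

text \<open>
 \<open>Q\<^sub>i(\<tau>) = g\<^bsub>(2i/\<ell>, 0)\<^esub>(\<ell>\<tau>)\<close>.  Even numerators make all translations that occur below even, so
 that no signs appear; up to sign they represent the same functions as all numerators.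
\<close>

definition hsiegel::"nat=>nat => complex => complex" where
 "hsiegel l i tt = siegel (2 * real i/real l) (of_nat l * tt)"

lemma not_dvd_imp_not_Ints:
 assumes "l > 0" "~ int l dvd u" shows "of_int u/real l ~: \<int>"
proof
 assume "of_int u/real l\<in>\<int>"
 then obtain n::int where "of_int u/real l = of_int n" by (auto elim:Ints_cases)
 hence "real_of_int u = of_int (n * int l)" using assms(1) by (simp add:field_simps)
 hence "u=n * int l" by linarith
 thus False using assms(2) by simp
qed

lemma not_dvd_double:
 assumes "odd l" "~ l dvd i" shows "~ int l dvd 2 * int i"
proof
 assume "int l dvd 2 * int i"
 hence "int l dvd int i"
 by (rule iffD1[OF coprime_dvd_mult_right_iff,rotated]) (use assms in simp)
 thus False using assms by simp
qed

lemma hsiegel_moebius: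
 assumes l:"odd l" and i:"~ l dvd i" and gg:"gg\<in>SL2Z" and tau:"Im tt > 0"
 shows "hsiegel l i (moebius gg tt)=ee (- (of_real (2 * real i/real l)-1)*(of_nat l-1)/2) *
 siegel_factor gg tt ^ l *
 (\<Prod>t<l. gsiegel (of_int (2*(int i * gg$1$1+int t * gg$2$1))/real l)
 (of_int (2*(int i * gg$1$2+int t * gg$2$2))/real l) tt)"
proof -
 have l0:"l > 0" using l by (auto intro:Nat.gr0I)
 have ni:"2 * real i/real l ~: \<int>"
 using not_dvd_imp_not_Ints[OF l0 not_dvd_double[OF l i]] by simp
 have "gsiegel (2 * real i/real l) (2 * real t/real l) (moebius gg tt) = siegel_factor gg tt *
 gsiegel (of_int (2*(int i * gg$1$1+int t * gg$2$1))/real l)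
 (of_int (2*(int i * gg$1$2+int t * gg$2$2))/real l) tt" for t
 using ni by (subst gsiegel_moebius[OF gg tau]) (simp_all add:add_divide_distrib ring_distribs mult.assoc)
 thus ?thesis
 unfolding hsiegel_def siegel_distribution[OF Im_moebius_pos[OF gg tau] l]
 by (simp add:prod.distrib)
qed

lemma hsiegel_eq:
 assumes l:"odd l" and tau:"Im tt > 0"
 shows "hsiegel l i tt=ee (- (of_real (2 * real i/real l)-1)*(of_nat l-1)/2) *
 (\<Prod>t<l. gsiegel (2 * real i/real l) (2 * real t/real l) tt)"
 unfolding hsiegel_def by (rule siegel_distribution[OF tau l])

lemma Gamma_princ_subset:"Gamma_princ l \<subseteq> SL2Z"
 by (auto simp:Gamma_princ_def)

lemma Gamma_princ_entries:
 assumes "gg\<in>Gamma_princ l"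
 shows "\<exists>\<alpha> \<beta> gg' \<delta>. gg$1$1=1+int l*\<alpha>&gg$1$2=int l*\<beta>&gg$2$1=int l * gg' &
 gg$2$2=1+int l*\<delta>"
proof -
 have "int l dvd gg$1$1-1" "int l dvd gg$1$2-0" "int l dvd gg$2$1-0" "int l dvd gg$2$2-1"
 using assms mat1_nth unfolding Gamma_princ_def by (metis (mono_tags,lifting) cong_iff_dvd_diff mem_Collect_eq)+
 then obtain a b c d where "gg$1$1-1=int l * a" "gg$1$2-0=int l * b"
 "gg$2$1-0=int l * c" "gg$2$2-1=int l * d"
 unfolding dvd_def by blast
 thus ?thesis by (intro exI[of _ a] exI[of _ b] exI[of _ c] exI[of _ d]) auto
qed

text \<open>A matrix congruent to 1 modulo l moves each of the l indices by integers. Summed over t,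
  the exponents of the resulting factors equal -2 \<mu> T / l up to an integer; i has disappeared,
  so the factor is common to all Q_i.\<close>

lemma hsiegel_Gamma_princ:
 assumes l:"odd l" and gg:"gg\<in>Gamma_princ l" and tau:"Im tt > 0"
 shows "EX c. c~=0&(ALL i. ~ l dvd i-->hsiegel l i (moebius gg tt) = c * hsiegel l i tt)"
proof -
 have gg':"gg\<in>SL2Z" using gg Gamma_princ_subset by blast
 have l0:"l > 0" using l by (auto intro:Nat.gr0I)
 obtain \<alpha> \<beta> \<mu> \<delta> where e:"gg$1$1=1+int l*\<alpha>" "gg$1$2=int l*\<beta>"
 "gg$2$1=int l*\<mu>" "gg$2$2=1+int l*\<delta>"
 using Gamma_princ_entries[OF gg] by blast
 define T where "T=(\<Sum>t<l. of_nat t * of_nat t::complex)"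
 define c where "c = siegel_factor gg tt ^ l * ee (- (2 * of_int \<mu> * T / of_nat l))"
 have "hsiegel l i (moebius gg tt) = c * hsiegel l i tt" if i:"~ l dvd i" for i
 proof -
 define \<phi> where "\<phi>=(%t. (of_int (2*(int i*\<beta>+int t*\<delta>)) * of_real (2 * real i/real l) -
 of_int (2*(int i*\<alpha>+int t*\<mu>)) * of_real (2 * real t/real l) +
 of_int (2*(int i*\<alpha>+int t*\<mu>)*(2*(int i*\<beta>+int t*\<delta>)) +
 2*(int i*\<alpha>+int t*\<mu>)+2*(int i*\<beta>+int t*\<delta>)))/(2::complex))"
 define M where "M=(%t. (int i*\<alpha>+int t*\<mu>)*(2*(int i*\<beta>+int t*\<delta>)) +
 (int i*\<alpha>+int t*\<mu>)+(int i*\<beta>+int t*\<delta>))"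
 have \<phi>: "\<phi> t=2 * of_nat i * of_nat i * of_int \<beta> / of_nat l +
 2 * of_nat i * of_int (\<delta> - \<alpha>) * of_nat t / of_nat l-2 * of_int \<mu>*(of_nat t * of_nat t) / of_nat l
 + of_int (M t)" for t
 proof -
 have "\<phi> t=((2 * of_nat i * of_nat i * of_int \<beta>+2 * of_nat i * of_int (\<delta> - \<alpha>) * of_nat t
 - 2 * of_int \<mu>*(of_nat t * of_nat t)) / of_nat l) + of_int (M t)"
 unfolding \<phi>_def M_def using l0 by (simp add:field_simps)
 thus ?thesis by (simp add:add_divide_distrib diff_divide_distrib)
 qed
 have sum_t:"(\<Sum>t<l. of_nat t)=(of_nat l*(of_nat l-1)/2::complex)"
 by (induction l) (auto simp:field_simps)
 have "even (l-1)" using l by simp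
 then obtain h where h:"l-1=2 * h" by blast
 hence h':"of_nat l-1=(2 * of_nat h::complex)"
 using l0 by (metis of_nat_1 of_nat_diff of_nat_mult of_nat_numeral Suc_leI One_nat_def)
 have "(\<Sum>t<l. \<phi> t) = of_nat l*(2 * of_nat i * of_nat i * of_int \<beta> / of_nat l) +
 2 * of_nat i * of_int (\<delta> - \<alpha>)*(\<Sum>t<l. of_nat t) / of_nat l-2 * of_int \<mu> * T / of_nat l
 + of_int (\<Sum>t<l. M t)"
 unfolding \<phi> T_def by (simp add:sum.distrib sum_subtractf sum_distrib_left sum_divide_distrib)
 also have "... = - (2 * of_int \<mu> * T / of_nat l) +
 of_int (2 * int i * int i*\<beta>+int i*(\<delta> - \<alpha>)*(2 * int h)+(\<Sum>t<l. M t))"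
 unfolding sum_t h' using l0 by simp
 finally have sum\<phi>: "ee (\<Sum>t<l. \<phi> t)=ee (- (2 * of_int \<mu> * T / of_nat l))"
 by (simp only:ee_add_int)
 have "gsiegel (of_int (2*(int i * gg$1$1+int t * gg$2$1))/real l)
 (of_int (2*(int i * gg$1$2+int t * gg$2$2))/real l) tt =
 ee (\<phi> t) * gsiegel (2 * real i/real l) (2 * real t/real l) tt" for t
 proof -
 have 1:"of_int (2*(int i * gg$1$1+int t * gg$2$1))/real l =
 2 * real i/real l + of_int (2*(int i*\<alpha>+int t*\<mu>))"
 using l0 by (simp add:e field_simps)
 have 2:"of_int (2*(int i * gg$1$2+int t * gg$2$2))/real l =
 2 * real t/real l + of_int (2*(int i*\<beta>+int t*\<delta>))"
 using l0 by (simp add:e field_simps)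
 show ?thesis unfolding 1 2 gsiegel_shift[OF tau] \<phi>_def ..
 qed
 thus ?thesis
 unfolding hsiegel_moebius[OF l i gg' tau] hsiegel_eq[OF l tau]
 by (simp add:prod.distrib c_def sum\<phi> flip:ee_sum)
 qed
 moreover have "c~=0"
 using eta_sq_nonzero[OF tau] eta_sq_nonzero[OF Im_moebius_pos[OF gg' tau]] autom_nonzero[OF gg' tau]
 by (simp add:c_def siegel_factor_def)
 ultimately show ?thesis by blast
qed

text \<open>Leading exponent, in powers of q, of Q_i transported by a matrix with first column (a,
  c).\<close>

definition cusp_bern::"nat=>int=>int=>nat=>real" where
 "cusp_bern l a c i=(\<Sum>t<l. bern l (2*(int i * a+int t * c)))"

lemma hsiegel_expansion:
 assumes l:"odd l" and i:"~ l dvd i" and gg:"gg\<in>SL2Z"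
 shows "EX P. disc_unit P&(ALL tt. Im tt > 0-->hsiegel l i (moebius gg tt) =
 siegel_factor gg tt ^ l * qpow (cusp_bern l (gg$1$1) (gg$2$1) i) tt * P (qpow (1/real l) tt))"
proof -
 have l0:"l > 0" using l by (auto intro:Nat.gr0I)
 define u v where "u=(%t. 2*(int i * gg$1$1+int t * gg$2$1))"
 and "v=(%t. 2*(int i * gg$1$2+int t * gg$2$2))"
 have "~ (int l dvd u t&int l dvd v t)" for t
 proof
 assume "int l dvd u t&int l dvd v t"
 hence "int l dvd u t * gg$2$2 - v t * gg$2$1" by auto
 also have "u t * gg$2$2 - v t * gg$2$1 =
 2 * int i*(gg$1$1 * gg$2$2-gg$1$2 * gg$2$1)"
 by (simp add:u_def v_def algebra_simps)
 also have "...=2 * int i" using gg by (simp only:mat2_exhaust)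
 finally show False using not_dvd_double[OF l i] by simp
 qed
 hence "ALL t. EX P. disc_unit P&(ALL tt. Im tt > 0-->gsiegel (of_int (u t)/real l) (of_int (v t)/real l) tt =
 qpow (bern l (u t)) tt * P (qpow (1/real l) tt))"
 using gsiegel_expansion[OF l0] by blast
 then obtain P where P: "!!t. disc_unit (P t)" "!!t tt. Im tt > 0 ==>
 gsiegel (of_int (u t)/real l) (of_int (v t)/real l) tt=qpow (bern l (u t)) tt * P t (qpow (1/real l) tt)"
 by metis
 define \<kappa> where "\<kappa>=ee (- (of_real (2 * real i/real l)-1)*(of_nat l-1)/2)"
 have "hsiegel l i (moebius gg tt) = siegel_factor gg tt ^ l *
 qpow (cusp_bern l (gg$1$1) (gg$2$1) i) tt*(\<kappa>*(\<Prod>t<l. P t (qpow (1/real l) tt)))"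
 if tau:"Im tt > 0" for tt
 proof -
 have "hsiegel l i (moebius gg tt)=\<kappa> * siegel_factor gg tt ^ l *
 (\<Prod>t<l. qpow (bern l (u t)) tt * P t (qpow (1/real l) tt))"
 unfolding hsiegel_moebius[OF l i gg tau] \<kappa>_def P(2)[OF tau,symmetric]
 by (simp only:u_def v_def)
 also have "...=\<kappa> * siegel_factor gg tt ^ l *
 (\<Prod>t<l. qpow (bern l (u t)) tt)*(\<Prod>t<l. P t (qpow (1/real l) tt))"
 by (simp add:prod.distrib)
 also have "(\<Prod>t<l. qpow (bern l (u t)) tt)=qpow (cusp_bern l (gg$1$1) (gg$2$1) i) tt"
 unfolding qpow_eq_ee ee_sum[symmetric] cusp_bern_def u_def
 by (simp add:sum_distrib_right)
 finally show ?thesis by (simp add:mult_ac)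
 qed
 moreover have "disc_unit (%x. \<kappa>*(\<Prod>t<l. P t x))"
 using P(1) by (intro disc_unit_mult disc_unit_const disc_unit_prod) (auto simp: \<kappa>_def)
 ultimately show ?thesis by blast
qed

lemma prod_power_int:
 fixes c::"'a::field"
 assumes "c~=0"
 shows "(\<Prod>i\<in>I. c powi e i) = c powi (\<Sum>i\<in>I. e i)"
 by (induction I rule:infinite_finite_induct) (auto simp:power_int_add assms)

lemma qpow_power_int:"qpow x tt powi n=qpow (of_int n * x) tt"
proof (cases "n\<ge>0")
 case True
 thus ?thesis by (simp add:power_int_def qpow_eq_ee ee_power mult.assoc)
next
 case False
 have "qpow x tt powi n=inverse (ee (of_nat (nat (- n))*(of_real x * tt)))"
 using False by (simp add:power_int_def power_inverse qpow_eq_ee ee_power)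
 also have "of_nat (nat (- n)) = - (of_int n::complex)" using False by simp
 finally show ?thesis by (simp add:qpow_eq_ee mult.assoc flip:ee_minus)
qed

lemma prod_qpow:"(\<Prod>i\<in>I. qpow (x i) tt)=qpow (\<Sum>i\<in>I. x i) tt"
 by (simp add:qpow_eq_ee sum_distrib_right ee_sum)

definition hquot::"nat=>nat=>(nat=>int) => complex => complex" where
 "hquot l k e tt=(\<Prod>i=1..k. hsiegel l i tt powi e i)"

definition hquot_ord::"nat=>nat=>(nat=>int)=>int=>int=>real" where
 "hquot_ord l k e a c=(\<Sum>i=1..k. of_int (e i) * cusp_bern l a c i)"

definition T_mat::"int=>int^2^2" where "T_mat n=mat2 1 n 0 1"

lemma T_mat_in_SL2Z [simp,intro]:"T_mat n\<in>SL2Z"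
 by (simp add:mat2_exhaust T_mat_def)

lemma moebius_T_mat [simp]:"moebius (T_mat n) z=z + of_int n"
 by (simp add:moebius_def T_mat_def)

lemma Gamma_princ_iff:
 "gg\<in>Gamma_princ l\<longleftrightarrow>gg\<in>SL2Z&int l dvd gg$1$1-1&int l dvd gg$1$2 &
 int l dvd gg$2$1&int l dvd gg$2$2-1"
 unfolding Gamma_princ_def by (simp add:forall_2 cong_iff_dvd_diff)

text \<open>Consequently tau -> tau + l is a period after transport to any cusp, so q^(1/l) is the
  right variable everywhere.\<close>

lemma conj_T_mat_in_Gamma_princ:
 assumes "gg\<in>SL2Z" shows "gg ** T_mat (int l) ** minv gg\<in>Gamma_princ l"
proof -
 have "gg$1$1 * gg$2$2-gg$1$2 * gg$2$1=1" using assms by (simp add:mat2_exhaust)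
 moreover have "(gg ** T_mat (int l) ** minv gg)$1$1-1 =
 (gg$1$1 * gg$2$2-gg$1$2 * gg$2$1-1)-int l*(gg$1$1 * gg$2$1)"
 "(gg ** T_mat (int l) ** minv gg)$2$2-1 =
 (gg$1$1 * gg$2$2-gg$1$2 * gg$2$1-1)+int l*(gg$1$1 * gg$2$1)"
 "(gg ** T_mat (int l) ** minv gg)$1$2=int l*(gg$1$1 * gg$1$1)"
 "(gg ** T_mat (int l) ** minv gg)$2$1 = - int l*(gg$2$1 * gg$2$1)"
 by (simp_all add:matrix_mult_2 T_mat_def minv_def algebra_simps)
 ultimately show ?thesis
 using assms by (simp add:Gamma_princ_iff SL2Z_mult minv_in_SL2Z)
qed

context
 fixes l k::nat
 assumes l:"l=2 * k+1" and k:"k\<ge>1"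
begin
lemma l_odd:"odd l" and l_pos:"l > 0" using l by auto

lemma not_dvd_index:"i\<in>{1..k} ==> ~ l dvd i"
 using l by (auto dest!: dvd_imp_le)

lemma hsiegel_nonzero:
 assumes "i\<in>{1..k}" "Im tt > 0" shows "hsiegel l i tt~=0"
proof -
 have "2 * real i/real l ~: \<int>"
 using not_dvd_imp_not_Ints[OF l_pos not_dvd_double[OF l_odd not_dvd_index[OF assms(1)]]] by simp
 thus ?thesis using assms l_pos
 by (simp add:hsiegel_def siegel_eq_gsiegel gsiegel_eq_0_iff)
qed

lemma hquot_nonzero:"Im tt > 0==>hquot l k e tt~=0"
 using hsiegel_nonzero by (auto simp:hquot_def)

lemma hquot_add:"Im tt > 0==>hquot l k (%i. e i+e' i) tt=hquot l k e tt * hquot l k e' tt"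
 using hsiegel_nonzero by (simp add:hquot_def power_int_add prod.distrib[symmetric])

lemma hquot_uminus:"hquot l k (%i. - e i) tt=inverse (hquot l k e tt)"
 by (simp add:hquot_def power_int_minus prod_inversef[symmetric])

lemma hquot_0:"hquot l k (%i. 0) tt=1"
 by (simp add:hquot_def)

lemma hquot_Gamma_princ:
 assumes "gg\<in>Gamma_princ l" "Im tt > 0" "(\<Sum>i=1..k. e i)=0"
 shows "hquot l k e (moebius gg tt)=hquot l k e tt"
proof -
 obtain c where c:"c~=0" "!!i. ~ l dvd i==>hsiegel l i (moebius gg tt) = c * hsiegel l i tt"
 using hsiegel_Gamma_princ[OF l_odd assms(1,2)] by blast
 have "hquot l k e (moebius gg tt)=(\<Prod>i=1..k. c powi e i * hsiegel l i tt powi e i)"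
 unfolding hquot_def using c(2) not_dvd_index by (intro prod.cong refl) (simp add:power_int_mult_distrib)
 also have "...=hquot l k e tt"
 using assms(3) c(1) by (simp add:prod.distrib prod_power_int hquot_def)
 finally show ?thesis .
qed

text \<open>The factor \<open>siegel_factor\<close> enters with exponent l times the sum of e, which
  is 0.\<close>

lemma hquot_expansion:
 assumes "gg\<in>SL2Z" "(\<Sum>i=1..k. e i)=0"
 shows "EX P. disc_unit P&(ALL tt. Im tt > 0-->hquot l k e (moebius gg tt) =
 qpow (hquot_ord l k e (gg$1$1) (gg$2$1)) tt * P (qpow (1/real l) tt))"
proof -
 have "\<forall>i\<in>{1..k}. EX P. disc_unit P&(ALL tt. Im tt > 0-->hsiegel l i (moebius gg tt) =
 siegel_factor gg tt ^ l * qpow (cusp_bern l (gg$1$1) (gg$2$1) i) tt * P (qpow (1/real l) tt))"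
 using hsiegel_expansion[OF l_odd not_dvd_index assms(1)] by blast
 then obtain P where P: "!!i. i\<in>{1..k}==>disc_unit (P i)"
 "!!i tt. i\<in>{1..k}==>Im tt > 0==>hsiegel l i (moebius gg tt) =
 siegel_factor gg tt ^ l * qpow (cusp_bern l (gg$1$1) (gg$2$1) i) tt * P i (qpow (1/real l) tt)"
 by metis
 have "hquot l k e (moebius gg tt)=qpow (hquot_ord l k e (gg$1$1) (gg$2$1)) tt *
 (\<Prod>i=1..k. P i (qpow (1/real l) tt) powi e i)" if tau:"Im tt > 0" for tt
 proof -
 have nz:"siegel_factor gg tt~=0"
 using siegel_factor_power_12[OF assms(1) tau] by (auto simp:zero_power)
 have "hquot l k e (moebius gg tt)=(\<Prod>i=1..k. (siegel_factor gg tt ^ l) powi e i *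
 qpow (of_int (e i) * cusp_bern l (gg$1$1) (gg$2$1) i) tt * P i (qpow (1/real l) tt) powi e i)"
 unfolding hquot_def by (intro prod.cong refl) (simp add:P(2)[OF _ tau] power_int_mult_distrib qpow_power_int)
 also have "...=(siegel_factor gg tt ^ l) powi (\<Sum>i=1..k. e i) *
 qpow (hquot_ord l k e (gg$1$1) (gg$2$1)) tt*(\<Prod>i=1..k. P i (qpow (1/real l) tt) powi e i)"
 using nz by (simp only:prod.distrib prod_qpow hquot_ord_def) (subst prod_power_int,auto)
 finally show ?thesis unfolding assms(2) by simp
 qed
 moreover have "disc_unit (%x. \<Prod>i=1..k. P i x powi e i)"
 using P(1) by (intro disc_unit_prod disc_unit_power_int)
 ultimately show ?thesis by blast
qed

lemma hquot_has_qexp: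
 assumes gg:"gg\<in>SL2Z" and e:"(\<Sum>i=1..k. e i)=0"
 shows "EX F. has_qexp l (%tt. hquot l k e (moebius gg tt)) F&F~=0 &
 of_int (fls_subdegree F)=real l * hquot_ord l k e (gg$1$1) (gg$2$1)"
proof -
 define E where "E=hquot_ord l k e (gg$1$1) (gg$2$1)"
 obtain P where P: "disc_unit P" "!!tt. Im tt > 0==>hquot l k e (moebius gg tt) =
 qpow E tt * P (qpow (1/real l) tt)"
 using hquot_expansion[OF assms] unfolding E_def by blast
 \<comment> \<open>The exponent E is a priori only real. Invariance under tau -> tau + l at this
   cusp forces l E to be an integer.\<close>
 have "ee (of_real (real l * E))=1"
 proof -
 define tt::complex where "tt=\<i>"
 have tau:"Im tt > 0" "Im (tt + of_nat l) > 0" by (simp_all add:tt_def)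
 have "moebius gg (tt + of_int (int l))=moebius (gg ** T_mat (int l) ** minv gg) (moebius gg tt)"
 using tau gg Im_moebius_pos[OF gg tau(1)] by (simp add:moebius_mult SL2Z_mult minv_in_SL2Z)
 hence "hquot l k e (moebius gg (tt + of_nat l))=hquot l k e (moebius gg tt)"
 using hquot_Gamma_princ[OF conj_T_mat_in_Gamma_princ[OF gg] Im_moebius_pos[OF gg tau(1)] e] by simp
 moreover have "qpow (1/real l) (tt + of_nat l)=qpow (1/real l) tt"
 proof -
 have "of_real (1/real l)*(tt + of_nat l) = of_real (1/real l) * tt + of_int 1"
 using l_pos by (simp add:field_simps)
 thus ?thesis unfolding qpow_eq_ee by (simp only:ee_add_int)
 qed
 moreover have "qpow E (tt + of_nat l)=qpow E tt * ee (of_real (real l * E))"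
 by (simp add:qpow_eq_ee ring_distribs ee_add mult.commute)
 moreover have "qpow E tt~=0" by (simp add:qpow_eq_ee)
 moreover have "P (qpow (1/real l) tt)~=0"
 using P(1) norm_qpow_less_1[OF tau(1),of "1/real l"] l_pos by (auto simp:disc_unit_def)
 ultimately show ?thesis using P(2)[OF tau(1)] P(2)[OF tau(2)] by simp
 qed
 then obtain n::int where "complex_of_real (real l * E) = of_int n" by (auto simp:ee_eq_1_iff)
 hence n:"real l * E = of_int n" by (metis of_real_eq_iff of_real_of_int_eq)
 hence "E = of_int n/real l" using l_pos by (simp add:field_simps)
 hence "!!tt. Im tt > 0==>hquot l k e (moebius gg tt)=qpow (of_int n/real l) tt * P (qpow (1/real l) tt)"
 using P(2) by simp
 from has_qexp_disc_unit[OF l_pos P(1) this] n show ?thesis unfolding E_def by metis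
qed

lemma hquot_holomorphic:
 assumes e:"(\<Sum>i=1..k. e i)=0"
 shows "hquot l k e holomorphic_on uhp"
proof -
 obtain P where P: "disc_unit P" "!!tt. Im tt > 0==>hquot l k e (moebius (mat 1) tt) =
 qpow (hquot_ord l k e 1 0) tt * P (qpow (1/real l) tt)"
 using hquot_expansion[OF mat1_in_SL2Z e] unfolding mat1_nth by blast
 have "(%tt. P (qpow (1/real l) tt)) holomorphic_on uhp"
 proof -
 have "P holomorphic_on ball 0 1" using P(1) by (simp add:disc_unit_def)
 moreover have "qpow (1/real l) holomorphic_on uhp"
 unfolding qpow_def by (intro holomorphic_intros)
 moreover have "qpow (1/real l) ` uhp \<subseteq> ball 0 1"
 using norm_qpow_less_1[of _ "1/real l"] l_pos by (auto simp:uhp_def)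
 ultimately show ?thesis using holomorphic_on_compose_gen by (force simp:o_def)
 qed
 hence "(%tt. qpow (hquot_ord l k e 1 0) tt * P (qpow (1/real l) tt)) holomorphic_on uhp"
 unfolding qpow_def by (intro holomorphic_intros)
 thus ?thesis
 by (rule holomorphic_transform) (use P(2) in \<open>auto simp:uhp_def\<close>)
qed
end

subsection \<open>Level one\<close>

definition S_mat::"int^2^2" where "S_mat=mat2 0 (-1) 1 0"

lemma S_mat_in_SL2Z [simp,intro]:"S_mat\<in>SL2Z"
 by (simp add:mat2_exhaust S_mat_def)

lemma finite_small_autom:
 assumes z:"Im z > 0"
 shows "finite {norm (autom gg z) | gg. norm (autom gg z)\<le>1}"
proof -
 define M where "M=\<lceil>1/Im z\<rceil>"
 define N where "N=\<lceil>1+\<bar>of_int M * \<bar>Re z\<bar>\<bar>\<rceil>"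
 have "{norm (autom gg z) | gg. norm (autom gg z)\<le>1} \<subseteq>
 (%(c,d). norm (of_int c * z + of_int d)) ` ({-M..M} \<times> {-N..N})"
 proof safe
 fix gg assume *: "norm (autom gg z)\<le>1"
 define c d where "c=gg$2$1" and "d=gg$2$2"
 have "\<bar>of_int c * Im z\<bar>\<le>norm (autom gg z)"
 using abs_Im_le_cmod[of "autom gg z"] by (simp add:autom_def c_def)
 hence "\<bar>of_int c\<bar> * Im z\<le>1" using * z by (simp add:abs_mult)
 hence "\<bar>of_int c\<bar>\<le>1/Im z" using z by (simp add:field_simps)
 hence cM: "\<bar>c\<bar>\<le>M" unfolding M_def by linarith
 have "\<bar>of_int c * Re z + of_int d\<bar>\<le>norm (autom gg z)"
 using abs_Re_le_cmod[of "autom gg z"] by (simp add:autom_def c_def d_def)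
 hence "\<bar>of_int d\<bar>\<le>1+\<bar>of_int c * Re z\<bar>" using * by linarith
 also have "\<bar>of_int c * Re z\<bar> \<le> of_int M * \<bar>Re z\<bar>"
 proof -
 have "\<bar>real_of_int c\<bar> \<le> of_int M" using cM by linarith
 thus ?thesis by (simp add:abs_mult mult_right_mono)
 qed
 finally have "\<bar>d\<bar>\<le>N" unfolding N_def by linarith
 with cM show "norm (autom gg z)\<in>(%(c,d). norm (of_int c * z + of_int d)) ` ({-M..M} \<times> {-N..N})"
 by (intro image_eqI[of _ _ "(c,d)"]) (auto simp:autom_def c_def d_def)
 qed
 thus ?thesis by (rule finite_subset) auto
qed

lemma fundamental_domain:
 assumes z:"Im z > 0"
 shows "\<exists>gg\<in>SL2Z. Im (moebius gg z)\<ge>1/2&0 \<le> Re (moebius gg z) & Re (moebius gg z)\<le>1"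
proof -
 define N where "N={norm (autom gg z) | gg. gg\<in>SL2Z&norm (autom gg z)\<le>1}"
 have fin:"finite N" unfolding N_def by (rule finite_subset[OF _ finite_small_autom[OF z]]) auto
 have "norm (autom (mat 1) z)\<in>N" unfolding N_def by (auto simp:autom_def intro!: exI[of _ "mat 1"])
 hence "Min N\<in>N" using fin by (intro Min_in) auto
 then obtain gg where gg:"gg\<in>SL2Z" "norm (autom gg z)\<le>1" "norm (autom gg z)=Min N"
 by (auto simp:N_def)
 have min:"norm (autom gg z)\<le>norm (autom sg z)" if "sg\<in>SL2Z" for sg
 proof (cases "norm (autom sg z)\<le>1")
 case True
 hence "norm (autom sg z)\<in>N" using that by (auto simp:N_def)
 thus ?thesis using fin gg(3) by simp
 qed (use gg(2) in linarith)
 define w where "w=moebius gg z"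
 have w:"Im w > 0" using Im_moebius_pos[OF gg(1) z] by (simp add:w_def)
 have "Im w\<ge>1/2"
 proof (rule ccontr)
 assume "~ Im w\<ge>1/2"
 define n where "n = - round (Re w)"
 define w' where "w'=w + of_int n"
 have n:"\<bar>Re w'\<bar>\<le>1/2"
 using of_int_round_abs_le[of "Re w"] by (simp add:w'_def n_def abs_minus_commute)
 have "norm w'^2 = Re w'^2+Im w'^2" by (simp add:cmod_power2)
 also have "Re w'^2\<le>(1/2)^2" using n power_mono[of "\<bar>Re w'\<bar>" "1/2" 2] by simp
 also have "Im w'^2<(1/2)^2"
 using \<open>~ Im w\<ge>1/2\<close> w by (intro power_strict_mono) (auto simp:w'_def)
 finally have "norm w'^2<1^2" by (simp add:power2_eq_square)
 hence nw:"norm w'<1" by (rule power2_less_imp_less) simp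
 have ST: "S_mat ** T_mat n\<in>SL2Z" by blast
 have "autom (S_mat ** T_mat n ** gg) z=autom (S_mat ** T_mat n) w * autom gg z"
 unfolding w_def by (rule autom_mult[OF ST gg(1) z])
 also have "autom (S_mat ** T_mat n) w=w'"
 by (simp add:autom_def matrix_mult_2 S_mat_def T_mat_def w'_def)
 finally have "norm (autom (S_mat ** T_mat n ** gg) z)=norm w' * norm (autom gg z)"
 by (simp add:norm_mult)
 moreover have "norm (autom gg z) > 0" using autom_nonzero[OF gg(1) z] by simp
 ultimately have "norm (autom (S_mat ** T_mat n ** gg) z)<norm (autom gg z)"
 using nw by simp
 with min[of "S_mat ** T_mat n ** gg"] ST gg(1) show False by (auto dest:SL2Z_mult)
 qed
 define m where "m = - \<lfloor>Re w\<rfloor>"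
 have "moebius (T_mat m ** gg) z=w + of_int m"
 using gg(1) z by (simp add:moebius_mult w_def)
 moreover have "0 \<le> Re (w + of_int m)" "Re (w + of_int m)\<le>1" by (simp_all add:m_def) linarith
 ultimately show ?thesis
 using \<open>Im w\<ge>1/2\<close> gg(1) by (intro bexI[of _ "T_mat m ** gg"]) auto
qed

text \<open>Vanishing at the cusp and the reduction to a compact box make |f| attain its maximum on
  the half-plane, unless f is zero. The maximum principle then makes f constant, with limit
  0.\<close>

lemma level_one_vanishing:
 assumes hol:"f holomorphic_on uhp"
 and inv:"!!gg z. gg\<in>SL2Z==>z\<in>uhp==>f (moebius gg z)=f z"
 and lim:"(f \<longlongrightarrow> 0) at_cusp"
 and z:"z\<in>uhp"
 shows "f z=0"
proof (rule ccontr)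
 assume nz:"f z~=0"
 have "eventually (%w. norm (f w)<norm (f z)) at_cusp"
 using lim nz by (auto simp:tendsto_iff dist_norm)
 then obtain Y where Y: "!!w. Im w > Y==>norm (f w)<norm (f z)"
 by (auto simp:eventually_at_cusp)
 define K where "K = cbox (Complex 0 (1/2)) (Complex 1 (max 1 Y))"
 have K: "K \<subseteq> uhp" by (auto simp:K_def uhp_def in_cbox_complex_iff)
 have red:"\<exists>w'\<in>K. norm (f w)=norm (f w')" if "w\<in>uhp" "norm (f w)\<ge>norm (f z)" for w
 proof -
 obtain gg where gg:"gg\<in>SL2Z" "Im (moebius gg w)\<ge>1/2" "0 \<le> Re (moebius gg w)" "Re (moebius gg w)\<le>1"
 using fundamental_domain[of w] \<open>w\<in>uhp\<close> by (auto simp:uhp_def)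
 have eq:"f (moebius gg w)=f w" by (rule inv[OF gg(1) \<open>w\<in>uhp\<close>])
 hence "~ Im (moebius gg w) > Y" using Y[of "moebius gg w"] that(2) by auto
 hence "moebius gg w\<in>K" using gg by (auto simp:K_def in_cbox_complex_iff)
 thus ?thesis using eq by (intro bexI[of _ "moebius gg w"]) auto
 qed
 have "continuous_on K (%w. norm (f w))"
 using holomorphic_on_imp_continuous_on[OF hol] K by (intro continuous_intros) (auto intro:continuous_on_subset)
 moreover obtain z' where "z'\<in>K" "norm (f z')=norm (f z)" using red[OF z] by auto
 ultimately obtain \<xi> where \<xi>: "\<xi>\<in>K" "!!w. w\<in>K==>norm (f w)\<le>norm (f \<xi>)"
 using continuous_attains_sup[of K "%w. norm (f w)"] compact_cbox by (auto simp:K_def)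
 have "norm (f z)\<le>norm (f \<xi>)" using \<xi>(2)[OF \<open>z'\<in>K\<close>] \<open>norm (f z')=norm (f z)\<close> by simp
 have "norm (f w)\<le>norm (f \<xi>)" if "w\<in>uhp" for w
 using red[OF that] \<xi>(2) \<open>norm (f z)\<le>norm (f \<xi>)\<close> by force
 hence "f constant_on uhp"
 using \<xi>(1) K by (intro maximum_modulus_principle[OF hol open_uhp connected_uhp open_uhp order.refl]) auto
 then obtain c where c:"!!w. w\<in>uhp==>f w = c" by (auto simp:constant_on_def)
 hence "eventually (%w. f w = c) at_cusp"
 using eventually_at_cusp_uhp by (auto elim:eventually_mono)
 hence "(f \<longlongrightarrow> c) at_cusp" by (rule tendsto_eventually)
 hence "c=0" using lim tendsto_unique[OF at_cusp_neq_bot] by blast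
 with c[OF z] nz show False by simp
qed

lemma filterlim_shift_at_cusp:"filterlim (%tt. tt+1) at_cusp at_cusp"
 unfolding filterlim_iff eventually_at_cusp
proof safe
 fix P::"complex=>bool" and y assume "ALL z. Im z > y-->P z"
 thus "EX y. ALL z. Im z > y-->P (z+1)" by (intro exI[of _ y]) simp
qed

definition level_one::"(complex => complex)=>bool" where
 "level_one f\<longleftrightarrow>f holomorphic_on uhp&(\<forall>gg\<in>SL2Z. \<forall>z\<in>uhp. f (moebius gg z)=f z)"

text \<open>Periodicity under tau -> tau + 1 multiplies the leading term q^(s/l) by e(s/l), which
  must therefore be 1.\<close>

lemma level_one_period:
 assumes "l > 0" "level_one f" "has_qexp l f F" "F~=0"
 shows "int l dvd fls_subdegree F"
proof -
 define s a where "s=fls_subdegree F" and "a=fls_nth F (fls_subdegree F)"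
 have a:"a~=0" using assms(4) by (simp add:a_def)
 have lim:"((%tt. f tt * qpow (- of_int s/real l) tt) \<longlongrightarrow> a) at_cusp"
 unfolding s_def a_def by (rule has_qexp_lead_tendsto) fact+
 have "f (tt+1) * qpow (- of_int s/real l) (tt+1) =
 f tt * qpow (- of_int s/real l) tt * ee (- of_int s / of_nat l)" if "tt\<in>uhp" for tt
 proof -
 have "f (moebius (T_mat 1) tt)=f tt"
 using assms(2) that T_mat_in_SL2Z unfolding level_one_def by blast
 hence "f (tt+1)=f tt" by simp
 moreover have "qpow x (tt+1)=qpow x tt * ee (of_real x)" for x
 by (simp add:qpow_eq_ee ring_distribs ee_add)
 moreover have "complex_of_real (- of_int s/real l) = - of_int s / of_nat l" by simp
 ultimately show ?thesis by (simp only:mult.assoc)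
 qed
 hence "eventually (%tt. f (tt+1) * qpow (- of_int s/real l) (tt+1) =
 f tt * qpow (- of_int s/real l) tt * ee (- of_int s / of_nat l)) at_cusp"
 using eventually_at_cusp_uhp by (auto elim:eventually_mono)
 moreover have "((%tt. f (tt+1) * qpow (- of_int s/real l) (tt+1)) \<longlongrightarrow> a) at_cusp"
 using filterlim_compose[OF lim filterlim_shift_at_cusp] .
 ultimately have "((%tt. f tt * qpow (- of_int s/real l) tt * ee (- of_int s / of_nat l)) \<longlongrightarrow> a) at_cusp"
 by (rule Lim_transform_eventually[rotated])
 moreover have "((%tt. f tt * qpow (- of_int s/real l) tt * ee (- of_int s / of_nat l)) \<longlongrightarrow>
 a * ee (- of_int s / of_nat l)) at_cusp"
 by (intro tendsto_intros lim)
 ultimately have "a=a * ee (- of_int s / of_nat l)"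
 using tendsto_unique[OF at_cusp_neq_bot] by blast
 hence "ee (- of_int s / of_nat l)=1" using a by simp
 then obtain n::int where "- of_int s / of_nat l=(of_int n::complex)" by (auto simp:ee_eq_1_iff)
 hence "- of_int s=(of_int n * of_nat l::complex)" using assms(1) by (simp add:field_simps)
 hence "of_int (- s)=(of_int (n * int l)::complex)" by simp
 hence "- s=n * int l" by (simp only:of_int_eq_iff)
 hence "s = - n * int l" by simp
 thus ?thesis by (simp add:s_def)
qed

lemma level_one_diff_poly:
 assumes "level_one f" "level_one j"
 shows "level_one (%z. f z-poly p (j z))"
proof -
 have "(%z. poly p (j z)) holomorphic_on uhp"
 using assms(2) holomorphic_on_compose_gen[of j uhp "poly p" UNIV]
 by (auto simp:level_one_def o_def intro!: holomorphic_intros)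
 thus ?thesis using assms by (auto simp:level_one_def intro!: holomorphic_intros)
qed

text \<open>Subtracting a multiple of a power of j removes the leading polar term; the pole order
  decreases until \<open>level_one_vanishing\<close> applies to the function minus its constant
  term.\<close>

theorem level_one_polynomial:
 assumes l:"l > 0" and j:"level_one j" "has_qexp l j J" "fls_subdegree J = - int l" "J~=0"
 and f:"level_one f" "has_qexp l f F"
 shows "EX p. \<forall>z\<in>uhp. f z=poly p (j z)"
 using f
proof (induction "nat (- fls_subdegree F)" arbitrary:f F rule:less_induct)
 case less
 show ?case
 proof (cases "fls_subdegree F\<ge>0")
 case True
 define c where "c=fls_nth F 0"
 have lev:"level_one (%z. f z-poly [:c:] (j z))"
 by (rule level_one_diff_poly[OF less.prems(1) j(1)])
 have "((%z. f z-poly [:c:] (j z)) \<longlongrightarrow> c - c) at_cusp"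
 using tendsto_diff[OF has_qexp_tendsto[OF l less.prems(2) True] tendsto_const[of "fls_nth F 0"]]
 by (simp add:c_def)
 hence "f z-poly [:c:] (j z)=0" if "z\<in>uhp" for z
 using level_one_vanishing[of "%z. f z-poly [:c:] (j z)" z] lev that by (simp add:level_one_def)
 thus ?thesis by (intro exI[of _ "[:c:]"]) auto
 next
 case False
 have F0:"F~=0"
 proof
 assume "F=0"
 thus False using False by simp
 qed
 obtain m where m:"fls_subdegree F=int l * m"
 using level_one_period[OF l less.prems F0] by blast
 define n where "n=nat (- m)"
 have "m<0"
 proof (rule ccontr)
 assume "~ m<0"
 hence "0\<le>int l * m" by (intro mult_nonneg_nonneg) auto
 with False m show False by simp
 qed
 hence m':"m = - int n" by (simp add:n_def)
 define s where "s=fls_subdegree F"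
 have Jn:"J ^ n~=0" "fls_subdegree (J ^ n) = s"
 using j(3,4) m m' by (simp_all add:s_def fls_subdegree_pow)
 define c where "c=fls_nth F s/fls_nth (J ^ n) s"
 have Jns:"fls_nth (J ^ n) s~=0" using Jn nth_fls_subdegree_nonzero by metis
 define G where "G=F-fls_const c * J ^ n"
 have G: "has_qexp l (%z. f z-poly (Polynomial.monom c n) (j z)) G"
 unfolding G_def poly_monom
 by (intro has_qexp_diff has_qexp_mult has_qexp_const has_qexp_power l less.prems j(2))
 have "nat (- fls_subdegree G)<nat (- fls_subdegree F)"
 proof (cases "G=0")
 case True thus ?thesis using False by simp
 next
 case ne:False
 have "fls_nth G i=0" if "i \<le> s" for i
 proof (cases "i = s")
 case True thus ?thesis using Jns by (simp add:G_def c_def)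
 next
 case False thus ?thesis using that Jn(2) by (simp add:G_def s_def)
 qed
 hence "fls_subdegree G > s"
 using ne nth_fls_subdegree_nonzero by (meson not_le_imp_less)
 thus ?thesis using False by (simp add:s_def)
 qed
 from less.hyps[OF this level_one_diff_poly[OF less.prems(1) j(1)] G]
 obtain p where "!!z. z\<in>uhp==>f z-poly (Polynomial.monom c n) (j z)=poly p (j z)" by blast
 hence "\<forall>z\<in>uhp. f z=poly (p+Polynomial.monom c n) (j z)" by (simp add:algebra_simps)
 thus ?thesis by blast
 qed
qed

subsection \<open>Representatives modulo the principal congruence subgroup\<close>

text \<open>Equality of classes modulo +-Gamma(l). The sign is included because -1 acts trivially on
  the half-plane, so that functions can separate classes.\<close>

definition cong_pm::"nat=>int^2^2=>int^2^2=>bool" where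
 "cong_pm l A B\<longleftrightarrow>(\<exists>eps\<in>{1,-1}. ALL i j. int l dvd A$i$j-eps * B$i$j)"

lemma cong_pm_refl:"cong_pm l A A"
 unfolding cong_pm_def by (intro bexI[of _ 1]) auto

lemma cong_pm_sym:"cong_pm l A B ==> cong_pm l B A"
proof -
 assume "cong_pm l A B"
 then obtain eps where eps:"eps\<in>{1,-1}" "!!i j. int l dvd A$i$j-eps * B$i$j" unfolding cong_pm_def by blast
 have "int l dvd B$i$j-eps * A$i$j" for i j
 proof -
 have "B$i$j-eps * A$i$j = - eps*(A$i$j-eps * B$i$j)" using eps(1) by auto
 thus ?thesis using eps(2) by simp
 qed
 thus ?thesis using eps(1) unfolding cong_pm_def by blast
qed

lemma cong_pm_trans:"cong_pm l A B ==> cong_pm l B C ==> cong_pm l A C"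
proof -
 assume "cong_pm l A B" "cong_pm l B C"
 then obtain eps eps' where eps:"eps\<in>{1,-1}" "!!i j. int l dvd A$i$j-eps * B$i$j"
 "eps'\<in>{1,-1}" "!!i j. int l dvd B$i$j-eps' * C$i$j" unfolding cong_pm_def by blast
 have "int l dvd A$i$j-eps * eps' * C$i$j" for i j
 proof -
 have eq:"A$i$j-eps * eps' * C$i$j=(A$i$j-eps * B$i$j)+eps*(B$i$j-eps' * C$i$j)"
 by (simp add:algebra_simps)
 show ?thesis unfolding eq by (intro dvd_add dvd_mult eps(2,4))
 qed
 thus ?thesis using eps(1,3) unfolding cong_pm_def by (intro bexI[of _ "eps * eps'"]) auto
qed

lemma cong_pm_mult_right:"cong_pm l A B ==> cong_pm l (A ** C) (B ** C)"
proof -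
 assume "cong_pm l A B"
 then obtain eps where eps:"eps\<in>{1,-1}" "!!i j. int l dvd A$i$j-eps * B$i$j" unfolding cong_pm_def by blast
 have "int l dvd (A ** C)$i$j-eps*(B ** C)$i$j" for i j
 proof -
 have "(A ** C)$i$j-eps*(B ** C)$i$j =
 (A$i$1-eps * B$i$1) * C$1$j+(A$i$2-eps * B$i$2) * C$2$j"
 by (simp add:matrix_mult_2 algebra_simps)
 thus ?thesis using eps(2) by simp
 qed
 thus ?thesis using eps(1) unfolding cong_pm_def by blast
qed

lemma moebius_uminus:"(!!i j. A$i$j = - B$i$j)==>moebius A z=moebius B z"
proof -
 assume *: "!!i j. A$i$j = - B$i$j"
 have "moebius A z=(- (of_int (B$1$1) * z + of_int (B$1$2)))/(- (of_int (B$2$1) * z + of_int (B$2$2)))"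
 unfolding moebius_def * by simp
 also have "...=moebius B z" unfolding moebius_def by (rule minus_divide_divide)
 finally show ?thesis .
qed

definition Gamma_inv::"nat=>(complex => complex)=>bool" where
 "Gamma_inv l f\<longleftrightarrow>(\<forall>gg\<in>Gamma_princ l. \<forall>z\<in>uhp. f (moebius gg z)=f z)"

lemma cong_pm_mat1:
 assumes "A\<in>SL2Z" "cong_pm l A (mat 1)" "Gamma_inv l f" "z\<in>uhp"
 shows "f (moebius A z)=f z"
proof -
 obtain eps where eps:"eps\<in>{1,-1}" "!!i j. int l dvd A$i$j-eps * mat 1$i$j"
 using assms(2) unfolding cong_pm_def by blast
 have d:"int l dvd A$1$1-eps" "int l dvd A$1$2" "int l dvd A$2$1" "int l dvd A$2$2-eps"
 using eps(2)[of 1 1] eps(2)[of 1 2] eps(2)[of 2 1] eps(2)[of 2 2] by simp_all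
 show ?thesis
 proof (cases "eps=1")
 case True
 hence "A\<in>Gamma_princ l" using d assms(1) by (simp add:Gamma_princ_iff)
 thus ?thesis using assms by (simp add:Gamma_inv_def)
 next
 case False
 hence e:"eps = -1" using eps(1) by simp
 define B where "B=mat2 (- A$1$1) (- A$1$2) (- A$2$1) (- A$2$2)"
 have B: "A$i$j = - B$i$j" for i j
 using exhaust_2[of i] exhaust_2[of j] by (auto simp:B_def)
 have "B$1$1-1 = - (A$1$1-eps)" "B$2$2-1 = - (A$2$2-eps)"
 by (simp_all add:B_def e)
 hence "int l dvd B$1$1-1" "int l dvd B$2$2-1"
 using d(1,4) by (simp_all only:dvd_minus_iff)
 hence "B\<in>Gamma_princ l" using d assms(1) by (simp add:Gamma_princ_iff B_def mat2_exhaust)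
 thus ?thesis using assms moebius_uminus[of A B z] B by (simp add:Gamma_inv_def)
 qed
qed

lemma cong_pm_imp_eq:
 assumes "A\<in>SL2Z" "B\<in>SL2Z" "cong_pm l A B" "Gamma_inv l f" "z\<in>uhp"
 shows "f (moebius A z)=f (moebius B z)"
proof -
 have "cong_pm l (A ** minv B) (mat 1)"
 using cong_pm_mult_right[OF assms(3),of "minv B"] minv_mult(2)[OF assms(2)] by simp
 moreover have "moebius A z=moebius (A ** minv B) (moebius B z)"
 using assms Im_moebius_pos[OF assms(2),of z] by (simp add:moebius_mult minv_in_SL2Z uhp_def)
 ultimately show ?thesis
 using cong_pm_mat1[of "A ** minv B" l f "moebius B z"] assms
 by (simp add:SL2Z_mult minv_in_SL2Z moebius_in_uhp)
qed

definition reps::"nat=>(int^2^2) set=>bool" where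
 "reps l R\<longleftrightarrow>finite R & R \<subseteq> SL2Z&(\<forall>gg\<in>SL2Z. \<exists>!sg. sg \<in> R & cong_pm l gg sg)"

lemma reps_exist:
 assumes "l > 0" shows "EX R. reps l R"
proof -
 define cls where "cls=(%A. {B\<in>SL2Z. cong_pm l A B})"
 define rep where "rep=(%C::(int^2^2) set. SOME B. B \<in> C)"
 define red where "red=(%A::int^2^2. (A$1$1 mod int l,A$1$2 mod int l,A$2$1 mod int l,A$2$2 mod int l))"
 have cls_eq:"cls A = cls B" if "cong_pm l A B" for A B
 using that cong_pm_sym cong_pm_trans unfolding cls_def by blast
 have red_eq:"cls A = cls B" if "red A=red B" for A B
 proof (rule cls_eq)
 have "int l dvd A$i$j-1 * B$i$j" for i j
 using that exhaust_2[of i] exhaust_2[of j] by (auto simp:red_def mod_eq_dvd_iff)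
 thus "cong_pm l A B" unfolding cong_pm_def by blast
 qed
 define h where "h=(%r. cls (SOME A. red A=r))"
 have h:"cls A=h (red A)" for A
 unfolding h_def by (rule red_eq[symmetric]) (rule someI,rule refl)
 have "red ` SL2Z \<subseteq> {0..<int l} \<times> {0..<int l} \<times> {0..<int l} \<times> {0..<int l}"
 using assms by (auto simp:red_def)
 hence "finite (red ` SL2Z)" by (rule finite_subset) auto
 hence fin:"finite (cls ` SL2Z)"
 proof -
 have "cls ` SL2Z=h ` (red ` SL2Z)" by (simp add:h image_image)
 thus ?thesis using \<open>finite (red ` SL2Z)\<close> by (simp only:finite_imageI)
 qed
 have rep:"rep (cls A)\<in>SL2Z & cong_pm l A (rep (cls A))" if "A\<in>SL2Z" for A
 proof -
 have "A \<in> cls A" using that by (simp add:cls_def cong_pm_refl)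
 hence "rep (cls A) \<in> cls A" unfolding rep_def by (rule someI)
 thus ?thesis by (simp add:cls_def)
 qed
 have "reps l (rep ` cls ` SL2Z)"
 unfolding reps_def
 proof (intro conjI ballI)
 show "finite (rep ` cls ` SL2Z)" using fin by simp
 show "rep ` cls ` SL2Z \<subseteq> SL2Z" using rep by blast
 fix gg::"int^2^2" assume gg:"gg\<in>SL2Z"
 show "\<exists>!sg. sg\<in>rep ` cls ` SL2Z & cong_pm l gg sg"
 proof (rule ex1I[of _ "rep (cls gg)"])
 fix sg assume "sg\<in>rep ` cls ` SL2Z & cong_pm l gg sg"
 then obtain A where A: "A\<in>SL2Z" "sg=rep (cls A)" "cong_pm l gg sg" by blast
 have "cls A = cls gg"
 using rep[OF A(1)] A(2,3) cls_eq cong_pm_sym cong_pm_trans by metis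
 thus "sg=rep (cls gg)" using A by simp
 qed (use rep gg in blast)
 qed
 thus ?thesis by blast
qed

lemma reps_bij:
 assumes R: "reps l R" and gg:"gg\<in>SL2Z"
 shows "\<exists>\<pi>. bij_betw \<pi> R R&(\<forall>sg\<in>R. cong_pm l (sg ** gg) (\<pi> sg))"
proof -
 have RS: "R \<subseteq> SL2Z" and fin:"finite R" using R by (auto simp:reps_def)
 have "\<forall>sg\<in>R. EX sg'. sg' \<in> R & cong_pm l (sg ** gg) sg'"
 using R RS gg SL2Z_mult unfolding reps_def by blast
 then obtain \<pi> where \<pi>: "!!sg. sg \<in> R==>\<pi> sg \<in> R & cong_pm l (sg ** gg) (\<pi> sg)" by metis
 have "inj_on \<pi> R"
 proof (rule inj_onI)
 fix sg sg' assume *: "sg \<in> R" "sg' \<in> R" "\<pi> sg=\<pi> sg'"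
 have "cong_pm l (sg ** gg) (sg' ** gg)" using \<pi> * cong_pm_sym cong_pm_trans by metis
 from cong_pm_mult_right[OF this,of "minv gg"]
 have "cong_pm l sg sg'" by (simp add:matrix_mul_assoc[symmetric] minv_mult gg)
 thus "sg = sg'" using R RS * cong_pm_refl unfolding reps_def by blast
 qed
 moreover have "\<pi> ` R \<subseteq> R" using \<pi> by blast
 ultimately have "bij_betw \<pi> R R"
 using fin by (simp add:bij_betw_def endo_inj_surj)
 thus ?thesis using \<pi> by blast
qed

text \<open>Right multiplication by \<open>gg\<close> permutes the representatives up to
  \<open>cong_pm\<close>, so symmetric expressions in the conjugates of functions for Gamma(l) have
  level one.\<close>

lemma reps_prod_invariant:
 assumes R: "reps l R" and gg:"gg\<in>SL2Z" and f:"Gamma_inv l f" "Gamma_inv l g" and z:"z\<in>uhp"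
 shows "(\<Prod>sg\<in>R. G (f (moebius sg (moebius gg z))))=(\<Prod>sg\<in>R. G (f (moebius sg z)))"
 and "(\<Sum>sg\<in>R. K (f (moebius sg (moebius gg z))) (g (moebius sg (moebius gg z)))) =
 (\<Sum>sg\<in>R. K (f (moebius sg z)) (g (moebius sg z)))"
proof -
 obtain \<pi> where \<pi>: "bij_betw \<pi> R R" "!!sg. sg \<in> R ==> cong_pm l (sg ** gg) (\<pi> sg)"
 using reps_bij[OF R gg] by blast
 have RS: "sg\<in>SL2Z" if "sg \<in> R" for sg using R that by (auto simp:reps_def)
 have eq:"h (moebius sg (moebius gg z))=h (moebius (\<pi> sg) z)" if "sg \<in> R" "Gamma_inv l h" for sg h
 proof -
 have "\<pi> sg \<in> R" using \<pi>(1) that by (auto simp:bij_betw_def)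
 thus ?thesis
 using cong_pm_imp_eq[OF SL2Z_mult[OF RS[OF that(1)] gg] RS \<pi>(2)[OF that(1)] that(2) z]
 moebius_mult[OF RS[OF that(1)] gg,of z] z by (simp add:uhp_def)
 qed
 have "(\<Prod>sg\<in>R. G (f (moebius sg (moebius gg z))))=(\<Prod>sg\<in>R. G (f (moebius (\<pi> sg) z)))"
 by (intro prod.cong refl) (simp only:eq[OF _ f(1)])
 also have "...=(\<Prod>sg\<in>R. G (f (moebius sg z)))"
 by (rule prod.reindex_bij_betw[OF \<pi>(1)])
 finally show "(\<Prod>sg\<in>R. G (f (moebius sg (moebius gg z))))=(\<Prod>sg\<in>R. G (f (moebius sg z)))" .
 have "(\<Sum>sg\<in>R. K (f (moebius sg (moebius gg z))) (g (moebius sg (moebius gg z)))) =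
 (\<Sum>sg\<in>R. K (f (moebius (\<pi> sg) z)) (g (moebius (\<pi> sg) z)))"
 by (intro sum.cong refl) (simp only:eq[OF _ f(1)] eq[OF _ f(2)])
 also have "...=(\<Sum>sg\<in>R. K (f (moebius sg z)) (g (moebius sg z)))"
 by (rule sum.reindex_bij_betw[OF \<pi>(1)])
 finally show "(\<Sum>sg\<in>R. K (f (moebius sg (moebius gg z))) (g (moebius sg (moebius gg z)))) =
 (\<Sum>sg\<in>R. K (f (moebius sg z)) (g (moebius sg z)))" .
qed

lemma zero_of_qexp_0:
 assumes l:"l > 0" and f:"f holomorphic_on uhp" "has_qexp l f 0" and z:"z\<in>uhp"
 shows "f z=0"
proof -
 have "eventually (%tt. f tt=0) at_cusp"
 using f(2) by (simp add:has_qexp_def)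
 then obtain Y where Y: "!!tt. Im tt > Y==>f tt=0" by (auto simp:eventually_at_cusp)
 define U where "U={tt. Im tt > max Y 0}"
 have "open U" unfolding U_def by (rule open_halfspace_Im_gt)
 define \<xi> where "\<xi> = Complex 0 (max Y 0+1)"
 have \<xi>: "\<xi>\<in>U" by (auto simp:U_def \<xi>_def max_def)
 show ?thesis
 proof (rule analytic_continuation[OF f(1) open_uhp connected_uhp])
 show "U \<subseteq> uhp" by (auto simp:U_def uhp_def)
 thus "\<xi>\<in>uhp" using \<xi> by blast
 show "\<xi> islimpt U" using \<open>open U\<close> \<xi> by (rule interior_limit_point[OF interior_open[THEN equalityD2,THEN subsetD]])
 show "f w=0" if "w\<in>U" for w using Y that by (simp add:U_def)
 qed fact
qed

subsection \<open>Holomorphic functions as elements of the function field\<close>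
lemma eval_mero_holomorphic:
 assumes "f holomorphic_on uhp" "z\<in>uhp"
 shows "eval_mero (mero f) z=f z"
proof -
 have an:"f analytic_on uhp" using assms open_uhp by (simp add:analytic_on_open)
 hence "f meromorphic_on uhp" by (rule analytic_on_imp_meromorphic_on)
 moreover have "f analytic_on {z}" using an assms(2) analytic_on_subset by blast
 ultimately show ?thesis using assms(2) by (simp add:eval_mero_mero)
qed

lemma mero_cong:
 assumes "f holomorphic_on uhp" "!!z. z\<in>uhp==>f z=g z"
 shows "mero f=mero g"
proof -
 have "g holomorphic_on uhp" using assms by (rule holomorphic_transform)
 hence "eval_mero (mero f) z=eval_mero (mero g) z" for z
 using assms by (cases "z\<in>uhp") (simp_all add:eval_mero_holomorphic eval_mero_outside)
 thus ?thesis by (simp add:eval_mero_inject[symmetric] fun_eq_iff)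
qed

lemma mero_eq_iff:
 assumes "f holomorphic_on uhp" "g holomorphic_on uhp"
 shows "mero f=mero g\<longleftrightarrow>(\<forall>z\<in>uhp. f z=g z)"
 using mero_cong[OF assms(1)] eval_mero_holomorphic[OF assms(1)] eval_mero_holomorphic[OF assms(2)] by metis

lemma mero_add:
 assumes "f holomorphic_on uhp" "g holomorphic_on uhp"
 shows "mero f+mero g=mero (%z. f z+g z)"
 unfolding plus_mero_uhp_def
 by (rule mero_cong[symmetric]) (use assms in \<open>auto intro!: holomorphic_intros simp:eval_mero_holomorphic\<close>)

lemma mero_mult:
 assumes "f holomorphic_on uhp" "g holomorphic_on uhp"
 shows "mero f * mero g=mero (%z. f z * g z)"
 unfolding times_mero_uhp_def
 by (rule mero_cong[symmetric]) (use assms in \<open>auto intro!: holomorphic_intros simp:eval_mero_holomorphic\<close>)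

lemma mero_uminus:
 assumes "f holomorphic_on uhp"
 shows "- mero f=mero (%z. - f z)"
 unfolding uminus_mero_uhp_def
 by (rule mero_cong[symmetric]) (use assms in \<open>auto intro!: holomorphic_intros simp:eval_mero_holomorphic\<close>)

lemma mero_inverse:
 assumes "f holomorphic_on uhp" "!!z. z\<in>uhp==>f z~=0"
 shows "inverse (mero f)=mero (%z. inverse (f z))"
 unfolding inverse_mero_uhp_def
 by (rule mero_cong[symmetric]) (use assms in \<open>auto intro!: holomorphic_intros simp:eval_mero_holomorphic\<close>)

lemma mero_power:
 assumes "f holomorphic_on uhp"
 shows "mero f ^ n=mero (%z. f z ^ n)"
proof (induction n)
 case 0 thus ?case by (simp add:one_mero_uhp_def)
next
 case (Suc n) thus ?case using assms by (simp add:mero_mult holomorphic_intros)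
qed

lemma mero_sum:
 assumes "!!i. i\<in>I==>f i holomorphic_on uhp"
 shows "(\<Sum>i\<in>I. mero (f i))=mero (%z. \<Sum>i\<in>I. f i z)"
 using assms
 by (induction I rule:infinite_finite_induct)
 (simp_all add:zero_mero_uhp_def mero_add holomorphic_on_sum)

lemma mero_prod:
 assumes "!!i. i\<in>I==>f i holomorphic_on uhp"
 shows "(\<Prod>i\<in>I. mero (f i))=mero (%z. \<Prod>i\<in>I. f i z)"
 using assms
 by (induction I rule:infinite_finite_induct)
 (simp_all add:one_mero_uhp_def mero_mult holomorphic_on_prod)

lemma holomorphic_poly_compose:
 "f holomorphic_on S==>(%z. poly p (f z)) holomorphic_on S" for p::"complex poly"
 by (induction p) (auto intro!: holomorphic_intros)

lemma of_rat_mero:"of_rat r=mero (%_. of_rat r)"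
proof -
 have nat:"of_nat n=mero (%_. of_nat n)" for n
 proof (induction n)
 case 0 thus ?case by (simp add:zero_mero_uhp_def)
 next
 case (Suc n) thus ?case by (simp add:one_mero_uhp_def mero_add)
 qed
 have int:"of_int n=mero (%_. of_int n)" for n
 proof (cases "n\<ge>0")
 case True thus ?thesis using nat[of "nat n"] by simp
 next
 case False
 have "of_int n = - (of_nat (nat (- n))::mero_uhp)" using False by simp
 also have "...=mero (%_. - of_nat (nat (- n)))" by (simp add:nat mero_uminus)
 also have "- of_nat (nat (- n))=(of_int n::complex)" using False by simp
 finally show ?thesis .
 qed
 obtain a b where r:"r = of_int a / of_int b" "b~=0"
 by (metis Fract_of_int_quotient Rat_cases less_irrefl)
 have "mero (%_. of_rat r) * of_int b=mero (%_. of_rat r * of_int b)"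
 by (simp add:int mero_mult)
 also have "of_rat r * of_int b=(of_int a::complex)" using r by (simp add:of_rat_divide)
 finally have "mero (%_. of_rat r) * of_int b = of_int a" by (simp add:int)
 hence "mero (%_. of_rat r) = of_int a / of_int b" using r(2) by (simp add:field_simps)
 thus ?thesis using r by (simp add:of_rat_divide)
qed

lemma poly_rat_mero:
 assumes "f holomorphic_on uhp"
 shows "poly (map_poly of_rat p) (mero f)=mero (%z. poly (map_poly of_rat p) (f z))"
proof (induction p)
 case 0 thus ?case by (simp add:zero_mero_uhp_def)
next
 case (pCons a p)
 have map:"map_poly of_rat (pCons a p)=pCons (of_rat a::'b::field_char_0) (map_poly of_rat p)"
 by (simp add:poly_eq_iff coeff_map_poly coeff_pCons split:nat.split)
 have "poly (map_poly of_rat (pCons a p)) (mero f) =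
 mero (%_. of_rat a)+mero f * mero (%z. poly (map_poly of_rat p) (f z))"
 unfolding map poly_pCons pCons.IH of_rat_mero ..
 also have "...=mero (%z. of_rat a+f z * poly (map_poly of_rat p) (f z))"
 using assms by (simp add:mero_add mero_mult holomorphic_poly_compose holomorphic_intros)
 finally show ?case unfolding map poly_pCons .
qed

lemma zero_in_Q_adjoin:"0\<in>Q_adjoin x"
 unfolding Q_adjoin_def by (auto intro!: exI[of _ 0])

lemma one_in_Q_adjoin:"1\<in>Q_adjoin x"
 unfolding Q_adjoin_def by (auto intro!: exI[of _ 1] simp:map_poly_1')

lemma integral_over_mero:
 assumes j:"j holomorphic_on uhp" and f:"f holomorphic_on uhp"
 and rel:"!!z. z\<in>uhp==>f z ^ n+(\<Sum>m<n. poly (map_poly of_rat (a m)) (j z) * f z ^ m)=0"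
 shows "integral_over (Q_adjoin (mero j)) (mero f)"
proof -
 define c where "c=(%m. poly (map_poly of_rat (a m)) (mero j))"
 have c:"c m=mero (%z. poly (map_poly of_rat (a m)) (j z))" for m
 unfolding c_def by (rule poly_rat_mero[OF j])
 define P where "P=Polynomial.monom 1 n+(\<Sum>m<n. Polynomial.monom (c m) m)"
 have coeff:"Polynomial.coeff P i=(if i=n then 1 else if i<n then c i else 0)" for i
 by (auto simp:P_def coeff_sum)
 have deg:"Polynomial.degree P=n"
 proof (rule antisym)
 show "Polynomial.degree P\<le>n" by (rule degree_le) (simp add:coeff)
 show "n\<le>Polynomial.degree P" by (rule le_degree) (simp add:coeff)
 qed
 have "poly P (mero f)=mero f ^ n+(\<Sum>m<n. c m * mero f ^ m)"
 by (simp add:P_def poly_sum poly_monom)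
 also have "...=mero (%z. f z ^ n+(\<Sum>m<n. poly (map_poly of_rat (a m)) (j z) * f z ^ m))"
 unfolding c using j f
 by (simp add:mero_power mero_mult mero_sum mero_add holomorphic_poly_compose holomorphic_intros)
 also have "...=0" unfolding zero_mero_uhp_def
 using rel by (intro mero_cong holomorphic_intros holomorphic_poly_compose j f)
 finally have "poly P (mero f)=0" .
 moreover have "Polynomial.coeff P i\<in>Q_adjoin (mero j)" for i
 using zero_in_Q_adjoin one_in_Q_adjoin by (auto simp:coeff c_def) (auto simp:Q_adjoin_def)
 ultimately show ?thesis unfolding integral_over_def using deg coeff by (intro exI[of _ P]) auto
qed

subsection \<open>Rational and integral coefficients\<close>

text \<open>
 A \<open>\<rat>\<close>-linear projection of \<open>\<complex>\<close> onto \<open>\<rat>\<close>: applied to the coefficients of a linear relation between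
 Laurent series over \<open>\<rat>\<close> it produces a relation over \<open>\<rat>\<close>.
\<close>
lemma rational_projection:
 obtains \<pi>::"complex=>rat" where "!!x y. \<pi> (x+y)=\<pi> x+\<pi> y" "!!r x. \<pi> (of_rat r * x)=r*\<pi> x"
 "!!r. \<pi> (of_rat r)=r"
proof -
 interpret V: vector_space_pair "%r x. of_rat r * x::complex" "%r x. r * x::rat"
 by unfold_locales (auto simp:algebra_simps of_rat_add of_rat_mult)
 have "V.vs1.independent {1}"
 by (simp add:V.vs1.dependent_single)
 then obtain g where g:"Vector_Spaces.linear (%r x. of_rat r * x::complex) (%r x. r * x::rat) g" "g 1=1"
 using V.linear_independent_extend[of "{1}" "%_. 1"] by auto
 interpret g:Vector_Spaces.linear "%r x. of_rat r * x::complex" "%r x. r * x::rat" g by fact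
 show thesis
 proof (rule that[of g])
 show "g (of_rat r)=r" for r using g.scale[of r 1] g(2) by simp
 qed (use g.add g.scale in auto)
qed

definition coeffs_in::"complex set => complex fls=>bool" where
 "coeffs_in S F\<longleftrightarrow>(ALL n. fls_nth F n\<in>S)"

lemma coeffs_in_mult:
 assumes "coeffs_in S F" "coeffs_in S G" "0\<in>S"
 and "!!x y. x\<in>S==>y\<in>S==>x+y\<in>S" "!!x y. x\<in>S==>y\<in>S==>x * y\<in>S"
 shows "coeffs_in S (F * G)"
proof -
 have sum:"(\<Sum>i\<in>I. t i)\<in>S" if "!!i. i\<in>I==>t i\<in>S" for t and I::"int set"
 using that assms(3,4) by (induction I rule:infinite_finite_induct) auto
 show ?thesis
 unfolding coeffs_in_def fls_times_nth(2)
 using assms(1,2,5) by (auto simp:coeffs_in_def intro!: sum)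
qed

lemma coeffs_in_1:"0\<in>S==>1\<in>S ==> coeffs_in S 1"
 by (auto simp:coeffs_in_def fls_one_nth)

lemma coeffs_in_power:
 assumes "coeffs_in S F" "0\<in>S" "1\<in>S"
 and "!!x y. x\<in>S==>y\<in>S==>x+y\<in>S" "!!x y. x\<in>S==>y\<in>S==>x * y\<in>S"
 shows "coeffs_in S (F ^ n)"
proof (induction n)
 case 0 thus ?case using assms by (simp add:coeffs_in_1)
next
 case (Suc n) thus ?case using assms by (simp add:coeffs_in_mult)
qed

lemmas coeffs_in_Ints_mult = coeffs_in_mult[where S=\<int>,OF _ _ Ints_0 Ints_add Ints_mult]
lemmas coeffs_in_Ints_power = coeffs_in_power[where S=\<int>,OF _ Ints_0 Ints_1 Ints_add Ints_mult]
lemmas coeffs_in_Rats_mult = coeffs_in_mult[where S=\<rat>,OF _ _ Rats_0 Rats_add Rats_mult]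
lemmas coeffs_in_Rats_power = coeffs_in_power[where S=\<rat>,OF _ Rats_0 Rats_1 Rats_add Rats_mult]

lemma coeffs_in_Ints_imp_Rats:"coeffs_in \<int> F ==> coeffs_in \<rat> F"
 using Ints_subset_Rats by (auto simp:coeffs_in_def)

lemma rational_linear_relation:
 fixes a::"'i => complex" and \<pi>::"complex=>rat"
 assumes \<pi>: "!!x y. \<pi> (x+y)=\<pi> x+\<pi> y" "!!r x. \<pi> (of_rat r * x)=r*\<pi> x" "!!r. \<pi> (of_rat r)=r"
 and S: "!!i. i\<in>I ==> coeffs_in \<rat> (S i)" and T: "coeffs_in \<rat> T"
 and eq:"T=(\<Sum>i\<in>I. fls_const (a i) * S i)"
 shows "T=(\<Sum>i\<in>I. fls_const (of_rat (\<pi> (a i))) * S i)"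
proof (rule fls_eqI)
 fix n
 have 0:"\<pi> 0=0" using \<pi>(3)[of 0] by simp
 have \<pi>sum:"\<pi> (\<Sum>i\<in>I. t i)=(\<Sum>i\<in>I. \<pi> (t i))" for t::"'i => complex"
 by (induction I rule:infinite_finite_induct) (auto simp: 0 \<pi>(1))
 obtain t where t:"fls_nth T n = of_rat t" using T unfolding coeffs_in_def by (metis Rats_cases)
 have "\<forall>i\<in>I. EX s. fls_nth (S i) n = of_rat s" using S unfolding coeffs_in_def by (metis Rats_cases)
 then obtain s where s:"!!i. i\<in>I==>fls_nth (S i) n = of_rat (s i)" by metis
 have "of_rat t=(\<Sum>i\<in>I. of_rat (s i) * a i)"
 using arg_cong[OF eq,of "%F. fls_nth F n"] s t by (simp add:fls_nth_sum mult.commute)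
 hence "\<pi> (of_rat t)=\<pi> (\<Sum>i\<in>I. of_rat (s i) * a i)" by simp
 hence "t=(\<Sum>i\<in>I. s i*\<pi> (a i))" by (simp add: \<pi>sum \<pi>(2,3))
 hence "of_rat t=(\<Sum>i\<in>I. of_rat (s i)*(of_rat (\<pi> (a i))::complex))"
 by (simp add:of_rat_sum of_rat_mult)
 thus "fls_nth T n=fls_nth (\<Sum>i\<in>I. fls_const (of_rat (\<pi> (a i))) * S i) n"
 using s t by (simp add:fls_nth_sum mult.commute)
qed

lemma common_denominator:
 assumes "finite I" "!!i. i\<in>I ==> coeffs_in \<int> (S i)"
 shows "\<exists>M::nat. M > 0 & coeffs_in \<int> (fls_const (of_nat M)*(\<Sum>i\<in>I. fls_const (of_rat (r i)) * S i))"
 using assms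
proof (induction I rule:finite_induct)
 case empty
 show ?case by (intro exI[of _ 1]) (simp add:coeffs_in_def)
next
 case (insert i I)
 then obtain M::nat where M: "M > 0" "coeffs_in \<int> (fls_const (of_nat M)*(\<Sum>i\<in>I. fls_const (of_rat (r i)) * S i))"
 by auto
 obtain p q where pq:"r i = of_int p / of_int q" "q > 0"
 by (metis Fract_of_int_quotient Rat_cases)
 define N where "N=nat q"
 have N: "N > 0" "of_nat N * of_rat (r i)=(of_int p::complex)"
 using pq by (simp_all add:N_def of_rat_divide)
 have eq:"of_nat (M * N) * fls_nth (\<Sum>i\<in>insert i I. fls_const (of_rat (r i)) * S i) n =
 of_nat M * (of_nat N * of_rat (r i)) * fls_nth (S i) n +
 of_nat N * (of_nat M * fls_nth (\<Sum>i\<in>I. fls_const (of_rat (r i)) * S i) n)" for n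
 using insert.hyps by (simp add:algebra_simps)
 have h1:"of_nat M * fls_nth (\<Sum>i\<in>I. fls_const (of_rat (r i)) * S i) n\<in>\<int>" for n
 using M(2) by (simp add:coeffs_in_def)
 have h2:"fls_nth (S i) n\<in>\<int>" for n using insert.prems by (simp add:coeffs_in_def)
 have "of_nat (M * N) * fls_nth (\<Sum>i\<in>insert i I. fls_const (of_rat (r i)) * S i) n\<in>\<int>" for n
 unfolding eq N(2)
 by (rule Ints_add[OF Ints_mult[OF Ints_mult[OF Ints_of_nat Ints_of_int] h2] Ints_mult[OF Ints_of_nat h1]])
 thus ?case using M(1) N(1) by (intro exI[of _ "M * N"]) (simp add:coeffs_in_def)
qed

lemma poly_eq_sum_le:
 fixes p::"'a::comm_semiring_1 poly"
 assumes "Polynomial.degree p\<le>d"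
 shows "poly p y=(\<Sum>i\<le>d. Polynomial.coeff p i * y ^ i)"
 unfolding poly_altdef using assms
 by (intro sum.mono_neutral_left) (auto simp:coeff_eq_0)

subsection \<open>Families of polynomials with modular coefficients\<close>

definition qhol::"nat=>(complex => complex)=>bool" where
 "qhol l f\<longleftrightarrow>f holomorphic_on uhp&(EX F. has_qexp l f F)"

definition qhol_poly::"nat=>(complex => complex poly)=>bool" where
 "qhol_poly l p\<longleftrightarrow>(ALL m. qhol l (%z. Polynomial.coeff (p z) m))"

context
 fixes l::nat assumes l:"l > 0"
begin
lemma qhol_const:"qhol l (%_. c)"
 using has_qexp_const[OF l] by (auto simp:qhol_def)

lemma qhol_add:"qhol l f==>qhol l g==>qhol l (%z. f z+g z)"
 unfolding qhol_def by (blast intro:holomorphic_on_add has_qexp_add[OF l])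

lemma qhol_mult:"qhol l f==>qhol l g==>qhol l (%z. f z * g z)"
 unfolding qhol_def by (blast intro:holomorphic_on_mult has_qexp_mult[OF l])

lemma qhol_uminus:"qhol l f==>qhol l (%z. - f z)"
 using has_qexp_uminus[OF l] by (auto simp:qhol_def intro!: holomorphic_intros)

lemma qhol_sum:"(!!i. i\<in>I==>qhol l (f i))==>qhol l (%z. \<Sum>i\<in>I. f i z)"
 by (induction I rule:infinite_finite_induct) (auto intro:qhol_const qhol_add)

lemma qhol_poly_mult:"qhol_poly l p==>qhol_poly l q==>qhol_poly l (%z. p z * q z)"
 by (auto simp:qhol_poly_def coeff_mult intro!: qhol_sum qhol_mult)

lemma qhol_poly_1:"qhol_poly l (%z. 1)"
 by (auto simp:qhol_poly_def intro!: qhol_const)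

lemma qhol_poly_prod:"(!!i. i\<in>I==>qhol_poly l (p i))==>qhol_poly l (%z. \<Prod>i\<in>I. p i z)"
 by (induction I rule:infinite_finite_induct) (auto intro:qhol_poly_1 qhol_poly_mult)

lemma qhol_poly_linear:"qhol l f==>qhol_poly l (%z. [:- f z,1:])"
 unfolding qhol_poly_def
proof
 fix m assume f:"qhol l f"
 show "qhol l (%z. Polynomial.coeff [:- f z,1:] m)"
 proof (cases m)
 case 0 thus ?thesis using f by (simp add:qhol_uminus)
 next
 case (Suc m') thus ?thesis by (cases m') (simp_all add:qhol_const)
 qed
qed

lemma qhol_poly_sum_smult:"(!!i. i\<in>I==>qhol l (f i))==>(!!i. i\<in>I==>qhol_poly l (p i)) ==>
 qhol_poly l (%z. \<Sum>i\<in>I. Polynomial.smult (f i z) (p i z))"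
 by (auto simp:qhol_poly_def coeff_sum intro!: qhol_sum qhol_mult)

end

definition modular_hol::"nat=>(complex => complex)=>bool" where
 "modular_hol l f\<longleftrightarrow>Gamma_inv l f&(\<forall>gg\<in>SL2Z. qhol l (%z. f (moebius gg z)))"

lemma modular_hol_qhol:"modular_hol l f==>qhol l f"
 unfolding modular_hol_def using mat1_in_SL2Z by (metis (no_types,lifting) ext moebius_mat1)

text \<open>The characteristic polynomial of f over the functions of level one: its roots are the
  conjugates of f under SL2(Z) modulo +-Gamma(l).\<close>

definition conj_poly::"(int^2^2) set=>(complex => complex) => complex => complex poly" where
 "conj_poly R f z=(\<Prod>sg\<in>R. [:- f (moebius sg z),1:])"

locale level_one_generator =
 fixes l::nat and R::"(int^2^2) set" and j::"complex => complex" and J::"complex fls"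
 assumes l:"l > 0" and R: "reps l R"
 and j:"level_one j" "has_qexp l j J" "fls_subdegree J = - int l" "J~=0"
begin
lemma R_fin:"finite R" and R_sub:"R \<subseteq> SL2Z"
 using R by (auto simp:reps_def)

lemma j_hol:"j holomorphic_on uhp" using j(1) by (simp add:level_one_def)

lemma conj_poly_invariant:
 assumes "Gamma_inv l f" "gg\<in>SL2Z" "z\<in>uhp"
 shows "conj_poly R f (moebius gg z) = conj_poly R f z"
 unfolding conj_poly_def
 using reps_prod_invariant(1)[OF R assms(2,1,1,3),of "%y. [:- y,1:]"] .

lemma qhol_conj_poly:"modular_hol l f==>qhol_poly l (conj_poly R f)"
 unfolding conj_poly_def[abs_def] using R_sub
 by (intro qhol_poly_prod qhol_poly_linear l) (auto simp:modular_hol_def)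

lemma level_one_coeffs:
 assumes "qhol_poly l p" "!!gg z. gg\<in>SL2Z==>z\<in>uhp==>p (moebius gg z)=p z"
 shows "EX a. ALL m. \<forall>z\<in>uhp. Polynomial.coeff (p z) m=poly (a m) (j z)"
proof -
 have "EX q. \<forall>z\<in>uhp. Polynomial.coeff (p z) m=poly q (j z)" for m
 proof -
 have "qhol l (%z. Polynomial.coeff (p z) m)" using assms(1) by (simp add:qhol_poly_def)
 then obtain F where F: "has_qexp l (%z. Polynomial.coeff (p z) m) F" by (auto simp:qhol_def)
 have "level_one (%z. Polynomial.coeff (p z) m)"
 using \<open>qhol l _\<close> assms(2) by (auto simp:level_one_def qhol_def)
 from level_one_polynomial[OF l j this F] show ?thesis .
 qed
 thus ?thesis by metis
qed

text \<open>The representative of the identity class shows that f and h occur, simultaneously, among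
  their own conjugates.\<close>

lemma conj_root:
 assumes "Gamma_inv l f" "Gamma_inv l h" "z\<in>uhp"
 obtains sg where "sg \<in> R" "f (moebius sg z)=f z" "h (moebius sg z)=h z"
proof -
 obtain sg where sg:"sg \<in> R" "cong_pm l (mat 1) sg"
 using R mat1_in_SL2Z unfolding reps_def by blast
 have "f (moebius (mat 1) z)=f (moebius sg z)" "h (moebius (mat 1) z)=h (moebius sg z)"
 using cong_pm_imp_eq[OF mat1_in_SL2Z _ sg(2)] assms sg(1) R_sub by blast+
 thus ?thesis using that[OF sg(1)] by simp
qed

lemma conj_poly_degree:"Polynomial.degree (conj_poly R f z) = card R"
 and conj_poly_monic:"Polynomial.coeff (conj_poly R f z) (card R)=1"
proof -
 have "Polynomial.degree (conj_poly R f z)=(\<Sum>sg\<in>R. Polynomial.degree [:- f (moebius sg z),1:])"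
 unfolding conj_poly_def by (rule degree_prod_eq_sum_degree) auto
 thus deg:"Polynomial.degree (conj_poly R f z) = card R" by simp
 have "Polynomial.coeff (conj_poly R f z) (Polynomial.degree (conj_poly R f z)) =
 (\<Prod>sg\<in>R. Polynomial.coeff [:- f (moebius sg z),1:] (Polynomial.degree [:- f (moebius sg z),1:]))"
 unfolding conj_poly_def by (rule lead_coeff_prod)
 thus "Polynomial.coeff (conj_poly R f z) (card R)=1" by (simp add:deg)
qed

text \<open>
 Modular functions without poles on the upper half-plane are integral over \<open>\<complex>[j]\<close>; rationality of
 the coefficients turns this into integrality over \<open>\<rat>[j]\<close>.
\<close>

theorem integral_over_j:
 assumes f:"modular_hol l f" "has_qexp l f F" "coeffs_in \<rat> F" and J: "coeffs_in \<rat> J"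
 shows "integral_over (Q_adjoin (mero j)) (mero f)"
proof -
 define n where "n = card R"
 have inv:"Gamma_inv l f" and hol:"f holomorphic_on uhp"
 using f(1) modular_hol_qhol[OF f(1)] by (auto simp:modular_hol_def qhol_def)
 obtain a where a:"!!m z. z\<in>uhp==>Polynomial.coeff (conj_poly R f z) m=poly (a m) (j z)"
 using level_one_coeffs[OF qhol_conj_poly[OF f(1)]] conj_poly_invariant[OF inv] by blast
 have rel:"f z ^ n+(\<Sum>m<n. poly (a m) (j z) * f z ^ m)=0" if z:"z\<in>uhp" for z
 proof -
 obtain sg where sg:"sg \<in> R" "f (moebius sg z)=f z" using conj_root[OF inv inv z] by blast
 have "poly (conj_poly R f z) (f z)=0"
 unfolding conj_poly_def poly_prod using sg R_fin by (intro prod_zero bexI[of _ sg]) auto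
 also have "poly (conj_poly R f z) (f z)=(\<Sum>m\<le>n. Polynomial.coeff (conj_poly R f z) m * f z ^ m)"
 by (simp add:poly_altdef conj_poly_degree n_def)
 also have "...=(\<Sum>m<n. Polynomial.coeff (conj_poly R f z) m * f z ^ m)+f z ^ n"
 unfolding lessThan_Suc_atMost[symmetric] by (simp add:conj_poly_monic n_def)
 also have "(\<Sum>m<n. Polynomial.coeff (conj_poly R f z) m * f z ^ m)=(\<Sum>m<n. poly (a m) (j z) * f z ^ m)"
 using z by (simp add:a)
 finally show ?thesis by (simp add:add.commute)
 qed
 define d where "d=(\<Sum>m<n. Polynomial.degree (a m))"
 have d:"Polynomial.degree (a m)\<le>d" if "m<n" for m
 unfolding d_def using that by (intro member_le_sum) auto
 define I where "I={..<n} \<times> {..d}"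
 define S where "S=(%(m,i). J ^ i * F ^ m)"
 have expand:"(\<Sum>m<n. poly (p m) y * x ^ m)=(\<Sum>(m,i)\<in>I. Polynomial.coeff (p m) i*(y ^ i * x ^ m))"
 if "!!m. m<n==>Polynomial.degree (p m)\<le>d" for p::"nat => complex poly" and x y
 proof -
 have "poly (p m) y=(\<Sum>i\<le>d. Polynomial.coeff (p m) i * y ^ i)" if "m<n" for m
 using poly_eq_sum_le[of "p m" d y] \<open>!!m. m<n==>Polynomial.degree (p m)\<le>d\<close>[OF that] by simp
 thus ?thesis unfolding I_def by (simp add:sum.cartesian_product[symmetric] sum_distrib_right mult.assoc)
 qed
 have qexp:"has_qexp l (%z. \<Sum>(m,i)\<in>I. c (m,i)*(j z ^ i * f z ^ m)) (\<Sum>x\<in>I. fls_const (c x) * S x)" for c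
 unfolding S_def case_prod_unfold prod.collapse
 by (intro has_qexp_sum has_qexp_mult has_qexp_power has_qexp_const j f l)
 obtain \<pi>::"complex=>rat" where \<pi>: "!!x y. \<pi> (x+y)=\<pi> x+\<pi> y" "!!r x. \<pi> (of_rat r * x)=r*\<pi> x"
 "!!r. \<pi> (of_rat r)=r" using rational_projection by blast
 have "has_qexp l (%z. - (f z ^ n)) (\<Sum>x\<in>I. fls_const (Polynomial.coeff (a (fst x)) (snd x)) * S x)"
 proof (rule has_qexp_cong[OF l qexp])
 show "eventually (%z. (\<Sum>(m,i)\<in>I. Polynomial.coeff (a (fst (m,i))) (snd (m,i))*(j z ^ i * f z ^ m))
 = - (f z ^ n)) at_cusp"
 using eventually_at_cusp_uhp
 proof eventually_elim
 case (elim z)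
 thus ?case using rel[OF elim] expand[of a "j z" "f z"] d by (simp add:eq_neg_iff_add_eq_0 add.commute)
 qed
 qed
 moreover have "has_qexp l (%z. - (f z ^ n)) (- (F ^ n))"
 by (intro has_qexp_uminus has_qexp_power l f)
 ultimately have eqF: "- (F ^ n)=(\<Sum>x\<in>I. fls_const (Polynomial.coeff (a (fst x)) (snd x)) * S x)"
 using has_qexp_unique[OF l] by blast
 have ratF: "coeffs_in \<rat> (- (F ^ n))"
 using coeffs_in_Rats_power[OF f(3),of n] by (auto simp:coeffs_in_def)
 have ratS: "coeffs_in \<rat> (S x)" for x
 unfolding S_def case_prod_unfold by (intro coeffs_in_Rats_mult coeffs_in_Rats_power f J)
 \<comment> \<open>The relation over C, read as an identity of rational Laurent series, survives the
   projection of its coefficients to the rationals. \<open>zero_of_qexp_0\<close> turns it back into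
   an identity of functions.\<close>
 have rat:"- (F ^ n)=(\<Sum>x\<in>I. fls_const (of_rat (\<pi> (Polynomial.coeff (a (fst x)) (snd x)))) * S x)"
 by (rule rational_linear_relation[OF \<pi> ratS ratF eqF])
 define b where "b=(%m. \<Sum>i\<le>d. Polynomial.monom (\<pi> (Polynomial.coeff (a m) i)) i)"
 have b_coeff:"Polynomial.coeff (b m) i=(if i\<le>d then \<pi> (Polynomial.coeff (a m) i) else 0)" for m i
 by (simp add:b_def coeff_sum)
 have b_deg:"Polynomial.degree (map_poly of_rat (b m)::complex poly)\<le>d" for m
 by (rule degree_le) (simp add:coeff_map_poly b_coeff)
 show ?thesis
 proof (rule integral_over_mero[OF j_hol hol])
 fix z assume z:"z\<in>uhp"
 define g where "g=(%z. f z ^ n+(\<Sum>m<n. poly (map_poly of_rat (b m)) (j z) * f z ^ m))"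
 have g:"g z=f z ^ n+(\<Sum>(m,i)\<in>I. of_rat (\<pi> (Polynomial.coeff (a (fst (m,i))) (snd (m,i))))*(j z ^ i * f z ^ m))" for z
 unfolding g_def by (subst expand[OF b_deg]) (auto simp:I_def coeff_map_poly b_coeff intro!: sum.cong)
 have "has_qexp l g (F ^ n+(\<Sum>x\<in>I. fls_const (of_rat (\<pi> (Polynomial.coeff (a (fst x)) (snd x)))) * S x))"
 unfolding g by (intro has_qexp_add has_qexp_power l f qexp[where c = "%x. of_rat (\<pi> (Polynomial.coeff (a (fst x)) (snd x)))"])
 hence "has_qexp l g 0" unfolding rat[symmetric] by simp
 moreover have "g holomorphic_on uhp"
 unfolding g_def by (intro holomorphic_intros holomorphic_poly_compose j_hol hol)
 ultimately show "g z=0" using zero_of_qexp_0[OF l] z by blast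
 qed
qed
end

section \<open>Lagrange interpolation in a primitive element\<close>

context level_one_generator
begin
lemma conj_poly_div:
 assumes "sg \<in> R"
 shows "synthetic_div (conj_poly R f z) (f (moebius sg z))=(\<Prod>sg'\<in>R-{sg}. [:- f (moebius sg' z),1:])"
proof -
 define q where "q=(\<Prod>sg'\<in>R-{sg}. [:- f (moebius sg' z),1:])"
 have "conj_poly R f z = [:- f (moebius sg z),1:] * q"
 unfolding conj_poly_def q_def using assms R_fin by (rule prod.remove[rotated])
 hence "conj_poly R f z+Polynomial.smult (f (moebius sg z)) q=pCons 0 q" by simp
 from synthetic_div_unique[OF this] show ?thesis by (simp add:q_def)
qed

lemma conj_poly_root:"sg \<in> R==>poly (conj_poly R f z) (f (moebius sg z))=0"
 unfolding conj_poly_def poly_prod using R_fin by (intro prod_zero bexI[of _ sg]) auto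

lemma poly_synthetic_div_root:
 fixes v h0::complex
 assumes "poly P v=0" "poly P h0=0"
 shows "poly (synthetic_div P v) h0=(if v=h0 then poly (pderiv P) h0 else 0)"
proof -
 have P: "P = [:- v,1:] * synthetic_div P v" using synthetic_div_correct'[of v P] assms by simp
 show ?thesis
 proof (cases "v=h0")
 case True
 have "poly (pderiv P) h0=poly (pderiv ([:- v,1:] * synthetic_div P v)) h0" using P by simp
 also have "...=poly (synthetic_div P v) h0" by (simp only:pderiv_mult poly_add poly_mult) (simp add:pderiv_pCons True)
 finally show ?thesis using True by simp
 next
 case False
 have "poly ([:- v,1:] * synthetic_div P v) h0=0" using P assms(2) by simp
 thus ?thesis using False by simp
 qed
qed

text \<open>Lagrange's interpolation polynomial without denominators: at a simple root given by a
  conjugate of h it takes the value of the same conjugate of f times the derivative of the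
  characteristic polynomial.\<close>

definition interp_poly::"(complex => complex)=>(complex => complex) => complex => complex poly" where
 "interp_poly f h z=(\<Sum>sg\<in>R. Polynomial.smult (f (moebius sg z)) (synthetic_div (conj_poly R h z) (h (moebius sg z))))"

text \<open>All summands except the one of the identity class contain a vanishing cofactor. Where
  conjugates of h collide, \<open>sep\<close> makes the derivative, and thus both sides,
  vanish.\<close>

lemma interp_poly_eval:
 assumes f:"Gamma_inv l f" and h:"Gamma_inv l h" and z:"z\<in>uhp"
 and sep:"!!sg sg'. sg \<in> R ==> sg' \<in> R ==> sg ~= sg'==>h (moebius sg z)=h (moebius sg' z) ==>
 poly (pderiv (conj_poly R h z)) (h (moebius sg z))=0"
 shows "poly (interp_poly f h z) (h z)=f z * poly (pderiv (conj_poly R h z)) (h z)"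
proof -
 obtain sg where sg:"sg \<in> R" "f (moebius sg z)=f z" "h (moebius sg z)=h z"
 using conj_root[OF f h z] by blast
 let ?P = "conj_poly R h z"
 have r0:"poly ?P (h z)=0" using conj_poly_root[OF sg(1),of h z] sg(3) by simp
 have "poly (interp_poly f h z) (h z) =
 (\<Sum>sg'\<in>R. f (moebius sg' z)*(if h (moebius sg' z)=h z then poly (pderiv ?P) (h z) else 0))"
 unfolding interp_poly_def poly_sum poly_smult
 by (intro sum.cong refl) (simp add:poly_synthetic_div_root[OF conj_poly_root r0])
 also have "...=(\<Sum>sg'\<in>R. if sg' = sg then f z * poly (pderiv ?P) (h z) else 0)"
 proof -
 have "poly (pderiv ?P) (h z)=0" if "x \<in> R" "x ~= sg" "h (moebius x z)=h z" for x
 using sep[OF sg(1) that(1)] that sg(3) by metis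
 thus ?thesis using sg by (intro sum.cong refl) auto
 qed
 also have "...=f z * poly (pderiv ?P) (h z)" using sg(1) R_fin by simp
 finally show ?thesis .
qed

lemma conj_poly_double_root:
 assumes "sg \<in> R" "sg' \<in> R" "sg ~= sg'" "h (moebius sg z)=h (moebius sg' z)"
 shows "poly (pderiv (conj_poly R h z)) (h (moebius sg z))=0"
proof -
 have "poly (pderiv (conj_poly R h z)) (h (moebius sg z)) =
 poly (synthetic_div (conj_poly R h z) (h (moebius sg z))) (h (moebius sg z))"
 using poly_synthetic_div_root[OF conj_poly_root conj_poly_root,OF assms(1) assms(1)] by simp
 also have "...=0"
 unfolding conj_poly_div[OF assms(1)] poly_prod using assms R_fin
 by (intro prod_zero bexI[of _ sg']) auto
 finally show ?thesis .
qed

text \<open>By \<open>stab\<close> the conjugates of h are pairwise different functions. Their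
  differences are nonzero elements of a field, so the product of the differences is not the zero
  function.\<close>

lemma separating_point:
 assumes h:"modular_hol l h"
 and stab:"!!gg. gg\<in>SL2Z==>(!!z. z\<in>uhp==>h (moebius gg z)=h z) ==> cong_pm l gg (mat 1)"
 obtains z where "z\<in>uhp" "inj_on (%sg. h (moebius sg z)) R"
proof -
 define d where "d=(%p::(int^2^2) \<times> (int^2^2). %z. h (moebius (fst p) z)-h (moebius (snd p) z))"
 define I where "I={p \<in> R \<times> R. fst p ~= snd p}"
 have fin:"finite I" using R_fin by (auto simp:I_def intro:finite_subset[of _ "R \<times> R"])
 have hol:"d p holomorphic_on uhp" if "p\<in>I" for p
 using h that R_sub unfolding d_def modular_hol_def qhol_def I_def
 by (intro holomorphic_on_diff) auto
 have "mero (d p)~=0" if p:"p\<in>I" for p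
 proof
 assume "mero (d p)=0"
 hence "\<forall>z\<in>uhp. d p z=0"
 unfolding zero_mero_uhp_def using hol[OF p] by (subst (asm) mero_eq_iff) auto
 hence eq:"h (moebius (fst p) z)=h (moebius (snd p) z)" if "z\<in>uhp" for z
 using that by (auto simp:d_def)
 have S: "fst p\<in>SL2Z" "snd p\<in>SL2Z" using p R_sub by (auto simp:I_def)
 have "h (moebius (fst p ** minv (snd p)) z)=h z" if z:"z\<in>uhp" for z
 using eq[of "moebius (minv (snd p)) z"] S z moebius_in_uhp[OF minv_in_SL2Z[OF S(2)] z]
 by (simp add:moebius_mult minv_in_SL2Z uhp_def)
 hence "cong_pm l (fst p ** minv (snd p)) (mat 1)"
 using S by (intro stab SL2Z_mult minv_in_SL2Z)
 from cong_pm_mult_right[OF this,of "snd p"]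
 have "cong_pm l (fst p) (snd p)" by (simp add:matrix_mul_assoc[symmetric] minv_mult S)
 moreover have "fst p \<in> R" "snd p \<in> R" "fst p ~= snd p" using p by (auto simp:I_def)
 ultimately show False using R S cong_pm_refl unfolding reps_def by blast
 qed
 hence "(\<Prod>p\<in>I. mero (d p))~=0" using fin by simp
 hence "mero (%z. \<Prod>p\<in>I. d p z)~=mero (%_. 0)"
 using hol by (simp add:mero_prod zero_mero_uhp_def)
 hence "~ (\<forall>z\<in>uhp. (\<Prod>p\<in>I. d p z)=0)"
 using hol by (subst (asm) mero_eq_iff) (auto intro!: holomorphic_on_prod)
 then obtain z where z:"z\<in>uhp" "(\<Prod>p\<in>I. d p z)~=0" by blast
 hence "d p z~=0" if "p\<in>I" for p using that fin by auto
 hence "inj_on (%sg. h (moebius sg z)) R"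
 by (intro inj_onI) (force simp:I_def d_def)
 with z(1) show thesis using that by blast
qed

lemma level_one_coeffs':
 assumes "qhol_poly l p" "!!gg z. gg\<in>SL2Z==>z\<in>uhp==>p (moebius gg z)=p z"
 "!!z. Polynomial.degree (p z)<n"
 shows "EX d c. \<forall>z\<in>uhp. ALL x. poly (p z) x=(\<Sum>(m,i)\<in>{..<n}\<times>{..d::nat}. c m i*(j z ^ i * x ^ m)) &
 (ALL m. Polynomial.coeff (p z) m=(\<Sum>i\<le>d. if m<n then c m i * j z ^ i else 0))"
proof -
 obtain a where a:"!!m z. z\<in>uhp==>Polynomial.coeff (p z) m=poly (a m) (j z)"
 using level_one_coeffs[OF assms(1,2)] by blast
 define d where "d=(\<Sum>m<n. Polynomial.degree (a m))"
 have d:"Polynomial.degree (a m)\<le>d" if "m<n" for m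
 unfolding d_def using that by (intro member_le_sum) auto
 have c:"Polynomial.coeff (p z) m=(\<Sum>i\<le>d. if m<n then Polynomial.coeff (a m) i * j z ^ i else 0)"
 if "z\<in>uhp" for z m
 proof (cases "m<n")
 case True
 thus ?thesis using a[OF that] poly_eq_sum_le[OF d[OF True],of "j z"] by simp
 next
 case False
 thus ?thesis using assms(3)[of z] by (simp add:coeff_eq_0)
 qed
 have "poly (p z) x=(\<Sum>(m,i)\<in>{..<n}\<times>{..d}. Polynomial.coeff (a m) i*(j z ^ i * x ^ m))"
 if "z\<in>uhp" for z x
 proof -
 have "n > 0" using assms(3)[of z] by simp
 have "poly (p z) x=(\<Sum>m\<le>n-1. Polynomial.coeff (p z) m * x ^ m)"
 using assms(3)[of z] by (intro poly_eq_sum_le) simp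
 also have "{..n-1}={..<n}" using \<open>n > 0\<close> by auto
 finally show ?thesis
 using c[OF that] by (simp add:sum.cartesian_product[symmetric] sum_distrib_right mult.assoc)
 qed
 with c show ?thesis by (intro exI[of _ d] exI[of _ "%m. Polynomial.coeff (a m)"]) auto
qed

text \<open>
 Lagrange interpolation in a primitive element \<open>h\<close> over the field of functions of level one
 expresses \<open>f\<close> as a quotient of two series with bounded denominators.
\<close>

theorem qexp_fraction:
 assumes h:"modular_hol l h" "has_qexp l h H" "coeffs_in \<int> H"
 and stab:"!!gg. gg\<in>SL2Z==>(!!z. z\<in>uhp==>h (moebius gg z)=h z) ==> cong_pm l gg (mat 1)"
 and f:"modular_hol l f" "has_qexp l f F" "coeffs_in \<rat> F" and J: "coeffs_in \<int> J"
 shows "EX D N. coeffs_in \<int> D & coeffs_in \<int> N&D~=0&D * F=N"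
proof -
 define n where "n = card R"
 have finv:"Gamma_inv l f" and hinv:"Gamma_inv l h" and fhol:"f holomorphic_on uhp" and hhol:"h holomorphic_on uhp"
 using f(1) h(1) modular_hol_qhol[OF f(1)] modular_hol_qhol[OF h(1)] by (auto simp:modular_hol_def qhol_def)
 have n:"n > 0"
 using R mat1_in_SL2Z R_fin unfolding n_def reps_def by (metis card_gt_0_iff empty_iff)
 define A where "A=(%z. pderiv (conj_poly R h z))"
 define B where "B=interp_poly f h"
 have Adeg:"Polynomial.degree (A z)<n" for z
 using n by (simp add:A_def degree_pderiv conj_poly_degree n_def)
 have Bdeg:"Polynomial.degree (B z)<n" for z
 proof -
 have "Polynomial.degree (Polynomial.smult (f (moebius sg z)) (synthetic_div (conj_poly R h z) (h (moebius sg z))))\<le>n-1" for sg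
 using degree_smult_le[of "f (moebius sg z)" "synthetic_div (conj_poly R h z) (h (moebius sg z))"]
 by (simp add:degree_synthetic_div conj_poly_degree n_def)
 hence "Polynomial.degree (B z)\<le>n-1" unfolding B_def interp_poly_def by (intro degree_sum_le R_fin)
 thus ?thesis using n by simp
 qed
 have Ainv:"A (moebius gg z)=A z" if "gg\<in>SL2Z" "z\<in>uhp" for gg z
 using conj_poly_invariant[OF hinv that] by (simp add:A_def)
 have Binv:"B (moebius gg z)=B z" if "gg\<in>SL2Z" "z\<in>uhp" for gg z
 unfolding B_def interp_poly_def conj_poly_invariant[OF hinv that]
 using reps_prod_invariant(2)[OF R that(1) finv hinv that(2),
 of "%u v. Polynomial.smult u (synthetic_div (conj_poly R h z) v)"] .
 have Aq:"qhol_poly l A"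
 using qhol_conj_poly[OF h(1)]
 by (auto simp:A_def qhol_poly_def coeff_pderiv intro!: qhol_mult qhol_const l)
 have Bq:"qhol_poly l B"
 proof -
 have "B=(%z. \<Sum>sg\<in>R. Polynomial.smult (f (moebius sg z)) (\<Prod>sg'\<in>R-{sg}. [:- h (moebius sg' z),1:]))"
 by (simp add:B_def interp_poly_def conj_poly_div fun_eq_iff)
 thus ?thesis using R_sub f(1) h(1)
 by (auto simp:modular_hol_def intro!: qhol_poly_sum_smult qhol_poly_prod qhol_poly_linear l)
 qed
 have rel:"f z * poly (A z) (h z)=poly (B z) (h z)" if "z\<in>uhp" for z
 unfolding A_def B_def
 by (rule interp_poly_eval[OF finv hinv that conj_poly_double_root,symmetric])
 obtain dA cA where A: "!!z x. z\<in>uhp==>poly (A z) x=(\<Sum>(m,i)\<in>{..<n}\<times>{..dA::nat}. cA m i*(j z ^ i * x ^ m))"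
 "!!z m. z\<in>uhp==>Polynomial.coeff (A z) m=(\<Sum>i\<le>dA. if m<n then cA m i * j z ^ i else 0)"
 using level_one_coeffs'[OF Aq Ainv Adeg] by blast
 obtain dB cB where B: "!!z x. z\<in>uhp==>poly (B z) x=(\<Sum>(m,i)\<in>{..<n}\<times>{..dB::nat}. cB m i*(j z ^ i * x ^ m))"
 using level_one_coeffs'[OF Bq Binv Bdeg] by blast
 text \<open>The coefficient of \<open>X\<^sup>n\<^sup>-\<^sup>1\<close> in the derivative is the constant \<open>n\<close>; normalising it keeps it fixed
 under the projection to \<open>\<rat>\<close>.\<close>
 define cA' where "cA'=(%m i. if m=n-1 then (if i=0 then of_nat n else 0) else cA m i)"
 have A':"poly (A z) x=(\<Sum>(m,i)\<in>{..<n}\<times>{..dA}. cA' m i*(j z ^ i * x ^ m))" if z:"z\<in>uhp" for z x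
 proof -
 have "(\<Sum>i\<le>dA. cA m i*(j z ^ i * x ^ m))=(\<Sum>i\<le>dA. cA' m i*(j z ^ i * x ^ m))" if m:"m<n" for m
 proof (cases "m=n-1")
 case True
 have "(\<Sum>i\<le>dA. cA m i * j z ^ i)=Polynomial.coeff (A z) m" using A(2)[OF z,of m] m by simp
 also have "... = of_nat n"
 using conj_poly_monic[of h z] n True by (simp add:A_def coeff_pderiv n_def)
 finally have 1:"(\<Sum>i\<le>dA. cA m i * j z ^ i) = of_nat n" .
 have "(\<Sum>i\<le>dA. cA' m i * j z ^ i)=(\<Sum>i\<le>dA. if i=0 then of_nat n else 0)"
 using True by (intro sum.cong) (auto simp:cA'_def)
 hence 2:"(\<Sum>i\<le>dA. cA' m i * j z ^ i) = of_nat n" by simp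
 have "(\<Sum>i\<le>dA. cA m i*(j z ^ i * x ^ m))=(\<Sum>i\<le>dA. cA m i * j z ^ i) * x ^ m"
 by (simp add:sum_distrib_right mult.assoc)
 also have "...=(\<Sum>i\<le>dA. cA' m i*(j z ^ i * x ^ m))"
 unfolding 1 2[symmetric] by (simp add:sum_distrib_right mult.assoc)
 finally show ?thesis .
 qed (simp add:cA'_def)
 thus ?thesis unfolding A(1)[OF z] by (simp add:sum.cartesian_product[symmetric])
 qed
 define IA where "IA={..<n} \<times> {..dA}"
 define IB where "IB={..<n} \<times> {..dB}"
 define S where "S=(%x. J ^ snd x * H ^ fst x)"
 define s where "s=(%x z. j z ^ snd x * h z ^ fst x)"
 have s:"has_qexp l (s x) (S x)" for x
 unfolding s_def S_def by (intro has_qexp_mult has_qexp_power j h l)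
 have S_int:"coeffs_in \<int> (S x)" for x
 unfolding S_def by (intro coeffs_in_Ints_mult coeffs_in_Ints_power h J)
 obtain \<pi>::"complex=>rat" where \<pi>: "!!x y. \<pi> (x+y)=\<pi> x+\<pi> y" "!!r x. \<pi> (of_rat r * x)=r*\<pi> x"
 "!!r. \<pi> (of_rat r)=r" using rational_projection by blast
 have \<pi>_nat:"\<pi> (of_nat n) = of_nat n" "\<pi> 0=0" using \<pi>(3)[of "of_nat n"] \<pi>(3)[of 0] by simp_all
 have \<pi>_minus:"\<pi> (- x) = - \<pi> x" for x using \<pi>(1)[of x "- x"] \<pi>_nat by simp
 define a where "a=(%x. cA' (fst x) (snd x))"
 define b where "b=(%x. cB (fst x) (snd x))"
 define D where "D=(\<Sum>x\<in>IA. fls_const (of_rat (\<pi> (a x))) * S x)"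
 define N where "N=(\<Sum>x\<in>IB. fls_const (of_rat (\<pi> (b x))) * S x)"
 have "F * (\<Sum>x\<in>IA. fls_const (a x) * S x)=(\<Sum>x\<in>IB. fls_const (b x) * S x)"
 proof (rule has_qexp_unique[OF l])
 show "has_qexp l (%z. f z * (\<Sum>x\<in>IA. a x * s x z)) (F * (\<Sum>x\<in>IA. fls_const (a x) * S x))"
 by (intro has_qexp_mult has_qexp_sum has_qexp_const s f l)
 have "has_qexp l (%z. \<Sum>x\<in>IB. b x * s x z) (\<Sum>x\<in>IB. fls_const (b x) * S x)"
 by (intro has_qexp_mult has_qexp_sum has_qexp_const s l)
 thus "has_qexp l (%z. f z * (\<Sum>x\<in>IA. a x * s x z)) (\<Sum>x\<in>IB. fls_const (b x) * S x)"
 proof (rule has_qexp_cong[OF l])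
 show "eventually (%z. (\<Sum>x\<in>IB. b x * s x z)=f z * (\<Sum>x\<in>IA. a x * s x z)) at_cusp"
 using eventually_at_cusp_uhp
 by eventually_elim
 (use rel A' B in \<open>simp add:IA_def IB_def a_def b_def s_def case_prod_unfold\<close>)
 qed
 qed
 hence "0=(\<Sum>x\<in>IA. fls_const (a x)*(F * S x))+(\<Sum>x\<in>IB. fls_const (- b x) * S x)"
 by (simp add:sum_distrib_left mult_ac sum_negf fls_const_uminus)
 also have "...=(\<Sum>x\<in>IA <+> IB. fls_const (case_sum a (%x. - b x) x) * case_sum (%x. F * S x) S x)"
 by (subst sum.Plus) (auto simp:IA_def IB_def)
 finally have 0:"0=(\<Sum>x\<in>IA <+> IB. fls_const (case_sum a (%x. - b x) x) * case_sum (%x. F * S x) S x)" .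
 have "coeffs_in \<rat> (case_sum (%x. F * S x) S x)" for x
 using coeffs_in_Rats_mult[OF f(3) coeffs_in_Ints_imp_Rats[OF S_int]] coeffs_in_Ints_imp_Rats[OF S_int]
 by (cases x) auto
 from rational_linear_relation[OF \<pi> this _ 0]
 have "0=(\<Sum>x\<in>IA <+> IB. fls_const (of_rat (\<pi> (case_sum a (%x. - b x) x))) * case_sum (%x. F * S x) S x)"
 by (simp add:coeffs_in_def)
 also have "...=(\<Sum>x\<in>IA. fls_const (of_rat (\<pi> (a x)))*(F * S x))+(\<Sum>x\<in>IB. fls_const (of_rat (\<pi> (- b x))) * S x)"
 by (subst sum.Plus) (auto simp:IA_def IB_def)
 also have "...=D * F-N"
 by (simp add:D_def N_def sum_distrib_left sum_distrib_right \<pi>_minus of_rat_minus sum_negf mult_ac fls_const_uminus)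
 finally have DFN: "D * F=N" by simp
 \<comment> \<open>At a separating point the conjugates of h would be n distinct roots of a
   polynomial of degree at most n-1. It is nonzero because its coefficient of X^(n-1) is the integer
   n, which the projection fixes.\<close>
 have "D~=0"
 proof
 assume "D=0"
 define d where "d=(%z. \<Sum>x\<in>IA. of_rat (\<pi> (a x)) * s x z)"
 have "has_qexp l d D"
 unfolding d_def D_def by (intro has_qexp_mult has_qexp_sum has_qexp_const s l)
 moreover have "d holomorphic_on uhp"
 unfolding d_def s_def by (intro holomorphic_intros j_hol hhol)
 ultimately have d0:"d z=0" if "z\<in>uhp" for z using zero_of_qexp_0[OF l] that \<open>D=0\<close> by blast
 obtain z where z:"z\<in>uhp" "inj_on (%sg. h (moebius sg z)) R" using separating_point[OF h(1) stab] by blast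
 define p where "p=(\<Sum>x\<in>IA. Polynomial.monom (of_rat (\<pi> (a x)) * j z ^ snd x) (fst x))"
 have "Polynomial.coeff p (n-1)=(\<Sum>x\<in>IA. if x=(n-1,0) then of_nat n else 0)"
 unfolding p_def coeff_sum using n
 by (intro sum.cong refl) (auto simp:a_def cA'_def IA_def \<pi>_nat split:if_splits)
 also have "... = of_nat n" using n by (subst sum.delta) (auto simp:IA_def)
 finally have "p~=0" using n by auto
 have root:"poly p (h (moebius sg z))=0" if "sg \<in> R" for sg
 proof -
 have "sg\<in>SL2Z" using that R_sub by blast
 hence "d (moebius sg z)=0" "j (moebius sg z)=j z"
 using d0 moebius_in_uhp z(1) j(1) by (auto simp:level_one_def)
 thus ?thesis by (simp add:d_def s_def p_def poly_sum poly_monom mult_ac)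
 qed
 have "n = card ((%sg. h (moebius sg z)) ` R)" using z(2) by (simp add:card_image n_def)
 also have "... \<le> card {x. poly p x=0}"
 using root poly_roots_finite[OF \<open>p~=0\<close>] by (intro card_mono) auto
 also have "...\<le>Polynomial.degree p" by (rule card_poly_roots_bound[OF \<open>p~=0\<close>])
 also have "...\<le>n-1"
 unfolding p_def
 by (intro degree_sum_le order.trans[OF degree_monom_le]) (auto simp:IA_def)
 finally show False using n by simp
 qed
 obtain M1 M2::nat where M: "M1 > 0" "coeffs_in \<int> (fls_const (of_nat M1) * D)"
 "M2 > 0" "coeffs_in \<int> (fls_const (of_nat M2) * N)"
 unfolding D_def N_def
 using common_denominator[of IA S "%x. \<pi> (a x)"] common_denominator[of IB S "%x. \<pi> (b x)"] S_int
 by (auto simp:IA_def IB_def)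
 have nat_int:"coeffs_in \<int> (fls_const (of_nat M))" for M by (auto simp:coeffs_in_def)
 show ?thesis
 proof (intro exI conjI)
 show "coeffs_in \<int> (fls_const (of_nat M2)*(fls_const (of_nat M1) * D))"
 by (intro coeffs_in_Ints_mult nat_int M)
 show "coeffs_in \<int> (fls_const (of_nat M1)*(fls_const (of_nat M2) * N))"
 by (intro coeffs_in_Ints_mult nat_int M)
 show "fls_const (of_nat M2)*(fls_const (of_nat M1) * D)~=0"
 using \<open>D~=0\<close> M by simp
 show "fls_const (of_nat M2)*(fls_const (of_nat M1) * D) * F=fls_const (of_nat M1)*(fls_const (of_nat M2) * N)"
 by (simp add:DFN[symmetric] mult_ac)
 qed
qed
end

subsection \<open>The Lipschitz formula\<close>

text \<open>The polylogarithm of order -p for p > 0; for p = 0 the term n = 0 counts, giving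
  1/(1-w). The operator w d/dw raises p by one.\<close>

definition power_lambert::"nat => complex => complex" where
 "power_lambert p w = suminf (%n. of_nat n ^ p * w ^ n)"

lemma summable_power_lambert:
 fixes w::"'a::{real_normed_field,banach}"
 assumes "norm w<1"
 shows "summable (%n. of_nat n ^ p * w ^ n)"
proof -
 have "summable (%n. norm (of_nat n ^ p * w ^ n))"
 using assms
 proof (induction p arbitrary:w)
 case 0
 thus ?case by (simp add:norm_power summable_geometric)
 next
 case (Suc p)
 obtain r where r:"norm w<r" "r<1" using Suc.prems dense by blast
 hence r0:"r > 0" using norm_ge_zero[of w] by linarith
 have "summable (%n. real n ^ p * r ^ n)"
 proof -
 have "norm (of_real r::'a)<1" using r r0 by simp
 from Suc.IH[OF this] show ?thesis using r0 by (simp add:norm_mult norm_power)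
 qed
 moreover have "eventually (%n. norm (norm (of_nat n ^ Suc p * w ^ n))\<le>real n ^ p * r ^ n) sequentially"
 proof -
 define s where "s=norm w/r"
 have s:"0 \<le> s" "s<1" using r r0 by (auto simp:s_def)
 have "(%n. of_nat n * s ^ n) \<longlonglongrightarrow> 0" using s by (intro powser_times_n_limit_0) auto
 hence "eventually (%n. real n * s ^ n<1) sequentially" by (rule order_tendstoD) simp
 thus ?thesis
 proof eventually_elim
 case (elim n)
 have "norm (of_nat n ^ Suc p * w ^ n)=real n ^ p * r ^ n*(real n * s ^ n)"
 using r0 by (simp add:norm_mult norm_power s_def power_divide)
 also have "...\<le>real n ^ p * r ^ n*1" using elim r0 by (intro mult_left_mono) auto
 finally show ?case by simp
 qed
 qed
 ultimately show ?case by (rule summable_comparison_test_ev[rotated])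
 qed
 thus ?thesis by (rule summable_norm_cancel)
qed

lemma power_lambert_deriv:
 assumes "norm w<1"
 shows "EX D. (power_lambert p has_field_derivative D) (at w)&w * D=power_lambert (Suc p) w"
proof -
 define c where "c=(%n. of_nat n ^ p::complex)"
 have sm:"!!x. norm x<1 ==> summable (%n. c n * x ^ n)" unfolding c_def by (rule summable_power_lambert)
 have 1:"((%x. suminf (%n. c n * x ^ n)) has_field_derivative suminf (%n. diffs c n * w ^ n)) (at w)"
 using termdiffs_strong_converges_everywhere termdiffs_strong' assms sm
 by (intro termdiffs_strong'[of 1]) auto
 have "(%n. diffs c n * w ^ n) sums suminf (%n. diffs c n * w ^ n)"
 using termdiff_converges[OF assms sm] by (simp add:summable_sums)
 hence "(%n. w * (diffs c n * w ^ n)) sums (w * suminf (%n. diffs c n * w ^ n))" by (rule sums_mult)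
 also have "(%n. w * (diffs c n * w ^ n))=(%n. of_nat (Suc n) ^ Suc p * w ^ Suc n)"
 by (simp add:diffs_def c_def fun_eq_iff mult_ac)
 finally have "(%n. of_nat n ^ Suc p * w ^ n) sums (w * suminf (%n. diffs c n * w ^ n))"
 by (subst (asm) sums_Suc_iff) simp
 thus ?thesis using 1 by (auto simp:power_lambert_def[abs_def] c_def sums_iff)
qed

lemma power_lambert_ee_deriv:
 assumes "Im z > 0"
 shows "((%z. power_lambert p (ee z)) has_field_derivative (2 * pi*\<i> * power_lambert (Suc p) (ee z))) (at z)"
proof -
 have "norm (ee z)<1" using assms by (simp add:norm_ee)
 then obtain D where D: "(power_lambert p has_field_derivative D) (at (ee z))" "ee z * D=power_lambert (Suc p) (ee z)"
 using power_lambert_deriv by blast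
 have "(ee has_field_derivative (2 * pi*\<i> * ee z)) (at z)"
 unfolding ee_def[abs_def] by (auto intro!: derivative_eq_intros)
 from DERIV_chain2[OF D(1) this] show ?thesis by (simp add:D(2)[symmetric] mult_ac)
qed

lemma power_lambert_0:
 assumes "norm w<1" shows "power_lambert 0 w=1/(1-w)"
 using suminf_geometric[OF assms] by (simp add:power_lambert_def)

lemma uhp_not_Ints:"Im z > 0==>z ~: \<int>\<^sub>\<le>\<^sub>0&1-z ~: \<int>\<^sub>\<le>\<^sub>0"
 by (auto elim!: nonpos_Ints_cases simp:complex_eq_iff)

lemma has_field_derivative_unique_on_uhp:
 assumes "!!z. Im z > 0==>f z=g z" "Im z > 0"
 "(f has_field_derivative a) (at z)" "(g has_field_derivative b) (at z)"
 shows "a=b"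
proof -
 have "eventually (%w. w\<in>uhp) (nhds z)"
 using open_uhp assms(2) by (intro eventually_nhds_in_open) (auto simp:uhp_def)
 hence "eventually (%w. f w=g w) (nhds z)"
 by eventually_elim (use assms(1) in \<open>simp add:uhp_def\<close>)
 hence "(g has_field_derivative a) (at z)"
 using assms(3) DERIV_cong_ev[of z z f g a a] by simp
 thus ?thesis using assms(4) DERIV_unique by blast
qed

text \<open>Differentiating 1/(Gamma(z) Gamma(1-z)) = sin(pi z)/pi gives pi cot(pi z), which is then
  written as a rational function of \<open>ee z\<close>.\<close>

lemma Digamma_reflection:
 assumes z:"Im z > 0"
 shows "Digamma (1-z)-Digamma z=pi*\<i> - 2 * pi*\<i> * power_lambert 0 (ee z)"
proof -
 have w:"norm (ee z)<1" using z by (simp add:norm_ee)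
 hence w1:"ee z~=1" by auto
 have n:"z ~: \<int>\<^sub>\<le>\<^sub>0" "1-z ~: \<int>\<^sub>\<le>\<^sub>0" using uhp_not_Ints[OF z] by auto
 have "((%z. rGamma z * rGamma (1-z)) has_field_derivative
 (- rGamma z * Digamma z) * rGamma (1-z)+(rGamma (1-z) * Digamma (1-z)) * rGamma z) (at z)"
 using n by (auto intro!: derivative_eq_intros)
 moreover have "((%z. sin (of_real pi * z) / of_real pi) has_field_derivative cos (of_real pi * z)) (at z)"
 by (auto intro!: derivative_eq_intros)
 ultimately have "(- rGamma z * Digamma z) * rGamma (1-z)+(rGamma (1-z) * Digamma (1-z)) * rGamma z
 = cos (of_real pi * z)"
 using rGamma_reflection_complex DERIV_unique by (metis (no_types,lifting) ext)
 hence 1:"(Digamma (1-z)-Digamma z)*(rGamma z * rGamma (1-z)) = cos (of_real pi * z)"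
 by (simp add:algebra_simps)
 define e where "e=exp (\<i>*(of_real pi * z))"
 have ee:"ee z=e^2" by (simp add:ee_def e_def exp_double[symmetric] mult_ac)
 have e0:"e~=0" by (simp add:e_def)
 have cs:"cos (of_real pi * z)=(e+inverse e)/2" "sin (of_real pi * z)=(e-inverse e)/(2*\<i>)"
 by (simp_all add:cos_exp_eq sin_exp_eq e_def exp_minus)
 have "(Digamma (1-z)-Digamma z)*((e-inverse e)/(2*\<i>) / of_real pi)=(e+inverse e)/2"
 using 1 unfolding rGamma_reflection_complex cs .
 moreover have "(Digamma (1-z)-Digamma z)*(e-inverse e) =
 (Digamma (1-z)-Digamma z)*((e-inverse e)/(2*\<i>) / of_real pi)*(2*\<i> * of_real pi)"
 proof -
 have c0:"2*\<i> * of_real pi~=0" by simp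
 show ?thesis
 by (simp only:divide_divide_eq_left times_divide_eq_right times_divide_eq_left
 nonzero_mult_div_cancel_right[OF c0])
 qed
 ultimately have "(Digamma (1-z)-Digamma z)*(e-inverse e)=(e+inverse e)/2*(2*\<i> * of_real pi)"
 by (simp only:)
 also have "...=pi*\<i>*(e+inverse e)" by simp
 finally have "(Digamma (1-z)-Digamma z)*(e-inverse e)=pi*\<i>*(e+inverse e)" .
 hence "(Digamma (1-z)-Digamma z)*(e-inverse e) * e=pi*\<i>*(e+inverse e) * e" by simp
 hence "(Digamma (1-z)-Digamma z)*(ee z-1)=pi*\<i>*(ee z+1)"
 using e0 by (simp add:ee power2_eq_square ring_distribs mult.assoc)
 hence "Digamma (1-z)-Digamma z=pi*\<i>*(ee z+1)/(ee z-1)"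
 using w1 by (simp add:eq_divide_eq)
 also have "...=pi*\<i> - 2 * pi*\<i>*(1/(1-ee z))"
 using w1 by (simp add:field_simps)
 finally show ?thesis using power_lambert_0[OF w] by simp
qed

text \<open>Repeated differentiation of \<open>Digamma_reflection\<close>: the left side passes to
  the next polygamma function, the right side acquires a factor 2 pi i and a larger p.\<close>

lemma Polygamma_reflection:
 assumes "Im z > 0"
 shows "(-1) ^ Suc n * Polygamma (Suc n) (1-z)-Polygamma (Suc n) z =
 - ((2 * pi*\<i>)^(n+2)) * power_lambert (Suc n) (ee z)"
 using assms
proof (induction n arbitrary:z)
 case 0
 have n:"z ~: \<int>\<^sub>\<le>\<^sub>0" "1-z ~: \<int>\<^sub>\<le>\<^sub>0" using uhp_not_Ints[OF 0] by auto
 have "((%z. Digamma (1-z)-Digamma z) has_field_derivative (- Polygamma 1 (1-z)-Polygamma 1 z)) (at z)"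
 using n by (auto intro!: derivative_eq_intros DERIV_chain2[OF has_field_derivative_Polygamma])
 moreover have "((%z. pi*\<i> - 2 * pi*\<i> * power_lambert 0 (ee z)) has_field_derivative
 (- (2 * pi*\<i>*(2 * pi*\<i> * power_lambert 1 (ee z))))) (at z)"
 by (auto intro!: derivative_eq_intros power_lambert_ee_deriv[OF 0])
 ultimately have "- Polygamma 1 (1-z)-Polygamma 1 z = - (2 * pi*\<i>*(2 * pi*\<i> * power_lambert 1 (ee z)))"
 by (rule has_field_derivative_unique_on_uhp[rotated 2]) (use Digamma_reflection 0 in auto)
 thus ?case by (simp add:power2_eq_square)
next
 case (Suc n)
 have n:"z ~: \<int>\<^sub>\<le>\<^sub>0" "1-z ~: \<int>\<^sub>\<le>\<^sub>0" using uhp_not_Ints[OF Suc.prems] by auto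
 have "((%z. (-1) ^ Suc n * Polygamma (Suc n) (1-z)-Polygamma (Suc n) z) has_field_derivative
 ((-1) ^ Suc n*(- Polygamma (Suc (Suc n)) (1-z))-Polygamma (Suc (Suc n)) z)) (at z)"
 using n by (auto intro!: derivative_eq_intros DERIV_chain2[OF has_field_derivative_Polygamma])
 moreover have "((%z. - ((2 * pi*\<i>)^(n+2)) * power_lambert (Suc n) (ee z)) has_field_derivative
 (- ((2 * pi*\<i>)^(n+2))*(2 * pi*\<i> * power_lambert (Suc (Suc n)) (ee z)))) (at z)"
 by (intro DERIV_cmult power_lambert_ee_deriv Suc.prems)
 ultimately have "(-1) ^ Suc n*(- Polygamma (Suc (Suc n)) (1-z))-Polygamma (Suc (Suc n)) z =
 - ((2 * pi*\<i>)^(n+2))*(2 * pi*\<i> * power_lambert (Suc (Suc n)) (ee z))"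
 by (rule has_field_derivative_unique_on_uhp[rotated 2]) (use Suc.IH Suc.prems in auto)
 thus ?case by (simp add:mult_ac)
qed

text \<open>The terms with m >= 0 and m < 0 are the series of the polygamma function at z and at 1 -
  z; for odd p the exponent p + 1 is even and the signs agree. Absolute convergence allows the
  unordered sum.\<close>

lemma has_sum_int_powers:
 fixes z::complex
 assumes z:"z ~: \<int>" and p:"odd p"
 shows "((%m::int. 1/(of_int m+z) ^ Suc p) has_sum
 (Polygamma p z+Polygamma p (1-z))/fact p) UNIV"
proof -
 have p0:"p > 0" using p by (auto intro:Nat.gr0I)
 have half:"((%k::nat. 1/(of_nat k+z) ^ Suc p) has_sum Polygamma p z/fact p) UNIV"
 if z:"z ~: \<int>" for z::complex
 proof (rule norm_summable_imp_has_sum)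
 have z0:"z~=0" using z by auto
 show "(%k::nat. 1/(of_nat k+z) ^ Suc p) sums (Polygamma p z/fact p)"
 using Polygamma_LIMSEQ[OF z0 p0] p by (simp add:field_simps)
 have "summable (%k. norm (inverse ((z + of_nat k) ^ Suc p)))"
 proof (rule summable_comparison_test_ev)
 show "summable (%k. 4 * inverse (real k^2))"
 by (intro summable_mult inverse_power_summable) auto
 have "eventually (%k. real k\<ge>2 * norm z+2) sequentially"
 by (intro eventually_compose_filterlim[OF eventually_ge_at_top filterlim_real_sequentially])
 thus "eventually (%k. norm (norm (inverse ((z + of_nat k) ^ Suc p)))\<le>4 * inverse (real k^2)) sequentially"
 proof eventually_elim
 case (elim k)
 have "real k=norm (z + of_nat k-z)" by simp
 also have "...\<le>norm (z + of_nat k)+norm z" by (rule norm_triangle_ineq4)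
 finally have ge:"norm (z + of_nat k)\<ge>real k/2" using elim by linarith
 have k2:"real k\<ge>2" using elim norm_ge_zero[of z] by linarith
 have "(real k/2)^2\<le>norm (z + of_nat k)^2" using ge by (intro power_mono) auto
 also have "...\<le>norm (z + of_nat k) ^ Suc p"
 using ge k2 p0 by (intro power_increasing) auto
 finally have "inverse (norm (z + of_nat k) ^ Suc p)\<le>inverse ((real k/2)^2)"
 using k2 by (intro le_imp_inverse_le) auto
 moreover have "norm (norm (inverse ((z + of_nat k) ^ Suc p)))=inverse (norm (z + of_nat k) ^ Suc p)"
 by (simp only:norm_inverse norm_power real_norm_def abs_norm_cancel abs_inverse abs_power_minus power_abs)
 moreover have "inverse ((real k/2)^2)=4 * inverse (real k^2)"
 by (simp add:power_divide inverse_eq_divide)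
 ultimately show ?case by (simp only:)
 qed
 qed
 thus "summable (%k. norm (1/(of_nat k+z) ^ Suc p))"
 by (simp only:inverse_eq_divide add.commute)
 qed
 have h1:"((%m::int. 1/(of_int m+z) ^ Suc p) has_sum Polygamma p z/fact p) {0..}"
 proof -
 have "bij_betw int UNIV {0..}" by (rule bij_betwI[of _ _ _ nat]) auto
 from has_sum_reindex_bij_betw[OF this,of "%m. 1/(of_int m+z) ^ Suc p"] half[OF z]
 show ?thesis by simp
 qed
 have h2:"((%m::int. 1/(of_int m+z) ^ Suc p) has_sum Polygamma p (1-z)/fact p) {..<0}"
 proof -
 have z':"1-z ~: \<int>" using z by (metis Ints_1 Ints_diff diff_diff_eq2 add_diff_cancel_left')
 have bij:"bij_betw (%k. - int k-1) UNIV {..<0}"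
 by (rule bij_betwI[of _ _ _ "%m. nat (- m-1)"]) auto
 have "1/(of_int (- int k-1)+z) ^ Suc p=1/(of_nat k+(1-z)) ^ Suc p" for k
 proof -
 have "of_int (- int k-1)+z = - (of_nat k+(1-z))" by simp
 hence "(of_int (- int k-1)+z) ^ Suc p=(of_nat k+(1-z)) ^ Suc p"
 proof -
 have "even (Suc p)" using p by simp
 thus ?thesis unfolding \<open>of_int (- int k-1)+z = - (of_nat k+(1-z))\<close> by (rule power_minus_even)
 qed
 thus ?thesis by simp
 qed
 thus ?thesis using has_sum_reindex_bij_betw[OF bij,of "%m. 1/(of_int m+z) ^ Suc p"] half[OF z']
 by simp
 qed
 have "{0..} \<union> {..<0}=(UNIV::int set)" by (rule UNIV_eq_I[symmetric],(simp only:Un_iff lessThan_iff atLeast_iff le_less_linear | (simp only:Un_iff lessThan_iff atLeast_iff,rule le_less_linear)))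
 moreover have "{0..} \<inter> {..<0}=({}::int set)"
 proof (rule equals0I)
 fix y::int assume y:"y\<in>{0..} \<inter> {..<0}"
 have "0\<le>y" by (rule atLeast_iff[THEN iffD1,OF IntD1[OF y]])
 moreover have "y<0" by (rule lessThan_iff[THEN iffD1,OF IntD2[OF y]])
 ultimately show False by linarith
 qed
 ultimately show ?thesis using has_sum_Un_disjoint[OF h1 h2] by (simp add:add_divide_distrib)
qed

lemma Lipschitz_formula:
 assumes z:"Im z > 0" and p:"odd p"
 shows "((%m::int. 1/(of_int m+z) ^ Suc p) has_sum ((2 * pi*\<i>) ^ Suc p/fact p * power_lambert p (ee z))) UNIV"
proof -
 obtain n where n:"p=Suc n" using p by (cases p) auto
 have "z ~: \<int>" using z by (auto elim!: Ints_cases)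
 moreover have "Polygamma p z+Polygamma p (1-z)=(2 * pi*\<i>) ^ Suc p * power_lambert p (ee z)"
 proof -
 have "Polygamma p z+Polygamma p (1-z) = - ((-1) ^ Suc n * Polygamma (Suc n) (1-z)-Polygamma (Suc n) z)"
 using p by (simp add:n)
 also have "...=(2 * pi*\<i>) ^ Suc p * power_lambert p (ee z)"
 unfolding Polygamma_reflection[OF z] by (simp add:n)
 finally show ?thesis .
 qed
 ultimately show ?thesis using has_sum_int_powers[of z p] p by simp
qed

section \<open>The zeta values at 4 and 6\<close>

lemma power_lambert_closed_step:
 assumes "!!w. norm w<1==>power_lambert p w=g w" "norm w<1" "(g has_field_derivative D) (at w)"
 shows "power_lambert (Suc p) w=w * D"
proof -
 obtain D' where D':"(power_lambert p has_field_derivative D') (at w)" "w * D'=power_lambert (Suc p) w"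
 using power_lambert_deriv[OF assms(2)] by blast
 have "eventually (%v. v\<in>ball 0 1) (nhds w)" using assms(2) by (intro eventually_nhds_in_open) auto
 hence "eventually (%v. power_lambert p v=g v) (nhds w)"
 by eventually_elim (use assms(1) in auto)
 hence "(g has_field_derivative D') (at w)"
 using D'(1) DERIV_cong_ev[of w w "power_lambert p" g D' D'] by simp
 hence "D'=D" using assms(3) DERIV_unique by blast
 thus ?thesis using D'(2) by simp
qed

text \<open>Iterating w d/dw from 1/(1-w); the numerators are w times the Eulerian
  polynomials.\<close>

lemma power_lambert_closed_forms:
 assumes "norm w<1"
 shows power_lambert_3:"power_lambert 3 w=w * (1+4 * w+w^2)/(1-w)^4"
 and power_lambert_5:"power_lambert 5 w=w * (1+26 * w+66 * w^2+26 * w^3+w^4)/(1-w)^6"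
proof -
 have nz:"1-w~=0" if "norm w<1" for w::complex using that by auto
 have 1:"power_lambert 1 w=w/(1-w)^2" if "norm w<1" for w
 proof -
 have "((%w. 1/(1-w)) has_field_derivative 1/(1-w)^2) (at w)"
 using nz[OF that] by (auto intro!: derivative_eq_intros simp:power2_eq_square)
 from power_lambert_closed_step[OF power_lambert_0 that this] show ?thesis by simp
 qed
 have 2:"power_lambert 2 w=w * (1+w)/(1-w)^3" if "norm w<1" for w
 proof -
 have "((%w. w/(1-w)^2) has_field_derivative (1+w)/(1-w)^3) (at w)"
 using nz[OF that] by (auto intro!: derivative_eq_intros simp:divide_simps) (simp add:algebra_simps power_numeral_reduce)
 from power_lambert_closed_step[OF 1 that this] show ?thesis by (simp add:numeral_2_eq_2)
 qed
 have 3:"power_lambert 3 w=w * (1+4 * w+w^2)/(1-w)^4" if "norm w<1" for w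
 proof -
 have "((%w. w * (1+w)/(1-w)^3) has_field_derivative (1+4 * w+w^2)/(1-w)^4) (at w)"
 using nz[OF that] by (auto intro!: derivative_eq_intros simp:divide_simps) (simp add:algebra_simps power_numeral_reduce)
 from power_lambert_closed_step[OF 2 that this] show ?thesis by (simp add:numeral_3_eq_3)
 qed
 have 4:"power_lambert 4 w=w * (1+11 * w+11 * w^2+w^3)/(1-w)^5" if "norm w<1" for w
 proof -
 have "((%w. w * (1+4 * w+w^2)/(1-w)^4) has_field_derivative
 (1+11 * w+11 * w^2+w^3)/(1-w)^5) (at w)"
 using nz[OF that] by (auto intro!: derivative_eq_intros simp:divide_simps) (simp add:algebra_simps power_numeral_reduce)
 from power_lambert_closed_step[OF 3 that this] show ?thesis by (simp add:numeral_eq_Suc)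
 qed
 have 5:"power_lambert 5 w=w * (1+26 * w+66 * w^2+26 * w^3+w^4)/(1-w)^6" if "norm w<1" for w
 proof -
 have "((%w. w * (1+11 * w+11 * w^2+w^3)/(1-w)^5) has_field_derivative
 (1+26 * w+66 * w^2+26 * w^3+w^4)/(1-w)^6) (at w)"
 using nz[OF that] by (auto intro!: derivative_eq_intros simp:divide_simps) (simp add:algebra_simps power_numeral_reduce)
 from power_lambert_closed_step[OF 4 that this] show ?thesis by (simp add:numeral_eq_Suc)
 qed
 show "power_lambert 3 w=w * (1+4 * w+w^2)/(1-w)^4" by (rule 3[OF assms])
 show "power_lambert 5 w=w * (1+26 * w+66 * w^2+26 * w^3+w^4)/(1-w)^6" by (rule 5[OF assms])
qed

text \<open>
 The values \<open>\<zeta>(4)\<close> and \<open>\<zeta>(6)\<close>: remove the pole from the Lipschitz formula and let \<open>z = it\<close> tend to \<open>0\<close>.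
\<close>
lemma Polygamma_1_limit:
 assumes p:"odd p"
 and lim:"((%t::real. Re ((2 * pi*\<i>) ^ Suc p * power_lambert p (of_real (exp (- 2 * pi * t))) -
 fact p/(\<i> * of_real t) ^ Suc p)) \<longlongrightarrow> L) (at_right 0)"
 shows "2 * Re (Polygamma p 1)=L"
proof -
 have c:"isCont (Polygamma p) (1::complex)"
 by (intro isCont_Polygamma continuous_ident) (auto elim!: nonpos_Ints_cases simp:complex_eq_iff)
 have 1:"((%t::real. \<i> * of_real t) \<longlongrightarrow> 0) (at_right 0)"
 by (auto intro!: tendsto_eq_intros)
 have "((%t::real. Re (Polygamma p (\<i> * of_real t+1)+Polygamma p (1-\<i> * of_real t))) \<longlongrightarrow>
 Re (Polygamma p 1+Polygamma p 1)) (at_right 0)"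
 by (intro tendsto_intros isCont_tendsto_compose[OF c]) (auto intro!: tendsto_eq_intros)
 moreover have "eventually (%t::real. Re (Polygamma p (\<i> * of_real t+1)+Polygamma p (1-\<i> * of_real t)) =
 Re ((2 * pi*\<i>) ^ Suc p * power_lambert p (of_real (exp (- 2 * pi * t)))-fact p/(\<i> * of_real t) ^ Suc p)) (at_right 0)"
 using eventually_at_right_less[of 0]
 proof eventually_elim
 case (elim t)
 obtain n where n:"p=Suc n" using p by (cases p) auto
 define z where "z=\<i> * complex_of_real t"
 have z:"Im z > 0" "z~=0" using elim by (auto simp:z_def)
 have "ee z=exp (of_real (- 2 * pi * t))"
 unfolding ee_def z_def by (intro arg_cong[of _ _ exp]) (simp add:complex_eq_iff)
 hence ee:"ee z = of_real (exp (- 2 * pi * t))" by (simp only:exp_of_real)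
 have "Polygamma p z+Polygamma p (1-z) = - ((-1) ^ Suc n * Polygamma (Suc n) (1-z)-Polygamma (Suc n) z)"
 using p by (simp add:n)
 also have "...=(2 * pi*\<i>) ^ Suc p * power_lambert p (ee z)"
 unfolding Polygamma_reflection[OF z(1)] by (simp add:n)
 finally have "Polygamma p (z+1)+Polygamma p (1-z)=(2 * pi*\<i>) ^ Suc p * power_lambert p (ee z)-fact p/z ^ Suc p"
 unfolding Polygamma_plus1[OF z(2)] using p by (simp add:algebra_simps)
 thus ?case by (simp only:ee[unfolded z_def] z_def)
 qed
 ultimately have "((%t::real. Re ((2 * pi*\<i>) ^ Suc p * power_lambert p (of_real (exp (- 2 * pi * t))) -
 fact p/(\<i> * of_real t) ^ Suc p)) \<longlongrightarrow> Re (Polygamma p 1+Polygamma p 1)) (at_right 0)"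
 by (rule Lim_transform_eventually)
 from tendsto_unique[OF _ this lim] show ?thesis by simp
qed

text \<open>This is 3! zeta(4). It is half the constant term left when the pole 6/t^4 cancels, in
  accordance with \<open>Polygamma_1_limit\<close>.\<close>

lemma Polygamma_3_1:"Re (Polygamma 3 1)=pi^4/15"
proof -
 have lim:"((%t::real. 16 * pi^4*(exp (- 2 * pi * t)*(1+4 * exp (- 2 * pi * t)+exp (- 2 * pi * t)^2) /
 (1-exp (- 2 * pi * t))^4)-6/t^4) \<longlongrightarrow> 2 * pi^4/15) (at_right 0)"
 by (real_asymp simp:field_simps) (simp add:power_numeral_reduce)
 have ev:"eventually (%t::real. 16 * pi^4*(exp (- 2 * pi * t)*(1+4 * exp (- 2 * pi * t)+exp (- 2 * pi * t)^2) /
 (1-exp (- 2 * pi * t))^4)-6/t^4 =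
 Re ((2 * pi*\<i>) ^ Suc 3 * power_lambert 3 (of_real (exp (- 2 * pi * t)))-fact 3/(\<i> * of_real t) ^ Suc 3)) (at_right 0)"
 using eventually_at_right_less[of 0]
 proof eventually_elim
 case (elim t)
 define r where "r=exp (- 2 * pi * t)"
 have r:"norm (complex_of_real r)<1" using elim by (simp add:r_def)
 have "(2 * pi*\<i>) ^ Suc 3 * power_lambert 3 (of_real r)-fact 3/(\<i> * of_real t) ^ Suc 3 =
 of_real (16 * pi^4*(r*(1+4 * r+r^2)/(1-r)^4)-6/t^4)"
 unfolding power_lambert_3[OF r] by (simp add:power_mult_distrib fact_numeral)
 thus ?case by (simp only:r_def Re_complex_of_real)
 qed
 have "2 * Re (Polygamma 3 1)=2 * pi^4/15"
 by (rule Polygamma_1_limit[OF _ Lim_transform_eventually[OF lim ev]]) simp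
 thus ?thesis by simp
qed

lemma Polygamma_5_1:"Re (Polygamma 5 1)=8 * pi^6/63"
proof -
 have lim:"((%t::real. - 64 * pi^6*(exp (- 2 * pi * t)*(1+26 * exp (- 2 * pi * t)+66 * exp (- 2 * pi * t)^2
 + 26 * exp (- 2 * pi * t)^3+exp (- 2 * pi * t)^4) /
 (1-exp (- 2 * pi * t))^6)+120/t^6) \<longlongrightarrow> 16 * pi^6/63) (at_right 0)"
 by (real_asymp simp:field_simps) (simp add:power_numeral_reduce)
 have ev:"eventually (%t::real. - 64 * pi^6*(exp (- 2 * pi * t)*(1+26 * exp (- 2 * pi * t)+66 * exp (- 2 * pi * t)^2
 + 26 * exp (- 2 * pi * t)^3+exp (- 2 * pi * t)^4) /
 (1-exp (- 2 * pi * t))^6)+120/t^6 =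
 Re ((2 * pi*\<i>) ^ Suc 5 * power_lambert 5 (of_real (exp (- 2 * pi * t)))-fact 5/(\<i> * of_real t) ^ Suc 5)) (at_right 0)"
 using eventually_at_right_less[of 0]
 proof eventually_elim
 case (elim t)
 define r where "r=exp (- 2 * pi * t)"
 have r:"norm (complex_of_real r)<1" using elim by (simp add:r_def)
 have i6:"\<i>^6 = -1" by (simp add:power_numeral_reduce)
 have "(2 * pi*\<i>) ^ Suc 5 * power_lambert 5 (of_real r)-fact 5/(\<i> * of_real t) ^ Suc 5 =
 of_real (- 64 * pi^6*(r*(1+26 * r+66 * r^2+26 * r^3+r^4)/(1-r)^6)+120/t^6)"
 unfolding power_lambert_5[OF r] by (simp add:power_mult_distrib fact_numeral i6)
 thus ?case by (simp only:r_def Re_complex_of_real)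
 qed
 have "2 * Re (Polygamma 5 1)=16 * pi^6/63"
 by (rule Polygamma_1_limit[OF _ Lim_transform_eventually[OF lim ev]]) simp
 thus ?thesis by simp
qed

section \<open>Lambert series\<close>

lemma power_lambert_holomorphic:"power_lambert p holomorphic_on ball 0 1"
 unfolding holomorphic_on_open[OF open_ball] using power_lambert_deriv[of _ p] by (metis mem_ball_0)

lemma power_lambert_fps:"power_lambert p has_fps_expansion Abs_fps (%n. of_nat n ^ p)"
proof (rule has_fps_expansionI)
 have "eventually (%w. w\<in>ball 0 (1::real)) (nhds (0::complex))" by (intro eventually_nhds_in_open) auto
 thus "eventually (%w. (%n. fps_nth (Abs_fps (%n. of_nat n ^ p)) n * w ^ n) sums power_lambert p w) (nhds 0)"
 by eventually_elim (auto simp:power_lambert_def intro!: summable_sums summable_power_lambert)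
qed

lemma power_lambert_bound:
 assumes p:"p > 0" and r:"0<r" "r<1"
 shows "EX C. ALL w. norm w\<le>r-->norm (power_lambert p w) \<le> C * norm w"
proof -
 have sr:"summable (%n. real (Suc n) ^ p * r ^ n)"
 proof -
 have "summable (%n. real n ^ p * r ^ n)" using summable_power_lambert[of r p] r by simp
 hence "summable (%n. real (Suc n) ^ p * r ^ Suc n)" by (subst summable_Suc_iff)
 hence "summable (%n. inverse r*(real (Suc n) ^ p * r ^ Suc n))" by (rule summable_mult)
 also have "(%n. inverse r*(real (Suc n) ^ p * r ^ Suc n))=(%n. real (Suc n) ^ p * r ^ n)"
 using r by (auto simp:fun_eq_iff)
 finally show ?thesis .
 qed
 have "norm (power_lambert p w) \<le> suminf (%n. real (Suc n) ^ p * r ^ n) * norm w" if w:"norm w\<le>r" for w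
 proof -
 have w1:"norm w<1" using w r by simp
 have le:"norm (of_nat (Suc n) ^ p * w ^ n)\<le>real (Suc n) ^ p * r ^ n" for n
 unfolding norm_mult norm_power norm_of_nat using w by (intro mult_left_mono power_mono) auto
 have sw:"summable (%n. norm (of_nat (Suc n) ^ p * w ^ n))"
 by (rule summable_comparison_test'[OF sr]) (use le in auto)
 have "(%n. of_nat n ^ p * w ^ n) sums power_lambert p w"
 unfolding power_lambert_def using summable_power_lambert[OF w1] by (rule summable_sums)
 hence "(%n. of_nat (Suc n) ^ p * w ^ Suc n) sums power_lambert p w"
 by (subst sums_Suc_iff) (simp add:zero_power[OF p])
 moreover have "(%n. w * (of_nat (Suc n) ^ p * w ^ n)) sums (w * suminf (%n. of_nat (Suc n) ^ p * w ^ n))"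
 by (rule sums_mult[OF summable_sums[OF summable_norm_cancel[OF sw]]])
 ultimately have "power_lambert p w=w * suminf (%n. of_nat (Suc n) ^ p * w ^ n)"
 by (simp add:mult_ac sums_unique2)
 hence "norm (power_lambert p w)=norm w * norm (suminf (%n. of_nat (Suc n) ^ p * w ^ n))"
 by (simp only:norm_mult)
 also have "...\<le>norm w * suminf (%n. norm (of_nat (Suc n) ^ p * w ^ n))"
 using sw by (intro mult_left_mono summable_norm) auto
 also have "...\<le>norm w * suminf (%n. real (Suc n) ^ p * r ^ n)"
 using sw sr le by (intro mult_left_mono suminf_le) auto
 finally show ?thesis by (simp add:mult.commute)
 qed
 thus ?thesis by blast
qed

text \<open>For p > 0 this is the sum of sigma_p(n) q^n over n >= 1, with sigma_p the sum of p-th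
  powers of divisors.\<close>

definition lambert::"nat => complex => complex" where
 "lambert p q = suminf (%n. power_lambert p (q ^ Suc n))"

context
 fixes p::nat assumes p:"p > 0"
begin
lemma lambert_terms:
 assumes r:"0<r" "r<1"
 shows "EX C. ALL q n. norm q\<le>r-->norm (power_lambert p (q ^ Suc n)) \<le> C * r ^ Suc n"
proof -
 obtain C where C: "!!w. norm w\<le>r==>norm (power_lambert p w) \<le> C * norm w"
 using power_lambert_bound[OF p r] by blast
 have C0:"C\<ge>0"
 proof -
 have "0 \<le> C * norm (complex_of_real r)" using C[of "of_real r"] r by (intro order.trans[OF norm_ge_zero]) auto
 thus ?thesis using r by (simp add:zero_le_mult_iff)
 qed
 have "norm (power_lambert p (q ^ Suc n)) \<le> C * r ^ Suc n" if q:"norm q\<le>r" for q n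
 proof -
 have le:"norm (q ^ Suc n)\<le>r ^ Suc n" using q unfolding norm_power by (intro power_mono) auto
 also have "...\<le>r^1" using r by (intro power_decreasing) auto
 finally have "norm (power_lambert p (q ^ Suc n)) \<le> C * norm (q ^ Suc n)" by (intro C) simp
 also have "... \<le> C * r ^ Suc n" using le C0 by (intro mult_left_mono)
 finally show ?thesis .
 qed
 thus ?thesis by blast
qed

lemma lambert_summable:
 assumes "norm q<1"
 shows "summable (%n. norm (power_lambert p (q ^ Suc n)))"
proof -
 obtain r where r:"norm q<r" "r<1" using assms dense by blast
 hence r0:"0<r" using norm_ge_zero[of q] by linarith
 obtain C where C: "!!q n. norm q\<le>r==>norm (power_lambert p (q ^ Suc n)) \<le> C * r ^ Suc n"
 using lambert_terms[OF r0 r(2)] by blast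
 show ?thesis
 proof (rule summable_comparison_test')
 show "summable (%n. C * r ^ Suc n)" using r r0 by (simp add:summable_mult summable_geometric)
 show "norm (norm (power_lambert p (q ^ Suc n))) \<le> C * r ^ Suc n" for n using C[of q n] r by simp
 qed
qed

lemma lambert_uniform_limit:
 assumes r:"0<r" "r<1"
 shows "uniform_limit (cball 0 r) (%N q. \<Sum>n<N. power_lambert p (q ^ Suc n)) (lambert p) sequentially"
proof -
 obtain C where C: "!!q n. norm q\<le>r==>norm (power_lambert p (q ^ Suc n)) \<le> C * r ^ Suc n"
 using lambert_terms[OF r] by blast
 have "uniform_limit (cball 0 r) (%N q. \<Sum>n<N. power_lambert p (q ^ Suc n)) (%q. suminf (%n. power_lambert p (q ^ Suc n))) sequentially"
 proof (rule Weierstrass_m_test)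
 show "summable (%n. C * r ^ Suc n)" using r by (simp add:summable_mult summable_geometric)
 show "norm (power_lambert p (q ^ Suc n)) \<le> C * r ^ Suc n" if "q \<in> cball 0 r" for q n using C[of q n] that by simp
 qed
 thus ?thesis by (simp add:lambert_def[abs_def])
qed

lemma lambert_term_holomorphic:"(%q. power_lambert p (q ^ Suc n)) holomorphic_on ball 0 1"
proof -
 have "(%q::complex. q ^ Suc n) ` ball 0 1 \<subseteq> ball 0 1"
 proof (clarsimp simp:norm_mult norm_power)
 fix q::complex assume "norm q<1"
 thus "norm q * norm q ^ n<1" using power_Suc_less_one[of "norm q" n]
 by (cases "q=0") auto
 qed
 thus ?thesis
 using holomorphic_on_compose_gen[OF _ power_lambert_holomorphic,of "%q. q ^ Suc n" "ball 0 1" p]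
 by (simp add:o_def holomorphic_on_power del:power_Suc)
qed

lemma lambert_holomorphic:"lambert p holomorphic_on ball 0 1"
proof (rule holomorphic_uniform_sequence[OF open_ball,where f = "%N q. \<Sum>n<N. power_lambert p (q ^ Suc n)"])
 show "(%q. \<Sum>n<N. power_lambert p (q ^ Suc n)) holomorphic_on ball 0 1" for N
 by (intro holomorphic_on_sum lambert_term_holomorphic)
 fix x::complex assume x:"x\<in>ball 0 1"
 obtain r where r:"norm x<r" "r<1" using x dense by auto
 hence r0:"0<r" using norm_ge_zero[of x] by linarith
 have sub:"cball x (r-norm x) \<subseteq> cball 0 r"
 proof
 fix y assume "y \<in> cball x (r-norm x)"
 hence "norm (y-x)\<le>r-norm x" by (simp add:dist_norm norm_minus_commute)
 thus "y \<in> cball 0 r" using norm_triangle_ineq[of x "y-x"] by simp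
 qed
 show "\<exists>d>0. cball x d \<subseteq> ball 0 1&uniform_limit (cball x d) (%N q. \<Sum>n<N. power_lambert p (q ^ Suc n)) (lambert p) sequentially"
 proof (intro exI[of _ "r-norm x"] conjI)
 show "cball x (r-norm x) \<subseteq> ball 0 1" using sub r by (force simp:subset_iff)
 show "uniform_limit (cball x (r-norm x)) (%N q. \<Sum>n<N. power_lambert p (q ^ Suc n)) (lambert p) sequentially"
 using lambert_uniform_limit[OF r0 r(2)] sub by (rule uniform_limit_on_subset)
 qed (use r in simp)
qed

lemma lambert_has_fps_expansion:"lambert p has_fps_expansion fps_expansion (lambert p) 0"
 using lambert_holomorphic by (intro analytic_at_imp_has_fps_expansion_0) (auto simp:analytic_at intro!: exI[of _ "ball 0 1"])

lemma lambert_partial_fps: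
 "(%q. \<Sum>n<N. power_lambert p (q ^ Suc n)) has_fps_expansion
 (\<Sum>n<N. fps_compose (Abs_fps (%m. of_nat m ^ p)) (fps_X ^ Suc n))"
proof (intro fps_expansion_intros)
 fix n
 have "(power_lambert p \<circ> (%q. q ^ Suc n)) has_fps_expansion fps_compose (Abs_fps (%m. of_nat m ^ p)) (fps_X ^ Suc n)"
 by (rule has_fps_expansion_compose[OF power_lambert_fps]) (auto intro:fps_expansion_intros simp del:power_Suc)
 thus "(%q. power_lambert p (q ^ Suc n)) has_fps_expansion fps_compose (Abs_fps (%m. of_nat m ^ p)) (fps_X ^ Suc n)"
 by (simp add:o_def)
qed

lemma lambert_uniform_limit_half:
 "uniform_limit (ball 0 (1/2)) (%N q. \<Sum>n<N. power_lambert p (q ^ Suc n)) (lambert p) sequentially"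
 by (rule uniform_limit_on_subset[OF lambert_uniform_limit[of "1/2"]]) auto

lemma lambert_term_holomorphic_half:
 "(%q. \<Sum>n<N. power_lambert p (q ^ Suc n)) holomorphic_on ball 0 (1/2)"
 by (intro holomorphic_on_sum holomorphic_on_subset[OF lambert_term_holomorphic]) auto

lemma lambert_int_fps:"int_fps (fps_expansion (lambert p) 0)"
 unfolding int_fps_def
proof
 fix n
 show "fps_nth (fps_expansion (lambert p) 0) n\<in>\<int>"
 proof (rule fps_expansion_uniform_limit_Ints[OF lambert_partial_fps lambert_has_fps_expansion
 lambert_term_holomorphic_half open_ball _ lambert_uniform_limit_half])
 fix N
 show "fps_nth (\<Sum>n<N. fps_compose (Abs_fps (%m. of_nat m ^ p)) (fps_X ^ Suc n)) n\<in>(\<int>::complex set)"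
 unfolding fps_sum_nth fps_compose_nth power_mult[symmetric] fps_X_power_nth
 by (auto intro!: Ints_sum Ints_mult Ints_power)
 qed auto
qed

lemma lambert_fps_nth:"fps_nth (fps_expansion (lambert p) 0) 0=0" "fps_nth (fps_expansion (lambert p) 0) 1=1"
proof -
 note * =fps_expansion_uniform_limit_eventually_const[OF lambert_partial_fps lambert_has_fps_expansion
 lambert_term_holomorphic_half open_ball _ lambert_uniform_limit_half]
 show "fps_nth (fps_expansion (lambert p) 0) 0=0"
 by (rule *) (use p in \<open>auto simp:fps_sum_nth\<close>)
 show "fps_nth (fps_expansion (lambert p) 0) 1=1"
 proof (rule *)
 have "fps_nth (fps_compose (Abs_fps (%m. of_nat m ^ p)) (fps_X ^ Suc n)) 1=(if n=0 then 1 else (0::complex))" for n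
 unfolding fps_compose_nth power_mult[symmetric] fps_X_power_nth
 using p by (simp add:atLeast0_atMost_Suc)
 hence one:"fps_nth (\<Sum>n<N. fps_compose (Abs_fps (%m. of_nat m ^ p)) (fps_X ^ Suc n)) 1=(1::complex)" if "N > 0" for N
 unfolding fps_sum_nth using that by simp
 show "eventually (%N. fps_nth (\<Sum>n<N. fps_compose (Abs_fps (%m. of_nat m ^ p)) (fps_X ^ Suc n)) 1=(1::complex)) sequentially"
 by (rule eventually_mono[OF eventually_gt_at_top[of 0]]) (rule one)
 qed auto
qed

lemma lambert_over_q:"((%q. lambert p q/q) \<longlongrightarrow> 1) (at 0)"
proof -
 have "(deriv ^^ 1) (lambert p) 0/fact 1=1"
 using fps_nth_fps_expansion[OF lambert_has_fps_expansion,of 1] lambert_fps_nth(2) by simp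
 moreover have "lambert p field_differentiable at 0"
 using lambert_holomorphic by (rule holomorphic_on_imp_differentiable_at) auto
 ultimately have "(lambert p has_field_derivative 1) (at 0)"
 using field_differentiable_derivI[of "lambert p" 0] by simp
 moreover have "lambert p 0=0"
 using has_fps_expansion_imp_0_eq_fps_nth_0[OF lambert_has_fps_expansion] lambert_fps_nth(1) by simp
 ultimately show ?thesis by (simp add:has_field_derivative_iff)
qed
end

subsection \<open>Eisenstein series\<close>
lemma summable_on_int_inverse_square:"(%m::int. 1/(1+(real_of_int m)\<^sup>2)) summable_on UNIV"
proof -
 have "summable (%k. 1/(1+(real k)\<^sup>2))"
 proof (rule summable_comparison_test_ev[OF _ inverse_power_summable[of 2]])
 show "eventually (%k. norm (1/(1+(real k)\<^sup>2))\<le>inverse (real k^2)) sequentially"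
 using eventually_gt_at_top[of 0] by eventually_elim (auto simp:inverse_eq_divide intro!: frac_le)
 qed auto
 hence s:"(%k::nat. 1/(1+(real k)\<^sup>2)) summable_on UNIV" by (rule summable_nonneg_imp_summable_on) auto
 have bij:"bij_betw int UNIV {0..}" "bij_betw (%k. - int k) UNIV {..0}"
 by (rule bij_betwI[of _ _ _ nat]; auto) (rule bij_betwI[of _ _ _ "%m. nat (- m)"]; auto)
 have 1:"(%m::int. 1/(1+(real_of_int m)\<^sup>2)) summable_on {0..}"
 using s summable_on_reindex_bij_betw[OF bij(1),of "%m. 1/(1+(real_of_int m)\<^sup>2)"] by simp
 have "(%m::int. 1/(1+(real_of_int m)\<^sup>2)) summable_on {..0}"
 using s summable_on_reindex_bij_betw[OF bij(2),of "%m. 1/(1+(real_of_int m)\<^sup>2)"] by simp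
 hence 2:"(%m::int. 1/(1+(real_of_int m)\<^sup>2)) summable_on {..<0}" by (rule summable_on_subset) auto
 have "{0..} \<union> {..<0}=(UNIV::int set)" by (rule UNIV_eq_I[symmetric],(simp only:Un_iff lessThan_iff atLeast_iff le_less_linear | (simp only:Un_iff lessThan_iff atLeast_iff,rule le_less_linear)))
 with summable_on_Un_disjoint[OF 1 2] show ?thesis by (simp add:disjoint_iff)
qed

lemma lattice_norm_bound:
 assumes "Im tt > 0"
 shows "\<exists>M>0. \<forall>m n::int. real_of_int m^2+real_of_int n^2\<le>M * norm (of_int m + of_int n * tt)^2"
proof -
 define x y where "x = Re tt" and "y=Im tt"
 have y:"y > 0" using assms by (simp add:y_def)
 define M where "M=2+(1+2 * x^2)/y^2"
 have "real_of_int m^2+real_of_int n^2\<le>M * norm (of_int m + of_int n * tt)^2" for m n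
 proof -
 define a b::real where "a = of_int m" and "b = of_int n"
 have N: "norm (of_int m + of_int n * tt)^2=(a+b * x)^2+(b * y)^2"
 by (simp add:cmod_power2 a_def b_def x_def y_def)
 have "a^2\<le>2*(a+b * x)^2+2*(b * x)^2"
 proof -
 have "0\<le>(a+2*(b * x))^2" by simp
 thus ?thesis by (simp add:power2_eq_square algebra_simps)
 qed
 hence "a^2+b^2\<le>2*(a+b * x)^2+(1+2 * x^2) * b^2"
 by (simp add:power_mult_distrib algebra_simps)
 also have "(1+2 * x^2) * b^2=(1+2 * x^2)/y^2*(b * y)^2"
 using y by (simp add:power_mult_distrib)
 also have "2*(a+b * x)^2+(1+2 * x^2)/y^2*(b * y)^2\<le>M * (a+b * x)^2+M * (b * y)^2"
 by (intro add_mono mult_right_mono) (auto simp:M_def)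
 finally show ?thesis unfolding N by (simp add:a_def b_def ring_distribs)
 qed
 moreover have "M > 0" unfolding M_def by (intro add_pos_nonneg) auto
 ultimately show ?thesis by blast
qed

text \<open>Since |m + n tt|^2 dominates a multiple of m^2 + n^2 and k >= 4, the terms are bounded
  by a multiple of the summable product 1/((1 + m^2)(1 + n^2)).\<close>

lemma eisenstein_summable:
 assumes tau:"Im tt > 0" and k:"k\<ge>4" "even k"
 shows "(%(m,n). 1/(of_int m + of_int n * tt) ^ k) summable_on (UNIV-{(0,0)}::(int \<times> int) set)"
proof -
 obtain M where M: "M > 0" "!!m n::int. real_of_int m^2+real_of_int n^2\<le>M * norm (of_int m + of_int n * tt)^2"
 using lattice_norm_bound[OF tau] by blast
 obtain s where s:"k=2 * s" "s\<ge>2" using k by (auto elim!: evenE)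
 define u where "u=(%m::int. 1/(1+(real_of_int m)\<^sup>2))"
 obtain U where U: "(u has_sum U) UNIV"
 using summable_on_int_inverse_square unfolding u_def summable_on_def by blast
 have "(%x. u (fst x) * u (snd x)) summable_on Sigma UNIV (%_. UNIV)"
 proof (rule summable_on_SigmaI)
 show "((%y. u (fst (m,y)) * u (snd (m,y))) has_sum u m * U) UNIV" for m
 using has_sum_cmult_right[OF U] by simp
 show "(%m. u m * U) summable_on UNIV"
 using U by (intro summable_on_cmult_left) (auto simp:summable_on_def)
 qed (auto simp:u_def)
 hence "(%x. u (fst x) * u (snd x)) summable_on (UNIV-{(0,0)})"
 by (rule summable_on_subset) auto
 hence uu:"(%x. 3 * M ^ s*(u (fst x) * u (snd x))) summable_on (UNIV-{(0,0)})"
 by (rule summable_on_cmult_right)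
 have "(%x. norm ((%(m,n). 1/(of_int m + of_int n * tt) ^ k) x)) summable_on (UNIV-{(0,0)}::(int \<times> int) set)"
 proof (rule Infinite_Sum.abs_summable_on_comparison_test'[OF uu])
 fix x::"int \<times> int" assume x:"x\<in>UNIV-{(0,0)}"
 obtain m n where mn:"x=(m,n)" by (cases x)
 define v where "v = of_int m + of_int n * tt"
 define Q where "Q=real_of_int m^2+real_of_int n^2"
 have Q1:"Q\<ge>1"
 proof -
 have "m^2+n^2\<ge>1"
 using x mn by (smt (verit) DiffD2 insertI1 zero_less_power2 zero_le_power2)
 hence "real_of_int (m^2+n^2)\<ge>1" by linarith
 thus ?thesis by (simp add:Q_def)
 qed
 have Qv:"Q\<le>M * norm v^2" unfolding Q_def v_def by (rule M)
 have v0:"norm v > 0" using Qv Q1 by (cases "v=0") auto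
 have "Q^2\<le>Q ^ s" using Q1 s by (intro power_increasing)
 also have "...\<le>(M * norm v^2) ^ s" using Qv Q1 by (intro power_mono) auto
 also have "...=M ^ s * norm v ^ k" by (simp add:s power_mult_distrib power_mult)
 finally have 1:"Q^2\<le>M ^ s * norm v ^ k" .
 have "(1+(real_of_int m)\<^sup>2)*(1+(real_of_int n)\<^sup>2)\<le>3 * Q^2"
 proof -
 have "(1+(real_of_int m)\<^sup>2)*(1+(real_of_int n)\<^sup>2)=1+Q+(real_of_int m)\<^sup>2*(real_of_int n)\<^sup>2"
 by (simp add:Q_def algebra_simps)
 also have "(real_of_int m)\<^sup>2*(real_of_int n)\<^sup>2\<le>Q * Q"
 unfolding Q_def by (intro mult_mono) auto
 also have "1+Q+Q * Q\<le>3 * Q^2"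
 using Q1 mult_left_mono[OF Q1,of Q] mult_mono[OF Q1 Q1] unfolding power2_eq_square by linarith
 finally show ?thesis by simp
 qed
 also have "...\<le>3*(M ^ s * norm v ^ k)" using 1 by simp
 finally have "1/norm v ^ k\<le>3 * M ^ s*(u m * u n)"
 using v0 unfolding u_def by (simp add:divide_simps mult_ac add_pos_nonneg)
 thus "norm ((%(m,n). 1/(of_int m + of_int n * tt) ^ k) x)\<le>3 * M ^ s*(u (fst x) * u (snd x))"
 by (simp add:mn norm_divide norm_power v_def)
 qed
 thus ?thesis by (rule abs_summable_summable)
qed

lemma has_sum_nonzero_int_powers:
 assumes p:"odd p"
 shows "((%m::int. 1 / of_int m ^ Suc p) has_sum (2 * Polygamma p (1::complex)/fact p)) (- {0})"
proof -
 have p0:"p > 0" using p by (auto intro:Nat.gr0I)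
 have half:"((%k::nat. 1 / of_nat (Suc k) ^ Suc p) has_sum (Polygamma p (1::complex)/fact p)) UNIV"
 proof (rule norm_summable_imp_has_sum)
 show "(%k::nat. 1 / of_nat (Suc k) ^ Suc p) sums (Polygamma p (1::complex)/fact p)"
 using Polygamma_LIMSEQ[of "1::complex" p] p p0 by (simp add:inverse_eq_divide add.commute)
 have "summable (%k. inverse (real (Suc k) ^ Suc p))"
 using inverse_power_summable[of "Suc p",where ?'a=real] p0 by (subst summable_Suc_iff) auto
 thus "summable (%k. norm (1 / of_nat (Suc k) ^ Suc p::complex))"
 by (simp only:norm_divide norm_power norm_of_nat norm_one inverse_eq_divide)
 qed
 have bij:"bij_betw (%k. int (Suc k)) UNIV {0<..}" "bij_betw (%k. - int (Suc k)) UNIV {..<0}"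
 by (rule bij_betwI[of _ _ _ "%m. nat (m-1)"]; auto) (rule bij_betwI[of _ _ _ "%m. nat (- m-1)"]; auto)
 have h1:"((%m::int. 1 / of_int m ^ Suc p) has_sum (Polygamma p (1::complex)/fact p)) {0<..}"
 using has_sum_reindex_bij_betw[OF bij(1),of "%m. 1/(of_int m::complex) ^ Suc p"] half by simp
 have ev:"even (Suc p)" using p by simp
 have "(of_int (- int (Suc k))::complex) ^ Suc p = of_nat (Suc k) ^ Suc p" for k
 unfolding of_int_minus of_int_of_nat_eq by (rule power_minus_even[OF ev])
 hence h2:"((%m::int. 1 / of_int m ^ Suc p) has_sum (Polygamma p (1::complex)/fact p)) {..<0}"
 using has_sum_reindex_bij_betw[OF bij(2),of "%m. 1/(of_int m::complex) ^ Suc p"] half by simp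
 have "{0<..} \<union> {..<0} = - {0::int}" by auto
 with has_sum_Un_disjoint[OF h1 h2] show ?thesis by (simp add:disjoint_iff)
qed

text \<open>Sum along rows of fixed n: the row n = 0, without the origin, gives the zeta value, and
  the rows n and -n both give the same Lipschitz series because the exponent is even.\<close>

theorem eisenstein_fourier:
 assumes tau:"Im tt > 0" and p:"odd p" "p\<ge>3"
 shows "eisenstein (Suc p) tt=2 * Polygamma p 1/fact p+2*((2 * pi*\<i>) ^ Suc p/fact p) * lambert p (ee tt)"
proof -
 define c where "c=(2 * pi*\<i>) ^ Suc p/fact p"
 define c0 where "c0=2 * Polygamma p (1::complex)/fact p"
 have p0:"p > 0" using p by simp
 define S where "S=eisenstein (Suc p) tt"
 define f where "f=(%(m::int,n::int). 1/(of_int m + of_int n * tt) ^ Suc p)"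
 have "f summable_on (UNIV-{(0,0)})"
 unfolding f_def using p by (intro eisenstein_summable tau) auto
 hence fS: "(f has_sum S) (UNIV-{(0,0)})"
 unfolding S_def eisenstein_def f_def[symmetric] by (rule has_sum_infsum)
 define B where "B=(%n::int. if n=0 then-{0::int} else UNIV)"
 have bij:"bij_betw (%(n,m). (m,n)) (Sigma UNIV B) (UNIV-{(0,0)})"
 by (rule bij_betwI[of _ _ _ "%(m,n). (n,m)"]) (auto simp:B_def split:if_splits)
 have swap:"((%x. f (case x of (n,m)=>(m,n))) has_sum S) (Sigma UNIV B)"
 using has_sum_reindex_bij_betw[OF bij,of f S] fS by simp
 define g where "g=(%n::int. if n=0 then c0 else c * power_lambert p (ee (of_int \<bar>n\<bar> * tt)))"
 have ev:"even (Suc p)" using p by simp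
 have "(g has_sum S) UNIV"
 proof (rule has_sum_SigmaD[OF swap])
 fix n::int
 show "((%m. f (case (n,m) of (n,m)=>(m,n))) has_sum g n) (B n)"
 proof (cases n "0::int" rule:linorder_cases)
 case equal
 thus ?thesis using has_sum_nonzero_int_powers[OF p(1)] by (simp add:f_def g_def B_def c0_def)
 next
 case greater
 have "Im (of_int n * tt) > 0" using greater tau by simp
 from Lipschitz_formula[OF this p(1)] greater show ?thesis by (simp add:f_def g_def B_def c_def)
 next
 case less
 have "Im (of_int (- n) * tt) > 0" using less tau by (simp add:mult_neg_pos)
 note L=Lipschitz_formula[OF this p(1)]
 have bij:"bij_betw uminus (UNIV::int set) UNIV" by (rule bij_betwI[of _ _ _ uminus]) auto
 have "(of_int (- m) + of_int (- n) * tt) ^ Suc p=(of_int m + of_int n * tt) ^ Suc p" for m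
 using power_minus_even[OF ev,of "of_int m + of_int n * tt"] by (simp del:power_Suc)
 hence "((%m. f (m,n)) has_sum c * power_lambert p (ee (of_int (- n) * tt))) UNIV"
 using L has_sum_reindex_bij_betw[OF bij,of "%m. 1/(of_int m + of_int (- n) * tt) ^ Suc p"]
 by (simp add:f_def c_def del:power_Suc)
 thus ?thesis using less by (simp add:g_def B_def)
 qed
 qed
 moreover have "(g has_sum (c0+2*(c * lambert p (ee tt)))) UNIV"
 proof -
 have q:"norm (ee tt)<1" using tau by (simp add:norm_ee)
 have half:"((%k::nat. c * power_lambert p (ee tt ^ Suc k)) has_sum (c * lambert p (ee tt))) UNIV"
 unfolding lambert_def
 by (rule has_sum_cmult_right[OF norm_summable_imp_has_sum[OF lambert_summable[OF p0 q]
 summable_sums[OF summable_norm_cancel[OF lambert_summable[OF p0 q]]]]])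
 have bij:"bij_betw (%k. int (Suc k)) UNIV {0<..}" "bij_betw (%k. - int (Suc k)) UNIV {..<0}"
 by (rule bij_betwI[of _ _ _ "%m. nat (m-1)"]; auto) (rule bij_betwI[of _ _ _ "%m. nat (- m-1)"]; auto)
 have gk:"g (int (Suc k)) = c * power_lambert p (ee tt ^ Suc k)" "g (- int (Suc k)) = c * power_lambert p (ee tt ^ Suc k)" for k
 unfolding g_def ee_power by (simp_all add:add.commute)
 have h1:"(g has_sum (c * lambert p (ee tt))) {0<..}"
 using has_sum_reindex_bij_betw[OF bij(1),of g] half unfolding gk by simp
 have h2:"(g has_sum (c * lambert p (ee tt))) {..<0}"
 using has_sum_reindex_bij_betw[OF bij(2),of g] half unfolding gk by simp
 have "(g has_sum (\<Sum>n\<in>{0}. g n)) {0}" by (rule has_sum_finite) simp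
 hence h0:"(g has_sum c0) {0}" by (simp add:g_def)
 have "(g has_sum (c * lambert p (ee tt) + c * lambert p (ee tt))) ({0<..} \<union> {..<0})"
 by (rule has_sum_Un_disjoint[OF h1 h2]) auto
 from has_sum_Un_disjoint[OF h0 this]
 have "(g has_sum (c0+(c * lambert p (ee tt) + c * lambert p (ee tt)))) ({0} \<union> ({0<..} \<union> {..<0}))" by auto
 moreover have "{0} \<union> ({0<..} \<union> {..<0})=(UNIV::int set)" by auto
 ultimately show ?thesis by simp
 qed
 ultimately have "S = c0+2*(c * lambert p (ee tt))" by (rule has_sum_unique)
 thus ?thesis by (simp add:S_def c0_def c_def)
qed

text \<open>The matrix permutes the nonzero lattice vectors, and each term acquires the factor (c tt
  + d)^k.\<close>

lemma eisenstein_moebius: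
 assumes gg:"gg\<in>SL2Z" and tau:"Im tt > 0"
 shows "eisenstein k (moebius gg tt)=autom gg tt ^ k * eisenstein k tt"
proof -
 define p q r s where "p=gg$1$1" and "q=gg$1$2" and "r=gg$2$1" and "s=gg$2$2"
 note pqrs=p_def[symmetric] q_def[symmetric] r_def[symmetric] s_def[symmetric]
 have det:"p * s-q * r=1" using gg by (simp add:mat2_exhaust pqrs)
 define J where "J=autom gg tt"
 have J: "J~=0" using autom_nonzero[OF gg tau] by (simp add:J_def)
 have J_eq:"J = of_int r * tt + of_int s" by (simp add:J_def autom_def pqrs)
 have MJ: "moebius gg tt * J = of_int p * tt + of_int q"
 using moebius_times_autom[OF gg tau] by (simp add:J_def pqrs)
 define h where "h=(%(m,n). (m * s+n * q,m * r+n * p))"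
 define h' where "h'=(%(m,n). (m * p-n * q,n * s-m * r))"
 have inv1:"h' (h x)=x" for x
 proof -
 obtain m n where x:"x=(m,n)" by (cases x)
 have "(m * s+n * q) * p-(m * r+n * p) * q=m*(p * s-q * r)"
 "(m * r+n * p) * s-(m * s+n * q) * r=n*(p * s-q * r)" by (simp_all add:algebra_simps)
 thus ?thesis by (simp add:x h_def h'_def det)
 qed
 have inv2:"h (h' x)=x" for x
 proof -
 obtain m n where x:"x=(m,n)" by (cases x)
 have "(m * p-n * q) * s+(n * s-m * r) * q=m*(p * s-q * r)"
 "(m * p-n * q) * r+(n * s-m * r) * p=n*(p * s-q * r)" by (simp_all add:algebra_simps)
 thus ?thesis by (simp add:x h_def h'_def det)
 qed
 have h0:"h (0,0)=(0,0)" "h' (0,0)=(0,0)" by (simp_all add:h_def h'_def)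
 have nz:"h x~=(0,0)" "h' x~=(0,0)" if "x~=(0,0)" for x
 using inv1[of x] inv2[of x] h0 that by metis+
 have bij:"bij_betw h (UNIV-{(0,0)}) (UNIV-{(0,0)})"
 by (rule bij_betwI[of _ _ _ h']) (use nz inv1 inv2 in \<open>auto simp:Pi_def\<close>)
 have "1/(of_int m + of_int n * moebius gg tt) ^ k =
 J ^ k*(1/(of_int (m * s+n * q) + of_int (m * r+n * p) * tt) ^ k)" for m n
 proof -
 have "(of_int m + of_int n * moebius gg tt) * J = of_int m * J + of_int n*(moebius gg tt * J)"
 by (simp add:algebra_simps)
 also have "... = of_int (m * s+n * q) + of_int (m * r+n * p) * tt"
 unfolding MJ unfolding J_eq by (simp add:algebra_simps)
 finally have "of_int (m * s+n * q) + of_int (m * r+n * p) * tt=(of_int m + of_int n * moebius gg tt) * J" ..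
 thus ?thesis using J by (simp only:power_mult_distrib) simp
 qed
 hence "eisenstein k (moebius gg tt) =
 infsum (%x. J ^ k*(case h x of (m,n)=>1/(of_int m + of_int n * tt) ^ k)) (UNIV-{(0,0)})"
 unfolding eisenstein_def h_def by (intro infsum_cong) auto
 also have "...=J ^ k * infsum (%x. case h x of (m,n)=>1/(of_int m + of_int n * tt) ^ k) (UNIV-{(0,0)})"
 by (rule infsum_cmult_right')
 also have "infsum (%x. case h x of (m,n)=>1/(of_int m + of_int n * tt) ^ k) (UNIV-{(0,0)})=eisenstein k tt"
 unfolding eisenstein_def by (rule infsum_reindex_bij_betw[OF bij])
 finally show ?thesis by (simp add:J_def)
qed

subsection \<open>Integral expansions in \<open>q\<close>\<close>

text \<open>The function q^(n/l) w(q) as a series in q^(1/l): exponents of \<open>w\<close> are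
  stretched by l and shifted by n.\<close>

definition spread::"nat=>int => complex fps => complex fls" where
 "spread l n w=fls_X_intpow n * fps_to_fls (fps_compose w (fps_X ^ l))"

lemma fps_compose_X_power_nth:
 assumes "l > 0"
 shows "fps_nth (fps_compose w (fps_X ^ l)) m=(if l dvd m then fps_nth w (m div l) else 0)"
proof -
 have "fps_nth (fps_compose w (fps_X ^ l)) m=(\<Sum>i=0..m. fps_nth w i*(if m=l * i then 1 else 0))"
 by (simp add:fps_compose_nth flip:power_mult)
 also have "...=(\<Sum>i\<in>{i\<in>{0..m}. m=l * i}. fps_nth w i)"
 unfolding sum.inter_filter[OF finite_atLeastAtMost] by (intro sum.cong) auto
 also have "{i\<in>{0..m}. m=l * i}=(if l dvd m then {m div l} else {})"
 using assms by (auto simp:dvd_def)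
 finally show ?thesis by simp
qed

lemma spread_nth:
 assumes "l > 0"
 shows "fls_nth (spread l n w) m =
 (if m\<ge>n&int l dvd (m-n) then fps_nth w (nat ((m-n) div int l)) else 0)"
proof -
 have "fls_nth (spread l n w) m=(if m<n then 0 else fps_nth (fps_compose w (fps_X ^ l)) (nat (m-n)))"
 by (simp add:spread_def fls_X_intpow_times_conv_shift)
 moreover have "l dvd nat (m-n)\<longleftrightarrow>int l dvd (m-n)" "nat (m-n) div l=nat ((m-n) div int l)" if "m\<ge>n"
 using that assms by (simp_all add:nat_dvd_iff int_dvd_int_iff[symmetric] nat_div_distrib del:int_dvd_int_iff)
 ultimately show ?thesis by (simp add:fps_compose_X_power_nth[OF assms])
qed

lemma spread_subdegree:
 assumes "l > 0" "fps_nth w 0~=0"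
 shows "spread l n w~=0" "fls_subdegree (spread l n w)=n"
proof -
 have 1:"fls_nth (spread l n w) n~=0" using assms by (simp add:spread_nth)
 show "spread l n w~=0" using 1 by auto
 show "fls_subdegree (spread l n w)=n"
 using 1 assms by (intro fls_subdegree_eqI) (auto simp:spread_nth)
qed

lemma coeffs_in_spread:
 assumes "l > 0" "int_fps w" shows "coeffs_in \<int> (spread l n w)"
 using assms by (auto simp:coeffs_in_def spread_nth int_fps_def)

lemma has_qexp_spread:
 assumes l:"l > 0" and W: "W has_fps_expansion w"
 and f:"!!tt. Im tt > 0==>f tt=qpow (of_int n/real l) tt * W (ee tt)"
 shows "has_qexp l f (spread l n w)"
proof -
 have "(W \<circ> (%x. x ^ l)) has_fps_expansion fps_compose w (fps_X ^ l)"
 using l by (intro has_fps_expansion_compose W) (auto intro!: fps_expansion_intros)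
 from has_laurent_expansion_fps[OF this]
 have 1:"has_qexp l (%tt. (W \<circ> (%x. x ^ l)) (qpow (1/real l) tt)) (fps_to_fls (fps_compose w (fps_X ^ l)))"
 by (rule has_qexpI[OF l]) simp
 have pw:"qpow (1/real l) tt ^ l=ee tt" for tt
 using l by (simp add:qpow_eq_ee ee_power)
 show ?thesis unfolding spread_def
 by (rule has_qexp_cong[OF l has_qexp_mult[OF l has_qexp_qpow[OF l,of n] 1]],
 rule eventually_mono[OF eventually_at_cusp_uhp]) (simp add:uhp_def f pw)
qed

lemma fps_expansion_nth_0:"fps_nth (fps_expansion f 0) 0=f 0"
 by (simp add:fps_expansion_def)

lemma ee_in_ball:"z\<in>uhp==>ee z\<in>ball 0 1"
 by (simp add:uhp_def norm_ee)

lemma filterlim_ee_at_cusp:"filterlim ee (at 0) at_cusp"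
proof -
 have "ee=qpow (1/real 1)" by (simp add:qpow_eq_ee fun_eq_iff)
 thus ?thesis using filterlim_qpow_at_cusp[of 1] by simp
qed

subsection \<open>The modular invariant\<close>

text \<open>\<open>eisen4\<close> and \<open>eisen6\<close> are the normalised Eisenstein series E_4
  and E_6 in the variable q, and \<open>eta_prod\<close> is Euler's product of the 1 - q^n.\<close>

definition eisen4::"complex => complex" where "eisen4 q=1+240 * lambert 3 q"
definition eisen6::"complex => complex" where "eisen6 q=1-504 * lambert 5 q"
definition eta_prod::"complex => complex" where "eta_prod=qprod (%_. 1) Suc"

lemma Polygamma_1_complex:"Polygamma p (1::complex) = of_real (Re (Polygamma p 1))"
 using Polygamma_of_real[of 1 p,where ?'a = complex] by simp

lemma eisenstein_4:
 assumes "Im tt > 0"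
 shows "60 * eisenstein 4 tt = of_real (4 * pi^4/3) * eisen4 (ee tt)"
proof -
 have e:"eisenstein (Suc 3) tt=2 * Polygamma 3 1/fact 3+2*((of_real (2 * pi)*\<i>) ^ Suc 3/fact 3) * lambert 3 (ee tt)"
 by (rule eisenstein_fourier) (use assms in auto)
 have S: "Suc 3=4" and i:"(of_real (2 * pi)*\<i>)^4=(16 * of_real pi^4::complex)" by (simp_all add:power_mult_distrib)
 have P: "Polygamma 3 (1::complex) = of_real (pi^4/15)" using Polygamma_1_complex[of 3] Polygamma_3_1 by simp
 have F: "fact 3=(6::complex)" by (simp add:fact_numeral)
 show ?thesis using e unfolding S i P F by (simp add:eisen4_def algebra_simps)
qed

lemma eisenstein_6:
 assumes "Im tt > 0"
 shows "140 * eisenstein 6 tt = of_real (8 * pi^6/27) * eisen6 (ee tt)"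
proof -
 have e:"eisenstein (Suc 5) tt=2 * Polygamma 5 1/fact 5+2*((of_real (2 * pi)*\<i>) ^ Suc 5/fact 5) * lambert 5 (ee tt)"
 by (rule eisenstein_fourier) (use assms in auto)
 have "\<i>^6 = -1" by (simp add:eval_nat_numeral)
 hence S: "Suc 5=6" and i:"(of_real (2 * pi)*\<i>)^6=(- 64 * of_real pi^6::complex)" by (simp_all add:power_mult_distrib)
 have P: "Polygamma 5 (1::complex) = of_real (8 * pi^6/63)" using Polygamma_1_complex[of 5] Polygamma_5_1 by simp
 have F: "fact 5=(120::complex)" by (simp add:fact_numeral)
 note e=e[unfolded S i P F]
 show ?thesis unfolding e by (simp add:eisen6_def field_simps)
qed

lemma eisen_moebius:
 assumes "gg\<in>SL2Z" "Im tt > 0"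
 shows "eisen4 (ee (moebius gg tt))=autom gg tt^4 * eisen4 (ee tt)"
 and "eisen6 (ee (moebius gg tt))=autom gg tt^6 * eisen6 (ee tt)"
proof -
 note m=Im_moebius_pos[OF assms]
 have lc:"x * (autom gg tt ^ n * y)=autom gg tt ^ n*(x * y)" for x y n by (rule mult.left_commute)
 have nz:"(of_real (4 * pi^4/3)::complex)~=0" "(of_real (8 * pi^6/27)::complex)~=0" by simp_all
 have "of_real (4 * pi^4/3) * eisen4 (ee (moebius gg tt)) = of_real (4 * pi^4/3)*(autom gg tt^4 * eisen4 (ee tt))"
 unfolding eisenstein_4[OF m,symmetric] eisenstein_moebius[OF assms]
 by (simp only:lc eisenstein_4[OF assms(2)])
 thus "eisen4 (ee (moebius gg tt))=autom gg tt^4 * eisen4 (ee tt)" by (rule mult_left_cancel[OF nz(1),THEN iffD1])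
 have "of_real (8 * pi^6/27) * eisen6 (ee (moebius gg tt)) = of_real (8 * pi^6/27)*(autom gg tt^6 * eisen6 (ee tt))"
 unfolding eisenstein_6[OF m,symmetric] eisenstein_moebius[OF assms]
 by (simp only:lc eisenstein_6[OF assms(2)])
 thus "eisen6 (ee (moebius gg tt))=autom gg tt^6 * eisen6 (ee tt)" by (rule mult_left_cancel[OF nz(2),THEN iffD1])
qed

lemma eisen_holomorphic:"eisen4 holomorphic_on ball 0 1" "eisen6 holomorphic_on ball 0 1"
 unfolding eisen4_def eisen6_def by (intro holomorphic_intros lambert_holomorphic; simp)+

lemma eta_prod_holomorphic:"eta_prod holomorphic_on ball 0 1"
 unfolding eta_prod_def by (rule qprod_holomorphic[where W=1]) auto

lemma eta_prod_0:"eta_prod 0=1"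
 by (simp add:eta_prod_def qprod_def)

lemma disc_prod_eq_eta_prod:"disc_prod tt=ee tt * eta_prod (ee tt)^24"
 by (simp add:disc_prod_def half_theta_def eta_prod_def qprod_def ee_power ee_add[symmetric] ring_distribs
 flip:power_Suc)

lemma holomorphic_compose_ee:"f holomorphic_on ball 0 1==>(%z. f (ee z)) holomorphic_on uhp"
 using holomorphic_on_compose_gen[of ee uhp f "ball 0 1"] ee_in_ball ee_holomorphic[OF holomorphic_on_ident]
 by (auto simp:o_def image_subset_iff)

lemma disc_prod_holomorphic:"disc_prod holomorphic_on uhp"
 unfolding disc_prod_eq_eta_prod[abs_def]
 by (intro holomorphic_intros holomorphic_compose_ee eta_prod_holomorphic)

text \<open>The quotient by the nowhere vanishing discriminant has level one, and its limit at
  infinity is 1728; \<open>level_one_vanishing\<close> applied to the difference gives equality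
  everywhere.\<close>

lemma eisen_discriminant:
 assumes z:"z\<in>uhp"
 shows "eisen4 (ee z)^3-eisen6 (ee z)^2=1728 * disc_prod z"
proof -
 define r where "r z=(eisen4 (ee z)^3-eisen6 (ee z)^2)/disc_prod z-1728" for z
 have "r z=0"
 proof (rule level_one_vanishing[OF _ _ _ z])
 show "r holomorphic_on uhp" unfolding r_def
 by (intro holomorphic_intros holomorphic_compose_ee eisen_holomorphic disc_prod_holomorphic disc_prod_nonzero)
 (simp add:uhp_def)
 show "r (moebius gg z)=r z" if "gg\<in>SL2Z" "z\<in>uhp" for gg z
 proof -
 have z:"Im z > 0" using that by (simp add:uhp_def)
 note a=autom_nonzero[OF that(1) z]
 have "(eisen4 (ee (moebius gg z))^3-eisen6 (ee (moebius gg z))^2) =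
 autom gg z^12*(eisen4 (ee z)^3-eisen6 (ee z)^2)"
 unfolding eisen_moebius[OF that(1) z] by (simp add:power_mult_distrib right_diff_distrib flip:power_mult)
 thus ?thesis unfolding r_def disc_prod_moebius[OF that(1) z] using a by simp
 qed
 \<comment> \<open>The same function in q with the common factor q cancelled, so that the limit at q
   = 0 can be taken: 3 * 240 + 2 * 504 = 1728.\<close>
 define R where "R q=(240*(lambert 3 q/q)*(3+720 * lambert 3 q+57600 * lambert 3 q^2) +
 504*(lambert 5 q/q)*(2-504 * lambert 5 q))/eta_prod q^24-1728" for q
 have l0:"(lambert p \<longlongrightarrow> 0) (at 0)" if "p > 0" for p
 proof -
 have A: "((%q. lambert p q/q * q) \<longlongrightarrow> 1*0) (at 0)"
 by (rule tendsto_mult[OF lambert_over_q[OF that] tendsto_ident_at])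
 have B: "eventually (%q. lambert p q/q * q=lambert p q) (at 0)"
 by (auto simp:eventually_at_filter)
 show ?thesis using A unfolding tendsto_cong[OF B] by simp
 qed
 have e0:"(eta_prod \<longlongrightarrow> 1) (at 0)"
 using continuous_on_interior[OF holomorphic_on_imp_continuous_on[OF eta_prod_holomorphic],of 0] eta_prod_0
 by (simp add:isCont_def)
 have "(R \<longlongrightarrow> (240*1*(3+720*0+57600*0^2)+504*1*(2-504*0))/1^24-1728) (at 0)"
 unfolding R_def by (intro tendsto_intros lambert_over_q l0 e0) auto
 hence "((%z. R (ee z)) \<longlongrightarrow> 0) at_cusp" using filterlim_compose[OF _ filterlim_ee_at_cusp] by fastforce
 moreover have "R (ee z)=r z" for z
 proof -
 have alg:"(1+240 * a)^3-(1-504 * b)^2=240 * a*(3+720 * a+57600 * a^2)+504 * b*(2-504 * b)"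
 for a b::complex by (simp add:power3_eq_cube power2_eq_square algebra_simps)
 have "eisen4 q^3-eisen6 q^2=q*(240*(lambert 3 q/q)*(3+720 * lambert 3 q+57600 * lambert 3 q^2) +
 504*(lambert 5 q/q)*(2-504 * lambert 5 q))" if "q~=0" for q
 unfolding eisen4_def eisen6_def alg distrib_left[of q] using that by simp
 from this[of "ee z"] show ?thesis unfolding R_def r_def disc_prod_eq_eta_prod by simp
 qed
 ultimately show "(r \<longlongrightarrow> 0) at_cusp" by simp
 qed
 moreover have "disc_prod z~=0" using z disc_prod_nonzero by (simp add:uhp_def)
 ultimately show ?thesis by (simp add:r_def divide_eq_eq)
qed

definition j_fun::"complex => complex" where "j_fun z=eisen4 (ee z)^3/disc_prod z"

lemma level_one_j_fun:"level_one j_fun"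
 unfolding level_one_def
proof (intro conjI ballI)
 show "j_fun holomorphic_on uhp" unfolding j_fun_def[abs_def]
 by (intro holomorphic_intros holomorphic_compose_ee eisen_holomorphic disc_prod_holomorphic disc_prod_nonzero)
 (simp add:uhp_def)
 fix gg z assume that:"gg\<in>SL2Z" "z\<in>uhp"
 have z:"Im z > 0" using that by (simp add:uhp_def)
 show "j_fun (moebius gg z)=j_fun z"
 unfolding j_fun_def eisen_moebius[OF that(1) z] disc_prod_moebius[OF that(1) z]
 using autom_nonzero[OF that(1) z] by (simp add:power_mult_distrib flip:power_mult)
qed

lemma klein_j_eq:"klein_j=mero j_fun"
proof -
 have eq:"j_fun z=(let g2=60 * eisenstein 4 z; g3=140 * eisenstein 6 z
 in 1728 * g2^3/(g2^3-27 * g3^2))" if "z\<in>uhp" for z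
 proof -
 have z:"Im z > 0" using that by (simp add:uhp_def)
 \<comment> \<open>The constant common to g_2^3 and 27 g_3^2, since (4/3)^3 = 27 (8/27)^2 = 64/27;
   it cancels in j.\<close>
 define P where "P=(of_real (64 * pi^12/27)::complex)"
 have P: "P~=0" by (simp add:P_def)
 have g2:"(60 * eisenstein 4 z)^3=P * eisen4 (ee z)^3"
 unfolding eisenstein_4[OF z] by (simp add:P_def power_mult_distrib power_divide flip:power_mult)
 have g3:"27*(140 * eisenstein 6 z)^2=P * eisen6 (ee z)^2"
 unfolding eisenstein_6[OF z] by (simp add:P_def power_mult_distrib power_divide flip:power_mult)
 have "1728*(P * eisen4 (ee z)^3)/(P * eisen4 (ee z)^3-P * eisen6 (ee z)^2) =
 (1728 * P * eisen4 (ee z)^3)/((1728 * P) * disc_prod z)"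
 unfolding right_diff_distrib[symmetric] eisen_discriminant[OF that] by (simp add:mult_ac)
 also have "...=j_fun z" using P by (simp add:j_fun_def)
 finally show ?thesis unfolding Let_def g2 g3 by (rule sym)
 qed
 show ?thesis unfolding klein_j_def
 using level_one_j_fun eq by (intro mero_cong[symmetric]) (auto simp:level_one_def)
qed

lemma j_fun_qexp:
 assumes l:"l > 0"
 shows "EX J. has_qexp l j_fun J&fls_subdegree J = - int l&J~=0 & coeffs_in \<int> J"
proof -
 define a where "a=fps_expansion (lambert 3) 0"
 define h where "h=fps_expansion eta_prod 0"
 define w where "w=(1+fps_const 240 * a)^3 * inverse (h^24)"
 have a:"lambert 3 has_fps_expansion a" "int_fps a" "fps_nth a 0=0"
 unfolding a_def using lambert_has_fps_expansion[of 3] lambert_int_fps[of 3] lambert_fps_nth[of 3] by simp_all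
 have h:"eta_prod has_fps_expansion h" "int_fps h" "fps_nth h 0=1"
 unfolding h_def using qprod_has_fps_expansion[of Suc "%_. 1" 1] qprod_int_fps[of Suc "%_. 1" 1]
 by (auto simp:eta_prod_def fps_expansion_nth_0 eta_prod_0[unfolded eta_prod_def])
 have c:"int_fps (fps_const 240)" by (auto simp:int_fps_def)
 have w:"(%q. eisen4 q^3 * inverse (eta_prod q^24)) has_fps_expansion w"
 unfolding eisen4_def w_def by (intro fps_expansion_intros a h) (simp add:h fps_power_zeroth)
 have wi:"int_fps w" unfolding w_def
 by (intro int_fps_mult int_fps_power int_fps_add int_fps_1 c a int_fps_inverse h) (simp add:h fps_power_zeroth)
 have w0:"fps_nth w 0~=0" by (simp add:w_def a h fps_power_zeroth)
 have "has_qexp l j_fun (spread l (- int l) w)"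
 proof (rule has_qexp_spread[OF l w])
 fix tt::complex assume "Im tt > 0"
 have "qpow (of_int (- int l)/real l) tt=inverse (ee tt)"
 using l by (simp add:qpow_eq_ee ee_minus)
 thus "j_fun tt=qpow (of_int (- int l)/real l) tt*(eisen4 (ee tt)^3 * inverse (eta_prod (ee tt)^24))"
 by (simp add:j_fun_def disc_prod_eq_eta_prod divide_inverse mult_ac)
 qed
 thus ?thesis using spread_subdegree[OF l w0] coeffs_in_spread[OF l wi] by blast
qed

subsection \<open>Roots of power series\<close>
text \<open>The logarithmic derivative of U is N times that of its N-th root u; here this is
  obtained by cancelling u^(N-1).\<close>

lemma fps_deriv_mult_cancel:
 fixes u U s::"complex fps"
 assumes "u ^ N=U" "U~=0" "N > 0" "fps_X * fps_deriv U = - (U * s)"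
 shows "fps_const (of_nat N)*(fps_X * fps_deriv u) = - (u * s)"
proof -
 have "u~=0" using assms by auto
 have "fps_X * fps_deriv U=fps_const (of_nat N) * fps_X * fps_deriv u * u^(N-1)"
 unfolding assms(1)[symmetric] by (simp add:fps_deriv_power mult_ac)
 hence "u^(N-1)*(fps_const (of_nat N)*(fps_X * fps_deriv u)) = - (u * u^(N-1) * s)"
 using assms by (simp add:mult_ac flip:power_Suc)
 hence "u^(N-1)*(fps_const (of_nat N)*(fps_X * fps_deriv u))=u^(N-1) * - (u * s)"
 by (simp add:mult_ac)
 thus ?thesis using \<open>u~=0\<close> by (metis mult_left_cancel power_not_zero)
qed

lemma X_deriv_nth:"fps_nth (fps_X * fps_deriv F) n = of_nat n * fps_nth F n" for F::"complex fps"
 by (cases n) simp_all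

lemma fps_root_recursion:
 fixes u s::"complex fps"
 assumes "fps_const (of_nat N)*(fps_X * fps_deriv u) = - (u * s)" "fps_nth s 0=0"
 shows "of_nat N * of_nat n * fps_nth u n = - (\<Sum>i<n. fps_nth u i * fps_nth s (n-i))"
proof -
 have "fps_nth (fps_const (of_nat N)*(fps_X * fps_deriv u)) n = of_nat N * of_nat n * fps_nth u n"
 by (simp only:fps_mult_left_const_nth X_deriv_nth mult.assoc)
 moreover have "fps_nth (u * s) n=(\<Sum>i<n. fps_nth u i * fps_nth s (n-i))"
 unfolding fps_mult_nth using assms(2) by (simp add:atLeast0AtMost flip:lessThan_Suc_atMost)
 ultimately show ?thesis using arg_cong[OF assms(1),of "%F. fps_nth F n"] by (simp only:fps_neg_nth)
qed

text \<open>In the recursion for the coefficients of u the n-th one is multiplied by N n and depends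
  only on earlier ones, so rationality propagates.\<close>

lemma fps_root_rational:
 fixes u s::"complex fps"
 assumes "fps_const (of_nat N)*(fps_X * fps_deriv u) = - (u * s)" "fps_nth s 0=0" "N > 0"
 "!!n. fps_nth s n\<in>\<rat>" "fps_nth u 0=1"
 shows "fps_nth u n\<in>\<rat>"
proof (induction n rule:less_induct)
 case (less n)
 show ?case
 proof (cases "n=0")
 case False
 have "fps_nth u n = - (\<Sum>i<n. fps_nth u i * fps_nth s (n-i))/(of_nat N * of_nat n)"
 using fps_root_recursion[OF assms(1,2),of n] False assms(3) by (simp add:field_simps)
 also have "...\<in>\<rat>" using less assms
 by (intro Rats_divide Rats_mult Rats_sum Rats_of_nat iffD2[OF Rats_minus_iff]) auto
 finally show ?thesis .
 qed (use assms in auto)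
qed

text \<open>If l does not divide n, then l does not divide both i and n - i, so each term of the
  recursion vanishes.\<close>

lemma fps_root_supported:
 fixes u s::"complex fps"
 assumes "fps_const (of_nat N)*(fps_X * fps_deriv u) = - (u * s)" "fps_nth s 0=0" "N > 0"
 "!!n. ~ l dvd n==>fps_nth s n=0"
 shows "~ l dvd n==>fps_nth u n=0"
proof (induction n rule:less_induct)
 case (less n)
 have "fps_nth u i * fps_nth s (n-i)=0" if "i<n" for i
 proof (cases "l dvd i")
 case True
 have "~ l dvd n-i" using less(2) that True by (metis dvd_add le_add_diff_inverse2 less_imp_le)
 thus ?thesis using assms by simp
 qed (use less that in auto)
 hence "(\<Sum>i<n. fps_nth u i * fps_nth s (n-i))=0" by (intro sum.neutral) simp
 hence "of_nat N * of_nat n * fps_nth u n=(0::complex)"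
 using fps_root_recursion[OF assms(1,2),of n] by simp
 thus ?case using less(2) assms(3) by (cases "n=0") auto
qed

subsection \<open>Almost integral Laurent series\<close>
text \<open>Write \<alpha> = a/b in lowest terms: b^n divides the fixed nonzero integer \<delta> for
  every n, hence b = +-1.\<close>

lemma rational_powers_bounded_denominator:
 fixes \<alpha> \<delta>::complex
 assumes "!!n. \<alpha> ^ n*\<delta>\<in>\<int>" "\<delta>~=0"
 shows "\<alpha>\<in>\<int>"
proof -
 obtain D::int where D: "\<delta> = of_int D" using assms(1)[of 0] by (auto elim:Ints_cases)
 obtain A::int where A: "\<alpha>*\<delta> = of_int A" using assms(1)[of 1] by (auto elim:Ints_cases)
 have D0:"D~=0" using D assms by auto
 obtain a b where ab:"A=a * gcd A D" "D=b * gcd A D" "coprime a b"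
 using gcd_coprime_exists[of A D] D0 by auto
 have g0:"(of_int (gcd A D)::complex)~=0" using D0 by simp
 have b0:"b~=0" using ab D0 by auto
 have "\<alpha>*(of_int b * of_int (gcd A D)) = of_int a * of_int (gcd A D)"
 using A unfolding D by (metis ab(1,2) of_int_mult)
 hence al:"\<alpha> * of_int b = of_int a" unfolding mult.assoc[symmetric] mult_right_cancel[OF g0] .
 have "b ^ n dvd D" for n
 proof -
 obtain z::int where z:"\<alpha> ^ n*\<delta> = of_int z" using assms(1)[of n] by (auto elim:Ints_cases)
 have "of_int (a ^ n * D)=(\<alpha> * of_int b) ^ n*\<delta>" by (simp add:al D)
 also have "... = of_int (z * b ^ n)" using z by (simp add:power_mult_distrib mult_ac)
 finally have "a ^ n * D=z * b ^ n" by (metis of_int_eq_iff)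
 hence "b ^ n dvd a ^ n * D" by simp
 moreover have "coprime (b ^ n) (a ^ n)" using ab(3) by (simp add:coprime_commute)
 ultimately show ?thesis by (simp add:coprime_dvd_mult_right_iff)
 qed
 hence "\<bar>b\<bar> ^ nat \<bar>D\<bar>\<le>\<bar>D\<bar>" using D0 dvd_imp_le_int[of D "b ^ nat \<bar>D\<bar>"] by (simp add:power_abs)
 have "\<bar>b\<bar>=1"
 proof (rule ccontr)
 assume "\<bar>b\<bar>~=1"
 hence "2\<le>\<bar>b\<bar>" using b0 by linarith
 hence "2 ^ nat \<bar>D\<bar>\<le>\<bar>b\<bar> ^ nat \<bar>D\<bar>" by (intro power_mono) auto
 moreover have "int (nat \<bar>D\<bar>)<2 ^ nat \<bar>D\<bar>" using of_nat_less_two_power by blast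
 ultimately show False using \<open>\<bar>b\<bar> ^ nat \<bar>D\<bar>\<le>\<bar>D\<bar>\<close> by linarith
 qed
 hence "b=1 | b = -1" by linarith
 thus ?thesis using al by (auto simp:minus_equation_iff[of \<alpha>])
qed

lemma fls_lead_mult:
 fixes F G::"complex fls"
 assumes "F~=0" "G~=0"
 shows "fls_nth (F * G) (fls_subdegree (F * G))=fls_nth F (fls_subdegree F) * fls_nth G (fls_subdegree G)"
 using assms by (simp add:fls_times_base)

lemma fls_lead_power:
 fixes F::"complex fls"
 assumes "F~=0"
 shows "fls_nth (F ^ n) (fls_subdegree (F ^ n))=fls_nth F (fls_subdegree F) ^ n"
proof (induction n)
 case (Suc n)
 thus ?case using fls_lead_mult[OF assms,of "F ^ n"] assms by simp
qed simp

lemma coeffs_in_Ints_diff:"coeffs_in \<int> F ==> coeffs_in \<int> G ==> coeffs_in \<int> (F-G)"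
 by (auto simp:coeffs_in_def)

text \<open>Split off the integral initial part of u, so that the tail v starts with the first
  nonintegral coefficient. The products v^n d are still integral, and their leading coefficients
  contradict \<open>rational_powers_bounded_denominator\<close>.\<close>

lemma fls_almost_integral:
 fixes u d::"complex fls"
 assumes d:"d~=0" and int:"!!n. coeffs_in \<int> (u ^ n * d)"
 shows "coeffs_in \<int> u"
proof (rule ccontr)
 assume "~ coeffs_in \<int> u"
 then obtain i where i:"fls_nth u i ~: \<int>" by (auto simp:coeffs_in_def)
 define s where "s=fls_subdegree u"
 have "i \<ge> s" using i unfolding s_def by (metis Ints_0 fls_eq0_below_subdegree not_le)
 hence ex:"fls_nth u (s+int (nat (i - s))) ~: \<int>" using i by simp
 define m where "m=(LEAST n. fls_nth u (s+int n) ~: \<int>)"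
 define m' where "m' = s+int m"
 have m1:"fls_nth u m' ~: \<int>" unfolding m'_def m_def by (rule LeastI[of "%n. fls_nth u (s+int n) ~: \<int>",OF ex])
 have m2:"fls_nth u i\<in>\<int>" if "i<m'" for i
 proof (cases "i < s")
 case True thus ?thesis unfolding s_def by simp
 next
 case False
 have "nat (i - s)<m" using that False unfolding m'_def by linarith
 from not_less_Least[OF this[unfolded m_def]] show ?thesis using False by simp
 qed
 define v where "v=Abs_fls (%i. if i\<ge>m' then fls_nth u i else 0)"
 have v:"fls_nth v i=(if i\<ge>m' then fls_nth u i else 0)" for i
 unfolding v_def by (rule nth_Abs_fls_lower_bound[of m']) auto
 have P: "coeffs_in \<int> (u - v)" using m2 by (auto simp:coeffs_in_def v)
 have vn:"coeffs_in \<int> (v ^ n*(u ^ i * d))" for n i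
 proof (induction n arbitrary:i)
 case (Suc n)
 have eq:"v ^ Suc n*(u ^ i * d) = v ^ n*(u ^ Suc i * d)-(u - v)*(v ^ n*(u ^ i * d))"
 by (simp add:algebra_simps)
 show ?case unfolding eq by (rule coeffs_in_Ints_diff[OF Suc coeffs_in_Ints_mult[OF P Suc]])
 qed (use int in simp)
 have vm:"fls_nth v m'~=0" using m1 v by auto
 hence v0:"v~=0" by auto
 have vs:"fls_subdegree v=m'" by (rule fls_subdegree_eqI) (use vm v in auto)
 have "fls_nth u m'\<in>\<int>"
 proof (rule rational_powers_bounded_denominator)
 show "fls_nth d (fls_subdegree d)~=0" using d by simp
 fix n
 have "fls_nth (v ^ n * d) (fls_subdegree (v ^ n * d))=fls_nth v m' ^ n * fls_nth d (fls_subdegree d)"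
 using fls_lead_mult[of "v ^ n" d] fls_lead_power[OF v0,of n] v0 d vs by simp
 moreover have "fls_nth (v ^ n * d) (fls_subdegree (v ^ n * d))\<in>\<int>"
 using vn[of n 0] by (simp add:coeffs_in_def)
 ultimately show "fls_nth u m' ^ n * fls_nth d (fls_subdegree d)\<in>\<int>" using v[of m'] by simp
 qed
 with m1 show False by simp
qed

text \<open>The power series with integer coefficients form a normal ring.\<close>
lemma fls_root_integral:
 fixes F D N::"complex fls"
 assumes D: "coeffs_in \<int> D" and D0:"D~=0" and N: "coeffs_in \<int> N" and DF: "D * F=N"
 and FM: "coeffs_in \<int> (F ^ M)" and M: "M > 0"
 shows "coeffs_in \<int> F"
proof (rule fls_almost_integral[where d = "D^(M-1)"])
 show "D^(M-1)~=0" using D0 by simp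
 fix n
 have r:"n mod M\<le>M-1" using M mod_less_divisor[of M n] by linarith
 \<comment> \<open>One denominator serves all powers of F: with r = n mod M, at most M-1 factors F
   remain outside powers of F^M, and each is absorbed by a factor D.\<close>
 have "F ^ n * D^(M-1)=(F ^ M)^(n div M)*((D * F)^(n mod M) * D^(M-1-n mod M))"
 proof -
 have "F ^ n=F^(M * (n div M)+n mod M)" by simp
 hence "F ^ n=(F ^ M)^(n div M) * F^(n mod M)" by (metis power_add power_mult)
 moreover have "D^(M-1)=D^(n mod M) * D^(M-1-n mod M)"
 using r by (metis le_add_diff_inverse power_add)
 ultimately show ?thesis by (simp add:power_mult_distrib mult_ac)
 qed
 thus "coeffs_in \<int> (F ^ n * D^(M-1))"
 unfolding DF by (simp add:coeffs_in_Ints_mult coeffs_in_Ints_power FM D N)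
qed

subsection \<open>Logarithmic derivatives of the products\<close>

text \<open>The series -X (log(1 - X^c))', that is, c times the sum of X^(c m) over m >= 1.\<close>

definition div_series::"nat => complex fps" where
 "div_series c=Abs_fps (%m. if m > 0 & c dvd m then of_nat c else 0)"

lemma logderiv_one_minus_X_power:
 assumes "c > 0"
 shows "fps_X * fps_deriv (1-fps_X ^ c) = - ((1-fps_X ^ c) * div_series c)"
proof (rule fps_ext)
 fix m
 have "fps_nth (fps_X ^ c * div_series c) m=(if m < c then 0 else fps_nth (div_series c) (m - c))"
 by (rule fps_X_power_mult_nth)
 thus "fps_nth (fps_X * fps_deriv (1-fps_X ^ c)) m=fps_nth (- ((1-fps_X ^ c) * div_series c)) m"
 unfolding X_deriv_nth using assms by (auto simp:left_diff_distrib div_series_def dvd_minus_self)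
qed

lemma logderiv_mult:
 fixes A B::"complex fps"
 assumes "fps_X * fps_deriv A = - (A * s)" "fps_X * fps_deriv B = - (B * t)"
 shows "fps_X * fps_deriv (A * B) = - (A * B * (s+t))"
proof -
 have "fps_X * fps_deriv (A * B)=A * (fps_X * fps_deriv B)+(fps_X * fps_deriv A) * B"
 by (simp add:algebra_simps)
 also have "... = - (A * B * (s+t))" unfolding assms by (simp add:algebra_simps)
 finally show ?thesis .
qed

lemma logderiv_prod:
 fixes A::"'i => complex fps"
 assumes "!!i. i\<in>I==>fps_X * fps_deriv (A i) = - (A i * s i)"
 shows "fps_X * fps_deriv (\<Prod>i\<in>I. A i) = - ((\<Prod>i\<in>I. A i)*(\<Sum>i\<in>I. s i))"
 using assms
proof (induction I rule:infinite_finite_induct)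
 case (insert i I)
 have "fps_X * fps_deriv (A i*(\<Prod>i\<in>I. A i)) = - (A i*(\<Prod>i\<in>I. A i)*(s i+(\<Sum>i\<in>I. s i)))"
 using insert by (intro logderiv_mult) auto
 thus ?case using insert by simp
qed auto

definition fps_powi::"complex fps=>int => complex fps" where
 "fps_powi A n=(if n\<ge>0 then A ^ nat n else inverse A ^ nat (- n))"

lemma fps_powi_nth_0:"fps_nth A 0=1==>fps_nth (fps_powi A n) 0=1"
 by (simp add:fps_powi_def fps_power_zeroth)

lemma int_fps_powi:"int_fps A==>fps_nth A 0=1==>int_fps (fps_powi A n)"
 by (auto simp:fps_powi_def intro:int_fps_inverse)

lemma has_fps_expansion_powi:
 "f has_fps_expansion A==>fps_nth A 0~=0==>(%x. f x powi n) has_fps_expansion fps_powi A n"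
 unfolding fps_powi_def power_int_def by (auto intro!: fps_expansion_intros)

lemma logderiv_powi:
 assumes "fps_X * fps_deriv A = - (A * s)" "fps_nth A 0=1"
 shows "fps_X * fps_deriv (fps_powi A n) = - (fps_powi A n*(fps_const (of_int n) * s))"
proof -
 have pow:"fps_X * fps_deriv (B ^ m) = - (B ^ m*(fps_const (of_nat m) * t))"
 if "fps_X * fps_deriv B = - (B * t)" for B t::"complex fps" and m
 using logderiv_prod[of "{..<m}" "%_. B" "%_. t"] that by (simp add:fps_of_nat)
 have inv:"fps_X * fps_deriv (inverse A) = - (inverse A * - s)"
 proof -
 have iA: "inverse A * A=1" by (rule inverse_mult_eq_1) (use assms in simp)
 have "fps_X * fps_deriv (inverse A) = - (fps_X * fps_deriv A) * inverse A^2"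
 using assms(2) by (simp add:fps_inverse_deriv mult_ac)
 also have "...=(inverse A * A) * inverse A * s" unfolding assms(1) by (simp add:power2_eq_square mult_ac)
 finally show ?thesis unfolding iA by simp
 qed
 show ?thesis
 proof (cases "n\<ge>0")
 case True
 thus ?thesis using pow[OF assms(1),of "nat n"] by (simp add:fps_powi_def)
 next
 case False
 have "(of_nat (nat (- n))::complex) = - of_int n" using False by simp
 thus ?thesis using pow[OF inv,of "nat (- n)"] False
 by (simp add:fps_powi_def fps_const_neg[symmetric] del:fps_const_neg)
 qed
qed

definition qprod_fps::"(nat=>nat) => complex fps" where
 "qprod_fps c=fps_expansion (qprod (%_. 1) c) 0"

definition divs::"(nat=>nat)=>nat=>nat" where
 "divs c n=(\<Sum>d | d dvd n&d\<in>range c. d)"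

context
 fixes c::"nat=>nat"
 assumes c:"!!n. n \<le> c n" and c0:"!!n. c n > 0" and inj:"inj c"
begin
lemma qprod_fps_nth_0:"fps_nth (qprod_fps c) 0=1"
proof -
 have z:"(0::complex) ^ c n=0" for n by (rule zero_power[OF c0])
 show ?thesis unfolding qprod_fps_def fps_expansion_nth_0 qprod_def z by simp
qed

lemma int_qprod_fps:"int_fps (qprod_fps c)"
 unfolding qprod_fps_def using qprod_int_fps[of c "%_. 1" 1] c by simp

lemma has_fps_qprod_fps:"qprod (%_. 1) c has_fps_expansion qprod_fps c"
 unfolding qprod_fps_def using qprod_has_fps_expansion[of c "%_. 1" 1] c by simp

text \<open>Because c m >= m, factors with index beyond n cannot change the coefficient of
  X^n.\<close>

lemma qprod_fps_stable:
 assumes "n<N"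
 shows "fps_nth (qprod_fps c) n=fps_nth (\<Prod>k<N. 1-fps_X ^ c k) n"
proof -
 have st:"fps_nth (\<Prod>k<N'. 1-fps_X ^ c k::complex fps) n=fps_nth (\<Prod>k<N. 1-fps_X ^ c k) n" if "N'\<ge>N" for N'
 using that
 proof (induction N' rule:nat_induct_at_least)
 case (Suc m)
 have "n < c m" using Suc(1) assms c[of m] by linarith
 thus ?case using Suc by (simp add:right_diff_distrib fps_X_power_mult_right_nth)
 qed simp
 show ?thesis unfolding qprod_fps_def
 proof (rule fps_expansion_uniform_limit_eventually_const[where A = "ball 0 (1/2)" and
 f = "%N z. \<Prod>k<N. 1-(1::complex) * z ^ c k"])
 show "(%z. \<Prod>k<N. 1-1 * z ^ c k) has_fps_expansion (\<Prod>k<N. 1-fps_X ^ c k::complex fps)" for N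
 using qprod_partial_fps[of c "%_. 1" 1 N] c by simp
 show "qprod (%_. 1) c has_fps_expansion fps_expansion (qprod (%_. 1) c) 0"
 using has_fps_qprod_fps by (simp add:qprod_fps_def)
 show "uniform_limit (ball 0 (1/2)) (%N z. \<Prod>k<N. 1-1 * z ^ c k) (qprod (%_. 1) c) sequentially"
 using qprod_uniform_limit_half[of c "%_. 1" 1] c by simp
 show "\<forall>\<^sub>F N' in sequentially. fps_nth (\<Prod>k<N'. 1-fps_X ^ c k) n=fps_nth (\<Prod>k<N. 1-fps_X ^ c k::complex fps) n"
 using eventually_ge_at_top[of N] by eventually_elim (rule st)
 qed (auto intro!: holomorphic_intros)
qed

lemma divs_eq_sum:
 assumes "j<N"
 shows "fps_nth (\<Sum>k<N. div_series (c k)) j=(if j=0 then 0 else of_nat (divs c j))"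
proof (cases "j=0")
 case False
 have "{d. d dvd j&d\<in>range c} = c ` {k. k<N & c k dvd j}"
 proof (safe; clarsimp?)
 fix k assume "c k dvd j"
 hence "k<N" using dvd_imp_le[of "c k" j] False c[of k] assms by simp
 thus "c k \<in> c ` {k. k<N & c k dvd j}" using \<open>c k dvd j\<close> by auto
 qed
 hence "divs c j=(\<Sum>k | k<N & c k dvd j. c k)"
 unfolding divs_def using inj by (simp add:sum.reindex inj_on_def)
 also have "{k. k<N & c k dvd j}={k\<in>{..<N}. c k dvd j}" by auto
 finally have "divs c j=(\<Sum>k<N. if c k dvd j then c k else 0)"
 by (simp only:sum.inter_filter[OF finite_lessThan])
 moreover have "fps_nth (\<Sum>k<N. div_series (c k)) j=(\<Sum>k<N. if c k dvd j then of_nat (c k) else 0)"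
 using False by (simp add:fps_sum_nth div_series_def)
 ultimately show ?thesis using False by (simp add:if_distrib[of of_nat] cong:if_cong)
qed (simp add:fps_sum_nth div_series_def)

lemma logderiv_qprod_fps:
 "fps_X * fps_deriv (qprod_fps c) = - (qprod_fps c * Abs_fps (%n. if n=0 then 0 else of_nat (divs c n)))"
proof (rule fps_ext)
 fix n
 define P where "P=(\<Prod>k<Suc n. 1-fps_X ^ c k::complex fps)"
 have P: "fps_nth (qprod_fps c) i=fps_nth P i" if "i\<le>n" for i
 unfolding P_def by (rule qprod_fps_stable) (use that in simp)
 have "fps_X * fps_deriv P = - (P * (\<Sum>k<Suc n. div_series (c k)))"
 unfolding P_def by (intro logderiv_prod logderiv_one_minus_X_power c0)
 from arg_cong[OF this,of "%F. fps_nth F n"]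
 have "of_nat n * fps_nth P n = - (\<Sum>i=0..n. fps_nth P i * fps_nth (\<Sum>k<Suc n. div_series (c k)) (n-i))"
 unfolding X_deriv_nth by (simp add:fps_mult_nth)
 also have "... = - (\<Sum>i=0..n. fps_nth P i*(if n-i=0 then 0 else of_nat (divs c (n-i))))"
 by (intro arg_cong[of _ _ uminus] sum.cong refl,subst divs_eq_sum) auto
 finally show "fps_nth (fps_X * fps_deriv (qprod_fps c)) n =
 fps_nth (- (qprod_fps c * Abs_fps (%n. if n=0 then 0 else of_nat (divs c n)))) n"
 unfolding X_deriv_nth by (simp add:fps_mult_nth P del:sum.atLeast0_atMost_Suc)
qed
end

subsection \<open>Expansions of the quotients at infinity\<close>

text \<open>\<open>pos_exps\<close> and \<open>neg_exps\<close> are the exponents of q in the two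
  families of factors of Q_i: the positive integers congruent to 2i and to -2i modulo l.\<close>

definition pos_exps::"nat=>nat=>nat=>nat" where "pos_exps l i n=n * l+2 * i"
definition neg_exps::"nat=>nat=>nat=>nat" where "neg_exps l i n=Suc n * l-2 * i"

text \<open>The expansion of \<open>hquot\<close> in q without its leading power; its constant term
  is 1 and its coefficients are integers.\<close>

definition hquot_fps::"nat=>nat=>(nat=>int) => complex fps" where
 "hquot_fps l k e=(\<Prod>i=1..k. fps_powi (qprod_fps (pos_exps l i) * qprod_fps (neg_exps l i)) (e i))"

definition hquot_divs::"nat=>nat=>(nat=>int)=>nat=>int" where
 "hquot_divs l k e n=(\<Sum>i=1..k. e i*(int (divs (pos_exps l i) n)+int (divs (neg_exps l i) n)))"

context
 fixes l k::nat
 assumes l:"l=2 * k+1" and k:"k\<ge>1"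
begin
lemma exps_props:
 assumes "i\<in>{1..k}"
 shows "n\<le>pos_exps l i n" "pos_exps l i n > 0" "inj (pos_exps l i)"
 "n\<le>neg_exps l i n" "neg_exps l i n > 0" "inj (neg_exps l i)"
proof -
 have 1:"2 * i<l" "i\<ge>1" "l\<ge>1" using assms l by auto
 have 2:"n\<le>n * l" for n using 1 by simp
 show "n\<le>pos_exps l i n" "pos_exps l i n > 0" unfolding pos_exps_def using 1 2[of n] by linarith+
 have 3:"neg_exps l i n=n * l+(l-2 * i)" for n using 1 by (simp add:neg_exps_def)
 show "n\<le>neg_exps l i n" "neg_exps l i n > 0" unfolding 3 using 1 2[of n] by linarith+
 show "inj (pos_exps l i)" using 1 by (auto simp:inj_def pos_exps_def)
 show "inj (neg_exps l i)"
 proof (rule injI)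
 fix x y assume "neg_exps l i x=neg_exps l i y"
 hence "x * l=y * l" unfolding 3 by linarith
 thus "x=y" using 1 by simp
 qed
qed

lemmas exps_pos=exps_props(1-3) and exps_neg=exps_props(4-6)

lemma pair_fps:
 assumes i:"i\<in>{1..k}"
 shows "fps_nth (qprod_fps (pos_exps l i) * qprod_fps (neg_exps l i)) 0=1"
 and "int_fps (qprod_fps (pos_exps l i) * qprod_fps (neg_exps l i))"
 and "(%q. qprod (%_. 1) (pos_exps l i) q * qprod (%_. 1) (neg_exps l i) q) has_fps_expansion
 (qprod_fps (pos_exps l i) * qprod_fps (neg_exps l i))"
 by (simp add:qprod_fps_nth_0 exps_pos[OF i] exps_neg[OF i])
 (rule int_fps_mult int_qprod_fps exps_pos[OF i] exps_neg[OF i],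
 auto intro!: fps_expansion_intros int_qprod_fps has_fps_qprod_fps exps_pos[OF i] exps_neg[OF i])

lemma hquot_fps_nth_0:"fps_nth (hquot_fps l k e) 0=1"
proof -
 have "fps_nth (\<Prod>i\<in>I. A i) 0=(\<Prod>i\<in>I. fps_nth (A i) 0)" for I and A::"nat => complex fps"
 by (induction I rule:infinite_finite_induct) simp_all
 thus ?thesis unfolding hquot_fps_def by (simp only:fps_powi_nth_0 pair_fps(1) prod.neutral_const cong:prod.cong)
qed

lemma int_hquot_fps:"int_fps (hquot_fps l k e)"
 unfolding hquot_fps_def by (intro int_fps_prod int_fps_powi pair_fps) auto

lemma logderiv_hquot_fps:
 "fps_X * fps_deriv (hquot_fps l k e) = - (hquot_fps l k e * Abs_fps (%n. if n=0 then 0 else of_int (hquot_divs l k e n)))"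
proof -
 have "fps_X * fps_deriv (hquot_fps l k e) = - (hquot_fps l k e*(\<Sum>i=1..k. fps_const (of_int (e i)) *
 (Abs_fps (%n. if n=0 then 0 else of_nat (divs (pos_exps l i) n))+Abs_fps (%n. if n=0 then 0 else of_nat (divs (neg_exps l i) n)))))"
 unfolding hquot_fps_def
 by (intro logderiv_prod logderiv_powi logderiv_mult logderiv_qprod_fps pair_fps(1)) (auto intro:exps_props)
 also have "(\<Sum>i=1..k. fps_const (of_int (e i)) *
 (Abs_fps (%n. if n=0 then 0 else of_nat (divs (pos_exps l i) n))+Abs_fps (%n. if n=0 then 0 else of_nat (divs (neg_exps l i) n))))
 = Abs_fps (%n. if n=0 then 0 else (of_int (hquot_divs l k e n)::complex))"
 by (rule fps_ext) (simp add:fps_sum_nth hquot_divs_def)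
 finally show ?thesis .
qed

definition div_weight::"(nat=>int)=>nat=>int" where
 "div_weight e d=(\<Sum>i=1..k. e i*((if d\<in>range (pos_exps l i) then int d else 0) +
 (if d\<in>range (neg_exps l i) then int d else 0)))"

lemma divs_eq:"n > 0==>int (divs c n)=(\<Sum>d | d dvd n. if d\<in>range c then int d else 0)"
proof -
 assume "n > 0"
 hence "finite {d. d dvd n}" by simp
 from sum.inter_filter[OF this,of int "%d. d\<in>range c"] show ?thesis by (simp add:divs_def)
qed

lemma hquot_divs_eq:
 assumes n:"n > 0"
 shows "hquot_divs l k e n=(\<Sum>d | d dvd n. div_weight e d)"
proof -
 have "e i*(int (divs (pos_exps l i) n)+int (divs (neg_exps l i) n)) =
 (\<Sum>d | d dvd n. e i*((if d\<in>range (pos_exps l i) then int d else 0) +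
 (if d\<in>range (neg_exps l i) then int d else 0)))" for i
 by (simp only:divs_eq[OF n] sum_distrib_left distrib_left sum.distrib)
 thus ?thesis unfolding hquot_divs_def div_weight_def by (simp only:sum.swap[of _ "{d. d dvd n}"])
qed

text \<open>Since \<open>hquot_divs\<close> is the sum of \<open>div_weight\<close> over divisors,
  this is Moebius inversion, carried out by induction on n.\<close>

lemma dvd_div_weight:
 fixes N::int
 assumes "!!n. n > 0==>N dvd hquot_divs l k e n"
 shows "n > 0==>N dvd div_weight e n"
proof (induction n rule:less_induct)
 case (less n)
 have fin:"finite {d. d dvd n}" using less by simp
 have "(\<Sum>d | d dvd n. div_weight e d)=div_weight e n+(\<Sum>d\<in>{d. d dvd n}-{n}. div_weight e d)"
 by (rule sum.remove[OF fin]) simp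
 moreover have "N dvd (\<Sum>d\<in>{d. d dvd n}-{n}. div_weight e d)"
 proof (rule dvd_sum)
 fix d assume "d\<in>{d. d dvd n}-{n}"
 hence "d > 0" "d<n" using less(2) dvd_pos_nat[of n d] dvd_imp_le[of d n] by simp_all
 thus "N dvd div_weight e d" using less by blast
 qed
 ultimately show ?case using assms[OF less(2)] hquot_divs_eq[OF less(2),of e] by (metis dvd_add_left_iff)
qed

text \<open>The exponents 2i and 2i + l occur only in the family \<open>pos_exps l i\<close>: the
  remaining coincidences are ruled out by size and by the parity of l.\<close>

lemma div_weight_index:
 assumes i:"i\<in>{1..k}"
 shows "div_weight e (2 * i)=2 * int i * e i" "div_weight e (2 * i+l)=(2 * int i+int l) * e i"
proof -
 have A: "2 * i\<in>range (pos_exps l j)\<longleftrightarrow>j=i" "2 * i+l\<in>range (pos_exps l j)\<longleftrightarrow>j=i"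
 "2 * i ~: range (neg_exps l j)" "2 * i+l ~: range (neg_exps l j)" if j:"j\<in>{1..k}" for j
 proof -
 have b:"2 * i<l" "2 * j<l" using i j l by auto
 have "n=0" if "2 * i=n * l+2 * j" for n using that b by (cases n) auto
 moreover have "2 * i=pos_exps l i 0" by (simp add:pos_exps_def)
 ultimately show "2 * i\<in>range (pos_exps l j)\<longleftrightarrow>j=i"
 unfolding image_iff pos_exps_def by (metis UNIV_I add_left_imp_eq mult_left_cancel zero_neq_numeral)
 have "n=1" if n:"2 * i+l=n * l+2 * j" for n
 proof (rule ccontr)
 assume "n~=1"
 then consider "n=0" | m where "n=Suc (Suc m)" by (metis One_nat_def not0_implies_Suc)
 thus False
 proof cases
 case 1
 have "even (2 * i+l)\<longleftrightarrow>even (2 * j)" using n 1 by simp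
 thus False using l by simp
 qed (use n b in auto)
 qed
 moreover have "2 * i+l=pos_exps l i 1" by (simp add:pos_exps_def)
 ultimately show "2 * i+l\<in>range (pos_exps l j)\<longleftrightarrow>j=i"
 unfolding image_iff pos_exps_def by (metis UNIV_I add_left_imp_eq mult_left_cancel zero_neq_numeral)
 have odd:"2 * i+2 * j~=Suc n * l" for n
 proof
 assume h:"2 * i+2 * j=Suc n * l"
 show False
 proof (cases n)
 case 0
 hence "even l" using h by (metis One_nat_def dvd_add dvd_triv_left mult_1)
 thus False using l by simp
 qed (use h b in auto)
 qed
 have ng:"neg_exps l j n+2 * j=Suc n * l" for n using b by (simp add:neg_exps_def)
 show "2 * i ~: range (neg_exps l j)" using ng odd by (metis rangeE)
 show "2 * i+l ~: range (neg_exps l j)"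
 proof
 assume "2 * i+l\<in>range (neg_exps l j)"
 then obtain n where "2 * i+l+2 * j=Suc n * l" using ng by (metis rangeE)
 hence h:"2 * i+2 * j=n * l" by simp
 show False using odd[of "n-1"] h i by (cases n) auto
 qed
 qed
 have S: "(\<Sum>j=1..k. e j*(if j=i then x else 0))=x * e i" for x
 using i by (simp add:if_distrib cong:if_cong)
 have "div_weight e (2 * i)=(\<Sum>j=1..k. e j*(if j=i then int (2 * i) else 0))"
 unfolding div_weight_def by (intro sum.cong refl) (simp add:A)
 thus "div_weight e (2 * i)=2 * int i * e i" by (simp only:S; simp)
 have "div_weight e (2 * i+l)=(\<Sum>j=1..k. e j*(if j=i then int (2 * i+l) else 0))"
 unfolding div_weight_def by (intro sum.cong refl) (simp add:A)
 thus "div_weight e (2 * i+l)=(2 * int i+int l) * e i" by (simp only:S; simp)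
qed

text \<open>Evaluating the weights at 2i and 2i + l shows that N divides 2i e_i and, after
  subtraction, l e_i. As 2i and l are coprime, N divides e_i; the choice N = 0 gives
  vanishing.\<close>

lemma dvd_exponents:
 fixes N::int
 assumes N: "!!n. n > 0==>N dvd hquot_divs l k e n" and i:"i\<in>{1..k}" and cop:"coprime i l"
 shows "N dvd e i"
proof -
 have 1:"N dvd 2 * int i * e i" "N dvd (2 * int i+int l) * e i"
 unfolding div_weight_index[OF i,symmetric] by (rule dvd_div_weight[OF N]; use i in simp)+
 have "odd l" using l by simp
 hence "coprime (2 * i) l" using cop by (simp add:coprime_left_2_iff_odd)
 hence "coprime (int (2 * i)) (int l)" by (simp only:coprime_int_iff)
 hence "coprime (2 * int i) (int l)" by (simp only:of_nat_mult of_nat_numeral)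
 then obtain u v where uv:"u*(2 * int i) + v * int l=1" by (metis bezout_int coprime_imp_gcd_eq_1)
 have "N dvd int l * e i" using dvd_diff[OF 1(2) 1(1)] by (simp add:algebra_simps)
 hence "N dvd u*(2 * int i * e i) + v * (int l * e i)" using 1(1) by simp
 also have "u*(2 * int i * e i) + v * (int l * e i)=(u*(2 * int i) + v * int l) * e i" by (simp add:algebra_simps)
 finally show ?thesis unfolding uv by simp
qed

lemma hsiegel_eq_qprod:
 assumes i:"i\<in>{1..k}" and tau:"Im tt > 0"
 shows "hsiegel l i tt = - qpow (cusp_bern l 1 0 i) tt *
 (qprod (%_. 1) (pos_exps l i) (ee tt) * qprod (%_. 1) (neg_exps l i) (ee tt))"
proof -
 define a where "a=2 * real i/real l"
 have b:"2 * i<l" "l > 0" using i l by auto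
 have a:"0\<le>a" "a<1" using b by (simp_all add:a_def)
 have "bern l (2 * int i)=(a\<^sup>2-a+1/6)/2"
 using frac_eq[of a] a unfolding bern_def a_def by simp
 hence cb:"cusp_bern l 1 0 i=real l*((a\<^sup>2-a+1/6)/2)" by (simp add:cusp_bern_def)
 have E: "qpow x (of_nat l * tt)=qpow (real l * x) tt" for x by (simp add:qpow_eq_ee mult_ac)
 have q:"norm (ee tt)<1" using tau by (simp add:norm_ee)
 have pw:"qpow (real n) tt=ee tt ^ n" for n by (simp add:qpow_eq_ee ee_power)
 have l1:"real l*(real n+a)=real (pos_exps l i n)" for n using b by (simp add:a_def pos_exps_def algebra_simps)
 have "real (neg_exps l i n)=real (Suc n * l)-real (2 * i)" for n
 unfolding neg_exps_def using b by (intro of_nat_diff) simp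
 hence l2:"real l*(real (Suc n)-a)=real (neg_exps l i n)" for n using b by (simp add:a_def algebra_simps)
 have c1:"convergent_prod (%n. 1-1 * ee tt ^ pos_exps l i n)" "convergent_prod (%n. 1-1 * ee tt ^ neg_exps l i n)"
 by (rule qprod_convergent[where W=1]; use exps_props[OF i] q in auto)+
 show ?thesis unfolding hsiegel_def siegel_def a_def[symmetric] E l1 l2 pw cb qprod_def prodinf_mult[OF c1]
 by simp
qed

lemma hquot_integral_qexp:
 assumes e:"(\<Sum>i=1..k. e i)=0"
 shows "EX n. of_int n=real l * hquot_ord l k e 1 0&has_qexp l (hquot l k e) (spread l n (hquot_fps l k e))"
proof -
 have l0:"l > 0" using l by simp
 obtain F::"complex fls" where F: "of_int (fls_subdegree F)=real l * hquot_ord l k e 1 0"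
 using hquot_has_qexp[OF l k mat1_in_SL2Z e] by auto
 define G where "G i q=qprod (%_. 1) (pos_exps l i) q * qprod (%_. 1) (neg_exps l i) q" for i q
 have "has_qexp l (hquot l k e) (spread l (fls_subdegree F) (hquot_fps l k e))"
 proof (rule has_qexp_spread[OF l0])
 show "(%q. \<Prod>i=1..k. G i q powi e i) has_fps_expansion hquot_fps l k e"
 unfolding hquot_fps_def G_def
 by (intro has_fps_expansion_prod has_fps_expansion_powi pair_fps) (simp_all only:pair_fps(1) one_neq_zero not_False_eq_True)
 fix tt::complex assume tau:"Im tt > 0"
 have "hquot l k e tt=(\<Prod>i=1..k. (-1) powi e i*(qpow (of_int (e i) * cusp_bern l 1 0 i) tt * G i (ee tt) powi e i))"
 unfolding hquot_def
 proof (intro prod.cong refl)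
 fix i assume "i\<in>{1..k}"
 have "hsiegel l i tt=(-1)*(qpow (cusp_bern l 1 0 i) tt * G i (ee tt))"
 unfolding hsiegel_eq_qprod[OF \<open>i\<in>{1..k}\<close> tau] G_def by simp
 thus "hsiegel l i tt powi e i=(-1) powi e i*(qpow (of_int (e i) * cusp_bern l 1 0 i) tt * G i (ee tt) powi e i)"
 by (simp only:power_int_mult_distrib qpow_power_int)
 qed
 \<comment> \<open>The signs (-1)^(e_i) multiply to 1 because the exponents sum to 0.\<close>
 also have "...=qpow (hquot_ord l k e 1 0) tt*(\<Prod>i=1..k. G i (ee tt) powi e i)"
 using e by (simp add:prod.distrib prod_power_int prod_qpow hquot_ord_def)
 finally show "hquot l k e tt=qpow (of_int (fls_subdegree F)/real l) tt*(\<Prod>i=1..k. G i (ee tt) powi e i)"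
 using F l0 by simp
 qed
 with F show ?thesis by blast
qed
end

subsection \<open>Cusps\<close>

text \<open>Homogeneous coordinates on the extended plane, which treat infinity and finite points
  alike.\<close>

definition proj1::"complex => complex => complex option" where
 "proj1 u v=(if v=0 then None else Some (u / v))"

lemma ext_moebius_proj1:
 assumes "u~=0 | v~=0"
 shows "ext_moebius gg (proj1 u v) =
 proj1 (of_int (gg$1$1) * u + of_int (gg$1$2) * v) (of_int (gg$2$1) * u + of_int (gg$2$2) * v)"
proof (cases "v=0")
 case True
 thus ?thesis using assms by (simp add:proj1_def)
next
 case False
 have q:"of_int a*(u / v) + of_int b=(of_int a * u + of_int b * v) / v" for a b::int
 using False by (simp add:add_divide_distrib)
 have gen:"(if B / v=0 then None else Some ((A / v)/(B / v)))=proj1 A B" for A B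
 using False by (simp add:proj1_def)
 have "proj1 u v=Some (u / v)" using False by (simp add:proj1_def)
 thus ?thesis by (simp only:ext_moebius.simps moebius_def q gen)
qed

lemma ext_moebius_mult:
 assumes "A\<in>SL2Z" "B\<in>SL2Z"
 shows "ext_moebius (A ** B) x=ext_moebius A (ext_moebius B x)"
proof -
 obtain u v where uv:"x=proj1 u v" "u~=0 | v~=0"
 proof (cases x)
 case None thus ?thesis using that[of 1 0] by (simp add:proj1_def)
 next
 case (Some z) thus ?thesis using that[of z 1] by (simp add:proj1_def)
 qed
 define p q r s where "p=B$1$1" and "q=B$1$2" and "r=B$2$1" and "s=B$2$2"
 have det:"p * s-q * r=1" using assms(2) by (simp add:mat2_exhaust p_def q_def r_def s_def)
 have detc:"of_int p * of_int s - of_int q * of_int r=(1::complex)"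
 using arg_cong[OF det,of of_int] by simp
 have nz:"of_int p * u + of_int q * v~=0 | of_int r * u + of_int s * v~=0"
 proof (rule ccontr)
 assume "~ ?thesis"
 hence z:"of_int p * u + of_int q * v=0" "of_int r * u + of_int s * v=0" by auto
 have "u=(of_int p * of_int s - of_int q * of_int r) * u" unfolding detc by simp
 also have "... = of_int s*(of_int p * u + of_int q * v) - of_int q*(of_int r * u + of_int s * v)"
 by (simp add:algebra_simps)
 finally have "u=0" using z by simp
 have "v=(of_int p * of_int s - of_int q * of_int r) * v" unfolding detc by simp
 also have "... = of_int p*(of_int r * u + of_int s * v) - of_int r*(of_int p * u + of_int q * v)"
 by (simp add:algebra_simps)
 finally have "v=0" using z by simp
 show False using \<open>u=0\<close> \<open>v=0\<close> uv by simp
 qed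
 show ?thesis
 unfolding uv(1) ext_moebius_proj1[OF uv(2)] p_def[symmetric] q_def[symmetric] r_def[symmetric] s_def[symmetric]
 ext_moebius_proj1[OF nz]
 by (simp add:matrix_mult_2 p_def q_def r_def s_def algebra_simps)
qed

lemma ext_moebius_mat1 [simp]:"ext_moebius (mat 1) x=x"
 by (cases x) (simp_all add:moebius_def)

lemma ext_moebius_minv:"gg\<in>SL2Z==>ext_moebius (minv gg) (ext_moebius gg x)=x"
 using ext_moebius_mult[of "minv gg" gg x] by (simp add:minv_mult minv_in_SL2Z)

lemma Gamma0_iff:"gg\<in>Gamma0 l\<longleftrightarrow>gg\<in>SL2Z&int l dvd gg$2$1"
 by (auto simp:Gamma0_def)

lemma Gamma0_mult:"A\<in>Gamma0 l==>B\<in>Gamma0 l==>A ** B\<in>Gamma0 l"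
 by (auto simp:Gamma0_iff matrix_mult_2)

lemma Gamma0_minv:"A\<in>Gamma0 l==>minv A\<in>Gamma0 l"
 by (auto simp:Gamma0_iff minv_def[of A] intro:minv_in_SL2Z[unfolded minv_def])

lemma mat1_in_Gamma0 [simp]:"mat 1\<in>Gamma0 l" by (simp add:Gamma0_iff)

lemma mat1_in_Gamma_princ [simp]:"mat 1\<in>Gamma_princ l" by (simp add:Gamma_princ_iff)

lemma Gamma_princ_subset_Gamma0:"Gamma_princ l \<subseteq> Gamma0 l"
 by (auto simp:Gamma_princ_iff Gamma0_iff)

lemma orbit_Gamma0_eq:
 assumes "\<delta>\<in>Gamma0 l"
 shows "orbit_of (Gamma0 l) (ext_moebius \<delta> y) = orbit_of (Gamma0 l) y"
proof -
 have sub:"orbit_of (Gamma0 l) (ext_moebius \<delta> y) \<subseteq> orbit_of (Gamma0 l) y" if "\<delta>\<in>Gamma0 l" for \<delta> y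
 unfolding orbit_of_def
 proof (rule image_subsetI)
 fix gg assume g:"gg\<in>Gamma0 l"
 have "ext_moebius gg (ext_moebius \<delta> y)=ext_moebius (gg ** \<delta>) y"
 using g that by (simp add:ext_moebius_mult Gamma0_iff)
 thus "ext_moebius gg (ext_moebius \<delta> y)\<in>(%gg. ext_moebius gg y) ` Gamma0 l"
 using Gamma0_mult[OF g that] by blast
 qed
 have "ext_moebius (minv \<delta>) (ext_moebius \<delta> y)=y"
 using assms by (simp add:ext_moebius_minv Gamma0_iff)
 thus ?thesis using sub[OF assms,of y] sub[OF Gamma0_minv[OF assms],of "ext_moebius \<delta> y"] by auto
qed

lemma curve_proj_orbit:"curve_proj (Gamma0 l) (orbit_of (Gamma_princ l) y) = orbit_of (Gamma0 l) y"
proof -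
 have "orbit_of (Gamma0 l) x = orbit_of (Gamma0 l) y" if "x \<in> orbit_of (Gamma_princ l) y" for x
 using that orbit_Gamma0_eq[of _ l y] Gamma_princ_subset_Gamma0[of l] unfolding orbit_of_def[of "Gamma_princ l"] by blast
 moreover have "y \<in> orbit_of (Gamma_princ l) y"
 unfolding orbit_of_def by (rule image_eqI[of _ _ "mat 1"]) simp_all
 ultimately show ?thesis unfolding curve_proj_def by blast
qed

lemma cusps_above_infI:
 assumes "P\<in>modular_curve (Gamma_princ l)" "gg\<in>Gamma0 l" "ext_moebius gg None\<in>P"
 shows "P \<in> cusps_above_inf l"
proof -
 obtain y where y:"P = orbit_of (Gamma_princ l) y" using assms(1) by (auto simp:modular_curve_def)
 obtain \<delta> where d:"\<delta>\<in>Gamma_princ l" "ext_moebius gg None=ext_moebius \<delta> y"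
 using assms(3) unfolding y orbit_of_def by blast
 have "orbit_of (Gamma0 l) y = orbit_of (Gamma0 l) None"
 using orbit_Gamma0_eq[OF assms(2),of None] orbit_Gamma0_eq[of \<delta> l y] d Gamma_princ_subset_Gamma0[of l] by auto
 thus ?thesis using assms(1) by (simp add:cusps_above_inf_def y curve_proj_orbit)
qed

lemma cusps_above_infD:
 assumes "P \<in> cusps_above_inf l" "x\<in>P"
 shows "\<exists>gg\<in>Gamma0 l. x=ext_moebius gg None"
proof -
 have "x \<in> orbit_of (Gamma0 l) x"
 unfolding orbit_of_def by (rule image_eqI[of _ _ "mat 1"]) simp_all
 hence "x \<in> curve_proj (Gamma0 l) P" using assms(2) by (auto simp:curve_proj_def)
 thus ?thesis using assms(1) by (auto simp:cusps_above_inf_def orbit_of_def)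
qed

lemma ext_moebius_None_not_uhp:"ext_moebius gg None ~: Some ` uhp"
proof -
 have "Im (of_int a / of_int b::complex)=0" for a b::int
 by (metis Im_complex_of_real of_real_divide of_real_of_int_eq)
 thus ?thesis by (auto simp:uhp_def)
qed

lemma cusp_cases:
 assumes "P\<in>modular_curve (Gamma_princ l)" "x\<in>P" "x ~: Some ` uhp"
 shows "\<exists>gg\<in>SL2Z. x=ext_moebius gg None"
proof -
 obtain y \<delta> where y:"y\<in>ext_uhp" "\<delta>\<in>SL2Z" "x=ext_moebius \<delta> y"
 using assms(1,2) Gamma_princ_subset[of l] by (auto simp:modular_curve_def orbit_of_def)
 from y(1) consider "y=None" | z where "z\<in>uhp" "y=Some z" | r where "r\<in>\<rat>" "y=Some r"
 by (auto simp:ext_uhp_def)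
 thus ?thesis
 proof cases
 case 2
 have "autom \<delta> z~=0" using autom_nonzero[OF y(2)] 2 by (simp add:uhp_def)
 hence "x=Some (moebius \<delta> z)" using y(3) 2 by (simp add:autom_def)
 thus ?thesis using assms(3) moebius_in_uhp[OF y(2) 2(1)] by blast
 next
 case 3
 obtain p q::int where pq:"q > 0" "coprime p q" "r = of_int p / of_int q"
 using Rats_cases'[OF 3(1)] by metis
 obtain s t where st:"p * s+q * t=1" using pq(2) by (metis bezout_int coprime_imp_gcd_eq_1 mult.commute)
 define gg where "gg=mat2 p (- t) q s"
 have g:"gg\<in>SL2Z" using st by (simp add:gg_def mat2_exhaust algebra_simps)
 have "y=ext_moebius gg None" using pq 3 by (simp add:gg_def)
 thus ?thesis using y(2,3) g ext_moebius_mult[OF y(2) g] SL2Z_mult[OF y(2) g] by metis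
 qed (use y in blast)
qed

text \<open>The quotient of the two matrices fixes infinity, so it is upper triangular with diagonal
  entries both 1 or both -1 and acts as a translation.\<close>

lemma same_cusp:
 assumes "gg\<in>SL2Z" "gg'\<in>SL2Z" "ext_moebius gg None=ext_moebius gg' None"
 shows "EX m. \<forall>z\<in>uhp. moebius gg' z=moebius gg (z + of_int m)"
proof -
 define \<delta> where "\<delta>=minv gg ** gg'"
 have d:"\<delta>\<in>SL2Z" using assms by (auto simp: \<delta>_def)
 have gd:"gg ** \<delta>=gg'" unfolding \<delta>_def matrix_mul_assoc using assms by (simp add:minv_mult)
 have "ext_moebius \<delta> None=None"
 unfolding \<delta>_def using assms by (simp add:ext_moebius_mult minv_in_SL2Z ext_moebius_minv flip:assms(3) del:ext_moebius.simps)
 hence c0:"\<delta>$2$1=0" by (simp split:if_splits)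
 have ad:"\<delta>$1$1*\<delta>$2$2=1" using d c0 by (simp add:mat2_exhaust)
 hence pm:"\<delta>$1$1=1&\<delta>$2$2=1 | \<delta>$1$1 = -1&\<delta>$2$2 = -1" by (simp add:zmult_eq_1_iff)
 have "moebius gg' z=moebius gg (z + of_int (\<delta>$1$2*\<delta>$2$2))" if z:"z\<in>uhp" for z
 proof -
 have "moebius \<delta> z=z + of_int (\<delta>$1$2*\<delta>$2$2)" using pm c0 by (auto simp:moebius_def)
 thus ?thesis using moebius_mult[OF assms(1) d,of z] z gd by (simp add:uhp_def)
 qed
 thus ?thesis by blast
qed

text \<open>Modulo l both matrices are upper triangular of determinant 1, so the diagonal is fixed
  by the upper left entry up to the common sign, and a translation adjusts the upper right
  entry.\<close>

lemma congruent_cusp: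
 assumes g:"gg\<in>SL2Z" "gg'\<in>SL2Z" and c:"int l dvd gg$2$1" "int l dvd gg'$2$1"
 and a:"int l dvd gg'$1$1-eps * gg$1$1" and eps:"eps=1 | eps = -1"
 shows "EX m. cong_pm l gg' (gg ** T_mat m)"
proof -
 define p q r s where "p=gg$1$1" and "q=gg$1$2" and "r=gg$2$1" and "s=gg$2$2"
 define p' q' r' s' where "p'=gg'$1$1" and "q'=gg'$1$2" and "r'=gg'$2$1" and "s'=gg'$2$2"
 note defs=p_def q_def r_def s_def p'_def q'_def r'_def s'_def
 have det:"p * s=1+q * r" "p' * s'=1+q' * r'" using g by (simp_all add:mat2_exhaust defs)
 obtain u where u:"r=int l * u" using c by (auto simp:defs)
 obtain u' where u':"r'=int l * u'" using c by (auto simp:defs)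
 obtain v where v:"p'-eps * p=int l * v" using a by (auto simp:defs)
 have e2:"eps * eps=1" using eps by auto
 \<comment> \<open>Solves p m + q = eps q' modulo l, using p s = 1 modulo l.\<close>
 define m where "m = s*(eps * q'-q)"
 have 1:"q'-eps*(p * m+q)=int l*(- eps * q * u*(eps * q'-q))"
 proof -
 have "eps*(p * m+q)=eps*((p * s)*(eps * q'-q)+q)" by (simp add:m_def algebra_simps)
 also have "...=(eps * eps) * q'+eps * q * r*(eps * q'-q)" unfolding det by (simp add:algebra_simps)
 finally show ?thesis unfolding e2 u by (simp add:algebra_simps)
 qed
 have 2:"int l dvd p*(s'-eps * s)"
 proof -
 have "p=(eps * eps) * p" unfolding e2 by simp
 also have "...=eps*(p'-int l * v)" unfolding v[symmetric] by (simp add:algebra_simps)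
 finally have p:"p=eps*(p'-int l * v)" .
 have "p * s'=eps*(p' * s')-eps * int l * v * s'" by (subst p) (simp add:algebra_simps)
 hence "p*(s'-eps * s)=eps*(p' * s')-eps * int l * v * s'-eps*(p * s)"
 by (simp add:right_diff_distrib)
 also have "...=int l*(eps * q' * u'-eps * v * s'-eps * q * u)" unfolding det u u' by (simp add:algebra_simps)
 finally show ?thesis by simp
 qed
 have 3:"int l dvd s'-eps*(r * m + s)"
 proof -
 have "s'-eps * s=(p * s-q * r)*(s'-eps * s)" using det by simp
 also have "... = s*(p*(s'-eps * s))-int l*(q * u*(s'-eps * s))" unfolding u by (simp add:algebra_simps)
 finally have 31:"int l dvd s'-eps * s" using 2 by (metis dvd_diff dvd_mult dvd_triv_left)
 have eq:"s'-eps*(r * m + s)=(s'-eps * s)-int l*(eps * u * m)" unfolding u by (simp add:algebra_simps)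
 show ?thesis unfolding eq by (rule dvd_diff[OF 31 dvd_triv_left])
 qed
 have 4:"int l dvd r'-eps * r" unfolding u u' by simp
 have 5:"int l dvd p'-eps * p" unfolding v by simp
 have "cong_pm l gg' (gg ** T_mat m)"
 unfolding cong_pm_def
 proof (rule bexI[of _ eps])
 show "ALL i j. int l dvd gg'$i$j-eps*(gg ** T_mat m)$i$j"
 using 1 3 4 5 by (simp add:forall_2 matrix_mult_2 T_mat_def defs[symmetric] mult.commute[of m])
 qed (use eps in auto)
 thus ?thesis by blast
qed

subsection \<open>Orders at the cusps\<close>
text \<open>Translation multiplies the leading coefficient by a nonzero constant. In particular, the
  order at a cusp does not depend on the matrix carrying infinity to it.\<close>

lemma qexp_shift_order:
 assumes l:"l > 0" and F: "has_qexp l f F" "F~=0" and G: "has_qexp l g G"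
 and g:"!!z. z\<in>uhp==>g z=f (z + of_int m)"
 shows "G~=0&fls_subdegree G=fls_subdegree F"
proof -
 define x where "x = - of_int (fls_subdegree F)/real l"
 define \<kappa> where "\<kappa>=qpow x (of_int m)"
 have k0:"\<kappa>~=0" by (simp add: \<kappa>_def qpow_eq_ee)
 have sh:"filterlim (%tt. tt + of_int m) at_cusp at_cusp"
 unfolding filterlim_iff eventually_at_cusp
 proof (intro allI impI)
 fix P::"complex=>bool" assume "EX y. ALL z. y<Im z-->P z"
 then obtain y where "ALL z. y<Im z-->P z" by blast
 thus "EX y. ALL z. y<Im z-->P (z + of_int m)" by (intro exI[of _ y]) simp
 qed
 have "((%tt. f (tt + of_int m) * qpow x (tt + of_int m)) \<longlongrightarrow> fls_nth F (fls_subdegree F)) at_cusp"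
 using filterlim_compose[OF has_qexp_lead_tendsto[OF l F] sh] unfolding x_def .
 moreover have "qpow x (tt + of_int m)=qpow x tt*\<kappa>" for tt
 by (simp add: \<kappa>_def qpow_eq_ee ring_distribs ee_add)
 ultimately have "((%tt. f (tt + of_int m)*(qpow x tt*\<kappa>)/\<kappa>) \<longlongrightarrow> fls_nth F (fls_subdegree F)/\<kappa>) at_cusp"
 using k0 by (intro tendsto_divide tendsto_const) simp_all
 moreover have "eventually (%tt. f (tt + of_int m)*(qpow x tt*\<kappa>)/\<kappa>=g tt * qpow x tt) at_cusp"
 using eventually_at_cusp_uhp by eventually_elim (simp add:g k0)
 ultimately have L: "((%tt. g tt * qpow x tt) \<longlongrightarrow> fls_nth F (fls_subdegree F)/\<kappa>) at_cusp"
 by (rule Lim_transform_eventually)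
 show ?thesis by (rule has_qexp_order_iff[OF l G _ L[unfolded x_def]]) (use F k0 in simp)
qed

lemma order_at_cusp:
 assumes l:"l > 0" and gg:"gg\<in>SL2Z" and F: "has_qexp l (%z. eval_mero f (moebius gg z)) F" "F~=0"
 shows "order_at l f (ext_moebius gg None)=fls_subdegree F"
proof -
 have "(THE n. \<exists>gg'\<in>SL2Z. EX F. ext_moebius gg' None=ext_moebius gg None &
 has_qexp l (%z. eval_mero f (moebius gg' z)) F&n=fls_subdegree F)=fls_subdegree F"
 proof (rule the_equality)
 fix n assume "\<exists>gg'\<in>SL2Z. EX F. ext_moebius gg' None=ext_moebius gg None &
 has_qexp l (%z. eval_mero f (moebius gg' z)) F&n=fls_subdegree F"
 then obtain gg' G where G: "gg'\<in>SL2Z" "ext_moebius gg' None=ext_moebius gg None"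
 "has_qexp l (%z. eval_mero f (moebius gg' z)) G" "n=fls_subdegree G" by blast
 obtain m where "\<forall>z\<in>uhp. moebius gg' z=moebius gg (z + of_int m)"
 using same_cusp[OF gg G(1) G(2)[symmetric]] by blast
 thus "n=fls_subdegree F" using qexp_shift_order[OF l F G(3),of m] G(4) by simp
 qed (use gg F in blast)
 thus ?thesis using ext_moebius_None_not_uhp[of gg] unfolding order_at_def by simp
qed

lemma order_congruent_cusp:
 assumes l:"l > 0" and g:"gg\<in>SL2Z" "gg'\<in>SL2Z" and c:"int l dvd gg$2$1" "int l dvd gg'$2$1"
 and a:"int l dvd gg'$1$1-eps * gg$1$1" and eps:"eps=1 | eps = -1"
 and f:"Gamma_inv l f" and F: "has_qexp l (%z. f (moebius gg z)) F" "F~=0"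
 and G: "has_qexp l (%z. f (moebius gg' z)) G"
 shows "fls_subdegree G=fls_subdegree F"
proof -
 obtain m where m:"cong_pm l gg' (gg ** T_mat m)" using congruent_cusp[OF g c a eps] by blast
 have "f (moebius gg' z)=f (moebius gg (z + of_int m))" if "z\<in>uhp" for z
 using cong_pm_imp_eq[OF g(2) _ m f that] moebius_mult[OF g(1),of "T_mat m" z] g that by (auto simp:uhp_def)
 thus ?thesis using qexp_shift_order[OF l F G,of m] by blast
qed

lemma fls_prod_nonzero:
 fixes F::"'i => complex fls"
 assumes "finite I" "!!i. i\<in>I==>F i~=0"
 shows "(\<Prod>i\<in>I. F i)~=0&fls_subdegree (\<Prod>i\<in>I. F i)=(\<Sum>i\<in>I. fls_subdegree (F i))"
 using assms by (induction I rule:finite_induct) auto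

context
 fixes l::nat and R::"(int^2^2) set"
 assumes l:"l > 0" and R: "reps l R"
begin
lemma reps_props:"finite R" "R \<subseteq> SL2Z" "R~={}"
 using R mat1_in_SL2Z unfolding reps_def by blast+

lemma compose_moebius_holomorphic:"f holomorphic_on uhp==>gg\<in>SL2Z==>(%z. f (moebius gg z)) holomorphic_on uhp"
 using holomorphic_on_compose_gen[of "moebius gg" uhp f uhp] moebius_holomorphic[of gg] moebius_in_uhp
 by (auto simp:o_def image_subset_iff)

text \<open>The product of all conjugates has level one. If the sum of orders were positive it would
  vanish at infinity, hence everywhere, contradicting the absence of zeros. Applied also to 1/f this
  gives equality.\<close>

lemma norm_order_nonpos:
 assumes f:"Gamma_inv l f" "f holomorphic_on uhp" "!!z. z\<in>uhp==>f z~=0"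
 and F: "!!sg. sg \<in> R==>has_qexp l (%z. f (moebius sg z)) (F sg)&F sg~=0"
 shows "(\<Sum>sg\<in>R. fls_subdegree (F sg))\<le>0"
proof (rule ccontr)
 assume "~ ?thesis"
 hence pos:"fls_subdegree (\<Prod>sg\<in>R. F sg) > 0" using fls_prod_nonzero[OF reps_props(1),of F] F by simp
 define N where "N z=(\<Prod>sg\<in>R. f (moebius sg z))" for z
 have q:"has_qexp l N (\<Prod>sg\<in>R. F sg)" unfolding N_def by (rule has_qexp_prod[OF l]) (use F in blast)
 have "(N \<longlongrightarrow> fls_nth (\<Prod>sg\<in>R. F sg) 0) at_cusp" by (rule has_qexp_tendsto[OF l q]) (use pos in simp)
 hence lim:"(N \<longlongrightarrow> 0) at_cusp" using fls_eq0_below_subdegree[OF pos] by simp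
 have "N \<i>=0"
 proof (rule level_one_vanishing[OF _ _ lim])
 show "N holomorphic_on uhp" unfolding N_def
 by (rule holomorphic_on_prod,rule compose_moebius_holomorphic) (use f reps_props in auto)
 show "N (moebius gg z)=N z" if "gg\<in>SL2Z" "z\<in>uhp" for gg z
 unfolding N_def using reps_prod_invariant(1)[OF R that(1) f(1) f(1) that(2),of "%x. x"] .
 qed (simp add:uhp_def)
 moreover have "N \<i>~=0" unfolding N_def using f(3) moebius_in_uhp reps_props by (auto simp:uhp_def)
 ultimately show False by simp
qed

lemma norm_order_eq_0:
 assumes f:"Gamma_inv l f" "f holomorphic_on uhp" "!!z. z\<in>uhp==>f z~=0"
 and F: "!!sg. sg \<in> R==>has_qexp l (%z. f (moebius sg z)) (F sg)&F sg~=0"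
 shows "(\<Sum>sg\<in>R. fls_subdegree (F sg))=0"
proof -
 have "(\<Sum>sg\<in>R. fls_subdegree (inverse (F sg)))\<le>0"
 proof (rule norm_order_nonpos[where f = "%z. inverse (f z)"])
 show "Gamma_inv l (%z. inverse (f z))" using f(1) by (simp add:Gamma_inv_def)
 show "(%z. inverse (f z)) holomorphic_on uhp" using f by (intro holomorphic_intros)
 show "has_qexp l (%z. inverse (f (moebius sg z))) (inverse (F sg))&inverse (F sg)~=0" if "sg \<in> R" for sg
 using has_qexp_inverse[OF l,of "%z. f (moebius sg z)" "F sg"] F[OF that] by simp
 qed (use f in simp)
 moreover have "(\<Sum>sg\<in>R. fls_subdegree (inverse (F sg))) = - (\<Sum>sg\<in>R. fls_subdegree (F sg))"
 unfolding sum_negf[symmetric] by (intro sum.cong refl) (use F fls_inverse_subdegree in auto)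
 ultimately show ?thesis using norm_order_nonpos[OF f F] by simp
qed

text \<open>Take the norm of f - c, where c is the value of f at one cusp. It vanishes at infinity,
  so it is zero, and in a field one factor must be zero.\<close>

lemma constant_if_orders_0:
 assumes f:"Gamma_inv l f" "f holomorphic_on uhp"
 and F: "!!sg. sg \<in> R==>has_qexp l (%z. f (moebius sg z)) (F sg)&fls_subdegree (F sg)=0"
 shows "EX c. \<forall>z\<in>uhp. f z = c"
proof -
 obtain sg0 where s0:"sg0 \<in> R" using reps_props by blast
 define c where "c=fls_nth (F sg0) 0"
 define N where "N z=(\<Prod>sg\<in>R. f (moebius sg z) - c)" for z
 have hol:"(%z. f (moebius sg z) - c) holomorphic_on uhp" if "sg \<in> R" for sg
 using that reps_props f by (intro holomorphic_intros compose_moebius_holomorphic) auto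
 have Nhol:"N holomorphic_on uhp" unfolding N_def by (rule holomorphic_on_prod) (rule hol)
 have N0:"N z=0" if z:"z\<in>uhp" for z
 proof (rule level_one_vanishing[OF Nhol _ _ z])
 show "N (moebius gg z)=N z" if "gg\<in>SL2Z" "z\<in>uhp" for gg z
 unfolding N_def using reps_prod_invariant(1)[OF R that(1) f(1) f(1) that(2),of "%x. x - c"] .
 have "(N \<longlongrightarrow> (\<Prod>sg\<in>R. fls_nth (F sg) 0 - c)) at_cusp" unfolding N_def
 proof (intro tendsto_prod tendsto_diff tendsto_const)
 fix sg assume "sg \<in> R"
 show "((%z. f (moebius sg z)) \<longlongrightarrow> fls_nth (F sg) 0) at_cusp"
 by (rule has_qexp_tendsto[OF l]) (use F[OF \<open>sg \<in> R\<close>] in auto)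
 qed
 moreover have "(\<Prod>sg\<in>R. fls_nth (F sg) 0 - c)=0" using s0 reps_props by (auto simp:c_def)
 ultimately show "(N \<longlongrightarrow> 0) at_cusp" by simp
 qed
 have "(\<Prod>sg\<in>R. mero (%z. f (moebius sg z) - c))=mero N"
 unfolding N_def by (rule mero_prod) (rule hol)
 also have "...=mero (%_. 0)" using Nhol N0 by (intro mero_cong) auto
 also have "...=0" by (simp add:zero_mero_uhp_def)
 finally obtain sg where s:"sg \<in> R" "mero (%z. f (moebius sg z) - c)=mero (%_. 0)"
 using reps_props by (auto simp:zero_mero_uhp_def[symmetric])
 have sS: "sg\<in>SL2Z" using s reps_props by auto
 have eq:"f (moebius sg z) = c" if "z\<in>uhp" for z
 using s(2) mero_eq_iff[OF hol[OF s(1)],of "%_. 0"] that by auto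
 have "f w = c" if w:"w\<in>uhp" for w
 using eq[of "moebius (minv sg) w"] moebius_minv(1)[OF sS,of w] moebius_in_uhp[OF minv_in_SL2Z[OF sS] w] w
 by (simp add:uhp_def)
 thus ?thesis by blast
qed
end

subsection \<open>Orders of the quotients\<close>
lemma bern_periodic:
 assumes "l > 0" shows "bern l (u+int l * m)=bern l u"
proof -
 have "of_int (u+int l * m)/real l = of_int u/real l + of_int m"
 using assms by (simp add:add_divide_distrib)
 moreover have "frac (x + of_int m)=frac x" for x::real by (simp add:frac_def)
 ultimately show ?thesis by (simp add:bern_def)
qed

lemma bern_minus:"bern l (- u)=bern l u"
proof -
 define x where "x = of_int u/real l"
 have "(frac (- x))\<^sup>2-frac (- x)=(frac x)\<^sup>2-frac x"
 proof (cases "x\<in>\<int>")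
 case True
 hence fx:"frac x=0" "frac (- x)=0" by (simp_all add:frac_eq_0_iff Ints_minus)
 show ?thesis unfolding fx ..
 next
 case False
 thus ?thesis by (simp add:frac_neg power2_eq_square algebra_simps)
 qed
 thus ?thesis by (simp add:bern_def x_def)
qed

lemma bern_cong:"l > 0==>int l dvd u - v==>bern l u=bern l v"
proof -
 assume l:"l > 0" "int l dvd u - v"
 then obtain m where "u - v=int l * m" by (elim dvdE)
 hence "u = v+int l * m" by linarith
 thus ?thesis using bern_periodic[OF l(1)] by simp
qed

lemma bern_value:
 assumes "0\<le>u" "u<int l"
 shows "bern l u=((of_int u/real l)\<^sup>2 - of_int u/real l+1/6)/2"
proof -
 have "real_of_int u<real l" using assms(2) by (metis of_int_less_iff of_int_of_nat_eq)
 hence "frac (of_int u/real l) = of_int u/real l" using assms by (intro frac_eq[THEN iffD2]) auto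
 thus ?thesis by (simp add:bern_def)
qed

lemma cusp_bern_dvd:
 assumes "l > 0" "int l dvd c"
 shows "cusp_bern l a c i=real l * bern l (2*(int i * a))"
proof -
 have "bern l (2*(int i * a+int t * c))=bern l (2*(int i * a))" for t
 using assms by (intro bern_cong) (auto simp:algebra_simps)
 thus ?thesis by (simp add:cusp_bern_def)
qed

text \<open>When 2c is prime to l, the numerators 2(i a + t c) run through all residues modulo l as
  t varies, so the sum is independent of i and a.\<close>

lemma cusp_bern_not_dvd:
 assumes l:"l > 0" and cop:"coprime (2 * c) (int l)"
 shows "cusp_bern l a c i=(\<Sum>s<l. bern l (int s))"
proof -
 define g where "g t=nat ((2*(int i * a+int t * c)) mod int l)" for t::nat
 have g:"int (g t)=(2*(int i * a+int t * c)) mod int l" for t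
 unfolding g_def using l by simp
 have "inj_on g {..<l}"
 proof (rule inj_onI)
 fix s t assume st:"s\<in>{..<l}" "t\<in>{..<l}" "g s=g t"
 hence "(2*(int i * a+int s * c)) mod int l=(2*(int i * a+int t * c)) mod int l" by (metis g)
 hence "int l dvd 2*(int i * a+int s * c)-2*(int i * a+int t * c)" by (rule mod_eq_dvd_iff[THEN iffD1])
 moreover have "2*(int i * a+int s * c)-2*(int i * a+int t * c)=(2 * c)*(int s-int t)"
 by (simp add:algebra_simps)
 ultimately have "int l dvd int s-int t" using cop by (simp add:coprime_dvd_mult_right_iff coprime_commute)
 moreover have "\<bar>int s-int t\<bar><int l" using st(1,2) by (simp add:abs_less_iff)
 ultimately have "int s-int t=0" using dvd_imp_le_int[of "int s-int t" "int l"] by fastforce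
 thus "s=t" by simp
 qed
 moreover have "g ` {..<l} \<subseteq> {..<l}" using l by (auto simp:g_def nat_less_iff)
 ultimately have bij:"bij_betw g {..<l} {..<l}" by (simp add:bij_betw_def endo_inj_surj)
 have "cusp_bern l a c i=(\<Sum>t<l. bern l (int (g t)))"
 unfolding cusp_bern_def g
 by (intro sum.cong refl bern_cong l) (metis dvd_minus_mod)
 also have "...=(\<Sum>s<l. bern l (int s))" by (rule sum.reindex_bij_betw[OF bij])
 finally show ?thesis .
qed

text \<open>All Q_i have the same exponent at such a cusp, and the exponents e_i sum to 0. This is
  why the divisors lie above infinity.\<close>

lemma hquot_ord_not_dvd:
 assumes "odd l" "coprime c (int l)" "(\<Sum>i=1..k. e i)=0"
 shows "hquot_ord l k e a c=0"
proof -
 have "l > 0" using assms(1) by (auto intro:Nat.gr0I)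
 moreover have "coprime (2 * c) (int l)" using assms by (simp add:coprime_left_2_iff_odd)
 ultimately have "hquot_ord l k e a c = of_int (\<Sum>i=1..k. e i)*(\<Sum>s<l. bern l (int s))"
 unfolding hquot_ord_def of_int_sum sum_distrib_right by (intro sum.cong refl) (simp add:cusp_bern_not_dvd)
 thus ?thesis unfolding assms(3) by simp
qed

lemma hquot_ord_dvd:
 assumes "l > 0" "int l dvd c"
 shows "hquot_ord l k e a c=real l*(\<Sum>i=1..k. of_int (e i) * bern l (2*(int i * a)))"
 unfolding hquot_ord_def sum_distrib_left by (intro sum.cong refl) (simp add:cusp_bern_dvd[OF assms])

subsection \<open>Rational linear systems\<close>
text \<open>Gaussian elimination, by induction on the equations: a pivot removes one equation and
  one unknown.\<close>

lemma homogeneous_rat_system: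
 fixes B::"'i => 'j=>rat"
 assumes "finite I" "finite J" "card I < card J"
 shows "EX x. (\<exists>j\<in>J. x j~=0)&(\<forall>i\<in>I. (\<Sum>j\<in>J. x j * B i j)=0)"
 using assms
proof (induction I arbitrary:J B rule:finite_induct)
 case empty
 hence "J~={}" by auto
 thus ?case by (intro exI[of _ "%_. 1"]) auto
next
 case (insert i I)
 show ?case
 proof (cases "\<forall>j\<in>J. B i j=0")
 case True
 have "card I < card J" using insert by simp
 then obtain x where "\<exists>j\<in>J. x j~=0" "\<forall>i\<in>I. (\<Sum>j\<in>J. x j * B i j)=0"
 using insert.IH[of J B] insert.prems(1) by blast
 thus ?thesis using True by (intro exI[of _ x]) auto
 next
 case False
 then obtain p where p:"p\<in>J" "B i p~=0" by blast
 define B' where "B' i' j=B i' j-B i' p * B i j/B i p" for i' j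
 have "card I < card (J-{p})" using insert p by simp
 then obtain x where x:"\<exists>j\<in>J-{p}. x j~=0" "!!i'. i'\<in>I==>(\<Sum>j\<in>J-{p}. x j * B' i' j)=0"
 using insert.IH[of "J-{p}" B'] insert.prems(1) by (metis finite_Diff)
 define S where "S=(\<Sum>j\<in>J-{p}. x j * B i j)"
 define y where "y=x(p := - S/B i p)"
 have sum:"(\<Sum>j\<in>J. y j * B i' j) = - S/B i p * B i' p+(\<Sum>j\<in>J-{p}. x j * B i' j)" for i'
 using insert p by (simp add:sum.remove[of J p] y_def)
 have "(\<Sum>j\<in>J. y j * B i j)=0" unfolding sum using p by (simp add:S_def)
 moreover have "(\<Sum>j\<in>J. y j * B i' j)=0" if "i'\<in>I" for i'
 proof -
 have "(\<Sum>j\<in>J-{p}. x j * B' i' j)=(\<Sum>j\<in>J-{p}. x j * B i' j)-(\<Sum>j\<in>J-{p}. B i' p/B i p*(x j * B i j))"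
 unfolding B'_def sum_subtractf[symmetric] by (intro sum.cong refl) (simp add:algebra_simps)
 also have "(\<Sum>j\<in>J-{p}. B i' p/B i p*(x j * B i j))=B i' p/B i p * S"
 by (simp add:S_def sum_distrib_left)
 finally show ?thesis using x(2)[OF that] unfolding sum by simp
 qed
 moreover have "\<exists>j\<in>J. y j~=0" using x(1) by (auto simp:y_def)
 ultimately show ?thesis by (intro exI[of _ y]) auto
 qed
qed

lemma integer_multiples:
 fixes x::"'j=>rat"
 assumes "finite J"
 shows "\<exists>D::int. D~=0&(\<forall>j\<in>J. of_int D * x j\<in>\<int>)"
 using assms
proof (induction J rule:finite_induct)
 case (insert j J)
 then obtain D::int where D: "D~=0" "\<forall>j\<in>J. of_int D * x j\<in>\<int>" by blast
 obtain a b where ab:"quotient_of (x j)=(a,b)" by fastforce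
 have b:"b > 0" "x j = of_int a / of_int b" using quotient_of_denom_pos[OF ab] quotient_of_div[OF ab] by auto
 have "of_int (D * b) * x i\<in>\<int>" if "i\<in>insert j J" for i
 proof (cases "i=j")
 case True
 have "of_int (D * b) * x j = of_int (D * a)" using b by simp
 thus ?thesis using True Ints_of_int by metis
 next
 case False
 hence "of_int b*(of_int D * x i)\<in>\<int>" using D that by (simp only:Ints_mult[OF Ints_of_int] insert_iff simp_thms)
 moreover have "of_int (D * b) * x i = of_int b*(of_int D * x i)" by simp
 ultimately show ?thesis by (simp only:)
 qed
 thus ?case using D b by (intro exI[of _ "D * b"]) auto
qed (auto intro:exI[of _ 1])

lemma homogeneous_system:
 fixes A::"'i => 'j => 'a::field_char_0"
 assumes "finite I" "finite J" "card I < card J" and A: "!!i j. i\<in>I==>j\<in>J==>A i j\<in>\<rat>"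
 shows "\<exists>n::'j=>int. (\<exists>j\<in>J. n j~=0)&(\<forall>i\<in>I. (\<Sum>j\<in>J. of_int (n j) * A i j)=0)"
proof -
 define B where "B i j=(SOME r. A i j = of_rat r)" for i j
 have B: "A i j = of_rat (B i j)" if "i\<in>I" "j\<in>J" for i j
 unfolding B_def by (rule someI_ex) (use A[OF that] in \<open>auto elim:Rats_cases\<close>)
 obtain x where x:"\<exists>j\<in>J. x j~=0" "!!i. i\<in>I==>(\<Sum>j\<in>J. x j * B i j)=0"
 using homogeneous_rat_system[OF assms(1-3),of B] by blast
 obtain D::int where D: "D~=0" "\<forall>j\<in>J. of_int D * x j\<in>\<int>" using integer_multiples[OF assms(2)] by blast
 define n where "n j=\<lfloor>of_int D * x j\<rfloor>" for j
 have n:"of_int (n j) = of_int D * x j" if "j\<in>J" for j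
 unfolding n_def using D that by (auto elim:Ints_cases)
 have "(\<Sum>j\<in>J. of_int (n j) * A i j)=0" if i:"i\<in>I" for i
 proof -
 have "of_int (n j) * A i j = of_rat (of_int D * (x j * B i j))" if "j\<in>J" for j
 using arg_cong[OF n[OF that],of "of_rat::rat => 'a"] B[OF i that] by (simp add:of_rat_mult)
 hence "(\<Sum>j\<in>J. of_int (n j) * A i j) = of_rat (of_int D * (\<Sum>j\<in>J. x j * B i j))"
 by (simp add:of_rat_sum sum_distrib_left)
 thus ?thesis using x(2)[OF i] by simp
 qed
 moreover obtain j where "j\<in>J" "x j~=0" using x by blast
 hence "\<exists>j\<in>J. n j~=0" using n[of j] D by (metis mult_eq_0_iff of_int_0 of_int_eq_0_iff)
 ultimately show ?thesis by blast
qed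

subsection \<open>The cyclotomic field\<close>
lemma ring_of_type_algebra_simps:
 "carrier (ring_of_type_algebra::'a::field ring)=UNIV"
 "x \<otimes>\<^bsub>ring_of_type_algebra\<^esub> y=x * (y::'a)" "x \<oplus>\<^bsub>ring_of_type_algebra\<^esub> y=x+(y::'a)"
 "\<one>\<^bsub>ring_of_type_algebra\<^esub>=(1::'a)" "\<zero>\<^bsub>ring_of_type_algebra\<^esub>=(0::'a)"
 by (simp_all add:ring_of_type_algebra_def)

lemma ring_of_type_algebra_inverse:
 fixes x::"'a::field"
 shows "\<ominus>\<^bsub>ring_of_type_algebra\<^esub> x = - x" "x~=0==>inv\<^bsub>ring_of_type_algebra\<^esub> x=inverse x"
proof -
 interpret K: field "ring_of_type_algebra::'a ring" by (rule field_from_type_algebra)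
 show "\<ominus>\<^bsub>ring_of_type_algebra\<^esub> x = - x"
 by (rule K.minus_equality) (simp_all add:ring_of_type_algebra_simps)
 show "inv\<^bsub>ring_of_type_algebra\<^esub> x=inverse x" if "x~=0"
 by (rule K.comm_inv_char) (use that in \<open>simp_all add:ring_of_type_algebra_simps\<close>)
qed

lemma cyclotomic_closed:
 shows "1 \<in> cyclotomic l" "x \<in> cyclotomic l ==> - x \<in> cyclotomic l"
 "x \<in> cyclotomic l==>y \<in> cyclotomic l==>x+y \<in> cyclotomic l"
 "x \<in> cyclotomic l==>y \<in> cyclotomic l==>x * y \<in> cyclotomic l"
 "x \<in> cyclotomic l==>x~=0==>inverse x \<in> cyclotomic l"
 unfolding cyclotomic_def
 using generate_field.intros[where R = "ring_of_type_algebra::complex ring" and H = "{exp (2 * of_real pi*\<i> / of_nat l)}"]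
 by (simp_all add:ring_of_type_algebra_simps ring_of_type_algebra_inverse)

lemma Ints_subset_cyclotomic:"of_int n \<in> cyclotomic l"
proof -
 have z:"0 \<in> cyclotomic l" using cyclotomic_closed(3)[OF cyclotomic_closed(1) cyclotomic_closed(2)[OF cyclotomic_closed(1)],of l] by simp
 have "of_nat m \<in> cyclotomic l" for m
 by (induction m) (simp_all add:z cyclotomic_closed)
 thus ?thesis by (cases n) (auto intro:cyclotomic_closed(2) simp del:of_nat_Suc)
qed

text \<open>The rational span of the l-th roots of unity. It is closed under the field operations
  and so contains the cyclotomic field.\<close>

definition root_sums::"nat => complex set" where
 "root_sums l={\<Sum>s<l. of_rat (a s) * ee (1 / of_nat l) ^ s | a. True}"

lemma root_sums_memI: "(\<Sum>s<l. of_rat (a s) * ee (1 / of_nat l) ^ s)\<in>root_sums l"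
 unfolding root_sums_def by (rule CollectI,rule exI[of _ a]) simp

context
 fixes l::nat assumes l:"l > 0"
begin
lemma zeta_power_l:"ee (1 / of_nat l) ^ l=1"
 using l by (simp add:ee_power)

lemma zeta_power_mod:"ee (1 / of_nat l)^(n mod l)=ee (1 / of_nat l) ^ n"
proof -
 have "ee (1 / of_nat l)^(l*(n div l)+n mod l)=ee (1 / of_nat l)^(n mod l)"
 unfolding power_add power_mult zeta_power_l by simp
 thus ?thesis by simp
qed

lemma root_sumsI:
 assumes "finite I" shows "(\<Sum>i\<in>I. of_rat (b i) * ee (1 / of_nat l) ^ f i)\<in>root_sums l"
proof -
 have "(\<Sum>i\<in>I. of_rat (b i) * ee (1 / of_nat l) ^ f i) =
 (\<Sum>s<l. \<Sum>i\<in>{i\<in>I. f i mod l = s}. of_rat (b i) * ee (1 / of_nat l) ^ f i)"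
 using l by (intro sum.group[symmetric] assms) auto
 also have "...=(\<Sum>s<l. of_rat (\<Sum>i\<in>{i\<in>I. f i mod l = s}. b i) * ee (1 / of_nat l) ^ s)"
 unfolding of_rat_sum sum_distrib_right
 by (intro sum.cong refl) (auto simp:zeta_power_mod)
 finally show ?thesis by (simp only:root_sums_memI)
qed

lemma root_sums_add:"x\<in>root_sums l==>y\<in>root_sums l==>x+y\<in>root_sums l"
proof -
 assume "x\<in>root_sums l" "y\<in>root_sums l"
 then obtain a b where "x=(\<Sum>s<l. of_rat (a s) * ee (1 / of_nat l) ^ s)" "y=(\<Sum>s<l. of_rat (b s) * ee (1 / of_nat l) ^ s)"
 unfolding root_sums_def by blast
 hence "x+y=(\<Sum>s<l. of_rat (a s+b s) * ee (1 / of_nat l) ^ s)"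
 by (simp add:of_rat_add distrib_right sum.distrib)
 thus ?thesis by (simp only:root_sums_memI)
qed

lemma root_sums_mult:"x\<in>root_sums l==>y\<in>root_sums l==>x * y\<in>root_sums l"
proof -
 assume "x\<in>root_sums l" "y\<in>root_sums l"
 then obtain a b where "x=(\<Sum>s<l. of_rat (a s) * ee (1 / of_nat l) ^ s)" "y=(\<Sum>s<l. of_rat (b s) * ee (1 / of_nat l) ^ s)"
 unfolding root_sums_def by blast
 hence "x * y=(\<Sum>(s,t)\<in>{..<l}\<times>{..<l}. of_rat (a s * b t) * ee (1 / of_nat l)^(s+t))"
 by (simp add:sum_product of_rat_mult power_add mult_ac flip:sum.cartesian_product)
 also have "...=(\<Sum>i\<in>{..<l}\<times>{..<l}. of_rat (a (fst i) * b (snd i)) * ee (1 / of_nat l)^(fst i + snd i))"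
 by (intro sum.cong) auto
 also have "...\<in>root_sums l" by (rule root_sumsI) simp
 finally show ?thesis .
qed

lemma root_sums_of_rat:"of_rat r\<in>root_sums l"
 using root_sumsI[of "{0}" "%_. r" "%_. 0"] by simp

lemma root_sums_power:"x\<in>root_sums l==>x ^ n\<in>root_sums l"
 using root_sums_of_rat[of 1] by (induction n) (simp_all add:root_sums_mult)

lemma root_sums_sum:"(!!i. i\<in>I==>f i\<in>root_sums l)==>(\<Sum>i\<in>I. f i)\<in>root_sums l"
 using root_sums_of_rat[of 0] by (induction I rule:infinite_finite_induct) (simp_all add:root_sums_add)

text \<open>The l + 1 powers of x up to x^l lie in a span of l elements, so they are linearly
  dependent over the rationals; dividing a relation by its lowest power of x expresses 1/x as a
  polynomial in x.\<close>

lemma root_sums_inverse: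
 assumes x:"x\<in>root_sums l" "x~=0"
 shows "inverse x\<in>root_sums l"
proof -
 have "EX a. x ^ i=(\<Sum>s<l. of_rat (a s) * ee (1 / of_nat l) ^ s)" for i
 using root_sums_power[OF x(1),of i] unfolding root_sums_def by blast
 then obtain a where a:"!!i. x ^ i=(\<Sum>s<l. of_rat (a i s) * ee (1 / of_nat l) ^ s)" by metis
 obtain n::"nat=>int" where n:"\<exists>i\<in>{..l}. n i~=0" "\<forall>s\<in>{..<l}. (\<Sum>i\<in>{..l}. of_int (n i) * a i s)=0"
 using homogeneous_system[of "{..<l}" "{..l}" "%s i. a i s"] by (auto simp:Rats_def)
 have "(\<Sum>i\<le>l. of_int (n i) * x ^ i)=(\<Sum>s<l. of_rat (\<Sum>i\<le>l. of_int (n i) * a i s) * ee (1 / of_nat l) ^ s)"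
 unfolding a of_rat_sum sum_distrib_left sum_distrib_right by (subst sum.swap) (simp add:of_rat_mult mult_ac)
 hence rel:"(\<Sum>i\<le>l. of_int (n i) * x ^ i)=0" using n(2) by simp
 define m where "m=(LEAST i. n i~=0)"
 obtain i where i:"i\<le>l" "n i~=0" using n by auto
 have m:"n m~=0" unfolding m_def by (rule LeastI[of "%i. n i~=0",OF i(2)])
 have ml:"m\<le>l" unfolding m_def using i by (meson Least_le le_trans)
 have low:"n j=0" if "j<m" for j using not_less_Least[of j "%i. n i~=0"] that by (auto simp:m_def)
 define Y where "Y=(\<Sum>i\<in>{m<..l}. of_int (n i) * x^(i-Suc m))"
 have "(\<Sum>i\<le>l. of_int (n i) * x ^ i)=(\<Sum>i\<in>{m..l}. of_int (n i) * x ^ i)"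
 by (rule sum.mono_neutral_right) (auto simp:low)
 also have "... = of_int (n m) * x ^ m+(\<Sum>i\<in>{m<..l}. of_int (n i) * x ^ i)"
 using ml by (simp add:sum.head)
 also have "(\<Sum>i\<in>{m<..l}. of_int (n i) * x ^ i)=x ^ m*(x * Y)"
 unfolding Y_def sum_distrib_left
 proof (intro sum.cong refl)
 fix i assume "i\<in>{m<..l}"
 hence "i=m+1+(i-Suc m)" by auto
 hence "x ^ i=x ^ m*(x * x^(i-Suc m))" by (metis power_add power_one_right mult.assoc)
 thus "of_int (n i) * x ^ i=x ^ m*(x * (of_int (n i) * x^(i-Suc m)))" by simp
 qed
 finally have "x ^ m*(of_int (n m)+x * Y)=0" using rel by (simp add:algebra_simps)
 hence "of_int (n m)+x * Y=0" using x by simp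
 hence xY: "x * Y = - of_int (n m)" by (simp add:add_eq_0_iff)
 have c:"(of_rat (- 1 / of_int (n m))::complex) = - 1 / of_int (n m)" by (simp add:of_rat_divide of_rat_minus)
 have "x * (of_rat (- 1 / of_int (n m)) * Y) = of_rat (- 1 / of_int (n m))*(x * Y)" by simp
 hence "x * (of_rat (- 1 / of_int (n m)) * Y)=1" unfolding c xY using m by simp
 hence "inverse x = of_rat (- 1 / of_int (n m)) * Y" by (rule inverse_unique)
 moreover have "Y\<in>root_sums l" unfolding Y_def
 using root_sums_of_rat[of "of_int _"] by (intro root_sums_sum root_sums_mult root_sums_power x) simp
 ultimately show ?thesis using root_sums_mult root_sums_of_rat by simp
qed

lemma cyclotomic_subset_root_sums:"cyclotomic l \<subseteq> root_sums l"
proof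
 fix x assume "x \<in> cyclotomic l"
 thus "x\<in>root_sums l" unfolding cyclotomic_def
 proof (induction rule:generate_field.induct)
 case one
 show ?case using root_sums_of_rat[of 1] by (simp add:ring_of_type_algebra_simps)
 next
 case (incl h)
 hence "h=ee (1 / of_nat l)" by (simp add:ee_def)
 thus ?case using root_sumsI[of "{0}" "%_. 1" "%_. 1"] by simp
 next
 case (a_inv h)
 thus ?case using root_sums_mult[OF root_sums_of_rat[of "-1"],of h]
 by (simp add:ring_of_type_algebra_inverse of_rat_minus)
 next
 case (m_inv h)
 thus ?case by (simp add:ring_of_type_algebra_inverse ring_of_type_algebra_simps root_sums_inverse)
 qed (simp_all add:ring_of_type_algebra_simps root_sums_add root_sums_mult)
qed
end

subsection \<open>Integral elements\<close>

definition rat_eval::"'a::field_char_0=>rat poly => 'a" where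
 "rat_eval x p=poly (map_poly of_rat p) x"

lemma Q_adjoin_eq:"Q_adjoin x=range (rat_eval x)"
 by (auto simp:Q_adjoin_def rat_eval_def)

lemma rat_eval_hom:"comm_ring_hom (rat_eval x)"
proof -
 interpret r:field_hom "of_rat::rat => 'a" by unfold_locales (simp_all add:of_rat_add of_rat_mult)
 interpret m:map_poly_comm_ring_hom "of_rat::rat => 'a" ..
 show ?thesis unfolding rat_eval_def
 by unfold_locales (simp_all add:m.hom_add m.hom_mult)
qed

lemma rat_eval_const:"rat_eval x [:r:] = of_rat r"
proof -
 have "map_poly of_rat [:r:] = [:of_rat r::'a:]"
 by (rule poly_eqI) (simp add:coeff_map_poly coeff_pCons split:nat.split)
 thus ?thesis by (simp add:rat_eval_def)
qed

text \<open>\<mu> is a root of the characteristic polynomial of the matrix, which is monic with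
  coefficients in Q[x].\<close>

lemma integral_over_eigenvalue:
 fixes x \<mu>::"'a::field_char_0" and v::"nat => 'a" and N p::nat
 assumes M: "!!i. i<N==>(\<Sum>j<N. rat_eval x (M i j) * v j)=\<mu> * v i" and v:"p<N" "v p~=0"
 shows "integral_over (Q_adjoin x) \<mu>"
proof -
 interpret h:comm_ring_hom "rat_eval x" by (rule rat_eval_hom)
 define A where "A=Matrix.mat N N (%(i,j). M i j)"
 define B where "B=map_mat (rat_eval x) A"
 have A: "A \<in> carrier_mat N N" and B: "B \<in> carrier_mat N N" by (simp_all add:A_def B_def)
 define w where "w=Matrix.vec N v"
 have "eigenvector B w \<mu>"
 unfolding eigenvector_def
 proof (intro conjI)
 show "w \<in> carrier_vec (dim_row B)" using B by (simp add:w_def)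
 show "w~=0\<^sub>v (dim_row B)"
 proof
 assume "w=0\<^sub>v (dim_row B)"
 hence "vec_index w p=0" using v B by simp
 thus False using v by (simp add:w_def)
 qed
 show "B *\<^sub>v w=\<mu> \<cdot>\<^sub>v w"
 proof (rule eq_vecI)
 fix i assume "i<dim_vec (\<mu> \<cdot>\<^sub>v w)"
 hence i:"i<N" by (simp add:w_def)
 have "vec_index (B *\<^sub>v w) i=(\<Sum>j<N. rat_eval x (M i j) * v j)"
 using i by (simp add:B_def A_def w_def scalar_prod_def atLeast0LessThan)
 thus "vec_index (B *\<^sub>v w) i = vec_index (\<mu> \<cdot>\<^sub>v w) i" using M[OF i] i by (simp add:w_def)
 qed (use B in \<open>simp add:w_def\<close>)
 qed
 hence "poly (char_poly B) \<mu>=0" using eigenvalue_root_char_poly[OF B] by (auto simp:eigenvalue_def)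
 moreover have "char_poly B=map_poly (rat_eval x) (char_poly A)" unfolding B_def by (rule h.char_poly_hom[OF A])
 hence "ALL i. Polynomial.coeff (char_poly B) i\<in>Q_adjoin x"
 by (simp add:coeff_map_poly Q_adjoin_eq)
 moreover have "Polynomial.coeff (char_poly B) (Polynomial.degree (char_poly B))=1"
 using degree_monic_char_poly[OF B] by simp
 ultimately show ?thesis unfolding integral_over_def by blast
qed

lemma sum_div_mod:
 fixes g::"nat=>nat => 'a::comm_monoid_add"
 assumes "n > 0"
 shows "(\<Sum>j<l*n. g (j div n) (j mod n))=(\<Sum>u<l. \<Sum>b<n. g u b)"
proof -
 have "(\<Sum>j<l*n. g (j div n) (j mod n))=(\<Sum>u<l. \<Sum>j\<in>{u*n..<u*n+n}. g (j div n) (j mod n))"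
 by (rule sum.nat_group[symmetric])
 also have "...=(\<Sum>u<l. \<Sum>b<n. g u b)"
 proof (rule sum.cong[OF refl])
 fix u
 have "(\<Sum>j\<in>{u*n..<u*n+n}. g (j div n) (j mod n))=(\<Sum>b\<in>{0..<n}. g ((u * n+b) div n) ((u * n+b) mod n))"
 unfolding sum.atLeastLessThan_shift_0[of _ "u * n"] o_def by (simp only:diff_add_inverse)
 also have "...=(\<Sum>b<n. g u b)" unfolding atLeast0LessThan using assms by (intro sum.cong refl) simp
 finally show "(\<Sum>j\<in>{u*n..<u*n+n}. g (j div n) (j mod n))=(\<Sum>b<n. g u b)" .
 qed
 finally show ?thesis .
qed

text \<open>Multiplication by \<open>c h\<close> acts on the span of the products \<open>Z\<^sup>t h\<^sup>b\<close> by a matrix over \<open>\<rat>[x]\<close>.\<close>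
lemma integral_over_root_sum_mult:
 fixes x Z h::"'a::field_char_0"
 assumes l:"l > 0" and Z: "Z ^ l=1" and h:"integral_over (Q_adjoin x) h"
 shows "integral_over (Q_adjoin x) ((\<Sum>s<l. of_rat (a s) * Z ^ s) * h)"
proof -
 interpret hom:comm_ring_hom "rat_eval x" by (rule rat_eval_hom)
 define C where "C=(\<Sum>s<l. of_rat (a s) * Z ^ s)"
 obtain p where p:"Polynomial.coeff p (Polynomial.degree p)=1" "!!i. Polynomial.coeff p i\<in>Q_adjoin x" "poly p h=0"
 using h unfolding integral_over_def by blast
 define n where "n=Polynomial.degree p"
 have n:"n > 0"
 proof (rule Nat.gr0I)
 assume "n=0"
 then obtain y where "p = [:y:]" by (metis n_def degree_eq_zeroE)
 thus False using p by simp
 qed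
 have "\<exists>\<beta>. Polynomial.coeff p b=rat_eval x \<beta>" for b using p(2)[of b] by (auto simp:Q_adjoin_eq)
 then obtain \<beta> where b:"!!i. Polynomial.coeff p i=rat_eval x (\<beta> i)" by metis
 have "poly p h=(\<Sum>i\<le>n. Polynomial.coeff p i * h ^ i)" by (simp add:poly_altdef n_def)
 hence hn:"h ^ n = - (\<Sum>i<n. rat_eval x (\<beta> i) * h ^ i)"
 using p(1,3) by (simp add:b[symmetric] n_def[symmetric] lessThan_Suc_atMost[symmetric] add_eq_0_iff)
 \<comment> \<open>The companion matrix of p: the action of multiplication by h on 1, h, ...,
   h^(n-1).\<close>
 define Bc where "Bc b b'=(if Suc b<n then (if b'=Suc b then 1 else 0) else-\<beta> b')" for b b'
 have Bc:"(\<Sum>b'<n. rat_eval x (Bc b b') * h ^ b')=h ^ Suc b" if "b<n" for b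
 proof (cases "Suc b<n")
 case True
 hence "(\<Sum>b'<n. rat_eval x (Bc b b') * h ^ b')=(\<Sum>b'<n. if b'=Suc b then h ^ b' else 0)"
 by (intro sum.cong refl) (simp add:Bc_def)
 thus ?thesis using True by simp
 next
 case False
 hence "Suc b=n" using that by simp
 moreover have "(\<Sum>b'<n. rat_eval x (Bc b b') * h ^ b') = - (\<Sum>i<n. rat_eval x (\<beta> i) * h ^ i)"
 using False by (simp add:Bc_def hom.hom_uminus sum_negf)
 ultimately show ?thesis using hn by simp
 qed
 \<comment> \<open>The circulant matrix of multiplication by C on the powers of Z, the index being
   read modulo l.\<close>
 have Ac:"(\<Sum>u<l. of_rat (a ((u+l-t) mod l)) * Z ^ u) = C * Z ^ t" if t:"t<l" for t
 proof -
 define g where "g s=(s+t) mod l" for s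
 have inv:"(g s+l-t) mod l = s" if "s<l" for s
 proof (cases "s+t<l")
 case False
 hence "g s = s+t-l" using t that by (simp add:g_def mod_if)
 thus ?thesis using False that by simp
 qed (use that in \<open>simp add:g_def\<close>)
 have "inj_on g {..<l}" by (rule inj_on_inverseI[where g = "%u. (u+l-t) mod l"]) (simp add:inv)
 moreover have "g ` {..<l} \<subseteq> {..<l}" using l by (auto simp:g_def)
 ultimately have bij:"bij_betw g {..<l} {..<l}" by (simp add:bij_betw_def endo_inj_surj)
 have Zmod:"Z^(m mod l)=Z ^ m" for m
 proof -
 have "Z^(l*(m div l)+m mod l)=Z^(m mod l)" unfolding power_add power_mult Z by simp
 thus ?thesis by simp
 qed
 have "(\<Sum>u<l. of_rat (a ((u+l-t) mod l)) * Z ^ u)=(\<Sum>s<l. of_rat (a ((g s+l-t) mod l)) * Z ^ g s)"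
 by (rule sum.reindex_bij_betw[OF bij,symmetric])
 also have "...=(\<Sum>s<l. of_rat (a s) * Z ^ s * Z ^ t)"
 by (intro sum.cong refl) (simp add:inv,simp add:g_def Zmod power_add)
 finally show ?thesis by (simp add:C_def sum_distrib_right)
 qed
 define v where "v j=Z^(j div n) * h^(j mod n)" for j
 define M where "M i j = [:a ((j div n+l-i div n) mod l):] * Bc (i mod n) (j mod n)" for i j
 show ?thesis unfolding C_def[symmetric]
 proof (rule integral_over_eigenvalue[where N = "l * n" and p=0])
 fix i assume i:"i<l * n"
 have 1:"i div n<l" "i mod n<n" using i n by (simp_all add:less_mult_imp_div_less)
 have "(\<Sum>j<l*n. rat_eval x (M i j) * v j)=(\<Sum>u<l. \<Sum>b<n.
 (of_rat (a ((u+l-i div n) mod l)) * rat_eval x (Bc (i mod n) b))*(Z ^ u * h ^ b))"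
 unfolding sum_div_mod[OF n,symmetric] M_def v_def hom.hom_mult rat_eval_const ..
 also have "...=(\<Sum>u<l. of_rat (a ((u+l-i div n) mod l)) * Z ^ u)*(\<Sum>b<n. rat_eval x (Bc (i mod n) b) * h ^ b)"
 unfolding sum_product by (intro sum.cong refl) (simp add:mult_ac)
 also have "... = C * h * v i" unfolding Ac[OF 1(1)] Bc[OF 1(2)] by (simp add:v_def mult_ac)
 finally show "(\<Sum>j<l*n. rat_eval x (M i j) * v j) = C * h * v i" .
 qed (use l n in \<open>auto simp:v_def\<close>)
qed

subsection \<open>The multiplicative group\<close>
lemma mero_group_simps:
 "carrier mero_group=UNIV-{0}" "x \<otimes>\<^bsub>mero_group\<^esub> y=x * y" "\<one>\<^bsub>mero_group\<^esub>=1"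
 by (simp_all add:mero_group_def mult_of_def ring_of_type_algebra_def)

lemma comm_group_mero_group:"comm_group mero_group"
proof (rule comm_groupI)
 fix x assume "x \<in> carrier mero_group"
 thus "\<exists>y\<in>carrier mero_group. y \<otimes>\<^bsub>mero_group\<^esub> x=\<one>\<^bsub>mero_group\<^esub>"
 by (intro bexI[of _ "inverse x"]) (simp_all add:mero_group_simps)
qed (simp_all add:mero_group_simps mult_ac)

interpretation M: comm_group mero_group by (rule comm_group_mero_group)

lemma mero_group_inv:"x~=0==>inv\<^bsub>mero_group\<^esub> x=inverse x"
 by (rule M.inv_equality) (simp_all add:mero_group_simps)

lemma mero_group_nat_pow:"x [^]\<^bsub>mero_group\<^esub> (n::nat)=x ^ n"
 by (induction n) (simp_all add:mero_group_simps mult.commute)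

lemma mero_group_int_pow:"x~=0==>x [^]\<^bsub>mero_group\<^esub> (n::int)=x powi n"
 by (simp add:int_pow_def2 mero_group_nat_pow power_int_def mero_group_inv power_inverse)

lemma finprod_mero_subgroup:
 assumes H: "subgroup H mero_group" and B: "finite B" "f\<in>B \<rightarrow> H"
 shows "finprod (mero_group\<lparr>carrier := H\<rparr>) f B=prod f B"
proof -
 have "group (mero_group\<lparr>carrier := H\<rparr>)" by (rule M.subgroup_imp_group[OF H])
 hence "comm_group (mero_group\<lparr>carrier := H\<rparr>)"
 by (rule group.group_comm_groupI) (simp add:mero_group_simps mult.commute)
 then interpret K: comm_group "mero_group\<lparr>carrier := H\<rparr>" .
 show ?thesis using B
 proof (induction B rule:finite_induct)
 case (insert b B)
 hence "f b\<in>H" "f\<in>B \<rightarrow> H" by auto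
 thus ?case using insert by (simp add:mero_group_simps)
 qed (simp add:mero_group_simps)
qed

subsection \<open>Residues modulo sign\<close>

text \<open>Equality modulo l up to sign, so that (Z/l)^x/{+-1} can be handled with integers and the
  representatives 1..k.\<close>

definition cong_sign::"nat=>int=>int=>bool" where
 "cong_sign l a b\<longleftrightarrow>int l dvd a-b | int l dvd a+b"

lemma cong_sign_refl [simp]:"cong_sign l a a" by (simp add:cong_sign_def)

lemma cong_sign_sym:"cong_sign l a b ==> cong_sign l b a"
 by (auto simp:cong_sign_def add.commute dvd_diff_commute)

lemma cong_sign_trans:
 assumes "cong_sign l a b" "cong_sign l b c" shows "cong_sign l a c"
proof -
 have "a - c=(a-b)+(b - c)" "a + c=(a-b)+(b + c)" "a + c=(a+b)-(b - c)" "a - c=(a+b)-(b + c)"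
 by simp_all
 thus ?thesis using assms unfolding cong_sign_def by (metis dvd_add dvd_diff)
qed

lemma cong_sign_mult:"cong_sign l a b ==> cong_sign l (c * a) (c * b)"
 unfolding cong_sign_def right_diff_distrib[symmetric] distrib_left[symmetric] by auto

lemma cong_sign_cancel:"cong_sign l (c * a) (c * b) ==> coprime c (int l) ==> cong_sign l a b"
 unfolding cong_sign_def right_diff_distrib[symmetric] distrib_left[symmetric]
 by (auto simp:coprime_dvd_mult_right_iff coprime_commute)

context
 fixes l k::nat
 assumes l:"Factorial_Ring.prime l" "l=2 * k+1" and k:"k\<ge>2"
begin
text \<open>A power of the coset of 2 is trivial iff the power of 2 lies in {1, l-1}. By Lagrange
  the quotient group has (l-1)/2 = k elements, so a generator has order k.\<close>

lemma order_class_of_2: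
 assumes d:"d=group.ord (residue_units_pm1 l) (class_of_2 l)"
 shows "d > 0" "cong_sign l (2 ^ n) 1\<longleftrightarrow>d dvd n"
 "generate (residue_units_pm1 l) {class_of_2 l} = carrier (residue_units_pm1 l)==>d=k"
proof -
 define L where "L=int l"
 have L: "L=2 * int k+1" "L > 4" using l k by (simp_all add:L_def)
 interpret R: residues_prime l "residue_ring (int l)"
 by unfold_locales (use l in auto)
 define G where "G=residue_units l"
 have Gd:"G=units_of (residue_ring (int l))" by (simp add:G_def residue_units_def)
 interpret G: comm_group G unfolding Gd by (rule R.units_comm_group)
 have carrier:"carrier G={1..L-1}" unfolding Gd units_of_carrier R.res_prime_units_eq L_def using l k by (simp add:of_nat_diff)
 have mult:"x \<otimes>\<^bsub>G\<^esub> y=(x * y) mod L" for x y unfolding Gd units_of_mult R.res_mult_eq L_def ..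
 have one:"\<one>\<^bsub>G\<^esub>=1" unfolding Gd units_of_one R.res_one_eq ..
 define H where "H={1,L-1}"
 have sq:"(L-1)*(L-1) mod L=1"
 proof -
 have "(L-1)*(L-1)=1+L * (L-2)" by (simp add:algebra_simps)
 thus ?thesis using L by simp
 qed
 have H: "subgroup H G"
 proof (rule G.subgroupI)
 show "H \<subseteq> carrier G" "H~={}" using L by (auto simp:H_def carrier)
 have i:"inv\<^bsub>G\<^esub> (L-1)=L-1"
 by (rule G.inv_equality) (use L sq in \<open>simp_all add:mult one carrier\<close>)
 have i1:"inv\<^bsub>G\<^esub> 1=1" using G.inv_one by (simp add:one)
 show "inv\<^bsub>G\<^esub> a\<in>H" if "a\<in>H" for a using that i i1 by (auto simp:H_def)
 show "a \<otimes>\<^bsub>G\<^esub> b\<in>H" if "a\<in>H" "b\<in>H" for a b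
 using that sq L by (auto simp:H_def mult)
 qed
 interpret N: normal H G using H G.normal_iff_subgroup by blast
 interpret Q: group "G Mod H" by (rule N.factorgroup_is_group)
 have Q: "residue_units_pm1 l=G Mod H" by (simp add:residue_units_pm1_def G_def H_def L_def)
 have C: "class_of_2 l=H #>\<^bsub>G\<^esub> 2" by (simp add:class_of_2_def G_def H_def L_def)
 have two:"2 \<in> carrier G" using L by (simp add:carrier)
 have Cc:"class_of_2 l \<in> carrier (G Mod H)" unfolding C carrier_FactGroup using two by blast
 have pw:"(class_of_2 l) [^]\<^bsub>G Mod H\<^esub> (n::nat)=H #>\<^bsub>G\<^esub> (2 [^]\<^bsub>G\<^esub> n)" for n
 proof (induction n)
 case 0
 thus ?case using G.coset_mult_one[of H] L by (simp add:H_def carrier)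
 next
 case (Suc n)
 thus ?case using N.rcos_sum[of "2 [^]\<^bsub>G\<^esub> n" 2] two by (simp add:C)
 qed
 have p2:"2 [^]\<^bsub>G\<^esub> (n::nat)=2 ^ n mod L" for n
 proof -
 have "2\<in>Units (residue_ring (int l))" using two unfolding Gd units_of_carrier .
 hence "2 [^]\<^bsub>G\<^esub> n=2 [^]\<^bsub>residue_ring (int l)\<^esub> n" unfolding Gd by (rule R.units_of_pow)
 also have "...=2 ^ n mod L" using R.pow_cong[of 2 n] L by (simp add:L_def[symmetric])
 finally show ?thesis .
 qed
 have iff:"(class_of_2 l) [^]\<^bsub>G Mod H\<^esub> (n::nat)=\<one>\<^bsub>G Mod H\<^esub> \<longleftrightarrow> cong_sign l (2 ^ n) 1" for n
 proof -
 have "H #>\<^bsub>G\<^esub> (2 [^]\<^bsub>G\<^esub> n)=H\<longleftrightarrow>2 [^]\<^bsub>G\<^esub> n\<in>H"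
 using G.coset_join1[OF _ _ H] G.coset_join2[OF _ H] two by (metis G.nat_pow_closed)
 also have "...\<longleftrightarrow>2 ^ n mod L=1 mod L | 2 ^ n mod L=(-1) mod L"
 using L by (simp add:H_def p2 zmod_minus1)
 also have "... \<longleftrightarrow> cong_sign l (2 ^ n) 1"
 unfolding mod_eq_dvd_iff cong_sign_def L_def by simp
 finally show ?thesis by (simp add:pw)
 qed
 have fin:"finite (carrier (G Mod H))" unfolding carrier_FactGroup carrier by simp
 show "d > 0" using Q.ord_ge_1[OF fin Cc] d by (simp add:Q)
 show "cong_sign l (2 ^ n) 1\<longleftrightarrow>d dvd n" using Q.pow_eq_id[OF Cc,of n] iff[of n] d by (simp add:Q)
 assume gen:"generate (residue_units_pm1 l) {class_of_2 l} = carrier (residue_units_pm1 l)"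
 have "card (rcosets\<^bsub>G\<^esub> H) * card H = order G" by (rule G.lagrange[OF H])
 moreover have "card H=2" using L by (simp add:H_def)
 moreover have "order G=2 * k" using L by (simp add:order_def carrier)
 ultimately have "card (carrier (G Mod H))=k" by (simp add:FactGroup_def)
 thus "d=k" using Q.generate_pow_card[OF Cc] gen d by (simp add:Q)
qed

lemma prime_coprime_index:"i\<in>{1..k} ==> coprime (2 ^ n * int i) (int l)"
proof -
 assume "i\<in>{1..k}"
 hence "~ l dvd i" using l by (auto dest:dvd_imp_le)
 hence "coprime i l" using l by (metis coprime_commute prime_imp_coprime)
 moreover have "odd l" using l by simp
 ultimately show ?thesis by (simp add:coprime_left_2_iff_odd)
qed

lemma cong_sign_index_exists:
 assumes "coprime a (int l)"
 shows "\<exists>i\<in>{1..k}. cong_sign l a (int i)"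
proof -
 define r where "r=a mod int l"
 have L: "int l > 1" using l k by simp
 have "r~=0"
 proof
 assume "r=0"
 hence "int l dvd a" by (simp add:r_def mod_eq_0_iff_dvd)
 hence "is_unit (int l)" using assms by (simp add:coprime_absorb_right)
 thus False using L by simp
 qed
 moreover have "0\<le>r" "r<int l" using L by (simp_all add:r_def)
 ultimately have r:"1\<le>r" "r\<le>2 * int k" using l by simp_all
 have dv:"int l dvd a-r" by (simp add:r_def)
 show ?thesis
 proof (cases "r\<le>int k")
 case True
 thus ?thesis using r dv by (intro bexI[of _ "nat r"]) (auto simp:cong_sign_def)
 next
 case False
 have "int l dvd (a-r)+int l" using dv by simp
 moreover have "int (nat (int l-r))=int l-r" using r l by simp
 ultimately have "cong_sign l a (int (nat (int l-r)))"
 unfolding cong_sign_def by (simp only:add_diff_eq diff_add_eq simp_thms)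
 moreover have "nat (int l-r)\<in>{1..k}" using False r l by auto
 ultimately show ?thesis by blast
 qed
qed

lemma cong_sign_index_unique:
 assumes "i\<in>{1..k}" "j\<in>{1..k}" "cong_sign l (int i) (int j)" shows "i=j"
proof -
 from assms(3) consider "int l dvd int i-int j" | "int l dvd int i+int j" unfolding cong_sign_def by blast
 thus ?thesis
 proof cases
 case 1
 have "\<bar>int i-int j\<bar><int l" using assms l by (simp add:abs_less_iff)
 hence "int i-int j=0" using 1 dvd_imp_le_int[of "int i-int j" "int l"] by fastforce
 thus ?thesis by simp
 next
 case 2
 hence "int l\<le>int i+int j" using assms by (intro zdvd_imp_le) auto
 thus ?thesis using assms l by simp
 qed
qed

text \<open>Division by 2 in (Z/l)^x/{+-1}: for odd j the representative l - j is even.\<close>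

definition half_index::"nat=>nat" where
 "half_index j=(if even j then j div 2 else (l-j) div 2)"

lemma half_index:
 assumes "j\<in>{1..k}"
 shows "half_index j\<in>{1..k}" "cong_sign l (2 * int (half_index j)) (int j)"
 "even j==>2 * half_index j=j" "odd j==>2 * half_index j=l-j"
proof -
 have e:"2 * half_index j=j" if "even j" using that by (simp add:half_index_def)
 have o:"2 * half_index j=l-j" if "odd j"
 proof -
 have "even (l-j)" using that l(2) by simp
 thus ?thesis using that by (simp add:half_index_def)
 qed
 show "even j==>2 * half_index j=j" "odd j==>2 * half_index j=l-j" using e o by auto
 have jl:"j\<le>l" using assms l by simp
 show "half_index j\<in>{1..k}" using e o assms l by (cases "even j") auto
 show "cong_sign l (2 * int (half_index j)) (int j)"
 proof (cases "even j")
 case True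
 hence "2 * int (half_index j)=int j" using e by (metis of_nat_mult of_nat_numeral)
 thus ?thesis by simp
 next
 case False
 hence "2 * int (half_index j)=int l-int j" using o jl by (metis of_nat_diff of_nat_mult of_nat_numeral)
 thus ?thesis by (simp add:cong_sign_def)
 qed
qed
end

subsection \<open>Orbits of doubling\<close>

locale doubling =
 fixes l k d::nat
 assumes l:"Factorial_Ring.prime l" "l=2 * k+1" and k:"k\<ge>2"
 and d:"d > 0" "!!n. cong_sign l (2 ^ n) 1\<longleftrightarrow>d dvd n"
begin

definition same_orbit::"nat=>nat=>bool" where
 "same_orbit i j\<longleftrightarrow>(EX n. cong_sign l (2 ^ n * int i) (int j))"

lemma same_orbit_refl:"same_orbit i i"
 unfolding same_orbit_def by (intro exI[of _ 0]) simp

lemma same_orbit_trans: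
 assumes "same_orbit i j" "same_orbit j m" shows "same_orbit i m"
proof -
 obtain a b where ab:"cong_sign l (2 ^ a * int i) (int j)" "cong_sign l (2 ^ b * int j) (int m)"
 using assms unfolding same_orbit_def by blast
 have "cong_sign l (2 ^ b*(2 ^ a * int i)) (int m)"
 by (rule cong_sign_trans[OF cong_sign_mult[OF ab(1)] ab(2)])
 hence "cong_sign l (2^(b+a) * int i) (int m)" by (simp add:power_add mult_ac)
 thus ?thesis unfolding same_orbit_def by blast
qed

text \<open>As 2^d is +-1 modulo l, another n(d-1) doublings undo n doublings.\<close>

lemma same_orbit_sym:
 assumes "same_orbit i j" shows "same_orbit j i"
proof -
 obtain n where n:"cong_sign l (2 ^ n * int i) (int j)" using assms unfolding same_orbit_def by blast
 have "cong_sign l (2^(n*(d-1))*(2 ^ n * int i)) (2^(n*(d-1)) * int j)" by (rule cong_sign_mult[OF n])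
 moreover have eq:"2^(n*(d-1))*(2 ^ n * int i)=int i*2^(n * d)"
 using d(1) by (cases d) (simp_all add:power_add)
 ultimately have A: "cong_sign l (int i*2^(n * d)) (2^(n*(d-1)) * int j)" by (simp only:)
 have B: "cong_sign l (int i*2^(n * d)) (int i*1)" by (rule cong_sign_mult) (simp add:d(2))
 have "cong_sign l (2^(n*(d-1)) * int j) (int i)"
 using cong_sign_trans[OF cong_sign_sym[OF A] B] by (simp only:mult_1_right)
 thus ?thesis unfolding same_orbit_def by blast
qed

definition orbit::"nat=>nat set" where "orbit i={j\<in>{1..k}. same_orbit i j}"
definition orbit_rep::"nat=>nat" where "orbit_rep i=Min (orbit i)"
definition orbit_reps::"nat set" where "orbit_reps = orbit_rep ` {1..k}"

lemma orbit_eq_iff:"i\<in>{1..k}==>j\<in>{1..k} ==> orbit i = orbit j \<longleftrightarrow> same_orbit i j"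
 using same_orbit_refl same_orbit_sym same_orbit_trans unfolding orbit_def by blast

lemma orbit_rep:"i\<in>{1..k} ==> orbit_rep i\<in>{1..k} & same_orbit i (orbit_rep i)"
proof -
 assume i:"i\<in>{1..k}"
 have "finite (orbit i)" "orbit i~={}" using i same_orbit_refl by (auto simp:orbit_def)
 hence "orbit_rep i \<in> orbit i" unfolding orbit_rep_def by (rule Min_in)
 thus ?thesis by (simp add:orbit_def)
qed

lemma orbit_rep_eq_iff:"i\<in>{1..k}==>j\<in>{1..k} ==> orbit_rep i = orbit_rep j \<longleftrightarrow> same_orbit i j"
 using orbit_rep[of i] orbit_rep[of j] orbit_eq_iff[of i j] same_orbit_sym same_orbit_trans
 unfolding orbit_rep_def by metis

lemma orbit_reps:"\<rho> \<in> orbit_reps==>\<rho>\<in>{1..k} & orbit_rep \<rho>=\<rho>"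
 unfolding orbit_reps_def using orbit_rep orbit_rep_eq_iff same_orbit_sym by (metis imageE)

text \<open>Since i is prime to l, it can be cancelled from 2^m i = +-2^n i, so the first d
  multiples are distinct; the others repeat them with period d.\<close>

lemma orbit_card:
 assumes i:"i\<in>{1..k}"
 shows "card (orbit i)=d"
proof -
 have "EX j. j\<in>{1..k} & cong_sign l (2 ^ n * int i) (int j)" for n
 using cong_sign_index_exists[OF l k prime_coprime_index[OF l k i]] by blast
 then obtain x where x:"!!n. x n\<in>{1..k}" "!!n. cong_sign l (2 ^ n * int i) (int (x n))" by metis
 have "orbit i=x ` {..<d}"
 proof
 show "x ` {..<d} \<subseteq> orbit i" using x by (auto simp:orbit_def same_orbit_def)
 show "orbit i \<subseteq> x ` {..<d}"
 proof
 fix j assume "j \<in> orbit i"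
 then obtain n where n:"cong_sign l (2 ^ n * int i) (int j)" "j\<in>{1..k}"
 by (auto simp:orbit_def same_orbit_def)
 have "cong_sign l (2^(n mod d) * int i*2^(d*(n div d))) (2^(n mod d) * int i*1)"
 by (rule cong_sign_mult) (simp add:d(2))
 moreover have "2^(n mod d) * int i*2^(d*(n div d))=2 ^ n * int i"
 by (simp add:mult_ac flip:power_add)
 ultimately have "cong_sign l (2 ^ n * int i) (2^(n mod d) * int i)" by (simp only:mult_1_right)
 from cong_sign_trans[OF cong_sign_sym[OF this] n(1)]
 have "cong_sign l (int (x (n mod d))) (int j)" by (rule cong_sign_trans[OF cong_sign_sym[OF x(2)]])
 hence "x (n mod d)=j" using cong_sign_index_unique[OF l k] x(1) n(2) by blast
 thus "j\<in>x ` {..<d}" using d(1) by auto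
 qed
 qed
 moreover have "inj_on x {..<d}"
 proof -
 have "m=n" if "m\<le>n" "n<d" "x m=x n" for m n
 proof -
 have "cong_sign l (2 ^ m * int i*2^(n-m)) (2 ^ m * int i*1)"
 using cong_sign_trans[OF x(2)[of n] cong_sign_sym[OF x(2)[of m,unfolded that(3)]]] that(1)
 by (simp add:mult_ac flip:power_add)
 hence "cong_sign l (2^(n-m)) 1" by (rule cong_sign_cancel) (rule prime_coprime_index[OF l k i])
 hence "d dvd n-m" by (simp add:d(2))
 thus ?thesis using that by (auto dest:dvd_imp_le)
 qed
 thus ?thesis by (intro inj_onI) (metis lessThan_iff nat_le_linear)
 qed
 ultimately show ?thesis by (simp add:card_image)
qed

lemma card_orbit_reps:"k=d * card orbit_reps"
proof -
 have "k = card (\<Union>(orbit ` {1..k}))"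
 proof -
 have "\<Union>(orbit ` {1..k})={1..k}" using same_orbit_refl by (auto simp:orbit_def)
 thus ?thesis by simp
 qed
 also have "...=(\<Sum>C\<in>orbit ` {1..k}. card C)"
 proof (rule card_Union_disjoint)
 show "pairwise disjnt (orbit ` {1..k})"
 proof (rule pairwiseI)
 fix A B assume "A \<in> orbit ` {1..k}" "B \<in> orbit ` {1..k}" "A~=B"
 then obtain i j where ij:"i\<in>{1..k}" "j\<in>{1..k}" "A = orbit i" "B = orbit j" "~ same_orbit i j"
 using orbit_eq_iff by blast
 thus "disjnt A B" unfolding disjnt_def orbit_def using same_orbit_sym same_orbit_trans by blast
 qed
 qed (auto simp:orbit_def)
 also have "...=(\<Sum>C\<in>orbit ` {1..k}. d)" by (intro sum.cong refl) (auto simp:orbit_card simp del:atLeastAtMost_iff)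
 also have "...=d * card (orbit ` {1..k})" by simp
 also have "card (orbit ` {1..k}) = card (Min ` orbit ` {1..k})"
 proof (rule card_image[symmetric],rule inj_onI)
 fix A B assume "A \<in> orbit ` {1..k}" "B \<in> orbit ` {1..k}" and M: "Min A=Min B"
 then obtain i j where ij:"i\<in>{1..k}" "j\<in>{1..k}" "A = orbit i" "B = orbit j" by blast
 hence "same_orbit i j" using M orbit_rep_eq_iff unfolding orbit_rep_def by blast
 thus "A=B" using ij orbit_eq_iff by blast
 qed
 also have "Min ` orbit ` {1..k} = orbit_reps" unfolding orbit_reps_def orbit_rep_def image_image ..
 finally show ?thesis .
qed
end

subsection \<open>The rank\<close>

definition diff_vec::"nat=>nat=>nat=>int" where
 "diff_vec i j t=(if t=i then 1 else 0)-(if t=j then 1 else 0)"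

lemma sum_diff_vec:"finite A==>(\<Sum>t\<in>A. diff_vec i j t)=(if i\<in>A then 1 else 0)-(if j\<in>A then 1 else 0)"
 by (simp add:diff_vec_def sum_subtractf)

text \<open>Isolates the combinatorics from the analysis: \<open>hq\<close> is a homomorphism from
  integer vectors of sum 0 on 1..k to the nonzero functions, with trivial kernel. It will be the map
  e -> \<open>mero (hquot l k e)\<close>.\<close>

locale exponent_group=doubling +
 fixes hq::"(nat=>int)=>mero_uhp"
 assumes hq_add:"!!e f. sum e {1..k}=0 ==> sum f {1..k}=0==>hq (%i. e i+f i)=hq e * hq f"
 and hq_nonzero:"!!e. sum e {1..k}=0==>hq e~=0"
 and hq_cong:"!!e f. (!!i. i\<in>{1..k}==>e i=f i)==>hq e=hq f"
 and hq_inj:"!!e i. sum e {1..k}=0==>hq e=1==>i\<in>{1..k}==>e i=0"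
begin
lemma hq_0:"hq (%_. 0)=1"
 using hq_add[of "%_. 0" "%_. 0"] hq_nonzero[of "%_. 0"] by simp

lemma hq_uminus:"sum e {1..k}=0==>hq (%i. - e i)=inverse (hq e)"
 using hq_add[of e "%i. - e i"] hq_0 by (simp add:sum_negf inverse_unique)

lemma hq_sum:"(!!b. b\<in>B ==> sum (e b) {1..k}=0)==>hq (%i. \<Sum>b\<in>B. e b i)=(\<Prod>b\<in>B. hq (e b))"
proof (induction B rule:infinite_finite_induct)
 case (insert b B)
 have "sum (%i. \<Sum>b\<in>B. e b i) {1..k}=(\<Sum>b\<in>B. sum (e b) {1..k})" by (rule sum.swap)
 also have "...=0" using insert by simp
 finally show ?case using insert hq_add[of "e b" "%i. \<Sum>b\<in>B. e b i"] by simp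
qed (simp_all add:hq_0)

lemma hq_scale:
 assumes "sum e {1..k}=0"
 shows "hq (%i. n * e i)=hq e powi n"
proof -
 have s:"sum (%i. c * e i) {1..k}=0" for c using assms by (simp flip:sum_distrib_left)
 have nat:"hq (%i. int m * e i)=hq e ^ m" for m
 proof (induction m)
 case (Suc m)
 have "(%i. int (Suc m) * e i)=(%i. e i+int m * e i)" by (simp add:fun_eq_iff algebra_simps)
 thus ?case using hq_add[OF assms s[of "int m"]] Suc by simp
 qed (simp add:hq_0)
 show ?thesis
 proof (cases "n\<ge>0")
 case True
 thus ?thesis using nat[of "nat n"] by (simp add:power_int_def)
 next
 case False
 have "hq (%i. - (int (nat (- n)) * e i))=inverse (hq e ^ nat (- n))"
 unfolding hq_uminus[OF s] nat ..
 thus ?thesis using False by (simp add:power_int_def power_inverse)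
 qed
qed

definition orbit_null::"(nat=>int)=>bool" where
 "orbit_null e\<longleftrightarrow>(\<forall>\<rho>\<in>orbit_reps. (\<Sum>i\<in>{i\<in>{1..k}. orbit_rep i=\<rho>}. e i)=0)"

lemma orbit_null_sum:
 assumes "orbit_null e" shows "sum e {1..k}=0"
proof -
 have "sum e {1..k}=(\<Sum>\<rho>\<in>orbit_reps. \<Sum>i\<in>{i\<in>{1..k}. orbit_rep i=\<rho>}. e i)"
 by (rule sum.group[symmetric]) (auto simp:orbit_reps_def)
 thus ?thesis using assms by (simp add:orbit_null_def)
qed

lemma orbit_null_lincomb:
 assumes "!!b. b\<in>B ==> orbit_null (e b)" shows "orbit_null (%i. \<Sum>b\<in>B. n b * e b i)"
 unfolding orbit_null_def
proof
 fix \<rho> assume r:"\<rho> \<in> orbit_reps"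
 have "(\<Sum>i\<in>{i\<in>{1..k}. orbit_rep i=\<rho>}. \<Sum>b\<in>B. n b * e b i) =
 (\<Sum>b\<in>B. n b*(\<Sum>i\<in>{i\<in>{1..k}. orbit_rep i=\<rho>}. e b i))"
 unfolding sum_distrib_left by (rule sum.swap)
 also have "...=0" using assms r by (simp add:orbit_null_def)
 finally show "(\<Sum>i\<in>{i\<in>{1..k}. orbit_rep i=\<rho>}. \<Sum>b\<in>B. n b * e b i)=0" .
qed

lemma orbit_null_diff_vec:
 assumes "i\<in>{1..k}" "j\<in>{1..k}" "same_orbit i j" shows "orbit_null (diff_vec i j)"
 unfolding orbit_null_def using assms orbit_rep_eq_iff[OF assms(1,2)] by (simp add:sum_diff_vec)

lemma orbit_null_add:"orbit_null e ==> orbit_null f ==> orbit_null (%i. e i+f i)"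
 by (simp add:orbit_null_def sum.distrib)

lemma orbit_null_uminus:"orbit_null e ==> orbit_null (%i. - e i)"
 by (simp add:orbit_null_def sum_negf)

text \<open>The exponent vector of the m-th Siegel quotient, once g_(j/l,0)(l tau) is recognised as
  Q_i with i = \<open>half_index l j\<close>.\<close>

definition unit_gen::"nat=>mero_uhp" where
 "unit_gen m=hq (%t. \<Sum>j=1..m. diff_vec j (half_index l j) t)"

definition unit_group::"mero_uhp set" where
 "unit_group=generate mero_group (unit_gen ` {1..k-1})"

lemma half_index_orbit:"j\<in>{1..k}==>half_index l j\<in>{1..k} & same_orbit j (half_index l j)"
proof -
 assume j:"j\<in>{1..k}"
 have "same_orbit (half_index l j) j"
 unfolding same_orbit_def by (intro exI[of _ 1]) (use half_index(2)[OF l k j] in simp)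
 thus ?thesis using half_index(1)[OF l k j] same_orbit_sym by blast
qed

lemma orbit_null_gen:"m\<le>k ==> orbit_null (%t. \<Sum>j=1..m. diff_vec j (half_index l j) t)"
 using orbit_null_lincomb[of "{1..m}" "%j. diff_vec j (half_index l j)" "%_. 1"]
 half_index_orbit orbit_null_diff_vec by simp

lemma unit_gen_nonzero:"m\<le>k==>unit_gen m~=0"
 unfolding unit_gen_def by (intro hq_nonzero orbit_null_sum orbit_null_gen)

lemma subgroup_unit_group:"subgroup unit_group mero_group"
 unfolding unit_group_def
 by (intro M.generate_is_subgroup) (use unit_gen_nonzero in \<open>auto simp:mero_group_simps\<close>)

lemma unit_group_closed:
 "1\<in>unit_group" "x\<in>unit_group==>y\<in>unit_group==>x * y\<in>unit_group"
 "x\<in>unit_group==>inverse x\<in>unit_group" "x\<in>unit_group==>x powi n\<in>unit_group"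
 "x\<in>unit_group==>x~=0"
proof -
 show 0:"x~=0" if "x\<in>unit_group" for x using subgroup.subset[OF subgroup_unit_group] that by (auto simp:mero_group_simps)
 show 1:"1\<in>unit_group" using subgroup.one_closed[OF subgroup_unit_group] by (simp add:mero_group_simps)
 show 2:"x * y\<in>unit_group" if "x\<in>unit_group" "y\<in>unit_group" for x y
 using subgroup.m_closed[OF subgroup_unit_group that] by (simp add:mero_group_simps)
 show 3:"inverse x\<in>unit_group" if "x\<in>unit_group" for x
 using subgroup.m_inv_closed[OF subgroup_unit_group that] 0[OF that] by (simp add:mero_group_inv)
 have "x ^ m\<in>unit_group" if "x\<in>unit_group" for x m using that by (induction m) (simp_all add: 1 2)
 thus "x\<in>unit_group==>x powi n\<in>unit_group" using 3 by (simp add:power_int_def)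
qed

lemma unit_group_prod:"(!!i. i\<in>I==>f i\<in>unit_group)==>(\<Prod>i\<in>I. f i)\<in>unit_group"
 by (induction I rule:infinite_finite_induct) (simp_all add:unit_group_closed)

lemma unit_group_orbit_null:"h\<in>unit_group==>EX e. orbit_null e&h=hq e"
 unfolding unit_group_def
proof (induction rule:generate.induct)
 case one
 have "orbit_null (%_. 0)" by (simp add:orbit_null_def)
 thus ?case using hq_0 by (intro exI[of _ "%_. 0"]) (simp add:mero_group_simps)
next
 case (incl h)
 then obtain m where m:"m\<in>{1..k-1}" "h=unit_gen m" by blast
 hence "m\<le>k" by (simp only:atLeastAtMost_iff) linarith
 thus ?case using orbit_null_gen m(2) unfolding unit_gen_def by blast
next
 case (inv h)
 then obtain m where m0:"m\<in>{1..k-1}" "h=unit_gen m" by blast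
 hence "m\<le>k" by (simp only:atLeastAtMost_iff) linarith
 note m=this m0(2)
 have "inv\<^bsub>mero_group\<^esub> h=hq (%t. - (\<Sum>j=1..m. diff_vec j (half_index l j) t))"
 using unit_gen_nonzero[OF m(1)] unfolding hq_uminus[OF orbit_null_sum[OF orbit_null_gen[OF m(1)]]]
 by (simp add:m mero_group_inv unit_gen_def)
 thus ?case using orbit_null_uminus[OF orbit_null_gen[OF m(1)]] by blast
next
 case (eng h1 h2)
 then obtain e f where "orbit_null e" "h1=hq e" "orbit_null f" "h2=hq f" by blast
 thus ?case using orbit_null_add[of e f] hq_add[of e f] orbit_null_sum by (metis mero_group_simps(2))
qed

lemma hq_diff_vec:
 assumes "i\<in>{1..k}" "j\<in>{1..k}"
 shows "sum (diff_vec i j) {1..k}=0" "hq (diff_vec i j) * hq (diff_vec j m)=hq (diff_vec i m) | m ~: {1..k}"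
 "hq (diff_vec i i)=1" "hq (diff_vec j i)=inverse (hq (diff_vec i j))"
proof -
 show s:"sum (diff_vec i j) {1..k}=0" using assms by (simp add:sum_diff_vec)
 show "hq (diff_vec i j) * hq (diff_vec j m)=hq (diff_vec i m) | m ~: {1..k}"
 proof (cases "m\<in>{1..k}")
 case True
 have "sum (diff_vec j m) {1..k}=0" using assms True by (simp add:sum_diff_vec)
 from hq_add[OF s this] have "hq (diff_vec i j) * hq (diff_vec j m)=hq (%t. diff_vec i j t+diff_vec j m t)" by simp
 also have "(%t. diff_vec i j t+diff_vec j m t)=diff_vec i m" by (simp add:diff_vec_def fun_eq_iff)
 finally show ?thesis by simp
 qed simp
 have "diff_vec i i=(%_. 0)" by (simp add:diff_vec_def fun_eq_iff)
 thus "hq (diff_vec i i)=1" using hq_0 by simp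
 have "diff_vec j i=(%t. - diff_vec i j t)" by (simp add:diff_vec_def fun_eq_iff)
 thus "hq (diff_vec j i)=inverse (hq (diff_vec i j))" using hq_uminus[OF s] by simp
qed

lemma half_index_bij:"bij_betw (half_index l) {1..k} {1..k}"
proof -
 have "inj_on (half_index l) {1..k}"
 proof (rule inj_onI)
 fix i j assume ij:"i\<in>{1..k}" "j\<in>{1..k}" "half_index l i=half_index l j"
 have "cong_sign l (int i) (int j)"
 using cong_sign_trans[OF cong_sign_sym[OF half_index(2)[OF l k ij(1)]]] half_index(2)[OF l k ij(2)] ij(3) by simp
 thus "i=j" using cong_sign_index_unique[OF l k ij(1,2)] by simp
 qed
 moreover have "half_index l ` {1..k} \<subseteq> {1..k}" using half_index(1)[OF l k] by blast
 ultimately show ?thesis by (simp add:bij_betw_def endo_inj_surj)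
qed

text \<open>The missing generator with \<open>j = k\<close> is obtained by going once around the cycles of \<^const>\<open>half_index\<close>.\<close>
lemma half_step_in_unit_group:
 assumes j:"j\<in>{1..k}" shows "hq (diff_vec j (half_index l j))\<in>unit_group"
proof -
 have gen:"unit_gen m\<in>unit_group" if "m\<le>k-1" for m
 proof (cases m)
 case 0
 thus ?thesis using hq_0 unit_group_closed(1) by (simp add:unit_gen_def)
 next
 case (Suc n)
 thus ?thesis unfolding unit_group_def using that by (intro generate.incl) auto
 qed
 \<comment> \<open>\<open>half_index\<close> permutes 1..k, so numerators and denominators cancel
   over the full range.\<close>
 have genk:"unit_gen k=1"
 proof -
 have "(\<Sum>j=1..k. diff_vec j (half_index l j) t)=0" if t:"t\<in>{1..k}" for t
 proof -
 have "(\<Sum>j=1..k. if t=half_index l j then 1 else 0::int)=(\<Sum>j=1..k. if t=j then 1 else 0)"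
 by (rule sum.reindex_bij_betw[OF half_index_bij,of "%j. if t=j then 1 else 0"])
 thus ?thesis by (simp add:diff_vec_def sum_subtractf)
 qed
 hence "unit_gen k=hq (%_. 0)" unfolding unit_gen_def by (intro hq_cong) simp
 thus ?thesis using hq_0 by simp
 qed
 have all:"unit_gen m\<in>unit_group" if "m\<le>k" for m
 using gen[of m] genk unit_group_closed(1) that by (cases "m=k") auto
 have dj:"sum (diff_vec j (half_index l j)) {1..k}=0" using half_index(1)[OF l k j] j by (simp add:sum_diff_vec)
 have jj:"j=Suc (j-1)" "j-1\<le>k" using j by auto
 have "unit_gen j=hq (%t. (\<Sum>i=1..j-1. diff_vec i (half_index l i) t)+diff_vec j (half_index l j) t)"
 unfolding unit_gen_def by (subst jj(1),subst sum.cl_ivl_Suc) (use jj in simp)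
 also have "...=unit_gen (j-1) * hq (diff_vec j (half_index l j))"
 unfolding unit_gen_def by (rule hq_add[OF orbit_null_sum[OF orbit_null_gen[OF jj(2)]] dj])
 finally have "hq (diff_vec j (half_index l j))=inverse (unit_gen (j-1)) * unit_gen j"
 using unit_gen_nonzero[OF jj(2)] by simp
 thus ?thesis using all[OF jj(2)] all[of j] j unit_group_closed by simp
qed

text \<open>Doubling is inverse to \<open>half_index\<close>, so each doubling step is a quotient
  supplied by \<open>half_step_in_unit_group\<close>; the quotients telescope along the chain from i
  to j.\<close>

lemma same_orbit_in_unit_group:
 assumes "same_orbit i j" "i\<in>{1..k}" "j\<in>{1..k}"
 shows "hq (diff_vec i j)\<in>unit_group"
proof -
 have "cong_sign l (2 ^ n * int i) (int j)==>i\<in>{1..k}==>hq (diff_vec i j)\<in>unit_group" for n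
 proof (induction n arbitrary:i)
 case 0
 hence "i=j" using cong_sign_index_unique[OF l k,of i j] assms(3) by simp
 thus ?case using hq_diff_vec(3)[OF assms(3,3)] unit_group_closed(1) by simp
 next
 case (Suc n)
 obtain i' where i':"i'\<in>{1..k}" "half_index l i'=i"
 using half_index_bij Suc.prems(2) by (metis bij_betw_imp_surj_on imageE)
 have "cong_sign l (2 ^ n*(2 * int i)) (2 ^ n * int i')"
 using half_index(2)[OF l k i'(1)] unfolding i'(2) by (rule cong_sign_mult)
 moreover have "2 ^ n*(2 * int i)=2 ^ Suc n * int i" by simp
 ultimately have "cong_sign l (2 ^ n * int i') (int j)"
 using Suc.prems(1) cong_sign_trans[OF cong_sign_sym] by metis
 hence 1:"hq (diff_vec i' j)\<in>unit_group" using Suc.IH i'(1) by blast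
 have "hq (diff_vec i' i)\<in>unit_group" using half_step_in_unit_group[OF i'(1)] i'(2) by simp
 hence 2:"hq (diff_vec i i')\<in>unit_group"
 using hq_diff_vec(4)[OF i'(1) Suc.prems(2)] unit_group_closed(3) by simp
 have "hq (diff_vec i i') * hq (diff_vec i' j)=hq (diff_vec i j)"
 using hq_diff_vec(2)[OF Suc.prems(2) i'(1),of j] assms(3) by blast
 thus ?case using unit_group_closed(2)[OF 2 1] by simp
 qed
 thus ?thesis using assms unfolding same_orbit_def by blast
qed

text \<open>A vector with sum 0 on every orbit is the combination with coefficients e_i of the
  differences between i and the representative of its orbit.\<close>

lemma orbit_null_in_unit_group:
 assumes "orbit_null e" shows "hq e\<in>unit_group"
proof -
 have s:"sum (diff_vec i (orbit_rep i)) {1..k}=0" if "i\<in>{1..k}" for i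
 using that orbit_rep[OF that] by (simp add:sum_diff_vec)
 have "hq e=hq (%t. \<Sum>i=1..k. e i * diff_vec i (orbit_rep i) t)"
 proof (rule hq_cong)
 fix t assume t:"t\<in>{1..k}"
 have "(\<Sum>i=1..k. e i * diff_vec i (orbit_rep i) t) =
 (\<Sum>i=1..k. if t=i then e i else 0)-(\<Sum>i=1..k. if orbit_rep i=t then e i else 0)"
 unfolding sum_subtractf[symmetric] by (intro sum.cong refl) (auto simp:diff_vec_def)
 also have "(\<Sum>i=1..k. if orbit_rep i=t then e i else 0)=(\<Sum>i\<in>{i\<in>{1..k}. orbit_rep i=t}. e i)"
 by (rule sum.inter_filter[symmetric]) simp
 also have "...=0"
 proof (cases "t \<in> orbit_reps")
 case False
 hence "{i\<in>{1..k}. orbit_rep i=t}={}" by (auto simp:orbit_reps_def)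
 thus ?thesis by (simp only:sum.empty)
 qed (use assms in \<open>simp add:orbit_null_def\<close>)
 finally show "e t=(\<Sum>i=1..k. e i * diff_vec i (orbit_rep i) t)" using t by simp
 qed
 also have "...=(\<Prod>i=1..k. hq (%t. e i * diff_vec i (orbit_rep i) t))"
 by (rule hq_sum) (use s in \<open>simp flip:sum_distrib_left\<close>)
 also have "...\<in>unit_group"
 proof (rule unit_group_prod)
 fix i assume i:"i\<in>{1..k}"
 show "hq (%t. e i * diff_vec i (orbit_rep i) t)\<in>unit_group"
 unfolding hq_scale[OF s[OF i]] using i orbit_rep[OF i]
 by (intro unit_group_closed(4) same_orbit_in_unit_group) auto
 qed
 finally show ?thesis .
qed

lemma independent_iff:
 assumes B: "finite B" "B \<subseteq> unit_group"
 shows "int_independent (mero_group\<lparr>carrier := unit_group\<rparr>) B \<longleftrightarrow>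
 (\<forall>n::mero_uhp=>int. (\<Prod>b\<in>B. b powi n b)=1-->(\<forall>b\<in>B. n b=0))"
proof -
 have p:"b [^]\<^bsub>mero_group\<lparr>carrier := unit_group\<rparr>\<^esub> m=b powi m" if "b\<in>B" for b and m::int
 using M.int_pow_consistent[OF subgroup_unit_group,of b m] that B unit_group_closed(5)[of b] mero_group_int_pow[of b m] by auto
 have "finprod (mero_group\<lparr>carrier := unit_group\<rparr>) (%b. b [^]\<^bsub>mero_group\<lparr>carrier := unit_group\<rparr>\<^esub> n b) B=(\<Prod>b\<in>B. b powi n b)"
 for n::"mero_uhp=>int"
 by (subst finprod_mero_subgroup[OF subgroup_unit_group B(1)]) (use p B unit_group_closed(4) in auto)
 thus ?thesis unfolding int_independent_def by (simp add:mero_group_simps)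
qed

text \<open>The differences between i and its orbit representative, for i not itself a
  representative, are independent since \<open>hq\<close> is injective. For the upper bound, more
  elements than that admit a nontrivial integer combination whose exponents vanish at all
  non-representatives.\<close>

lemma rank_unit_group:"abelian_rank (mero_group\<lparr>carrier := unit_group\<rparr>)=enat (k - card orbit_reps)"
proof -
 define I where "I={1..k} - orbit_reps"
 have rs:"orbit_reps \<subseteq> {1..k}" using orbit_reps by blast
 have cI: "card I=k - card orbit_reps" unfolding I_def using rs by (simp add:card_Diff_subset finite_subset)
 have repI: "orbit_rep j ~: I" if "j\<in>{1..k}" for j using that by (simp add:I_def orbit_reps_def)
 have upper:"card B\<le>k - card orbit_reps"
 if B: "finite B" "B \<subseteq> unit_group" "int_independent (mero_group\<lparr>carrier := unit_group\<rparr>) B" for B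
 proof (rule ccontr)
 assume "~ card B\<le>k - card orbit_reps"
 hence c:"card I < card B" by (simp add:cI)
 have "EX e. orbit_null e&b=hq e" if "b\<in>B" for b using unit_group_orbit_null that B by blast
 then obtain e where e:"!!b. b\<in>B ==> orbit_null (e b)" "!!b. b\<in>B==>b=hq (e b)" by metis
 have "finite I" by (simp add:I_def)
 from homogeneous_system[OF this B(1) c,of "%i b. of_int (e b i)::rat"]
 obtain n where n:"\<exists>b\<in>B. n b~=0" "!!i. i\<in>I==>(\<Sum>b\<in>B. of_int (n b) * of_int (e b i)::rat)=0" by auto
 define E where "E i=(\<Sum>b\<in>B. n b * e b i)" for i
 have E0:"E i=0" if "i\<in>I" for i
 proof -
 have "(of_int (E i)::rat)=0" using n(2)[OF that] by (simp add:E_def)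
 thus ?thesis by simp
 qed
 have En:"orbit_null E" unfolding E_def by (rule orbit_null_lincomb) (rule e(1))
 \<comment> \<open>The orbit sum is 0 and all other entries in the orbit are already 0.\<close>
 have R0:"E \<rho>=0" if r:"\<rho> \<in> orbit_reps" for \<rho>
 proof -
 have "(\<Sum>i\<in>{i\<in>{1..k}. orbit_rep i=\<rho>}. E i)=(\<Sum>i\<in>{\<rho>}. E i)"
 proof (rule sum.mono_neutral_right)
 show "\<forall>i\<in>{i\<in>{1..k}. orbit_rep i=\<rho>}-{\<rho>}. E i=0"
 proof
 fix i assume i:"i\<in>{i\<in>{1..k}. orbit_rep i=\<rho>}-{\<rho>}"
 hence "i ~: orbit_reps" using orbit_reps[of i] by auto
 thus "E i=0" using i E0 by (simp add:I_def)
 qed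
 qed (use orbit_reps[OF r] in auto)
 thus ?thesis using En r by (simp add:orbit_null_def)
 qed
 have "E i=0" if "i\<in>{1..k}" for i using E0[of i] R0[of i] that by (cases "i \<in> orbit_reps") (auto simp:I_def)
 hence "hq E=1" using hq_cong[of E "%_. 0"] hq_0 by simp
 moreover have "hq E=(\<Prod>b\<in>B. b powi n b)"
 proof -
 have "hq E=(\<Prod>b\<in>B. hq (%i. n b * e b i))" unfolding E_def
 by (rule hq_sum) (use orbit_null_sum[OF e(1)] in \<open>simp flip:sum_distrib_left\<close>)
 also have "...=(\<Prod>b\<in>B. b powi n b)"
 proof (intro prod.cong refl)
 fix b assume b:"b\<in>B"
 show "hq (%i. n b * e b i)=b powi n b"
 using hq_scale[OF orbit_null_sum[OF e(1)[OF b]],of "n b"] unfolding e(2)[OF b,symmetric] .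
 qed
 finally show ?thesis .
 qed
 ultimately have "\<forall>b\<in>B. n b=0" using B independent_iff[OF B(1,2)] by simp
 thus False using n by blast
 qed
 define b where "b i=hq (diff_vec i (orbit_rep i))" for i
 have bs:"sum (diff_vec i (orbit_rep i)) {1..k}=0" if "i\<in>I" for i
 using that orbit_rep[of i] by (simp add:sum_diff_vec I_def)
 have val:"diff_vec j (orbit_rep j) i=(if i=j then 1 else 0)" if "i\<in>I" "j\<in>I" for i j
 using repI[of j] that by (auto simp:diff_vec_def I_def)
 have indep:"m i=0" if m:"(\<Prod>i\<in>I. b i powi m i)=1" and i:"i\<in>I" for m i
 proof -
 define E where "E t=(\<Sum>i\<in>I. m i * diff_vec i (orbit_rep i) t)" for t
 have s:"sum (%t. m i * diff_vec i (orbit_rep i) t) {1..k}=0" if "i\<in>I" for i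
 using bs[OF that] by (simp flip:sum_distrib_left)
 have "hq E=(\<Prod>i\<in>I. hq (%t. m i * diff_vec i (orbit_rep i) t))" unfolding E_def by (rule hq_sum[OF s])
 also have "...=(\<Prod>i\<in>I. b i powi m i)" unfolding b_def by (intro prod.cong refl hq_scale bs)
 finally have "hq E=1" using m by simp
 moreover have "sum E {1..k}=0" unfolding E_def by (subst sum.swap,rule sum.neutral,rule ballI,rule s)
 ultimately have "E i=0" using hq_inj[of E i] i by (simp add:I_def)
 moreover have "E i=(\<Sum>j\<in>I. if i=j then m j else 0)"
 unfolding E_def using val[OF i] by (intro sum.cong refl) simp
 ultimately show ?thesis using i by (simp add:I_def)
 qed
 have inj:"inj_on b I"
 proof (rule inj_onI)
 fix i j assume ij:"i\<in>I" "j\<in>I" "b i=b j"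
 define m::"nat=>int" where "m t=(if t=i then 1 else 0)-(if t=j then 1 else 0)" for t
 show "i=j"
 proof (rule ccontr)
 assume ne:"i~=j"
 have bn:"b t~=0" if "t\<in>I" for t unfolding b_def using bs[OF that] by (rule hq_nonzero)
 have "(\<Prod>t\<in>I. b t powi m t)=(\<Prod>t\<in>{i,j}. b t powi m t)"
 by (rule prod.mono_neutral_right) (use ij in \<open>auto simp:I_def m_def\<close>)
 also have "...=1" using ne ij bn by (simp add:m_def power_int_minus)
 finally have "m i=0" using indep ij(1) by blast
 thus False using ne by (simp add:m_def)
 qed
 qed
 have bB: "finite (b ` I)" "b ` I \<subseteq> unit_group"
 using orbit_rep by (auto simp:I_def b_def intro!: same_orbit_in_unit_group)
 have ind:"int_independent (mero_group\<lparr>carrier := unit_group\<rparr>) (b ` I)"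
 unfolding independent_iff[OF bB] by (auto simp:prod.reindex[OF inj] dest:indep)
 show ?thesis unfolding abelian_rank_def
 proof (rule antisym)
 show "(SUP B\<in>{B. finite B&B \<subseteq> carrier (mero_group\<lparr>carrier := unit_group\<rparr>) &
 int_independent (mero_group\<lparr>carrier := unit_group\<rparr>) B}. enat (card B))\<le>enat (k - card orbit_reps)"
 by (rule SUP_least) (use upper in simp)
 show "enat (k - card orbit_reps)\<le>(SUP B\<in>{B. finite B&B \<subseteq> carrier (mero_group\<lparr>carrier := unit_group\<rparr>) &
 int_independent (mero_group\<lparr>carrier := unit_group\<rparr>) B}. enat (card B))"
 by (rule SUP_upper2[of "b ` I"]) (use bB ind cI in \<open>simp_all add:card_image[OF inj]\<close>)
 qed
qed

lemma orbit_null_if_transitive: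
 assumes "d=k" "sum e {1..k}=0" shows "orbit_null e"
proof -
 have "d * card orbit_reps=k" using card_orbit_reps by (rule sym)
 hence "k * card orbit_reps=k*1" unfolding assms(1) mult_1_right .
 hence c1:"card orbit_reps=1" unfolding mult_cancel1 using k by simp
 obtain sg where s:"orbit_reps={sg}" using c1 by (rule card_1_singletonE)
 have all:"{i\<in>{1..k}. orbit_rep i=\<rho>}={1..k}" if r:"\<rho> \<in> orbit_reps" for \<rho>
 proof -
 have "orbit_rep i=\<rho>" if "i\<in>{1..k}" for i
 proof -
 have "orbit_rep i \<in> orbit_reps" unfolding orbit_reps_def using that by (rule imageI)
 thus ?thesis using r unfolding s by simp
 qed
 thus ?thesis by blast
 qed
 show ?thesis unfolding orbit_null_def
 proof
 fix \<rho> assume "\<rho> \<in> orbit_reps"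
 show "sum e {i\<in>{1..k}. orbit_rep i=\<rho>}=0" unfolding all[OF \<open>\<rho> \<in> orbit_reps\<close>] by (rule assms(2))
 qed
qed

lemma rank_unit_group_real:
 "ereal_of_enat (abelian_rank (mero_group\<lparr>carrier := unit_group\<rparr>))=ereal (real k-real k/real d)"
proof -
 have "real k=real d * real (card orbit_reps)" using arg_cong[OF card_orbit_reps,of real] unfolding of_nat_mult .
 hence "real k/real d=real (card orbit_reps)" using d(1) by simp
 moreover have "card orbit_reps\<le>k" unfolding orbit_reps_def using card_image_le[of "{1..k}" orbit_rep] by simp
 ultimately show ?thesis unfolding rank_unit_group by (simp add:of_nat_diff)
qed
end

subsection \<open>The quotients as modular units\<close>
text \<open>The two families of factors are interchanged and a^2 - a is unchanged, so there is not
  even a sign.\<close>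

lemma siegel_reflect:"siegel (1-a) tt = siegel a tt"
proof -
 have 1:"(1-a)\<^sup>2-(1-a)+1/6=a\<^sup>2-a+1/6" by (simp add:power2_eq_square algebra_simps)
 have 2:"real n+(1-a)=real (Suc n)-a" "real (Suc n)-(1-a)=real n+a" for n by simp_all
 show ?thesis unfolding siegel_def 1 2 by (simp only:mult.commute)
qed

context
 fixes l k::nat
 assumes l:"Factorial_Ring.prime l" "l=2 * k+1" and k:"k\<ge>2"
begin
lemma level_props:"k\<ge>1" "l > 0" "odd l" "l\<ge>5" using l k by simp_all

lemma not_dvd_imp_coprime:"~ int l dvd c ==> coprime c (int l)"
 using l(1) by (metis coprime_commute prime_imp_coprime prime_nat_int_transfer)

lemma siegel_eq_hsiegel_half:
 assumes j:"j\<in>{1..k}"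
 shows "siegel (real j/real l) (of_nat l * tt)=hsiegel l (half_index l j) tt"
proof (cases "even j")
 case True
 have "2 * real (half_index l j)=real j"
 using half_index(3)[OF l k j True] by (metis of_nat_mult of_nat_numeral)
 thus ?thesis by (simp add:hsiegel_def)
next
 case False
 have "2 * real (half_index l j)=real l-real j"
 using half_index(4)[OF l k j False] j l by (metis of_nat_mult of_nat_numeral of_nat_diff atLeastAtMost_iff le_add1 le_trans mult_2 trans_le_add1)
 hence "2 * real (half_index l j)/real l=1-real j/real l"
 using level_props by (simp add:diff_divide_distrib)
 thus ?thesis by (simp add:hsiegel_def siegel_reflect)
qed

lemma hquot_diff_vec:
 assumes "i\<in>{1..k}" "j\<in>{1..k}" "Im tt > 0"
 shows "hquot l k (diff_vec i j) tt=hsiegel l i tt/hsiegel l j tt"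
proof -
 have single:"hquot l k (%t. if t=i then 1 else 0) tt=hsiegel l i tt" if "i\<in>{1..k}" for i
 proof -
 have "hquot l k (%t. if t=i then 1 else 0) tt=(\<Prod>t=1..k. if t=i then hsiegel l t tt else 1)"
 unfolding hquot_def by (intro prod.cong refl) simp
 thus ?thesis using that by simp
 qed
 have "diff_vec i j=(%t. (if t=i then 1 else 0) + - (if t=j then 1 else 0))"
 by (simp add:diff_vec_def fun_eq_iff)
 hence "hquot l k (diff_vec i j) tt=hquot l k (%t. if t=i then 1 else 0) tt * hquot l k (%t. - (if t=j then 1 else 0)) tt"
 by (simp only:hquot_add[OF l(2) level_props(1) assms(3)])
 thus ?thesis unfolding hquot_uminus[OF l(2) level_props(1)] single[OF assms(1)] single[OF assms(2)]
 by (simp add:divide_inverse)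
qed

lemma siegel_quotient_eq:
 assumes "m\<le>k"
 shows "siegel_quotient l m=mero (hquot l k (%t. \<Sum>j=1..m. diff_vec j (half_index l j) t))"
 unfolding siegel_quotient_def
proof (rule mero_cong[symmetric])
 have h:"half_index l j\<in>{1..k}" if "j\<in>{1..k}" for j using half_index(1)[OF l k that] .
 have "(\<Sum>t=1..k. \<Sum>j=1..m. diff_vec j (half_index l j) t)=(\<Sum>j=1..m. \<Sum>t=1..k. diff_vec j (half_index l j) t)"
 by (rule sum.swap)
 also have "...=0" by (rule sum.neutral,rule ballI) (use h assms in \<open>simp add:sum_diff_vec\<close>)
 finally show "hquot l k (%t. \<Sum>j=1..m. diff_vec j (half_index l j) t) holomorphic_on uhp"
 by (rule hquot_holomorphic[OF l(2) level_props(1)])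
 fix z assume "z\<in>uhp"
 hence z:"Im z > 0" by (simp add:uhp_def)
 show "hquot l k (%t. \<Sum>j=1..m. diff_vec j (half_index l j) t) z =
 (\<Prod>j=1..m. siegel (2 * real j/real l) (of_nat l * z) / siegel (real j/real l) (of_nat l * z))"
 using assms
 proof (induction m)
 case 0
 thus ?case using hquot_0[OF l(2) level_props(1)] by simp
 next
 case (Suc m)
 have j:"Suc m\<in>{1..k}" using Suc by simp
 have eq:"(%t. \<Sum>j=1..Suc m. diff_vec j (half_index l j) t) =
 (%t. (\<Sum>j=1..m. diff_vec j (half_index l j) t)+diff_vec (Suc m) (half_index l (Suc m)) t)"
 by (simp add:fun_eq_iff)
 have "hquot l k (%t. \<Sum>j=1..m. diff_vec j (half_index l j) t) z =
 (\<Prod>j=1..m. siegel (2 * real j/real l) (of_nat l * z) / siegel (real j/real l) (of_nat l * z))"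
 using Suc by simp
 thus ?case unfolding eq hquot_add[OF l(2) level_props(1) z] hquot_diff_vec[OF j h[OF j] z]
 siegel_eq_hsiegel_half[OF j,symmetric] prod.cl_ivl_Suc by (simp add:hsiegel_def)
 qed
qed

lemma modular_hol_hquot:
 assumes e:"sum e {1..k}=0"
 shows "modular_hol l (%z. c * hquot l k e z)"
 unfolding modular_hol_def
proof (intro conjI ballI)
 obtain R where R: "reps l R" using reps_exist[OF level_props(2)] by blast
 note hol=hquot_holomorphic[OF l(2) level_props(1) e]
 show "Gamma_inv l (%z. c * hquot l k e z)"
 unfolding Gamma_inv_def using hquot_Gamma_princ[OF l(2) level_props(1) _ _ e] by (simp add:uhp_def)
 fix gg assume g:"gg\<in>SL2Z"
 obtain F where F: "has_qexp l (%z. hquot l k e (moebius gg z)) F"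
 using hquot_has_qexp[OF l(2) level_props(1) g e] by blast
 show "qhol l (%z. c * hquot l k e (moebius gg z))"
 unfolding qhol_def using has_qexp_mult[OF level_props(2) has_qexp_const[OF level_props(2),of c] F]
 compose_moebius_holomorphic[OF level_props(2) R hol g] by (auto intro!: holomorphic_intros)
qed

lemma hquot_qexp:
 assumes e:"sum e {1..k}=0" and g:"gg\<in>SL2Z" and c:"c~=0"
 shows "EX F. has_qexp l (%z. c * hquot l k e (moebius gg z)) F&F~=0 &
 of_int (fls_subdegree F)=real l * hquot_ord l k e (gg$1$1) (gg$2$1)"
proof -
 obtain F where F: "has_qexp l (%z. hquot l k e (moebius gg z)) F" "F~=0"
 "of_int (fls_subdegree F)=real l * hquot_ord l k e (gg$1$1) (gg$2$1)"
 using hquot_has_qexp[OF l(2) level_props(1) g e] by blast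
 have "fls_const c~=0" using c by simp
 hence "fls_const c * F~=0" "fls_subdegree (fls_const c * F)=fls_subdegree F" using F by simp_all
 thus ?thesis using has_qexp_mult[OF level_props(2) has_qexp_const[OF level_props(2),of c] F(1)] F(3) by metis
qed

lemma hquot_spread:
 assumes e:"sum e {1..k}=0"
 obtains n where "of_int n=real l * hquot_ord l k e 1 0"
 "has_qexp l (hquot l k e) (spread l n (hquot_fps l k e))"
 using hquot_integral_qexp[OF l(2) level_props(1),of e] e by blast

lemma int_spread_hquot:"coeffs_in \<int> (spread l n (hquot_fps l k e))"
 by (rule coeffs_in_spread[OF level_props(2) int_hquot_fps[OF l(2) level_props(1)]])

text \<open>\<open>integral_over_j\<close> requires rational coefficients, so it is applied to the
  product without c. The constant, written as a rational combination of powers of zeta, is restored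
  by \<open>integral_over_root_sum_mult\<close>.\<close>

lemma hquot_integral:
 assumes c:"c \<in> cyclotomic l" and e:"sum e {1..k}=0"
 shows "mero (%z. c * hquot l k e z)\<in>integral_closure_j l"
proof -
 note l0=level_props(2)
 define f where "f=(%z. c * hquot l k e z)"
 have mh:"modular_hol l f" unfolding f_def by (rule modular_hol_hquot[OF e])
 hence inv:"Gamma_inv l f" and hol:"f holomorphic_on uhp"
 using modular_hol_qhol[OF mh] by (simp_all add:modular_hol_def qhol_def)
 have ev:"eval_mero (mero f) z=f z" if "z\<in>uhp" for z by (rule eval_mero_holomorphic[OF hol that])
 obtain n where n:"has_qexp l (hquot l k e) (spread l n (hquot_fps l k e))" by (rule hquot_spread[OF e])
 have fld:"mero f\<in>modular_field l"
 unfolding modular_field_def modular_function_def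
 proof (intro CollectI conjI ballI)
 fix gg z assume "gg\<in>Gamma_princ l" "z\<in>uhp"
 thus "eval_mero (mero f) (moebius gg z)=eval_mero (mero f) z"
 using ev moebius_in_uhp Gamma_princ_subset[of l] inv unfolding Gamma_inv_def by (metis subsetD)
 next
 fix gg assume g:"gg\<in>SL2Z"
 obtain F where F: "has_qexp l (%z. f (moebius gg z)) F" using mh g by (auto simp:modular_hol_def qhol_def)
 have ev':"eventually (%z. f (moebius gg z)=eval_mero (mero f) (moebius gg z)) at_cusp"
 by (rule eventually_mono[OF eventually_at_cusp_uhp]) (simp add:ev moebius_in_uhp g)
 show "EX F. has_qexp l (%z. eval_mero (mero f) (moebius gg z)) F"
 by (rule exI,rule has_qexp_cong[OF l0 F ev'])
 next
 have "has_qexp l f (fls_const c * spread l n (hquot_fps l k e))"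
 unfolding f_def by (rule has_qexp_mult[OF l0 has_qexp_const[OF l0] n])
 moreover have "eventually (%z. f z=eval_mero (mero f) z) at_cusp"
 by (rule eventually_mono[OF eventually_at_cusp_uhp]) (simp add:ev)
 ultimately have "has_qexp l (eval_mero (mero f)) (fls_const c * spread l n (hquot_fps l k e))"
 by (rule has_qexp_cong[OF l0])
 moreover have "fls_nth (fls_const c * spread l n (hquot_fps l k e)) m \<in> cyclotomic l" for m
 proof -
 obtain q where "fls_nth (spread l n (hquot_fps l k e)) m = of_int q"
 using int_spread_hquot unfolding coeffs_in_def by (metis Ints_cases)
 thus ?thesis using cyclotomic_closed(4)[OF c Ints_subset_cyclotomic] by simp
 qed
 ultimately show "EX F. has_qexp l (eval_mero (mero f)) F&(ALL n. fls_nth F n \<in> cyclotomic l)" by blast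
 qed
 obtain R where R: "reps l R" using reps_exist[OF l0] by blast
 obtain J where J: "has_qexp l j_fun J" "fls_subdegree J = - int l" "J~=0" "coeffs_in \<int> J"
 using j_fun_qexp[OF l0] by blast
 interpret g:level_one_generator l R j_fun J
 by unfold_locales (use l0 R J level_one_j_fun in auto)
 have mh1:"modular_hol l (hquot l k e)" using modular_hol_hquot[OF e,of 1] by simp
 have hh:"hquot l k e holomorphic_on uhp" using modular_hol_qhol[OF mh1] by (simp add:qhol_def)
 have I: "integral_over (Q_adjoin klein_j) (mero (hquot l k e))"
 unfolding klein_j_eq
 by (rule g.integral_over_j[OF mh1 n]) (use J int_spread_hquot in \<open>auto intro:coeffs_in_Ints_imp_Rats\<close>)
 obtain a where a:"c=(\<Sum>s<l. of_rat (a s) * ee (1 / of_nat l) ^ s)"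
 using cyclotomic_subset_root_sums[OF l0] c unfolding root_sums_def by blast
 define Z where "Z=mero (%_. ee (1 / of_nat l))"
 have Zp:"Z ^ s=mero (%_. ee (1 / of_nat l) ^ s)" for s unfolding Z_def by (rule mero_power) simp
 have Zl:"Z ^ l=1" unfolding Zp zeta_power_l[OF l0] one_mero_uhp_def ..
 have C: "(\<Sum>s<l. of_rat (a s) * Z ^ s)=mero (%_. c)"
 proof -
 have "(\<Sum>s<l. of_rat (a s) * Z ^ s)=(\<Sum>s<l. mero (%_. of_rat (a s) * ee (1 / of_nat l) ^ s))"
 unfolding Zp of_rat_mero by (intro sum.cong refl mero_mult) simp_all
 also have "...=mero (%_. c)" unfolding a by (rule mero_sum) simp
 finally show ?thesis .
 qed
 have "mero f=(\<Sum>s<l. of_rat (a s) * Z ^ s) * mero (hquot l k e)"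
 unfolding C f_def by (rule mero_mult[symmetric]) (use hh in simp_all)
 hence "integral_over (Q_adjoin klein_j) (mero f)"
 using integral_over_root_sum_mult[OF l0 Zl I,of a] by simp
 thus ?thesis using fld unfolding integral_closure_j_def f_def by blast
qed

text \<open>The inverse has the same shape, with exponents -e and constant 1/c, so integrality gives
  a unit. There are no zeros or poles on the half-plane, and a nonzero order at a cusp forces l to
  divide the lower left entry, which puts the cusp above infinity.\<close>

theorem hquot_in_units_plus:
 assumes c:"c \<in> cyclotomic l" "c~=0" and e:"sum e {1..k}=0"
 shows "mero (%z. c * hquot l k e z)\<in>units_plus l"
proof -
 note l0=level_props(2)
 define f where "f=(%z. c * hquot l k e z)"
 have hol:"f holomorphic_on uhp"
 using modular_hol_qhol[OF modular_hol_hquot[OF e,of c]] by (simp add:qhol_def f_def)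
 have ev:"eval_mero (mero f) z=f z" if "z\<in>uhp" for z by (rule eval_mero_holomorphic[OF hol that])
 have nz:"f z~=0" if "z\<in>uhp" for z
 using that c hquot_nonzero[OF l(2) level_props(1)] by (simp add:f_def uhp_def)
 have ne:"sum (%i. - e i) {1..k}=0" using e by (simp add:sum_negf)
 have hol':"(%z. inverse c * hquot l k (%i. - e i) z) holomorphic_on uhp"
 using modular_hol_qhol[OF modular_hol_hquot[OF ne,of "inverse c"]] by (simp add:qhol_def)
 have "mero f * mero (%z. inverse c * hquot l k (%i. - e i) z)=mero (%z. f z * (inverse c * hquot l k (%i. - e i) z))"
 by (rule mero_mult[OF hol hol'])
 also have "...=mero (%_. 1)"
 proof (rule mero_cong)
 show "(%z. f z * (inverse c * hquot l k (%i. - e i) z)) holomorphic_on uhp" by (intro holomorphic_on_mult hol hol')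
 show "f z * (inverse c * hquot l k (%i. - e i) z)=1" if "z\<in>uhp" for z
 proof -
 have h:"hquot l k e z~=0" using nz[OF that] by (simp add:f_def)
 have "f z * (inverse c * inverse (hquot l k e z))=(c * inverse c)*(hquot l k e z * inverse (hquot l k e z))"
 by (simp only:f_def mult_ac)
 thus ?thesis unfolding hquot_uminus[OF l(2) level_props(1)] using c h by simp
 qed
 qed
 finally have "mero f * mero (%z. inverse c * hquot l k (%i. - e i) z)=1" by (simp add:one_mero_uhp_def)
 hence units:"mero f\<in>modular_units l"
 unfolding modular_units_def f_def using hquot_integral[OF c(1) e] hquot_integral[OF cyclotomic_closed(5)[OF c] ne] by blast
 have "P \<in> cusps_above_inf l" if P: "P\<in>modular_curve (Gamma_princ l)" "x\<in>P" "order_at l (mero f) x~=0" for P x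
 proof (cases "x\<in>Some ` uhp")
 case True
 then obtain z where z:"z\<in>uhp" "x=Some z" by blast
 have "eval_mero (mero f) holomorphic_on uhp" using hol by (rule holomorphic_transform) (simp add:ev)
 hence "eval_mero (mero f) analytic_on {z}" using z open_uhp analytic_on_open analytic_on_subset by blast
 hence "zorder (eval_mero (mero f)) z=0" by (rule zorder_eq_0I) (simp add:ev z nz)
 thus ?thesis using P(3) z by (simp add:order_at_def)
 next
 case False
 then obtain gg where g:"gg\<in>SL2Z" "x=ext_moebius gg None" using cusp_cases[OF P(1,2)] by blast
 obtain F where F: "has_qexp l (%z. f (moebius gg z)) F" "F~=0"
 "of_int (fls_subdegree F)=real l * hquot_ord l k e (gg$1$1) (gg$2$1)"
 using hquot_qexp[OF e g(1) c(2)] unfolding f_def by blast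
 have "has_qexp l (%z. eval_mero (mero f) (moebius gg z)) F"
 by (rule has_qexp_cong[OF l0 F(1)],rule eventually_mono[OF eventually_at_cusp_uhp]) (simp add:ev moebius_in_uhp g)
 hence "order_at l (mero f) x=fls_subdegree F" unfolding g(2) by (rule order_at_cusp[OF l0 g(1) _ F(2)])
 hence "hquot_ord l k e (gg$1$1) (gg$2$1)~=0" using F(3) P(3) by auto
 hence "int l dvd gg$2$1" using hquot_ord_not_dvd[OF level_props(3) not_dvd_imp_coprime e] by blast
 hence "gg\<in>Gamma0 l" using g by (simp add:Gamma0_iff)
 thus ?thesis using cusps_above_infI[OF P(1),of gg] P(2) g(2) by simp
 qed
 thus ?thesis using units unfolding units_plus_def zeros_and_poles_def f_def by blast
qed

text \<open>The case N = 0 of \<open>dvd_exponents\<close>: divisibility by 0 is vanishing.\<close>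

lemma hquot_divs_0_imp_0:
 assumes "!!n. n > 0==>hquot_divs l k e n=0" "i\<in>{1..k}"
 shows "e i=0"
proof -
 have cop:"coprime i l" using prime_coprime_index[OF l k assms(2),of 0] by simp
 have dv:"0 dvd hquot_divs l k e n" if "n > 0" for n unfolding assms(1)[OF that] by (rule dvd_refl)
 have "0 dvd e i" by (rule dvd_exponents[OF l(2) level_props(1) dv assms(2) cop])
 thus ?thesis by simp
qed

text \<open>Comparing q-expansions, the series \<open>hquot_fps\<close> must be 1. Its logarithmic
  derivative is therefore 0, so all divisor sums vanish.\<close>

lemma hquot_constant:
 assumes e:"sum e {1..k}=0" and const:"!!z. z\<in>uhp==>hquot l k e z = c" and i:"i\<in>{1..k}"
 shows "e i=0"
proof -
 note l0=level_props(2)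
 define V where "V=hquot_fps l k e"
 have V0:"fps_nth V 0=1" unfolding V_def by (rule hquot_fps_nth_0[OF l(2) level_props(1)])
 obtain n where n:"has_qexp l (hquot l k e) (spread l n V)" unfolding V_def by (rule hquot_spread[OF e])
 have "has_qexp l (%_. c) (spread l n V)"
 by (rule has_qexp_cong[OF l0 n],rule eventually_mono[OF eventually_at_cusp_uhp]) (simp add:const)
 hence eq:"spread l n V=fls_const c" by (rule has_qexp_unique[OF l0 _ has_qexp_const[OF l0]])
 have nth:"fps_nth V m=(if n+int l * int m=0 then c else 0)" for m
 proof -
 have "fls_nth (spread l n V) (n+int l * int m)=fps_nth V m" using l0 by (simp add:spread_nth)
 thus ?thesis unfolding eq by simp
 qed
 have n0:"n=0" using nth[of 0] V0 by (cases "n=0") simp_all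
 have "V=1"
 proof (rule fps_ext)
 fix m
 show "fps_nth V m=fps_nth 1 m" using nth[of m] nth[of 0] V0 l0 n0 by (cases "m=0") simp_all
 qed
 define sd where "sd=Abs_fps (%n. if n=0 then 0 else of_int (hquot_divs l k e n)::complex)"
 have "fps_X * fps_deriv V = - (V * sd)"
 unfolding V_def sd_def by (rule logderiv_hquot_fps[OF l(2) level_props(1)])
 hence z:"sd=0" unfolding \<open>V=1\<close> by simp
 have "hquot_divs l k e n=0" if "n > 0" for n
 proof -
 have "of_int (hquot_divs l k e n)=fps_nth sd n" using that by (simp add:sd_def)
 thus ?thesis unfolding z by simp
 qed
 thus ?thesis by (rule hquot_divs_0_imp_0[OF _ i])
qed

subsection \<open>A function with stabilizer \<open>\<plusminus>\<Gamma>(\<ell>)\<close>\<close>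
text \<open>In Q_1/Q_k the first function contributes B_2(2a/l); the second contributes B_2(a/l)
  because 2k = -1 modulo l and B_2 is even. The difference is the stated quadratic polynomial in
  a.\<close>

lemma hquot_ord_separator:
 assumes c:"int l dvd c" and a:"a\<in>{1..k}" "cong_sign l a' (int a)"
 shows "real l * hquot_ord l k (diff_vec 1 k) a' c=real_of_int (int a*(3 * int a-int l))/2"
proof -
 note l0=level_props(2)
 have bs:"bern l u=bern l v" if "cong_sign l u v" for u v
 using that bern_cong[OF l0,of u v] bern_cong[OF l0,of u "- v"] bern_minus[of l v] by (auto simp:cong_sign_def)
 have "cong_sign l (2*(int k * a')) a'"
 proof -
 have "2*(int k * a')+a'=int l * a'" using l(2) by (simp add:algebra_simps)
 thus ?thesis unfolding cong_sign_def by simp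
 qed
 hence b1:"bern l (2*(int k * a'))=bern l (int a)" using bs a(2) by metis
 have b2:"bern l (2*(int 1 * a'))=bern l (2 * int a)" using bs[OF cong_sign_mult[OF a(2),of 2]] by simp
 have "(\<Sum>i=1..k. of_int (diff_vec 1 k i) * bern l (2*(int i * a'))) =
 (\<Sum>i=1..k. if i=1 then bern l (2*(int i * a')) else 0)-(\<Sum>i=1..k. if i=k then bern l (2*(int i * a')) else 0)"
 unfolding sum_subtractf[symmetric] by (intro sum.cong refl) (auto simp:diff_vec_def)
 also have "...=bern l (2*(int 1 * a'))-bern l (2*(int k * a'))" using k by simp
 finally have "real l * hquot_ord l k (diff_vec 1 k) a' c=real l*(real l*(bern l (2 * int a)-bern l (int a)))"
 unfolding hquot_ord_dvd[OF l0 c] b1 b2 by simp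
 also have "bern l (2 * int a)=((2*(real a/real l))\<^sup>2-2*(real a/real l)+1/6)/2"
 using bern_value[of "2 * int a" l] a(1) l by simp
 also have "bern l (int a)=((real a/real l)\<^sup>2-real a/real l+1/6)/2"
 using bern_value[of "int a" l] a(1) l by simp
 also have "L * (L * (((2 * y)\<^sup>2-2 * y+1/6)/2-(y\<^sup>2-y+1/6)/2))=(3*(L * y)\<^sup>2-L * (L * y))/2"
 for L y::real by (simp add:power2_eq_square field_simps)
 also have "real l*(real a/real l)=real a" using l0 by simp
 finally show ?thesis by (simp add:power2_eq_square algebra_simps)
qed

text \<open>Makes Q_1/Q_k a primitive element of the function field. A matrix fixing it preserves
  its order at infinity, which pins down the first column modulo l up to sign; the leading exponent
  then restricts the remaining translation.\<close>

lemma separator_stabilizer: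
 assumes g:"gg\<in>SL2Z" and stable:"!!z. z\<in>uhp==>hquot l k (diff_vec 1 k) (moebius gg z)=hquot l k (diff_vec 1 k) z"
 shows "cong_pm l gg (mat 1)"
proof -
 note l0=level_props(2)
 define h where "h=hquot l k (diff_vec 1 k)"
 have e:"sum (diff_vec 1 k) {1..k}=0" using k by (simp add:sum_diff_vec)
 have inv:"Gamma_inv l h" using modular_hol_hquot[OF e,of 1] by (simp add:modular_hol_def h_def)
 obtain F where F: "has_qexp l (%z. h (moebius (mat 1) z)) F" "F~=0"
 "of_int (fls_subdegree F)=real l * hquot_ord l k (diff_vec 1 k) 1 0"
 using hquot_qexp[OF e mat1_in_SL2Z,of 1] by (auto simp:h_def)
 hence F1:"has_qexp l h F" by simp
 obtain G where G: "has_qexp l (%z. h (moebius gg z)) G"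
 "of_int (fls_subdegree G)=real l * hquot_ord l k (diff_vec 1 k) (gg$1$1) (gg$2$1)"
 using hquot_qexp[OF e g,of 1] by (auto simp:h_def)
 have "has_qexp l h G"
 by (rule has_qexp_cong[OF l0 G(1)],rule eventually_mono[OF eventually_at_cusp_uhp],unfold h_def,rule stable)
 hence GF: "G=F" by (rule has_qexp_unique[OF l0 _ F1])
 have ord1:"real l * hquot_ord l k (diff_vec 1 k) 1 0=real_of_int (3-int l)/2"
 using hquot_ord_separator[of 0 1 1] k by simp
 have c:"int l dvd gg$2$1"
 proof (rule ccontr)
 assume "~ int l dvd gg$2$1"
 hence "hquot_ord l k (diff_vec 1 k) (gg$1$1) (gg$2$1)=0"
 by (intro hquot_ord_not_dvd[OF level_props(3) not_dvd_imp_coprime e])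
 hence "real_of_int (fls_subdegree F)=0" using G(2) unfolding GF by simp
 hence "real_of_int (3-int l)/2=0" using F(3) ord1 by linarith
 thus False using level_props(4) by simp
 qed
 have cop:"coprime (gg$1$1) (int l)"
 proof (rule not_dvd_imp_coprime,rule notI)
 assume "int l dvd gg$1$1"
 hence "int l dvd gg$1$1 * gg$2$2-gg$1$2 * gg$2$1" using c by simp
 thus False using g level_props(4) by (simp add:mat2_exhaust)
 qed
 obtain a where a:"a\<in>{1..k}" "cong_sign l (gg$1$1) (int a)"
 using cong_sign_index_exists[OF l k cop] by blast
 have "real_of_int (int a*(3 * int a-int l))/2=real_of_int (fls_subdegree F)"
 unfolding G(2)[unfolded GF] hquot_ord_separator[OF c a] ..
 also have "...=real_of_int (3-int l)/2" unfolding F(3) ord1 ..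
 finally have "real_of_int (int a*(3 * int a-int l))=real_of_int (3-int l)"
 by (metis divide_cancel_right zero_neq_numeral)
 hence "int a*(3 * int a-int l)=3-int l" by (simp only:of_int_eq_iff)
 hence "(int a-1)*(3*(int a+1)-int l)=0" by (simp add:algebra_simps)
 hence "int a=1 | int l=3*(int a+1)" by auto
 \<comment> \<open>Equality of orders factors as (a - 1)(3(a + 1) - l) = 0, and a prime l >= 5 is
   not divisible by 3.\<close>
 moreover have "int l~=3*(int a+1)"
 proof
 assume "int l=3*(int a+1)"
 hence "l=3*(a+1)" by presburger
 hence "3 dvd l" by simp
 thus False using l(1) level_props(4) by (auto dest:primes_dvd_imp_eq[rotated 2])
 qed
 ultimately have "a=1" by simp
 then obtain eps where eps:"eps=1 | eps=(-1::int)" "int l dvd gg$1$1-eps*(mat 1::int^2^2)$1$1"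
 using a(2) unfolding cong_sign_def by force
 obtain m where m:"cong_pm l gg (mat 1 ** T_mat m)"
 using congruent_cusp[OF mat1_in_SL2Z g _ c eps(2) eps(1)] by auto
 have T: "(mat 1::int^2^2) ** T_mat m=T_mat m" by (rule matrix_mul_lid)
 have per:"h (z + of_int m)=h z" if "z\<in>uhp" for z
 using cong_pm_imp_eq[OF g _ m[unfolded T] inv that] stable[OF that] by (simp add:h_def)
 \<comment> \<open>Translation by m must fix the leading term of exponent (3 - l)/2 in q^(1/l);
   hence l divides 3m, and so m.\<close>
 define x where "x = - of_int (fls_subdegree F)/real l"
 define \<kappa> where "\<kappa>=qpow x (of_int m)"
 have sh:"filterlim (%tt. tt + of_int m) at_cusp at_cusp"
 unfolding filterlim_iff eventually_at_cusp
 proof (intro allI impI)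
 fix P::"complex=>bool" assume "EX y. ALL z. y<Im z-->P z"
 then obtain y where "ALL z. y<Im z-->P z" by blast
 thus "EX y. ALL z. y<Im z-->P (z + of_int m)" by (intro exI[of _ y]) simp
 qed
 define L where "L=fls_nth F (fls_subdegree F)"
 have L0:"L~=0" using F(2) by (simp add:L_def)
 have lim:"((%tt. h tt * qpow x tt) \<longlongrightarrow> L) at_cusp"
 unfolding L_def x_def by (rule has_qexp_lead_tendsto[OF l0 F1 F(2)])
 have "((%tt. h (tt + of_int m) * qpow x (tt + of_int m)) \<longlongrightarrow> L) at_cusp" by (rule filterlim_compose[OF lim sh])
 moreover have "eventually (%tt. h (tt + of_int m) * qpow x (tt + of_int m)=h tt * qpow x tt*\<kappa>) at_cusp"
 by (rule eventually_mono[OF eventually_at_cusp_uhp])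
 (simp add:per \<kappa>_def qpow_eq_ee ring_distribs ee_add)
 ultimately have "((%tt. h tt * qpow x tt*\<kappa>) \<longlongrightarrow> L) at_cusp" by (rule Lim_transform_eventually)
 hence "L=L * \<kappa>" using tendsto_unique[OF at_cusp_neq_bot _ tendsto_mult[OF lim tendsto_const]] by blast
 hence "\<kappa>=1" using L0 by simp
 then obtain q::int where q:"of_real x * of_int m=(of_int q::complex)"
 unfolding \<kappa>_def qpow_eq_ee ee_eq_1_iff by blast
 have "of_real (x * of_int m)=(of_real (of_int q)::complex)" using q by simp
 hence "x * of_int m = of_int q" by (simp only:of_real_eq_iff)
 hence "- of_int (fls_subdegree F) * real_of_int m = of_int q * real l" using l0 by (simp add:x_def field_simps)
 moreover have "2 * real_of_int (fls_subdegree F)=real_of_int (3-int l)" using F(3) ord1 by simp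
 ultimately have "- real_of_int (3-int l) * real_of_int m=2*(of_int q * real l)" by (metis mult.assoc mult_minus_left mult_minus_right)
 hence "real_of_int (- (3-int l) * m)=real_of_int (2*(q * int l))" by simp
 hence "- (3-int l) * m=2*(q * int l)" by (simp only:of_int_eq_iff)
 hence "3 * m=int l*(m-2 * q)" by (simp add:algebra_simps)
 hence "int l dvd 3 * m" by simp
 moreover have "coprime (3::int) (int l)"
 proof (rule not_dvd_imp_coprime,rule notI)
 assume "int l dvd 3"
 hence "int l\<le>3" by (rule zdvd_imp_le) simp
 thus False using level_props(4) by simp
 qed
 ultimately have "int l dvd m" by (simp add:coprime_dvd_mult_right_iff coprime_commute)
 hence "cong_pm l (T_mat m) (mat 1)"
 unfolding cong_pm_def by (intro bexI[of _ 1]) (auto simp:forall_2 T_mat_def)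
 thus ?thesis using cong_pm_trans m[unfolded T] by blast
qed
end

subsection \<open>Units supported above infinity\<close>

context
 fixes l k::nat
 assumes l:"Factorial_Ring.prime l" "l=2 * k+1" and k:"k\<ge>2"
begin
lemma level_pos:"l > 0" and index_pos:"k\<ge>1" using l k by simp_all

lemma units_plus_regular:
 assumes f:"f\<in>units_plus l"
 shows "eval_mero f holomorphic_on uhp" "!!z. z\<in>uhp==>eval_mero f z~=0"
proof -
 have f0:"f~=0" using f by (auto simp:units_plus_def modular_units_def)
 have A: "eval_mero f analytic_on {z}&eval_mero f z~=0" if z:"z\<in>uhp" for z
 proof -
 have "order_at l f (Some z)=0"
 proof (rule ccontr)
 assume ne:"order_at l f (Some z)~=0"
 have P: "orbit_of (Gamma_princ l) (Some z)\<in>modular_curve (Gamma_princ l)"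
 using z by (auto simp:modular_curve_def ext_uhp_def)
 have x:"Some z \<in> orbit_of (Gamma_princ l) (Some z)"
 unfolding orbit_of_def by (rule image_eqI[of _ _ "mat 1"]) simp_all
 have "orbit_of (Gamma_princ l) (Some z) \<in> cusps_above_inf l"
 using f P x ne unfolding units_plus_def zeros_and_poles_def by blast
 then obtain gg where "Some z=ext_moebius gg None" using cusps_above_infD x by blast
 thus False using ext_moebius_None_not_uhp[of gg] z by (metis imageI)
 qed
 hence zo:"zorder (eval_mero f) z=0" using z by (simp add:order_at_def)
 have "isolated_singularity_at (eval_mero f) z"
 using z eval_mero_meromorphic[of f] meromorphic_on_isolated_singularity meromorphic_on_subset by blast
 hence "~ is_pole (eval_mero f) z" using isolated_pole_imp_neg_zorder[of "eval_mero f" z] zo by auto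
 hence an:"eval_mero f analytic_on {z}"
 using nicely_meromorphic_on_imp_analytic_at[OF eval_mero_nicely_meromorphic z] by blast
 have "frequently (%w. eval_mero f w~=0) (at z)"
 by (rule eventually_frequently[OF at_neq_bot eventually_eval_nonzero[OF f0 z]])
 thus ?thesis using zorder_eq_0_iff[OF an] zo an by blast
 qed
 have "eval_mero f analytic_on uhp" using A by (subst analytic_on_analytic_at) blast
 thus "eval_mero f holomorphic_on uhp" by (rule analytic_imp_holomorphic)
 show "!!z. z\<in>uhp==>eval_mero f z~=0" using A by blast
qed

text \<open>A cusp with lower entry c prime to l is not equivalent to infinity under Gamma_0(l):
  from a/c = a'/c' with l dividing c' it would follow that l divides a', against determinant
  1.\<close>

lemma order_0_off_inf:
 assumes f:"f\<in>units_plus l" and g:"gg\<in>SL2Z" "~ int l dvd gg$2$1"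
 and G: "has_qexp l (%z. eval_mero f (moebius gg z)) G" "G~=0"
 shows "fls_subdegree G=0"
proof (rule ccontr)
 assume ne:"fls_subdegree G~=0"
 define x where "x=ext_moebius gg None"
 have "order_at l f x~=0" unfolding x_def order_at_cusp[OF level_pos g(1) G] by (rule ne)
 moreover have "x\<in>ext_uhp" by (auto simp:x_def ext_uhp_def)
 hence "orbit_of (Gamma_princ l) x\<in>modular_curve (Gamma_princ l)" by (auto simp:modular_curve_def)
 moreover have xo:"x \<in> orbit_of (Gamma_princ l) x"
 unfolding orbit_of_def by (rule image_eqI[of _ _ "mat 1"]) simp_all
 ultimately have "orbit_of (Gamma_princ l) x \<in> cusps_above_inf l"
 using f unfolding units_plus_def zeros_and_poles_def by blast
 then obtain \<delta> where d:"\<delta>\<in>Gamma0 l" "x=ext_moebius \<delta> None" using cusps_above_infD xo by blast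
 define a c a' c' where "a=gg$1$1" and "c=gg$2$1" and "a'=\<delta>$1$1" and "c'=\<delta>$2$1"
 have c':"int l dvd c'" using d by (simp add:Gamma0_iff c'_def)
 have nc:"~ int l dvd c" using g by (simp add:c_def)
 have c0:"c~=0" using nc by auto
 have ex:"ext_moebius \<delta> None=Some (of_int a / of_int c)"
 using d(2) c0 by (simp add:x_def a_def c_def)
 hence "c'~=0" "of_int a' / of_int c'=(of_int a / of_int c::complex)"
 by (auto simp:a'_def c'_def split:if_splits)
 hence "of_int (a' * c)=(of_int (a * c')::complex)" using c0 by (simp add:frac_eq_eq)
 hence "a' * c=a * c'" by (simp only:of_int_eq_iff)
 hence "int l dvd a' * c" using c' by simp
 hence "int l dvd a'"
 using not_dvd_imp_coprime[OF l k nc] by (simp add:coprime_dvd_mult_left_iff coprime_commute)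
 hence "int l dvd a' * \<delta>$2$2-\<delta>$1$2 * c'" using c' by simp
 hence "int l dvd 1" using d by (simp add:Gamma0_iff mat2_exhaust a'_def c'_def)
 thus False using l k by simp
qed

lemma units_plus_modular_hol:
 assumes f:"f\<in>units_plus l" shows "modular_hol l (eval_mero f)"
proof -
 have m:"modular_function l f"
 using f by (simp add:units_plus_def modular_units_def integral_closure_j_def modular_field_def)
 obtain R where R: "reps l R" using reps_exist[OF level_pos] by blast
 show ?thesis
 using m compose_moebius_holomorphic[OF level_pos R units_plus_regular(1)[OF f]]
 unfolding modular_hol_def modular_function_def Gamma_inv_def qhol_def by blast
qed

lemma bern_rational:"bern l u\<in>\<rat>"
 unfolding bern_def frac_def by (intro Rats_divide Rats_add Rats_diff Rats_power Rats_of_int Rats_of_nat) simp_all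

lemma qexp_nonzero:
 assumes "modular_hol l g" "!!z. z\<in>uhp==>g z~=0" "gg\<in>SL2Z" "has_qexp l (%z. g (moebius gg z)) F"
 shows "F~=0"
proof
 assume "F=0"
 moreover have "(%z. g (moebius gg z)) holomorphic_on uhp" using assms(1,3) by (auto simp:modular_hol_def qhol_def)
 ultimately have "g (moebius gg \<i>)=0"
 using zero_of_qexp_0[OF level_pos,of "%z. g (moebius gg z)" \<i>] assms(4) by (simp add:uhp_def)
 thus False using assms(2) moebius_in_uhp[OF assms(3),of \<i>] by (simp add:uhp_def)
qed

text \<open>
 A unit has \<open>k\<close> orders above infinity, subject to one linear relation coming from the norm to
 level one, so \<open>k + 1\<close> unknown exponents always admit a multiplicative relation.
\<close>

theorem units_plus_power:
 assumes f:"f\<in>units_plus l"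
 shows "\<exists>M>0. EX e c. sum e {1..k}=0 & c~=0&(\<forall>z\<in>uhp. eval_mero f z ^ M = c * hquot l k e z)"
proof -
 define g where "g=eval_mero f"
 note mg=units_plus_modular_hol[OF f,folded g_def]
 note ghol=units_plus_regular(1)[OF f,folded g_def]
 note gnz=units_plus_regular(2)[OF f,folded g_def]
 obtain R where R: "reps l R" using reps_exist[OF level_pos] by blast
 have RS: "finite R" "R \<subseteq> SL2Z" using reps_props[OF level_pos R] by blast+
 have "EX G. has_qexp l (%z. g (moebius sg z)) G&G~=0" if "sg\<in>SL2Z" for sg
 using mg that qexp_nonzero[OF mg gnz that] unfolding modular_hol_def qhol_def by blast
 then obtain G where G: "!!sg. sg\<in>SL2Z==>has_qexp l (%z. g (moebius sg z)) (G sg)&G sg~=0" by metis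
 \<comment> \<open>One cusp a/l above infinity for each class of (Z/l)^x modulo sign.\<close>
 have "\<exists>gg\<in>SL2Z. gg$1$1=int a&gg$2$1=int l" if a:"a\<in>{1..k}" for a
 proof -
 have "coprime (int a) (int l)" using prime_coprime_index[OF l k a,of 0] by simp
 then obtain u v where uv:"u * int a + v * int l=1" by (metis bezout_int coprime_imp_gcd_eq_1)
 have "mat2 (int a) (- v) (int l) u\<in>SL2Z" using uv by (simp add:mat2_exhaust algebra_simps)
 thus ?thesis by (intro bexI[of _ "mat2 (int a) (- v) (int l) u"]) simp_all
 qed
 then obtain gg where gg:"!!a. a\<in>{1..k}==>gg a\<in>SL2Z&gg a$1$1=int a&gg a$2$1=int l" by metis
 define \<nu> where "\<nu> a=fls_subdegree (G (gg a))" for a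
 \<comment> \<open>Column 0 belongs to the unknown power of f, columns 1..k to the exponents. Row 0
   demands that the exponents sum to 0, row i < k that the orders agree at the cusp i/l. The cusp
   k/l gets no row: the norm relation settles it.\<close>
 define A::"nat=>nat=>real" where
 "A i j=(if i=0 then (if j=0 then 0 else 1) else if j=0 then of_int (\<nu> i)
 else-(real l*(real l * bern l (2*(int j * int i)))))" for i j
 have "A i j\<in>\<rat>" for i j
 proof -
 have "- (real l*(real l * bern l (2*(int j * int i))))\<in>\<rat>"
 by (intro Rats_minus_iff[THEN iffD2] Rats_mult Rats_of_nat bern_rational)
 thus ?thesis by (simp add:A_def)
 qed
 then obtain n0 where n0:"\<exists>j\<in>{0..k}. n0 j~=0" "\<forall>i\<in>{0..<k}. (\<Sum>j\<in>{0..k}. of_int (n0 j) * A i j)=0"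
 using homogeneous_system[of "{0..<k}" "{0..k}" A] by auto
 \<comment> \<open>Normalises the sign of the solution so that the exponent of f is
   nonnegative.\<close>
 define s where "s=(if n0 0<0 then -1 else 1::int)"
 define n where "n j = s * n0 j" for j
 have nnz:"\<exists>j\<in>{0..k}. n j~=0" using n0(1) by (auto simp:n_def s_def)
 have npos:"n 0\<ge>0" by (simp add:n_def s_def)
 have rel:"of_int (n 0) * A i 0+(\<Sum>j=1..k. of_int (n j) * A i j)=0" if "i<k" for i
 proof -
 have "(\<Sum>j\<in>{0..k}. of_int (n j) * A i j) = of_int s*(\<Sum>j\<in>{0..k}. of_int (n0 j) * A i j)"
 unfolding sum_distrib_left by (intro sum.cong refl) (simp add:n_def)
 also have "...=0" using n0(2) that by simp
 finally show ?thesis by (simp add:sum.atLeast_Suc_atMost)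
 qed
 have "(\<Sum>j=1..k. real_of_int (n j) * A 0 j)=(\<Sum>j=1..k. real_of_int (n j))"
 by (intro sum.cong refl) (simp add:A_def)
 hence "real_of_int (sum n {1..k})=0" using rel[of 0] k by (simp add:A_def)
 hence e:"sum n {1..k}=0" by (simp only:of_int_eq_0_iff)
 have eq:"real_of_int (n 0) * real_of_int (\<nu> a)=real l * hquot_ord l k n (int a) (int l)" if a:"1\<le>a" "a<k" for a
 proof -
 have "(\<Sum>j=1..k. real_of_int (n j) * A a j) = - (real l * hquot_ord l k n (int a) (int l))"
 unfolding hquot_ord_dvd[OF level_pos dvd_refl] sum_distrib_left sum_negf[symmetric]
 using a by (intro sum.cong refl) (simp add:A_def)
 thus ?thesis using rel[OF a(2)] a by (simp add:A_def)
 qed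
 define M where "M=nat (n 0)"
 have M: "real M=real_of_int (n 0)" using npos by (simp add:M_def)
 have ne:"sum (%i. - n i) {1..k}=0" using e by (simp add:sum_negf)
 define Q where "Q z=g z ^ M * hquot l k (%i. - n i) z" for z
 have mh:"modular_hol l (hquot l k (%i. - n i))" using modular_hol_hquot[OF l k ne,of 1] by simp
 have hhol:"hquot l k (%i. - n i) holomorphic_on uhp" using modular_hol_qhol[OF mh] by (simp add:qhol_def)
 have Qinv:"Gamma_inv l Q" using mg mh unfolding modular_hol_def Gamma_inv_def Q_def by simp
 have Qhol:"Q holomorphic_on uhp" unfolding Q_def by (intro holomorphic_intros ghol hhol)
 have Qnz:"Q z~=0" if "z\<in>uhp" for z
 using gnz[OF that] hquot_nonzero[OF l(2) index_pos] that by (simp add:Q_def uhp_def)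
 have "EX F. has_qexp l (%z. hquot l k (%i. - n i) (moebius sg z)) F&F~=0 &
 of_int (fls_subdegree F)=real l * hquot_ord l k (%i. - n i) (sg$1$1) (sg$2$1)" if "sg\<in>SL2Z" for sg
 using hquot_qexp[OF l k ne that,of 1] by simp
 then obtain H where H: "!!sg. sg\<in>SL2Z==>has_qexp l (%z. hquot l k (%i. - n i) (moebius sg z)) (H sg)&H sg~=0 &
 of_int (fls_subdegree (H sg))=real l * hquot_ord l k (%i. - n i) (sg$1$1) (sg$2$1)" by metis
 define F where "F sg=G sg ^ M * H sg" for sg
 have F: "has_qexp l (%z. Q (moebius sg z)) (F sg)&F sg~=0" if "sg\<in>SL2Z" for sg
 unfolding Q_def F_def using G[OF that] H[OF that] by (auto intro!: has_qexp_mult has_qexp_power level_pos)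
 have neg:"hquot_ord l k (%i. - n i) a c = - hquot_ord l k n a c" for a c
 by (simp add:hquot_ord_def sum_negf)
 have Fs:"real_of_int (fls_subdegree (F sg))=real M * real_of_int (fls_subdegree (G sg)) -
 real l * hquot_ord l k n (sg$1$1) (sg$2$1)" if "sg\<in>SL2Z" for sg
 proof -
 have "fls_subdegree (F sg)=int M * fls_subdegree (G sg)+fls_subdegree (H sg)"
 unfolding F_def using G[OF that] H[OF that] by (simp add:fls_subdegree_pow)
 thus ?thesis using H[OF that] by (simp add:neg)
 qed
 have O1:"fls_subdegree (F sg)=0" if s:"sg\<in>SL2Z" "~ int l dvd sg$2$1" for sg
 proof -
 have "fls_subdegree (G sg)=0" using order_0_off_inf[OF f s] G[OF s(1)] by (simp add:g_def)
 moreover have "hquot_ord l k n (sg$1$1) (sg$2$1)=0"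
 by (rule hquot_ord_not_dvd[OF level_props(3)[OF l k] not_dvd_imp_coprime[OF l k s(2)] e])
 ultimately show ?thesis using Fs[OF s(1)] by simp
 qed
 have O2:"fls_subdegree (F (gg a))=0" if a:"1\<le>a" "a<k" for a
 proof -
 have ga:"gg a\<in>SL2Z" "gg a$1$1=int a" "gg a$2$1=int l" using gg[of a] a by auto
 have "real_of_int (fls_subdegree (F (gg a)))=0"
 unfolding Fs[OF ga(1)] ga(2,3) M \<nu>_def[symmetric] eq[OF a] by simp
 thus ?thesis by simp
 qed
 have O3:"\<exists>a\<in>{1..k}. cong_sign l (sg$1$1) (int a)&fls_subdegree (F sg)=fls_subdegree (F (gg a))"
 if s:"sg\<in>SL2Z" "int l dvd sg$2$1" for sg
 proof -
 have "coprime (sg$1$1) (int l)"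
 proof (rule not_dvd_imp_coprime[OF l k],rule notI)
 assume "int l dvd sg$1$1"
 hence "int l dvd sg$1$1 * sg$2$2 - sg$1$2 * sg$2$1" using s by simp
 thus False using s(1) l k by (simp add:mat2_exhaust)
 qed
 then obtain a where a:"a\<in>{1..k}" "cong_sign l (sg$1$1) (int a)"
 using cong_sign_index_exists[OF l k] by blast
 note ga=gg[OF a(1)]
 have "EX eps. (eps=1 | eps=(-1::int))&int l dvd sg$1$1-eps * gg a$1$1"
 proof (cases "int l dvd sg$1$1-int a")
 case True
 thus ?thesis using ga by (intro exI[of _ 1]) simp
 next
 case False
 thus ?thesis using ga a(2) by (intro exI[of _ "-1"]) (simp add:cong_sign_def)
 qed
 then obtain eps where ep:"eps=1 | eps=(-1::int)" "int l dvd sg$1$1-eps * gg a$1$1" by blast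
 have "fls_subdegree (F sg)=fls_subdegree (F (gg a))"
 by (rule order_congruent_cusp[OF level_pos _ s(1) _ s(2) ep(2,1) Qinv]) (use ga F s in auto)
 thus ?thesis using a by blast
 qed
 define om where "om=fls_subdegree (F (gg k))"
 have kk:"k\<in>{1..k}" using k by simp
 \<comment> \<open>The representatives whose first column modulo l belongs, up to sign, to k/l. Only
   they can contribute to the total order of \<open>Q\<close>, each the same amount
   \<open>om\<close>; as the total is 0 and S is nonempty, \<open>om\<close> is 0.\<close>
 define S where "S={sg\<in>R. int l dvd sg$2$1 & cong_sign l (sg$1$1) (int k)}"
 have FS: "fls_subdegree (F sg)=(if sg\<in>S then om else 0)" if sR: "sg \<in> R" for sg
 proof (cases "int l dvd sg$2$1")
 case False
 thus ?thesis using O1 RS sR by (auto simp:S_def)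
 next
 case True
 obtain a where a:"a\<in>{1..k}" "cong_sign l (sg$1$1) (int a)" "fls_subdegree (F sg)=fls_subdegree (F (gg a))"
 using O3[of sg] True RS sR by blast
 show ?thesis
 proof (cases "a=k")
 case ak:True
 thus ?thesis using a True sR by (simp add:S_def om_def)
 next
 case ak:False
 have "~ cong_sign l (sg$1$1) (int k)"
 using cong_sign_index_unique[OF l k a(1) kk] cong_sign_trans[OF cong_sign_sym[OF a(2)]] ak by blast
 moreover have "fls_subdegree (F (gg a))=0" using O2[of a] a(1) ak by simp
 ultimately show ?thesis using a(3) by (simp add:S_def)
 qed
 qed
 have "(\<Sum>sg\<in>R. fls_subdegree (F sg))=0"
 by (rule norm_order_eq_0[OF level_pos R Qinv Qhol Qnz]) (use F RS in auto)
 moreover have "(\<Sum>sg\<in>R. fls_subdegree (F sg))=(\<Sum>sg\<in>R. if sg\<in>S then om else 0)"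
 by (rule sum.cong[OF refl FS])
 moreover have "(\<Sum>sg\<in>R. if sg\<in>S then om else 0)=(\<Sum>sg\<in>S. om)"
 by (rule sum.mono_neutral_cong_right) (use RS in \<open>auto simp:S_def\<close>)
 ultimately have "int (card S) * om=0" by simp
 moreover have "S~={}"
 proof -
 note gk=gg[OF kk]
 obtain sg where s:"sg \<in> R" "cong_pm l (gg k) sg" using R gk unfolding reps_def by blast
 then obtain eps where ep:"eps=1 | eps = -1" "!!i j. int l dvd gg k$i$j-eps * sg$i$j"
 unfolding cong_pm_def by blast
 have "int l dvd int l-eps * sg$2$1" using ep(2)[of 2 1] gk by simp
 hence "int l dvd int l-(int l-eps * sg$2$1)" by (rule dvd_diff[OF dvd_refl])
 hence 1:"int l dvd sg$2$1" using ep(1) by auto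
 have "int l dvd int k-eps * sg$1$1" using ep(2)[of 1 1] gk by simp
 hence "cong_sign l (int k) (sg$1$1)" using ep(1) by (auto simp:cong_sign_def)
 hence "sg\<in>S" using s 1 cong_sign_sym by (simp add:S_def)
 thus ?thesis by blast
 qed
 moreover have "finite S" using RS by (simp add:S_def)
 ultimately have "om=0" by (simp add:card_eq_0_iff)
 hence "fls_subdegree (F sg)=0" if "sg \<in> R" for sg using FS[OF that] by simp
 hence "EX c. \<forall>z\<in>uhp. Q z = c"
 by (intro constant_if_orders_0[OF level_pos R Qinv Qhol,of F]) (use F RS in auto)
 then obtain c where c:"!!z. z\<in>uhp==>Q z = c" by blast
 have i:"\<i>\<in>uhp" by (simp add:uhp_def)
 have c0:"c~=0" using c[OF i] Qnz[OF i] by simp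
 \<comment> \<open>For M = 0 the product itself would be constant, so by
   \<open>hquot_constant\<close> the whole solution of the system would be trivial.\<close>
 have "M > 0"
 proof (rule Nat.gr0I)
 assume M0:"M=0"
 have "- n j=0" if "j\<in>{1..k}" for j
 by (rule hquot_constant[OF l k ne _ that,of c]) (use c M0 in \<open>simp add:Q_def\<close>)
 moreover have "n 0=0" using M0 npos by (simp add:M_def)
 ultimately have "n j=0" if "j\<in>{0..k}" for j using that by (cases "j=0") auto
 thus False using nnz by blast
 qed
 moreover have "g z ^ M = c * hquot l k n z" if z:"z\<in>uhp" for z
 proof -
 have "hquot l k n z~=0" using hquot_nonzero[OF l(2) index_pos] z by (simp add:uhp_def)
 thus ?thesis using c[OF z] unfolding Q_def hquot_uminus[OF l(2) index_pos] by (simp add:divide_eq_eq flip:divide_inverse)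
 qed
 ultimately show ?thesis using e c0 unfolding g_def by blast
qed

section \<open>Extraction of the M-th root\<close>

lemma fls_eq_shift_fps:
 fixes F::"complex fls"
 shows "F=fls_X_intpow (fls_subdegree F) * fps_to_fls (Abs_fps (%m. fls_nth F (fls_subdegree F+int m)))"
 by (rule fls_eqI) (simp add:fls_X_intpow_times_conv_shift)

lemma logderiv_compose_power:
 fixes V s::"complex fps"
 assumes "fps_X * fps_deriv V = - (V * s)"
 shows "fps_X * fps_deriv (fps_compose V (fps_X ^ l)) =
 - (fps_compose V (fps_X ^ l)*(fps_const (of_nat l) * fps_compose s (fps_X ^ l)))"
proof -
 have z:"fps_nth (fps_X ^ l::complex fps) 0=0" using level_pos by simp
 have "fps_X * fps_deriv (fps_compose V (fps_X ^ l))=fps_const (of_nat l) * fps_compose (fps_X * fps_deriv V) (fps_X ^ l)"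
 proof (rule fps_ext)
 fix m
 show "fps_nth (fps_X * fps_deriv (fps_compose V (fps_X ^ l))) m =
 fps_nth (fps_const (of_nat l) * fps_compose (fps_X * fps_deriv V) (fps_X ^ l)) m"
 unfolding fps_mult_left_const_nth X_deriv_nth fps_compose_X_power_nth[OF level_pos]
 by (auto simp:mult.assoc[symmetric] simp flip:of_nat_mult)
 qed
 also have "... = - (fps_compose V (fps_X ^ l)*(fps_const (of_nat l) * fps_compose s (fps_X ^ l)))"
 unfolding assms fps_compose_uminus fps_compose_mult_distrib[OF z] by (simp add:mult_ac)
 finally show ?thesis .
qed

text \<open>Starting from f^M = c \<open>hquot l k e\<close>, integrality of the normalised
  q-expansion of f turns into divisibility of e by M. What remains is a continuous function with
  constant M-th power.\<close>

theorem units_plus_imp_hquot: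
 assumes f:"f\<in>units_plus l"
 shows "EX c e. c \<in> cyclotomic l & c~=0 & sum e {1..k}=0&f=mero (%z. c * hquot l k e z)"
proof -
 define g where "g=eval_mero f"
 note mg=units_plus_modular_hol[OF f,folded g_def]
 note ghol=units_plus_regular(1)[OF f,folded g_def]
 note gnz=units_plus_regular(2)[OF f,folded g_def]
 obtain M e c where M: "M > 0" and e:"sum e {1..k}=0" and c:"c~=0"
 and pw:"!!z. z\<in>uhp==>g z ^ M = c * hquot l k e z"
 using units_plus_power[OF f] unfolding g_def by blast
 obtain G where G: "has_qexp l g G" "!!n. fls_nth G n \<in> cyclotomic l"
 using f unfolding units_plus_def modular_units_def integral_closure_j_def modular_field_def g_def by blast
 have G0:"G~=0" using qexp_nonzero[OF mg gnz mat1_in_SL2Z,of G] G(1) by simp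
 \<comment> \<open>Dividing by the leading coefficient makes F^M equal to the integral series of the
   product, without any constant.\<close>
 define b where "b=fls_nth G (fls_subdegree G)"
 have b0:"b~=0" using G0 by (simp add:b_def)
 define F where "F=fls_const (inverse b) * G"
 have F: "has_qexp l (%z. inverse b * g z) F"
 unfolding F_def by (rule has_qexp_mult[OF level_pos has_qexp_const[OF level_pos] G(1)])
 have F0:"F~=0" using G0 b0 by (simp add:F_def)
 define s where "s=fls_subdegree F"
 have "fls_const (inverse b)~=0" using b0 by simp
 hence sG: "s=fls_subdegree G" unfolding s_def F_def using G0 by simp
 have F1:"fls_nth F s=1" using b0 unfolding sG F_def by (simp add:b_def)
 define V where "V=hquot_fps l k e"
 have V0:"fps_nth V 0=1" unfolding V_def by (rule hquot_fps_nth_0[OF l(2) index_pos])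
 obtain n where n:"has_qexp l (hquot l k e) (spread l n V)" unfolding V_def by (rule hquot_spread[OF l k e])
 have spr:"spread l n V~=0" "fls_subdegree (spread l n V)=n" using spread_subdegree[OF level_pos,of V n] V0 by simp_all
 define C where "C=inverse b ^ M * c"
 have C0:"C~=0" using b0 c by (simp add:C_def)
 have "has_qexp l (%z. (inverse b * g z) ^ M) (fls_const C * spread l n V)"
 by (rule has_qexp_cong[OF level_pos has_qexp_mult[OF level_pos has_qexp_const[OF level_pos,of C] n]],
 rule eventually_mono[OF eventually_at_cusp_uhp]) (simp add:C_def power_mult_distrib pw)
 hence FM: "F ^ M=fls_const C * spread l n V"
 by (rule has_qexp_unique[OF level_pos has_qexp_power[OF level_pos F]])
 have "fls_const C~=0" using C0 by simp
 hence Ms:"int M * s=n"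
 using arg_cong[OF FM,of fls_subdegree] spr F0 by (simp add:fls_subdegree_pow s_def)
 have "1=fls_nth (F ^ M) (fls_subdegree (F ^ M))" using fls_lead_power[OF F0,of M] F1 by (simp add:s_def)
 also have "... = C"
 proof -
 have "fls_subdegree (F ^ M)=n" using Ms by (simp add:fls_subdegree_pow s_def)
 moreover have "fls_nth (spread l n V) n=1" using V0 level_pos by (simp add:spread_nth)
 ultimately show ?thesis unfolding FM by simp
 qed
 finally have FM1:"F ^ M = spread l n V" using FM by simp
 define u where "u=Abs_fps (%m. fls_nth F (s+int m))"
 have Fu:"F=fls_X_intpow s * fps_to_fls u" unfolding u_def s_def by (rule fls_eq_shift_fps)
 have u0:"fps_nth u 0=1" using F1 by (simp add:u_def)
 define U where "U=fps_compose V (fps_X ^ l)"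
 have "fls_X_intpow n * fps_to_fls (u ^ M)=fls_X_intpow n * fps_to_fls U"
 proof -
 have "F ^ M=fls_X_intpow (int M * s) * fps_to_fls (u ^ M)"
 unfolding Fu power_mult_distrib fls_X_intpow_power fps_to_fls_power by simp
 thus ?thesis unfolding FM1 Ms by (simp add:spread_def U_def)
 qed
 hence uM: "u ^ M=U" by simp
 define sd where "sd=Abs_fps (%n. if n=0 then 0 else (of_int (hquot_divs l k e n)::complex))"
 have Vd:"fps_X * fps_deriv V = - (V * sd)" unfolding V_def sd_def by (rule logderiv_hquot_fps[OF l(2) index_pos])
 define S where "S=fps_const (of_nat l) * fps_compose sd (fps_X ^ l)"
 have Ud:"fps_X * fps_deriv U = - (U * S)" unfolding U_def S_def by (rule logderiv_compose_power[OF Vd])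
 have Sn:"fps_nth S m=(if l dvd m then of_nat l * fps_nth sd (m div l) else 0)" for m
 unfolding S_def fps_mult_left_const_nth fps_compose_X_power_nth[OF level_pos] by simp
 have "U~=0" using u0 uM by (metis fps_zero_nth power_eq_0_iff zero_neq_one)
 note ud=fps_deriv_mult_cancel[OF uM this M Ud]
 have S0:"fps_nth S 0=0" by (simp add:Sn sd_def)
 have "fps_nth S m\<in>\<rat>" for m by (simp add:Sn sd_def)
 hence urat:"fps_nth u m\<in>\<rat>" for m by (rule fps_root_rational[OF ud S0 M _ u0])
 \<comment> \<open>U is a series in X^l, and the root recursion preserves this; so u comes from a
   series v in q itself, with v^M = V.\<close>
 have usup:"fps_nth u m=0" if "~ l dvd m" for m
 by (rule fps_root_supported[OF ud S0 M _ that]) (simp add:Sn)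
 have Frat:"coeffs_in \<rat> F"
 unfolding coeffs_in_def
 proof
 fix m
 show "fls_nth F m\<in>\<rat>"
 proof (cases "m < s")
 case True thus ?thesis unfolding s_def by simp
 next
 case False thus ?thesis using urat[of "nat (m - s)"] by (simp add:u_def)
 qed
 qed
 have FMint:"coeffs_in \<int> (F ^ M)" unfolding FM1 V_def by (rule int_spread_hquot[OF l k])
 obtain R where R: "reps l R" using reps_exist[OF level_pos] by blast
 obtain J where J: "has_qexp l j_fun J" "fls_subdegree J = - int l" "J~=0" "coeffs_in \<int> J"
 using j_fun_qexp[OF level_pos] by blast
 interpret j:level_one_generator l R j_fun J
 by unfold_locales (use level_pos R J level_one_j_fun in auto)
 have e1:"sum (diff_vec 1 k) {1..k}=0" using k by (simp add:sum_diff_vec)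
 have mh1:"modular_hol l (hquot l k (diff_vec 1 k))" using modular_hol_hquot[OF l k e1,of 1] by simp
 obtain n1 where n1:"has_qexp l (hquot l k (diff_vec 1 k)) (spread l n1 (hquot_fps l k (diff_vec 1 k)))"
 by (rule hquot_spread[OF l k e1])
 have mbg:"modular_hol l (%z. inverse b * g z)"
 using mg qhol_mult[OF level_pos qhol_const[OF level_pos,of "inverse b"]] unfolding modular_hol_def Gamma_inv_def by simp
 \<comment> \<open>The primitive element Q_1/Q_k has an integral expansion, so interpolation in it
   writes F as a quotient of integral series.\<close>
 obtain D N where DN: "coeffs_in \<int> D" "coeffs_in \<int> N" "D~=0" "D * F=N"
 using j.qexp_fraction[OF mh1 n1 int_spread_hquot[OF l k] separator_stabilizer[OF l k] mbg F Frat J(4)] by blast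
 have Fint:"coeffs_in \<int> F" by (rule fls_root_integral[OF DN(1,3,2,4) FMint M])
 define v where "v=Abs_fps (%m. fps_nth u (l * m))"
 have vi:"int_fps v" using Fint by (simp add:int_fps_def v_def u_def coeffs_in_def)
 have v0:"fps_nth v 0=1" using u0 by (simp add:v_def)
 have vu:"fps_compose v (fps_X ^ l)=u"
 by (rule fps_ext) (auto simp:fps_compose_X_power_nth[OF level_pos] v_def usup)
 have z:"fps_nth (fps_X ^ l::complex fps) 0=0" using level_pos by simp
 have "fps_compose (v ^ M) (fps_X ^ l)=fps_compose V (fps_X ^ l)"
 unfolding fps_compose_power[OF z,symmetric] vu uM U_def ..
 hence "fps_nth (v ^ M) m=fps_nth V m" for m
 using fps_compose_X_power_nth[OF level_pos,of "v ^ M" "l * m"] fps_compose_X_power_nth[OF level_pos,of V "l * m"] level_pos by simp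
 hence vM: "v ^ M=V" by (rule fps_ext)
 have "V~=0" using V0 by auto
 note vd=fps_deriv_mult_cancel[OF vM this M Vd]
 \<comment> \<open>Minus the logarithmic derivative of v. It is integral because v is and has
   constant term 1; the series \<open>sd\<close> belonging to V = v^M is M times it.\<close>
 define W where "W = - (fps_X * fps_deriv v) * inverse v"
 have vv:"v * inverse v=1" using inverse_mult_eq_1[of v] v0 by (simp add:mult.commute)
 have "sd=(v * inverse v) * sd" unfolding vv by simp
 also have "...=inverse v * (v * sd)" by (simp only:mult_ac)
 also have "v * sd = - (fps_const (of_nat M)*(fps_X * fps_deriv v))" unfolding vd by simp
 also have "inverse v * - (fps_const (of_nat M)*(fps_X * fps_deriv v))=fps_const (of_nat M) * W"
 by (simp add:W_def mult_ac)
 finally have sW: "sd=fps_const (of_nat M) * W" .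
 have XI: "int_fps (fps_X * fps_deriv v)"
 unfolding int_fps_def X_deriv_nth using vi unfolding int_fps_def by (intro allI Ints_mult Ints_of_nat) blast
 have "int_fps 0" by (simp add:int_fps_def)
 hence "int_fps ((0-fps_X * fps_deriv v) * inverse v)"
 by (rule int_fps_mult[OF int_fps_diff[OF _ XI] int_fps_inverse[OF vi v0]])
 hence Wi:"int_fps W" by (simp add:W_def)
 have dv:"int M dvd hquot_divs l k e m" if m:"m > 0" for m
 proof -
 obtain q where q:"fps_nth W m = of_int q" using Wi unfolding int_fps_def by (metis Ints_cases)
 have "of_int (hquot_divs l k e m)=fps_nth sd m" using m by (simp add:sd_def)
 also have "... = of_int (int M * q)" unfolding sW by (simp add:q)
 finally have "hquot_divs l k e m=int M * q" by (simp only:of_int_eq_iff)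
 thus ?thesis by simp
 qed
 have de:"int M dvd e i" if "i\<in>{1..k}" for i
 using dvd_exponents[OF l(2) index_pos dv that] prime_coprime_index[OF l k that,of 0] by simp
 define e' where "e' i=e i div int M" for i
 have ee':"e i=int M * e' i" if "i\<in>{1..k}" for i using de[OF that] by (simp add:e'_def)
 have "int M * sum e' {1..k} = sum e {1..k}" unfolding sum_distrib_left by (rule sum.cong[OF refl]) (simp add:ee')
 hence es:"sum e' {1..k}=0" using e M by simp
 have hpw:"hquot l k e z=hquot l k e' z ^ M" for z
 unfolding hquot_def prod_power_distrib
 proof (rule prod.cong[OF refl])
 fix i assume i:"i\<in>{1..k}"
 have "hsiegel l i z powi (e' i * int M)=(hsiegel l i z powi e' i) powi int M" by (rule power_int_mult)
 thus "hsiegel l i z powi e i=(hsiegel l i z powi e' i) ^ M" unfolding ee'[OF i] by (simp add:mult.commute)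
 qed
 define q where "q z=g z/hquot l k e' z" for z
 have hn:"hquot l k e' z~=0" if "z\<in>uhp" for z using hquot_nonzero[OF l(2) index_pos] that by (simp add:uhp_def)
 have h'hol:"hquot l k e' holomorphic_on uhp" by (rule hquot_holomorphic[OF l(2) index_pos es])
 \<comment> \<open>So q takes only finitely many values, and being continuous on a connected set it
   is constant.\<close>
 have "q z ^ M = c" if "z\<in>uhp" for z
 using pw[OF that] hn[OF that] unfolding q_def power_divide hpw by simp
 hence "q ` uhp \<subseteq> {w. w ^ M = c}" by blast
 hence fin:"finite (q ` uhp)" using finite_nth_roots[OF M] finite_subset by blast
 have "continuous_on uhp q" unfolding q_def
 by (intro holomorphic_on_imp_continuous_on holomorphic_on_divide ghol h'hol hn)
 then obtain a where a:"!!z. z\<in>uhp==>q z=a"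
 using continuous_finite_range_constant[OF connected_uhp _ fin] unfolding constant_on_def by blast
 have ga:"g z=a * hquot l k e' z" if "z\<in>uhp" for z using a[OF that] hn[OF that] by (simp add:q_def divide_eq_eq)
 have i:"\<i>\<in>uhp" by (simp add:uhp_def)
 have a0:"a~=0" using ga[OF i] gnz[OF i] by auto
 obtain n' where n':"has_qexp l (hquot l k e') (spread l n' (hquot_fps l k e'))" by (rule hquot_spread[OF l k es])
 have "has_qexp l g (fls_const a * spread l n' (hquot_fps l k e'))"
 by (rule has_qexp_cong[OF level_pos has_qexp_mult[OF level_pos has_qexp_const[OF level_pos,of a] n']],
 rule eventually_mono[OF eventually_at_cusp_uhp]) (simp add:ga)
 hence "G=fls_const a * spread l n' (hquot_fps l k e')" by (rule has_qexp_unique[OF level_pos G(1)])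
 \<comment> \<open>The series of the product starts with 1, so a is a coefficient of the expansion
   of f and therefore cyclotomic.\<close>
 hence "fls_nth G n'=a" using hquot_fps_nth_0[OF l(2) index_pos,of e'] level_pos by (simp add:spread_nth)
 hence ac:"a \<in> cyclotomic l" using G(2) by metis
 have ahol:"(%z. a * hquot l k e' z) holomorphic_on uhp" by (intro holomorphic_intros h'hol)
 have "eval_mero f z=eval_mero (mero (%z. a * hquot l k e' z)) z" for z
 proof (cases "z\<in>uhp")
 case True
 thus ?thesis using ga[OF True] eval_mero_holomorphic[OF ahol True] by (simp add:g_def)
 qed (simp add:eval_mero_outside)
 hence "f=mero (%z. a * hquot l k e' z)" by (metis eval_mero_inject ext)
 thus ?thesis using ac a0 es by blast
qed
end

subsection \<open>The theorem\<close>
lemma exponent_group_hquot: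
 assumes l:"Factorial_Ring.prime l" "l=2 * k+1" and k:"k\<ge>2"
 and d:"d > 0" "!!n. cong_sign l (2 ^ n) 1\<longleftrightarrow>d dvd n"
 shows "exponent_group l k d (%e. mero (hquot l k e))"
proof
 have k1:"k\<ge>1" using k by simp
 have hol:"hquot l k e holomorphic_on uhp" if "sum e {1..k}=0" for e by (rule hquot_holomorphic[OF l(2) k1 that])
 show "mero (hquot l k (%i. e i+f i))=mero (hquot l k e) * mero (hquot l k f)"
 if "sum e {1..k}=0" "sum f {1..k}=0" for e f
 unfolding mero_mult[OF hol[OF that(1)] hol[OF that(2)]]
 by (rule mero_cong) (use hol[of "%i. e i+f i"] that hquot_add[OF l(2) k1] in \<open>simp_all add:sum.distrib uhp_def\<close>)
 show "mero (hquot l k e)~=0" if "sum e {1..k}=0" for e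
 proof
 assume "mero (hquot l k e)=0"
 hence "hquot l k e \<i>=0"
 using mero_eq_iff[OF hol[OF that],of "%_. 0"] by (simp add:zero_mero_uhp_def uhp_def)
 thus False using hquot_nonzero[OF l(2) k1,of \<i> e] by simp
 qed
 show "mero (hquot l k e)=mero (hquot l k f)" if "!!i. i\<in>{1..k}==>e i=f i" for e f
 proof -
 have "hquot l k e=hquot l k f" unfolding hquot_def fun_eq_iff using that by (auto intro!: prod.cong)
 thus ?thesis by simp
 qed
 show "e i=0" if "sum e {1..k}=0" "mero (hquot l k e)=1" "i\<in>{1..k}" for e i
 using mero_eq_iff[OF hol[OF that(1)],of "%_. 1"] that(2) hquot_constant[OF l k that(1) _ that(3),of 1]
 by (simp add:one_mero_uhp_def)
qed (use assms in auto)

theorem theorem1p3: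
 fixes l k d::nat
 assumes "Factorial_Ring.prime l" and "l=2 * k+1" and "5\<le>l"
 and "d=group.ord (residue_units_pm1 l) (class_of_2 l)"
 shows "real_units l k \<subseteq> units_plus l
 & ereal_of_enat (abelian_rank (mero_group\<lparr>carrier := real_units l k\<rparr>))
 = ereal (real k-real k/real d)
 & (generate (residue_units_pm1 l) {class_of_2 l} = carrier (residue_units_pm1 l)
 --> internal_direct_product mero_group (real_units l k) (const_units l) (units_plus l))"
proof -
 note l=assms(1,2)
 have k:"k\<ge>2" using assms(2,3) by simp
 have k1:"k\<ge>1" using k by simp
 note d = order_class_of_2[OF l k assms(4)]
 interpret E: exponent_group l k d "%e. mero (hquot l k e)"
 by (rule exponent_group_hquot[OF l k d(1,2)])
 have gen:"siegel_quotient l m=E.unit_gen m" if "m\<in>{1..k-1}" for m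
 unfolding E.unit_gen_def by (rule siegel_quotient_eq[OF l k]) (use that in auto)
 have im:"siegel_quotient l ` {1..k-1}=E.unit_gen ` {1..k-1}" by (rule image_cong[OF refl gen])
 have ru:"real_units l k=E.unit_group"
 by (simp only:real_units_def E.unit_group_def im)
 have hol:"hquot l k e holomorphic_on uhp" if "sum e {1..k}=0" for e by (rule hquot_holomorphic[OF l(2) k1 that])
 have memb:"EX e. sum e {1..k}=0&h=mero (hquot l k e)" if "h\<in>real_units l k" for h
 using E.unit_group_orbit_null[of h] E.orbit_null_sum that unfolding ru by blast
 have sub:"real_units l k \<subseteq> units_plus l"
 proof
 fix h assume "h\<in>real_units l k"
 then obtain e where e:"sum e {1..k}=0" "h=mero (hquot l k e)" using memb by blast
 show "h\<in>units_plus l" using hquot_in_units_plus[OF l k cyclotomic_closed(1) one_neq_zero e(1)] e(2) by simp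
 qed
 have const:"x \<in> const_units l\<longleftrightarrow>(EX c. c \<in> cyclotomic l & c~=0&x=mero (%_. c))" for x
 by (auto simp:const_units_def)
 have inter:"x=1" if x:"x\<in>real_units l k" "x \<in> const_units l" for x
 proof -
 obtain e where e:"sum e {1..k}=0" "x=mero (hquot l k e)" using memb x(1) by blast
 obtain c where c:"x=mero (%_. c)" using x(2) unfolding const by blast
 have "\<forall>z\<in>uhp. hquot l k e z = c" using mero_eq_iff[OF hol[OF e(1)],of "%_. c"] e(2) c by simp
 hence "e i=0" if "i\<in>{1..k}" for i using hquot_constant[OF l k e(1) _ that] by blast
 hence "x=mero (hquot l k (%_. 0))" unfolding e(2) by (intro E.hq_cong) auto
 thus ?thesis using E.hq_0 by simp
 qed
 have sgc:"subgroup (const_units l) mero_group"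
 proof (rule M.subgroupI)
 have nz:"mero (%_. c)~=0" if "c~=0" for c
 using mero_eq_iff[of "%_. c" "%_. 0"] that by (auto simp:zero_mero_uhp_def uhp_def intro!: exI[of _ \<i>])
 show "const_units l \<subseteq> carrier mero_group" using nz by (auto simp:const mero_group_simps)
 have "mero (%_. 1) \<in> const_units l"
 unfolding const by (intro exI[of _ 1] conjI cyclotomic_closed(1) one_neq_zero refl)
 thus "const_units l~={}" by blast
 show "inv\<^bsub>mero_group\<^esub> x \<in> const_units l" if xc:"x \<in> const_units l" for x
 proof -
 obtain c where c:"c \<in> cyclotomic l" "c~=0" "x=mero (%_. c)" using xc unfolding const by blast
 have "inv\<^bsub>mero_group\<^esub> x=mero (%_. inverse c)"
 unfolding c(3) mero_group_inv[OF nz[OF c(2)]] by (rule mero_inverse) (use c in simp_all)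
 moreover have "inverse c~=0" using c(2) by simp
 ultimately show ?thesis unfolding const using cyclotomic_closed(5)[OF c(1,2)] by blast
 qed
 show "x \<otimes>\<^bsub>mero_group\<^esub> y \<in> const_units l" if xc:"x \<in> const_units l" and yc:"y \<in> const_units l" for x y
 proof -
 obtain c where c:"c \<in> cyclotomic l" "c~=0" "x=mero (%_. c)" using xc unfolding const by blast
 obtain c' where c':"c' \<in> cyclotomic l" "c'~=0" "y=mero (%_. c')" using yc unfolding const by blast
 have "x \<otimes>\<^bsub>mero_group\<^esub> y=mero (%_. c * c')" unfolding mero_group_simps c c' by (rule mero_mult) simp_all
 moreover have "c * c'~=0" using c(2) c'(2) by simp
 ultimately show ?thesis unfolding const using cyclotomic_closed(4)[OF c(1) c'(1)] by blast
 qed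
 qed
 have mult:"mero (hquot l k e) * mero (%_. c)=mero (%z. c * hquot l k e z)" if "sum e {1..k}=0" for e c
 unfolding mult.commute[of "mero (hquot l k e)"] by (rule mero_mult) (use hol[OF that] in simp_all)
 \<comment> \<open>For d = k there is a single orbit of doubling, so sum e = 0 alone puts the
   product into the generated group.\<close>
 have prod:"real_units l k <#>\<^bsub>mero_group\<^esub> const_units l=units_plus l" if g:"d=k"
 proof
 show "real_units l k <#>\<^bsub>mero_group\<^esub> const_units l \<subseteq> units_plus l"
 proof
 fix x assume "x\<in>real_units l k <#>\<^bsub>mero_group\<^esub> const_units l"
 then obtain h y where hy:"h\<in>real_units l k" "y \<in> const_units l" "x=h * y"
 by (auto simp:set_mult_def mero_group_simps)
 obtain e where e:"sum e {1..k}=0" "h=mero (hquot l k e)" using memb hy(1) by blast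
 obtain c where c:"c \<in> cyclotomic l" "c~=0" "y=mero (%_. c)" using hy(2) unfolding const by blast
 show "x\<in>units_plus l"
 unfolding hy(3) e(2) c(3) mult[OF e(1)] by (rule hquot_in_units_plus[OF l k c(1,2) e(1)])
 qed
 show "units_plus l \<subseteq> real_units l k <#>\<^bsub>mero_group\<^esub> const_units l"
 proof
 fix f assume "f\<in>units_plus l"
 then obtain c e where ce:"c \<in> cyclotomic l" "c~=0" "sum e {1..k}=0" "f=mero (%z. c * hquot l k e z)"
 using units_plus_imp_hquot[OF l k] by blast
 have "mero (hquot l k e)\<in>real_units l k"
 unfolding ru by (rule E.orbit_null_in_unit_group[OF E.orbit_null_if_transitive[OF g ce(3)]])
 moreover have "mero (%_. c) \<in> const_units l" unfolding const using ce(1,2) by blast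
 moreover have "f=mero (hquot l k e) * mero (%_. c)" unfolding mult[OF ce(3)] by (rule ce(4))
 ultimately show "f\<in>real_units l k <#>\<^bsub>mero_group\<^esub> const_units l"
 unfolding set_mult_def mero_group_simps by blast
 qed
 qed
 have one:"1\<in>real_units l k" "1 \<in> const_units l"
 using E.unit_group_closed(1) subgroup.one_closed[OF sgc] by (simp_all add:ru mero_group_simps)
 have "internal_direct_product mero_group (real_units l k) (const_units l) (units_plus l)" if "d=k"
 unfolding internal_direct_product_def mero_group_simps
 using E.subgroup_unit_group[folded ru] sgc inter one prod[OF that] by blast
 thus ?thesis using sub E.rank_unit_group_real[folded ru] d(3) by blast
qed
end
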